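(* Let $(\overline X,\overline Y^1,\dots,\overline Y^m)$ be the unique (pathwise) solution of the system (S) of the context with given initial data $(\overline X_0,\overline Y_0^1,\dots,\overline Y_0^m)$. Assume additionally that $\overline\mu_0=\mathrm{Law}(\overline X_0)$ belongs to $\mathcal W_2(\mathbb R^d)$ and is of the form $\overline\mu_0=\rho_0\,dx$, where $\rho_0$ has finite entropy, i.e. $\int_{\mathbb R^d}\rho_0(x)\log\rho_0(x)\,dx<\infty$. Then, with $\overline\mu_t=\mathrm{Law}(\overline X(t))$, the $(m+1)$-tuple $(\overline\mu_t,\overline Y^1(t),\dots,\overline Y^m(t))$ is the unique solution in $C^0([0,T];\mathcal W_1(\mathbb R^d)\times(\mathbb R^d)^m)$ of the PDE–ODE system $$\begin{cases}(\partial_t-\sigma\Delta)\overline\mu_t=-\mathrm{div}\Big(\big(H_1\ast\overline\mu_t(\cdot)+\frac1m\sum_{j=1}^mK_1(\overline Y^j(t)-\cdot)\big)\overline\mu_t\Big)\\ \frac{d}{dt}\overline Y^i(t)=K_2\ast\overline\mu_t(\overline Y^i(t))+\frac1m\sum_{j=1}^mH_2(\overline Y^j(t)-\overline Y^i(t))+u^i(t,\overline\mu_t),\quad i=1,\dots,m\\ \overline\mu_0=\mathrm{Law}(\overline X_0),\ \overline Y^i(0)=\overline Y^i_0,\quad i=1,\dots,m.\end{cases}$$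
   Context: Fix $d,m\in\mathbb N$, $T>0$, $\sigma>0$, a filtered probability space $(\Omega,\mathcal F,(\mathcal F_t),\mathbb P)$ and a $d$-dimensional $(\mathcal F_t)$-Brownian motion $W$. $\mathcal W_p(\mathbb R^d)$ is the space of Borel probability measures on $\mathbb R^d$ with finite $p$-th moment, with the $p$-Wasserstein distance. $\mathrm{Law}(X)=X_\sharp\mathbb P$ and $\mathrm{ev}_t(f)=f(t)$. For a Lipschitz $H$ and $\mu\in\mathcal W_1(\mathbb R^d)$, $H\ast\mu(x)=\int_{\mathbb R^d}H(x-y)\,d\mu(y)$. $H_1,H_2,K_1,K_2:\mathbb R^d\to\mathbb R^d$ are globally Lipschitz. The controls $u^i:[0,T]\times\mathcal W_1(\mathbb R^d)\to\mathbb R^d$ are Carathéodory functions (measurable in $t$, continuous in $\mu$, with $u^i(\cdot,\mu)\in L^1(0,T)$ for each $\mu$), and $u^i(t,\cdot)$ is Lipschitz for each $t$ with a Lipschitz constant that is integrable on $[0,T]$. The random variable $\overline X_0$ is $\mathcal F_0$-measurable and $\overline Y^i_0\in\mathbb R^d$. System (S): $$\begin{cases} d\overline X(t)=\Big(H_1\ast\overline\mu_t(\overline X(t))+\frac1m\sum_{j=1}^mK_1(\overline Y^j(t)-\overline X(t))\Big)dt+\sqrt{2\sigma}\,dW(t)\\ \frac{d}{dt}\overline Y^i(t)=K_2\ast\overline\mu_t(\overline Y^i(t))+\frac1m\sum_{j=1}^mH_2(\overline Y^j(t)-\overline Y^i(t))+u^i(t,\overline\mu_t),\quad i=1,\dots,m\\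 \overline X(0)=\overline X_0,\ \overline Y^i(0)=\overline Y^i_0,\quad i=1,\dots,m\\ \overline\mu=\mathrm{Law}(\overline X),\ \overline\mu_t=(\mathrm{ev}_t)_\sharp\overline\mu.\end{cases}$$ A pathwise solution consists of a $C^0([0,T];\mathbb R^d)$-valued random variable $\overline X$ satisfying the first equation in integral form almost surely for all $t$, and deterministic $\overline Y^i\in C^0([0,T];\mathbb R^d)$ that are Carathéodory solutions of the ODEs. Such a solution exists and is pathwise unique. The PDE is understood in the weak sense: for every $\varphi\in C_c^\infty(\mathbb R^d)$ and $t\in[0,T]$, $$\int\varphi\,d\overline\mu_t=\int\varphi\,d\overline\mu_0+\int_0^t\int\Big[\Big\langle\nabla\varphi(x),H_1\ast\overline\mu_s(x)+\frac1m\sum_{j=1}^mK_1(\overline Y^j(s)-x)\Big\rangle+\sigma\Delta\varphi(x)\Big]d\overline\mu_s(x)\,ds;$$ the ODEs are understood in the Carathéodory sense. *)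

theory Defs
  imports "HOL-Probability.Probability"
begin

definition couplings :: "'a::euclidean_space measure \<Rightarrow> 'a measure \<Rightarrow> ('a \<times> 'a) measure set" where
  "couplings \<mu> \<nu> = {\<pi>. prob_space \<pi> \<and> sets \<pi> = sets borel \<and>
     distr \<pi> borel fst = \<mu> \<and> distr \<pi> borel snd = \<nu>}"

definition wasserstein_space :: "real \<Rightarrow> 'a::euclidean_space measure set" where
  "wasserstein_space p = {\<mu>. prob_space \<mu> \<and> sets \<mu> = sets borel \<and>
     integrable \<mu> (\<lambda>x. norm x powr p)}"

text \<open>For measures in \<^term>\<open>wasserstein_space p\<close> the infimum is finite, so \<^const>\<open>enn2real\<close>
  loses nothing.\<close>

definition wasserstein :: "real \<Rightarrow> 'a::euclidean_space measure \<Rightarrow> 'a measure \<Rightarrow> real" where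
  "wasserstein p \<mu> \<nu> =
     enn2real (INF \<pi>\<in>couplings \<mu> \<nu>. \<integral>\<^sup>+z. ennreal (dist (fst z) (snd z) powr p) \<partial>\<pi>) powr (1 / p)"

definition wasserstein_continuous_on ::
    "real \<Rightarrow> real set \<Rightarrow> (real \<Rightarrow> 'a::euclidean_space measure) \<Rightarrow> bool" where
  "wasserstein_continuous_on p I \<mu> \<longleftrightarrow>
     (\<forall>t\<in>I. \<mu> t \<in> wasserstein_space p) \<and>
     (\<forall>t\<in>I. ((\<lambda>s. wasserstein p (\<mu> s) (\<mu> t)) \<longlongrightarrow> 0) (at t within I))"

definition conv_measure ::
    "('a::euclidean_space \<Rightarrow> 'a) \<Rightarrow> 'a measure \<Rightarrow> 'a \<Rightarrow> 'a" where
  "conv_measure H \<mu> x = (\<integral>y. H (x - y) \<partial>\<mu>)"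

definition globally_lipschitz :: "('a::euclidean_space \<Rightarrow> 'a) \<Rightarrow> bool" where
  "globally_lipschitz H \<longleftrightarrow> (\<exists>L. L-lipschitz_on UNIV H)"

text \<open>The extended real integral of \<open>\<rho> log \<rho>\<close>, with \<open>0 log 0 = 0\<close>. If both the positive and the
  negative part diverge, the value is \<open>\<infinity> - \<infinity> = \<infinity>\<close>; for a density with finite second moment the
  negative part is always finite.\<close>

definition entropy_integral :: "('a::euclidean_space \<Rightarrow> real) \<Rightarrow> ereal" where
  "entropy_integral \<rho> =
     enn2ereal (\<integral>\<^sup>+x. ennreal (\<rho> x * ln (\<rho> x)) \<partial>lborel)
     - enn2ereal (\<integral>\<^sup>+x. ennreal (- (\<rho> x * ln (\<rho> x))) \<partial>lborel)"

definition filtration_on :: "real set \<Rightarrow> 'w measure \<Rightarrow> (real \<Rightarrow> 'w measure) \<Rightarrow> bool" where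
  "filtration_on I M F \<longleftrightarrow>
     (\<forall>t\<in>I. subalgebra M (F t)) \<and> (\<forall>s\<in>I. \<forall>t\<in>I. s \<le> t \<longrightarrow> subalgebra (F t) (F s))"

text \<open>The increment density is that of the centred normal law with covariance \<open>(t - s) Id\<close>.\<close>

definition brownian_motion_on ::
    "real set \<Rightarrow> 'w measure \<Rightarrow> (real \<Rightarrow> 'w measure) \<Rightarrow> (real \<Rightarrow> 'w \<Rightarrow> 'a::euclidean_space) \<Rightarrow> bool" where
  "brownian_motion_on I M F W \<longleftrightarrow>
     (\<forall>t\<in>I. W t \<in> borel_measurable (F t)) \<and>
     (AE \<omega> in M. W 0 \<omega> = 0) \<and>
     (AE \<omega> in M. continuous_on I (\<lambda>t. W t \<omega>)) \<and>
     (\<forall>s\<in>I. \<forall>t\<in>I. s < t \<longrightarrow>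
        prob_space.indep_set M (sets (F s))
          (sets (vimage_algebra (space M) (\<lambda>\<omega>. W t \<omega> - W s \<omega>) borel)) \<and>
        distributed M lborel (\<lambda>\<omega>. W t \<omega> - W s \<omega>)
          (\<lambda>x. \<Prod>b\<in>Basis. ennreal (normal_density 0 (sqrt (t - s)) (x \<bullet> b))))"

text \<open>The Banach space of continuous paths on \<open>[0,T]\<close> with the supremum distance; its elements are
  functions that are \<^const>\<open>undefined\<close> outside \<open>[0,T]\<close>.\<close>

definition path_space :: "real \<Rightarrow> (real \<Rightarrow> 'a::euclidean_space) metric" where
  "path_space T = cfunspace (top_of_set {0..T}) euclidean_metric"

definition path_borel :: "real \<Rightarrow> (real \<Rightarrow> 'a::euclidean_space) measure" where
  "path_borel T = sigma (mspace (path_space T)) {U. openin (mtopology_of (path_space T)) U}"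

definition marginal :: "(real \<Rightarrow> 'a::euclidean_space) measure \<Rightarrow> real \<Rightarrow> 'a measure" where
  "marginal P t = distr P borel (\<lambda>f. f t)"

definition caratheodory_control ::
    "real \<Rightarrow> (real \<Rightarrow> 'a::euclidean_space measure \<Rightarrow> 'a) \<Rightarrow> bool" where
  "caratheodory_control T u \<longleftrightarrow>
     (\<forall>\<mu>\<in>wasserstein_space 1. (\<lambda>t. u t \<mu>) \<in> borel_measurable (lebesgue_on {0..T})) \<and>
     (\<forall>t\<in>{0..T}. \<forall>\<mu>\<in>wasserstein_space 1. \<forall>\<epsilon>>0. \<exists>\<delta>>0. \<forall>\<nu>\<in>wasserstein_space 1.
        wasserstein 1 \<mu> \<nu> < \<delta> \<longrightarrow> dist (u t \<mu>) (u t \<nu>) < \<epsilon>) \<and>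
     (\<forall>\<mu>\<in>wasserstein_space 1. (\<lambda>t. u t \<mu>) absolutely_integrable_on {0..T})"

definition integrably_lipschitz_control ::
    "real \<Rightarrow> (real \<Rightarrow> 'a::euclidean_space measure \<Rightarrow> 'a) \<Rightarrow> bool" where
  "integrably_lipschitz_control T u \<longleftrightarrow>
     (\<exists>L. L absolutely_integrable_on {0..T} \<and>
        (\<forall>t\<in>{0..T}. 0 \<le> L t \<and>
           (\<forall>\<mu>\<in>wasserstein_space 1. \<forall>\<nu>\<in>wasserstein_space 1.
              dist (u t \<mu>) (u t \<nu>) \<le> L t * wasserstein 1 \<mu> \<nu>)))"

text \<open>The vector \<open>y\<close> collects the \<open>m\<close> points \<open>y\<^sup>1, \<dots>, y\<^sup>m\<close>, where \<open>m\<close> is the cardinality of \<open>'m\<close>.\<close>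

definition particle_drift ::
    "('a::euclidean_space \<Rightarrow> 'a) \<Rightarrow> ('a \<Rightarrow> 'a) \<Rightarrow> 'a measure \<Rightarrow> 'a ^ 'm::finite \<Rightarrow> 'a \<Rightarrow> 'a" where
  "particle_drift H1 K1 \<mu> y x =
     conv_measure H1 \<mu> x + (1 / real CARD('m)) *\<^sub>R (\<Sum>j\<in>UNIV. K1 (y $ j - x))"

definition leader_field ::
    "('a::euclidean_space \<Rightarrow> 'a) \<Rightarrow> ('a \<Rightarrow> 'a) \<Rightarrow> ('m::finite \<Rightarrow> real \<Rightarrow> 'a measure \<Rightarrow> 'a) \<Rightarrow>
     real \<Rightarrow> 'a measure \<Rightarrow> 'a ^ 'm \<Rightarrow> 'a ^ 'm" where
  "leader_field K2 H2 u t \<mu> y =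
     (\<chi> i. conv_measure K2 \<mu> (y $ i)
        + (1 / real CARD('m)) *\<^sub>R (\<Sum>j\<in>UNIV. H2 (y $ j - y $ i)) + u i t \<mu>)"

text \<open>Caratheodory solutions of \<open>y' = f(t, y)\<close>, \<open>y(0) = y0\<close>, on \<open>[0,T]\<close>.\<close>

definition caratheodory_solution ::
    "real \<Rightarrow> (real \<Rightarrow> 'b::euclidean_space \<Rightarrow> 'b) \<Rightarrow> 'b \<Rightarrow> (real \<Rightarrow> 'b) \<Rightarrow> bool" where
  "caratheodory_solution T f y0 y \<longleftrightarrow>
     continuous_on {0..T} y \<and>
     (\<lambda>s. f s (y s)) absolutely_integrable_on {0..T} \<and>
     (\<forall>t\<in>{0..T}. y t = y0 + (LINT s:{0..t}|lebesgue. f s (y s)))"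

text \<open>Pathwise solutions of the McKean--Vlasov SDE coupled with the ODEs. That the time marginals
  have finite first moment is needed for the convolutions and the controls to be defined.\<close>

definition pathwise_solution ::
    "'w measure \<Rightarrow> (real \<Rightarrow> 'w \<Rightarrow> 'a::euclidean_space) \<Rightarrow> real \<Rightarrow> real \<Rightarrow>
     ('a \<Rightarrow> 'a) \<Rightarrow> ('a \<Rightarrow> 'a) \<Rightarrow> ('a \<Rightarrow> 'a) \<Rightarrow> ('a \<Rightarrow> 'a) \<Rightarrow> ('m::finite \<Rightarrow> real \<Rightarrow> 'a measure \<Rightarrow> 'a) \<Rightarrow>
     ('w \<Rightarrow> 'a) \<Rightarrow> 'a ^ 'm \<Rightarrow> ('w \<Rightarrow> real \<Rightarrow> 'a) \<Rightarrow> (real \<Rightarrow> 'a ^ 'm) \<Rightarrow> bool" where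
  "pathwise_solution M W T \<sigma> H1 H2 K1 K2 u X0 Y0 X Y \<longleftrightarrow>
     X \<in> measurable M (path_borel T) \<and>
     (let \<mu> = marginal (distr M (path_borel T) X) in
       (\<forall>t\<in>{0..T}. \<mu> t \<in> wasserstein_space 1) \<and>
       (AE \<omega> in M.
          X \<omega> 0 = X0 \<omega> \<and>
          (\<lambda>s. particle_drift H1 K1 (\<mu> s) (Y s) (X \<omega> s)) absolutely_integrable_on {0..T} \<and>
          (\<forall>t\<in>{0..T}. X \<omega> t = X0 \<omega>
             + (LINT s:{0..t}|lebesgue. particle_drift H1 K1 (\<mu> s) (Y s) (X \<omega> s))
             + sqrt (2 * \<sigma>) *\<^sub>R W t \<omega>)) \<and>
       caratheodory_solution T (\<lambda>t. leader_field K2 H2 u t (\<mu> t)) Y0 Y)"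

primrec C_k :: "nat \<Rightarrow> ('a::euclidean_space \<Rightarrow> real) \<Rightarrow> bool" where
  "C_k 0 f \<longleftrightarrow> continuous_on UNIV f"
| "C_k (Suc k) f \<longleftrightarrow> (\<forall>x. f differentiable (at x)) \<and>
     (\<forall>v. C_k k (\<lambda>x. frechet_derivative f (at x) v))"

definition test_function :: "('a::euclidean_space \<Rightarrow> real) \<Rightarrow> bool" where
  "test_function \<phi> \<longleftrightarrow> (\<forall>k. C_k k \<phi>) \<and> compact (closure {x. \<phi> x \<noteq> 0})"

definition grad :: "('a::euclidean_space \<Rightarrow> real) \<Rightarrow> 'a \<Rightarrow> 'a" where
  "grad \<phi> x = (\<Sum>b\<in>Basis. frechet_derivative \<phi> (at x) b *\<^sub>R b)"

definition laplacian :: "('a::euclidean_space \<Rightarrow> real) \<Rightarrow> 'a \<Rightarrow> real" where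
  "laplacian \<phi> x =
     (\<Sum>b\<in>Basis. frechet_derivative (\<lambda>y. frechet_derivative \<phi> (at y) b) (at x) b)"

text \<open>Weak solutions on \<open>[0,T]\<close> of \<open>\<partial>\<^sub>t \<mu> - \<sigma> \<Delta> \<mu> = - div (b\<^sub>t \<mu>)\<close>, where \<open>b\<^sub>t\<close> may
  depend on the solution.\<close>

definition weak_fokker_planck ::
    "real \<Rightarrow> real \<Rightarrow> (real \<Rightarrow> 'a::euclidean_space \<Rightarrow> 'a) \<Rightarrow> (real \<Rightarrow> 'a measure) \<Rightarrow> bool" where
  "weak_fokker_planck T \<sigma> b \<mu> \<longleftrightarrow>
     (\<forall>\<phi>. test_function \<phi> \<longrightarrow>
       (\<forall>t\<in>{0..T}. (\<integral>x. \<phi> x \<partial>\<mu> t) = (\<integral>x. \<phi> x \<partial>\<mu> 0)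
          + (LINT s:{0..t}|lebesgue. (\<integral>x. grad \<phi> x \<bullet> b s x + \<sigma> * laplacian \<phi> x \<partial>\<mu> s))))"

definition pde_ode_solution ::
    "real \<Rightarrow> real \<Rightarrow> ('a::euclidean_space \<Rightarrow> 'a) \<Rightarrow> ('a \<Rightarrow> 'a) \<Rightarrow> ('a \<Rightarrow> 'a) \<Rightarrow> ('a \<Rightarrow> 'a) \<Rightarrow>
     ('m::finite \<Rightarrow> real \<Rightarrow> 'a measure \<Rightarrow> 'a) \<Rightarrow> 'a measure \<Rightarrow> 'a ^ 'm \<Rightarrow>
     (real \<Rightarrow> 'a measure) \<Rightarrow> (real \<Rightarrow> 'a ^ 'm) \<Rightarrow> bool" where
  "pde_ode_solution T \<sigma> H1 H2 K1 K2 u \<mu>0 Y0 \<mu> Y \<longleftrightarrow>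
     wasserstein_continuous_on 1 {0..T} \<mu> \<and> continuous_on {0..T} Y \<and>
     weak_fokker_planck T \<sigma> (\<lambda>t. particle_drift H1 K1 (\<mu> t) (Y t)) \<mu> \<and>
     caratheodory_solution T (\<lambda>t. leader_field K2 H2 u t (\<mu> t)) Y0 Y \<and>
     \<mu> 0 = \<mu>0"

end

theory Submission
  imports Defs "HOL-Real_Asymp.Real_Asymp"
begin

text \<open>
  Both halves go through the Euler scheme, in place of Ito calculus and of parabolic theory. If the
  argument of the drift is projected onto a ball, an Euler step is a bounded shift followed by a
  step of the heat semigroup. Hence the expectation of a test function along the scheme telescopes
  into a Riemann sum of the generator, up to an error that vanishes with the step size; as the
  scheme converges pathwise to \<open>X\<close>, the law of \<open>X\<close> solves the weak equation.

  For uniqueness, let \<open>(\<nu>, Z)\<close> be a solution and freeze its drift. Testing the equation with the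
  heat flow of a Lipschitz function \<open>f\<close> gives a Duhamel formula, from which \<open>\<integral>f d\<nu>\<^sub>t\<close> agrees over one
  step with the backward Euler recursion up to \<open>o(h)\<close>. So \<open>\<nu>\<^sub>t\<close> is the law of the limit of the Euler
  scheme for the drift of \<open>\<nu>\<close>, driven by the given \<open>W\<close> and \<open>X0\<close>. This couples \<open>\<nu>\<^sub>t\<close> with \<open>X\<^sub>t\<close>: comparing
  the two schemes, and the two systems of ODEs, bounds \<open>W1(\<mu>\<^sub>t,\<nu>\<^sub>t) + |Y\<^sub>t - Z\<^sub>t|\<close> on a short interval by
  half of its supremum, so that it vanishes on \<open>[0,T]\<close> interval by interval.
\<close>

section \<open>Wasserstein distance of order one\<close>

text \<open>The obstacle is that the drift is Lipschitz but unbounded, while a competing solution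
  \<nu> comes with first moments only. Projecting onto a ball of radius R bounds one shift by a
  multiple of h (1 + R); letting R grow like a small power of 1 / h keeps the error per step at
  o(h), and \<nu> sees the projection only through the uniformly small tails of its first moments.
  On the other side, a single Euler path is bounded independently of h and R, so that pathwise the
  projection eventually disappears. The error per step is o(h) for a merely Lipschitz f because
  \<sigma> > 0: the heat flow keeps the Lipschitz constant of f, and after time \<tau> its gradient
  is Lipschitz with a constant of order 1 / sqrt \<tau>, a singularity that is integrable up to the
  final time. The last comparison halves a supremum instead of using Gronwall's inequality: the
  distance of two solutions need not be measurable in time, and the Lipschitz constants of the
  controls, only integrable in time, enter through the modulus of continuity of their
  primitive.\<close>

lemma wasserstein_space_1_iff:
  "\<mu> \<in> wasserstein_space 1 \<longleftrightarrow> prob_space \<mu> \<and> sets \<mu> = sets borel \<and> integrable \<mu> norm"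
  unfolding wasserstein_space_def by simp

lemma lipschitz_measurable:
  fixes f :: "'a::euclidean_space \<Rightarrow> 'b::euclidean_space"
  shows "L-lipschitz_on UNIV f \<Longrightarrow> f \<in> borel_measurable borel"
  by (intro borel_measurable_continuous_onI lipschitz_on_continuous_on)

lemma lipschitz_integrable:
  fixes f :: "'a::euclidean_space \<Rightarrow> 'b::euclidean_space"
  assumes "\<mu> \<in> wasserstein_space 1" "L-lipschitz_on UNIV f"
  shows "integrable \<mu> f"
proof -
  interpret prob_space \<mu> using assms wasserstein_space_1_iff by auto
  have [measurable_cong]: "sets \<mu> = sets borel" using assms wasserstein_space_1_iff by auto
  have [measurable]: "f \<in> borel_measurable borel" by (rule lipschitz_measurable[OF assms(2)])
  have n: "integrable \<mu> norm" using assms wasserstein_space_1_iff by auto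
  have "integrable \<mu> (\<lambda>x. norm (f 0) + L * norm x)"
    using n by auto
  then show ?thesis
  proof (rule Bochner_Integration.integrable_bound)
    show "AE x in \<mu>. norm (f x) \<le> norm (norm (f 0) + L * norm x)"
    proof (rule AE_I2)
      fix x
      have "dist (f x) (f 0) \<le> L * dist x 0"
        using lipschitz_onD[OF assms(2)] by blast
      then have "norm (f x) \<le> norm (f 0) + L * norm x"
        by (smt (verit) dist_norm norm_triangle_sub dist_0_norm dist_commute)
      then show "norm (f x) \<le> norm (norm (f 0) + L * norm x)" by auto
    qed
  qed simp
qed

text \<open>The easy half of Kantorovich-Rubinstein duality, one coupling at a time: both integrals
  are pulled back to the coupling, where the integrands differ by at most \<open>L * dist\<close>.
  Vector values are allowed because \<open>f\<close> will be a reflected interaction kernel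
  \<open>\<lambda>y. H (x - y)\<close>.\<close>

lemma coupling_lipschitz_bound:
  fixes f :: "'a::euclidean_space \<Rightarrow> 'b::euclidean_space"
  assumes \<mu>: "\<mu> \<in> wasserstein_space 1" and \<nu>: "\<nu> \<in> wasserstein_space 1"
    and \<pi>: "\<pi> \<in> couplings \<mu> \<nu>" and f: "L-lipschitz_on UNIV f"
  shows "ennreal (norm ((\<integral>x. f x \<partial>\<mu>) - (\<integral>x. f x \<partial>\<nu>))) \<le> ennreal L * (\<integral>\<^sup>+z. ennreal (dist (fst z) (snd z)) \<partial>\<pi>)"
proof -
  interpret prob_space \<pi> using \<pi> unfolding couplings_def by auto
  have s[measurable_cong]: "sets \<pi> = sets borel"
    and d1: "distr \<pi> borel fst = \<mu>" and d2: "distr \<pi> borel snd = \<nu>"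
    using \<pi> unfolding couplings_def by auto
  have [measurable]: "f \<in> borel_measurable borel" by (rule lipschitz_measurable[OF f])
  have [measurable]: "fst \<in> measurable \<pi> borel" "snd \<in> measurable \<pi> borel"
    by (auto simp: measurable_cong_sets[OF s refl] borel_prod[symmetric])
  have i1: "integrable \<pi> (\<lambda>z. f (fst z))"
    using lipschitz_integrable[OF \<mu> f] unfolding d1[symmetric] by (simp add: integrable_distr_eq)
  have i2: "integrable \<pi> (\<lambda>z. f (snd z))"
    using lipschitz_integrable[OF \<nu> f] unfolding d2[symmetric] by (simp add: integrable_distr_eq)
  have e: "(\<integral>x. f x \<partial>\<mu>) - (\<integral>x. f x \<partial>\<nu>) = (\<integral>z. f (fst z) - f (snd z) \<partial>\<pi>)"
    unfolding d1[symmetric] d2[symmetric] using i1 i2 by (simp add: integral_distr)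
  have "ennreal (norm (\<integral>z. f (fst z) - f (snd z) \<partial>\<pi>)) \<le> (\<integral>\<^sup>+z. norm (f (fst z) - f (snd z)) \<partial>\<pi>)"
    by (rule integral_norm_bound_ennreal) (use i1 i2 in auto)
  also have "\<dots> \<le> (\<integral>\<^sup>+z. ennreal L * ennreal (dist (fst z) (snd z)) \<partial>\<pi>)"
  proof (rule nn_integral_mono)
    fix z
    have "norm (f (fst z) - f (snd z)) \<le> L * dist (fst z) (snd z)"
      using lipschitz_onD[OF f, of "fst z" "snd z"] by (simp add: dist_norm)
    then show "ennreal (norm (f (fst z) - f (snd z))) \<le> ennreal L * ennreal (dist (fst z) (snd z))"
      using lipschitz_on_nonneg[OF f] by (simp add: ennreal_mult[symmetric])
  qed
  also have "\<dots> = ennreal L * (\<integral>\<^sup>+z. ennreal (dist (fst z) (snd z)) \<partial>\<pi>)"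
    by (rule nn_integral_cmult) simp
  finally show ?thesis unfolding e .
qed

lemma wasserstein_1:
  "wasserstein 1 \<mu> \<nu> = enn2real (INF \<pi>\<in>couplings \<mu> \<nu>. \<integral>\<^sup>+z. ennreal (dist (fst z) (snd z)) \<partial>\<pi>)"
  unfolding wasserstein_def by simp

text \<open>One coupling of finite cost, so that the infimum in \<open>wasserstein\<close> is finite
  and \<open>enn2real\<close> does not turn an infinite cost into 0.\<close>

lemma product_coupling:
  fixes \<mu> \<nu> :: "'a::euclidean_space measure"
  assumes \<mu>: "\<mu> \<in> wasserstein_space 1" and \<nu>: "\<nu> \<in> wasserstein_space 1"
  shows "\<mu> \<Otimes>\<^sub>M \<nu> \<in> couplings \<mu> \<nu>"
    and "(\<integral>\<^sup>+z. ennreal (dist (fst z) (snd z)) \<partial>(\<mu> \<Otimes>\<^sub>M \<nu>)) \<le> ennreal ((\<integral>x. norm x \<partial>\<mu>) + (\<integral>x. norm x \<partial>\<nu>))"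
proof -
  interpret M: prob_space \<mu> using \<mu> wasserstein_space_1_iff by auto
  interpret N: prob_space \<nu> using \<nu> wasserstein_space_1_iff by auto
  have s[measurable_cong]: "sets \<mu> = sets borel" "sets \<nu> = sets borel"
    and i: "integrable \<mu> norm" "integrable \<nu> norm" using assms wasserstein_space_1_iff by auto
  interpret P: pair_prob_space \<mu> \<nu> ..
  have sp: "sets (\<mu> \<Otimes>\<^sub>M \<nu>) = sets borel"
    using sets_pair_measure_cong[OF s] borel_prod by metis
  have "distr (\<mu> \<Otimes>\<^sub>M \<nu>) borel fst = distr (\<mu> \<Otimes>\<^sub>M \<nu>) \<mu> fst"
    by (rule distr_cong) (auto simp: s)
  also have "\<dots> = \<mu>" by (rule N.distr_pair_fst)
  finally have 1: "distr (\<mu> \<Otimes>\<^sub>M \<nu>) borel fst = \<mu>" .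
  have 2: "distr (\<mu> \<Otimes>\<^sub>M \<nu>) borel snd = \<nu>"
  proof (rule measure_eqI)
    fix A assume "A \<in> sets (distr (\<mu> \<Otimes>\<^sub>M \<nu>) borel snd)"
    then have A: "A \<in> sets \<nu>" by (simp add: s)
    have "snd -` A \<inter> space (\<mu> \<Otimes>\<^sub>M \<nu>) = space \<mu> \<times> A"
      using A sets.sets_into_space[OF A] by (auto simp: space_pair_measure)
    then show "emeasure (distr (\<mu> \<Otimes>\<^sub>M \<nu>) borel snd) A = emeasure \<nu> A"
      using N.emeasure_pair_measure_Times[OF sets.top[of \<mu>] A] M.emeasure_space_1 A
      by (subst emeasure_distr) (simp_all add: s)
  qed (simp add: s)
  show "\<mu> \<Otimes>\<^sub>M \<nu> \<in> couplings \<mu> \<nu>"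
    unfolding couplings_def using sp 1 2 P.prob_space_axioms by auto
  have "(\<integral>\<^sup>+z. ennreal (dist (fst z) (snd z)) \<partial>(\<mu> \<Otimes>\<^sub>M \<nu>)) \<le>
      (\<integral>\<^sup>+z. ennreal (norm (fst z)) + ennreal (norm (snd z)) \<partial>(\<mu> \<Otimes>\<^sub>M \<nu>))"
    by (rule nn_integral_mono) (auto simp: dist_norm norm_triangle_ineq4 simp flip: ennreal_plus)
  also have "\<dots> = (\<integral>\<^sup>+z. ennreal (norm (fst z)) \<partial>(\<mu> \<Otimes>\<^sub>M \<nu>)) + (\<integral>\<^sup>+z. ennreal (norm (snd z)) \<partial>(\<mu> \<Otimes>\<^sub>M \<nu>))"
    by (rule nn_integral_add) auto
  also have "(\<integral>\<^sup>+z. ennreal (norm (fst z)) \<partial>(\<mu> \<Otimes>\<^sub>M \<nu>)) = (\<integral>\<^sup>+x. ennreal (norm x) \<partial>distr (\<mu> \<Otimes>\<^sub>M \<nu>) borel fst)"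
    by (rule nn_integral_distr[symmetric]) auto
  also have "\<dots> = ennreal (\<integral>x. norm x \<partial>\<mu>)" unfolding 1 using i(1) by (simp add: nn_integral_eq_integral)
  also have "(\<integral>\<^sup>+z. ennreal (norm (snd z)) \<partial>(\<mu> \<Otimes>\<^sub>M \<nu>)) = (\<integral>\<^sup>+x. ennreal (norm x) \<partial>distr (\<mu> \<Otimes>\<^sub>M \<nu>) borel snd)"
    by (rule nn_integral_distr[symmetric]) auto
  also have "\<dots> = ennreal (\<integral>x. norm x \<partial>\<nu>)" unfolding 2 using i(2) by (simp add: nn_integral_eq_integral)
  finally show "(\<integral>\<^sup>+z. ennreal (dist (fst z) (snd z)) \<partial>(\<mu> \<Otimes>\<^sub>M \<nu>)) \<le> ennreal ((\<integral>x. norm x \<partial>\<mu>) + (\<integral>x. norm x \<partial>\<nu>))"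
    by simp
qed

lemma wasserstein_nonneg: "0 \<le> wasserstein 1 \<mu> \<nu>"
  unfolding wasserstein_1 by simp

lemma wasserstein_le_moments:
  fixes \<mu> \<nu> :: "'a::euclidean_space measure"
  assumes \<mu>: "\<mu> \<in> wasserstein_space 1" and \<nu>: "\<nu> \<in> wasserstein_space 1"
  shows "wasserstein 1 \<mu> \<nu> \<le> (\<integral>x. norm x \<partial>\<mu>) + (\<integral>x. norm x \<partial>\<nu>)"
proof -
  have "(INF \<pi>\<in>couplings \<mu> \<nu>. \<integral>\<^sup>+z. ennreal (dist (fst z) (snd z)) \<partial>\<pi>)
      \<le> ennreal ((\<integral>x. norm x \<partial>\<mu>) + (\<integral>x. norm x \<partial>\<nu>))"
    using INF_lower2[where f = "\<lambda>\<pi>. \<integral>\<^sup>+z. ennreal (dist (fst z) (snd z)) \<partial>\<pi>", OF product_coupling(1)[OF assms] product_coupling(2)[OF assms]] .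
  then show ?thesis unfolding wasserstein_1
    by (intro enn2real_leI) auto
qed

lemma wasserstein_lipschitz_bound:
  fixes f :: "'a::euclidean_space \<Rightarrow> 'b::euclidean_space"
  assumes \<mu>: "\<mu> \<in> wasserstein_space 1" and \<nu>: "\<nu> \<in> wasserstein_space 1"
    and f: "L-lipschitz_on UNIV f"
  shows "norm ((\<integral>x. f x \<partial>\<mu>) - (\<integral>x. f x \<partial>\<nu>)) \<le> L * wasserstein 1 \<mu> \<nu>"
proof -
  let ?I = "INF \<pi>\<in>couplings \<mu> \<nu>. \<integral>\<^sup>+z. ennreal (dist (fst z) (snd z)) \<partial>\<pi>"
  have fin: "?I \<noteq> \<infinity>"
    using INF_lower2[where f = "\<lambda>\<pi>. \<integral>\<^sup>+z. ennreal (dist (fst z) (snd z)) \<partial>\<pi>", OF product_coupling(1)[OF \<mu> \<nu>] product_coupling(2)[OF \<mu> \<nu>]]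
    by (metis ennreal_less_top infinity_ennreal_def leD)
  then have I: "?I = ennreal (wasserstein 1 \<mu> \<nu>)" unfolding wasserstein_1
    by (simp add: ennreal_enn2real_if)
  have L: "0 \<le> L" using lipschitz_on_nonneg[OF f] .
  show ?thesis
  proof (rule field_le_epsilon)
    fix e :: real assume e: "e > 0"
    \<comment> \<open>The infimum need not be attained, so a coupling within \<open>d\<close> of it
      is used; \<open>L + 1\<close> instead of \<open>L\<close> allows \<open>L = 0\<close> and
      still gives \<open>L * d \<le> e\<close>.\<close>
    define d where "d = e / (L + 1)"
    have d: "d > 0" using e L unfolding d_def by auto
    have "?I < ennreal (wasserstein 1 \<mu> \<nu> + d)"
      unfolding I using d wasserstein_nonneg by (intro ennreal_lessI) (auto intro: add_nonneg_pos)
    then obtain \<pi> where p: "\<pi> \<in> couplings \<mu> \<nu>"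
      "(\<integral>\<^sup>+z. ennreal (dist (fst z) (snd z)) \<partial>\<pi>) < ennreal (wasserstein 1 \<mu> \<nu> + d)"
      by (auto simp: INF_less_iff)
    have "ennreal (norm ((\<integral>x. f x \<partial>\<mu>) - (\<integral>x. f x \<partial>\<nu>))) \<le> ennreal L * ennreal (wasserstein 1 \<mu> \<nu> + d)"
      using coupling_lipschitz_bound[OF \<mu> \<nu> p(1) f] p(2) by (meson less_imp_le mult_left_mono order_trans zero_le)
    then have "norm ((\<integral>x. f x \<partial>\<mu>) - (\<integral>x. f x \<partial>\<nu>)) \<le> L * (wasserstein 1 \<mu> \<nu> + d)"
      using L d wasserstein_nonneg[of \<mu> \<nu>]
      by (simp add: ennreal_mult[symmetric] del: ennreal_plus)
    also have "\<dots> \<le> L * wasserstein 1 \<mu> \<nu> + e"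
    proof -
      have "L * d \<le> e" unfolding d_def using L e by (simp add: field_simps)
      then show ?thesis by (simp add: distrib_left)
    qed
    finally show "norm ((\<integral>x. f x \<partial>\<mu>) - (\<integral>x. f x \<partial>\<nu>)) \<le> L * wasserstein 1 \<mu> \<nu> + e" .
  qed
qed

text \<open>The joint law of \<open>X\<close> and \<open>Y\<close> competes in the infimum. Upper
  bounds between laws of processes on one probability space come from here.\<close>

lemma (in prob_space) wasserstein_distr_le:
  fixes X Y :: "'a \<Rightarrow> 'b::euclidean_space"
  assumes [measurable]: "X \<in> borel_measurable M" "Y \<in> borel_measurable M"
    and "0 \<le> C" and "(\<integral>\<^sup>+\<omega>. ennreal (dist (X \<omega>) (Y \<omega>)) \<partial>M) \<le> ennreal C"
  shows "wasserstein 1 (distr M borel X) (distr M borel Y) \<le> C"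
proof -
  let ?\<pi> = "distr M borel (\<lambda>\<omega>. (X \<omega>, Y \<omega>))"
  have [measurable]: "(\<lambda>\<omega>. (X \<omega>, Y \<omega>)) \<in> borel_measurable M"
    unfolding borel_prod[symmetric] by measurable
  have [measurable]: "fst \<in> borel_measurable borel" "snd \<in> borel_measurable borel"
    by (auto intro!: borel_measurable_continuous_onI continuous_intros)
  have p: "?\<pi> \<in> couplings (distr M borel X) (distr M borel Y)"
    unfolding couplings_def by (auto intro!: prob_space_distr simp: distr_distr o_def)
  have "(\<integral>\<^sup>+z. ennreal (dist (fst z) (snd z)) \<partial>?\<pi>) = (\<integral>\<^sup>+\<omega>. ennreal (dist (X \<omega>) (Y \<omega>)) \<partial>M)"
    by (subst nn_integral_distr) (auto intro!: borel_measurable_continuous_onI continuous_intros measurable_compose[OF _ measurable_ennreal])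
  with assms have "(\<integral>\<^sup>+z. ennreal (dist (fst z) (snd z)) \<partial>?\<pi>) \<le> ennreal C" by simp
  from INF_lower2[where f = "\<lambda>\<pi>. \<integral>\<^sup>+z. ennreal (dist (fst z) (snd z)) \<partial>\<pi>", OF p this] show ?thesis
    unfolding wasserstein_1 using assms(3) by (intro enn2real_leI) auto
qed

text \<open>Closed sets form a generator that is stable under intersections, and the indicator of a
  nonempty closed set is the limit of the Lipschitz functions
  \<open>max 0 (1 - n * infdist x X)\<close>.\<close>

lemma measure_eqI_bounded_lipschitz:
  fixes M N :: "'a::euclidean_space measure"
  assumes "prob_space M" "prob_space N" and [measurable_cong]: "sets M = sets borel" "sets N = sets borel"
    and eq: "\<And>(f :: 'a \<Rightarrow> real) L. L-lipschitz_on UNIV f \<Longrightarrow> (\<And>x. 0 \<le> f x \<and> f x \<le> 1) \<Longrightarrow>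
      (\<integral>x. f x \<partial>M) = (\<integral>x. f x \<partial>N)"
  shows "M = N"
proof (rule measure_eqI_generator_eq[where E = "Collect closed" and \<Omega> = UNIV and A = "\<lambda>_. UNIV"])
  interpret M: prob_space M by fact
  interpret N: prob_space N by fact
  fix X :: "'a set" assume "X \<in> Collect closed"
  then have X: "closed X" and [measurable]: "X \<in> sets borel" by auto
  show "emeasure M X = emeasure N X"
  \<comment> \<open>\<open>infdist x {}\<close> is 0 by convention, so for the empty set the
    approximation would tend to 1.\<close>
  proof (cases "X = {}")
    case False
    define f where "f n x = max 0 (1 - real n * infdist x X)" for n :: nat and x
    have lip: "(real n)-lipschitz_on UNIV (f n)" for n
    proof (rule lipschitz_onI)
      fix x y :: 'a
      have "\<bar>infdist x X - infdist y X\<bar> \<le> dist x y"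
        using infdist_triangle_abs by blast
      then have "real n * \<bar>infdist x X - infdist y X\<bar> \<le> real n * dist x y"
        by (intro mult_left_mono) auto
      moreover have "\<bar>f n x - f n y\<bar> \<le> \<bar>real n * infdist x X - real n * infdist y X\<bar>"
        unfolding f_def by (auto simp: max_def)
      moreover have "\<bar>real n * infdist x X - real n * infdist y X\<bar> = real n * \<bar>infdist x X - infdist y X\<bar>"
        by (simp add: abs_mult flip: right_diff_distrib)
      ultimately show "dist (f n x) (f n y) \<le> real n * dist x y" by (simp add: dist_real_def)
    qed simp
    have m[measurable]: "f n \<in> borel_measurable borel" for n by (rule lipschitz_measurable[OF lip])
    have b: "0 \<le> f n x \<and> f n x \<le> 1" for n x
      unfolding f_def by (auto intro!: mult_nonneg_nonneg infdist_nonneg)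
    have lim: "(\<lambda>n. f n x) \<longlonglongrightarrow> indicator X x" for x
    proof (cases "x \<in> X")
      case True
      then show ?thesis unfolding f_def by simp
    next
      case False
      then have p: "infdist x X > 0" using X \<open>X \<noteq> {}\<close> infdist_pos_not_in_closed by blast
      obtain k :: nat where k: "1 / infdist x X \<le> real k" using real_arch_simple by blast
      have "eventually (\<lambda>n. f n x = 0) sequentially"
      proof (rule eventually_sequentiallyI[of k])
        fix n assume "k \<le> n"
        then have "1 / infdist x X \<le> real n" using k by linarith
        then show "f n x = 0" using p unfolding f_def by (auto simp: field_simps)
      qed
      then show ?thesis using False by (simp add: tendsto_eventually)
    qed
    have "(\<lambda>n. \<integral>x. f n x \<partial>M) \<longlonglongrightarrow> (\<integral>x. indicator X x \<partial>M)"
      by (rule integral_dominated_convergence[where w = "\<lambda>_. 1"])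
         (use b lim X in \<open>auto simp: abs_le_iff\<close>)
    moreover have "(\<lambda>n. \<integral>x. f n x \<partial>N) \<longlonglongrightarrow> (\<integral>x. indicator X x \<partial>N)"
      by (rule integral_dominated_convergence[where w = "\<lambda>_. 1"])
         (use b lim X in \<open>auto simp: abs_le_iff\<close>)
    moreover have "(\<integral>x. f n x \<partial>M) = (\<integral>x. f n x \<partial>N)" for n
      by (rule eq[OF lip]) (use b in auto)
    ultimately have "(\<integral>x. indicator X x \<partial>M) = (\<integral>x. indicator X x \<partial>N :: real)"
      using LIMSEQ_unique by auto
    then show ?thesis using X by (simp add: M.emeasure_eq_measure N.emeasure_eq_measure)
  qed simp
next
  show "Int_stable (Collect closed :: 'a set set)" by (auto simp: Int_stable_def)
qed (auto simp: assms borel_eq_closed sets_measure_of prob_space.emeasure_space_1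
      intro!: finite_measure.emeasure_finite prob_space.finite_measure)

text \<open>Continuity at each time becomes uniform by a Lebesgue number of a cover of the interval.
  The conclusion speaks of integrals of Lipschitz functions and not of \<open>wasserstein\<close>
  itself: the two comparisons with a centre of the cover are then joined by the triangle inequality
  of the norm, and no gluing of couplings is needed.\<close>

lemma wasserstein_uniformly_continuous:
  fixes \<nu> :: "real \<Rightarrow> 'a::euclidean_space measure"
  assumes \<nu>: "wasserstein_continuous_on 1 {0..T} \<nu>" and e: "e > 0"
  shows "\<exists>d>0. \<forall>r\<in>{0..T}. \<forall>s\<in>{0..T}. \<bar>r - s\<bar> < d \<longrightarrow>
    (\<forall>L (f :: 'a \<Rightarrow> 'b::euclidean_space). L-lipschitz_on UNIV f \<longrightarrow>
      norm ((\<integral>x. f x \<partial>\<nu> r) - (\<integral>x. f x \<partial>\<nu> s)) \<le> L * e)"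
proof -
  have w: "\<nu> t \<in> wasserstein_space 1" if "t \<in> {0..T}" for t
    using \<nu> that unfolding wasserstein_continuous_on_def by auto
  \<comment> \<open>The limit at \<open>t\<close> leaves out \<open>s = t\<close>; for that time the
    two integrals coincide and nothing has to be shown.\<close>
  have "\<exists>d>0. \<forall>s\<in>{0..T}. dist s t < d \<longrightarrow> s \<noteq> t \<longrightarrow> wasserstein 1 (\<nu> s) (\<nu> t) < e / 2" if t: "t \<in> {0..T}" for t
  proof -
    have "((\<lambda>s. wasserstein 1 (\<nu> s) (\<nu> t)) \<longlongrightarrow> 0) (at t within {0..T})"
      using \<nu> t unfolding wasserstein_continuous_on_def by auto
    then have "eventually (\<lambda>s. dist (wasserstein 1 (\<nu> s) (\<nu> t)) 0 < e / 2) (at t within {0..T})"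
      using e by (intro tendstoD) auto
    then show ?thesis unfolding eventually_at dist_real_def by (metis abs_ge_self diff_zero order_le_less_trans)
  qed
  then obtain d where d: "\<And>t. t \<in> {0..T} \<Longrightarrow> d t > 0"
    "\<And>t s. t \<in> {0..T} \<Longrightarrow> s \<in> {0..T} \<Longrightarrow> dist s t < d t \<Longrightarrow> s \<noteq> t \<Longrightarrow> wasserstein 1 (\<nu> s) (\<nu> t) < e / 2"
    by metis
  obtain \<epsilon> where \<epsilon>: "0 < \<epsilon>" "\<And>x. x \<in> {0..T} \<Longrightarrow> \<exists>G \<in> (\<lambda>t. ball t (d t)) ` {0..T}. ball x \<epsilon> \<subseteq> G"
  proof (rule Heine_Borel_lemma[of "{0..T}" "(\<lambda>t. ball t (d t)) ` {0..T}"])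
    show "{0..T} \<subseteq> \<Union> ((\<lambda>t. ball t (d t)) ` {0..T})" using d(1) by (auto intro!: bexI)
  qed (auto intro: that)
  show ?thesis
  proof (intro exI conjI ballI allI impI)
    fix r s L and f :: "'a \<Rightarrow> 'b"
    assume rs: "r \<in> {0..T}" "s \<in> {0..T}" "\<bar>r - s\<bar> < \<epsilon>" and f: "L-lipschitz_on UNIV f"
    obtain t where t: "t \<in> {0..T}" "ball r \<epsilon> \<subseteq> ball t (d t)" using \<epsilon>(2)[OF rs(1)] by auto
    have L: "0 \<le> L" using lipschitz_on_nonneg[OF f] .
    have *: "norm ((\<integral>x. f x \<partial>\<nu> q) - (\<integral>x. f x \<partial>\<nu> t)) \<le> L * (e / 2)" if q: "q \<in> {0..T}" "q \<in> ball r \<epsilon>" for q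
    proof (cases "q = t")
      case False
      have "q \<in> ball t (d t)" using q(2) t(2) by blast
      then have "dist q t < d t" by (simp add: dist_commute)
      then have "wasserstein 1 (\<nu> q) (\<nu> t) < e / 2" using d(2) q t False by auto
      then show ?thesis
        using wasserstein_lipschitz_bound[OF w[OF q(1)] w[OF t(1)] f] L
        by (meson less_imp_le mult_left_mono order_trans)
    qed (use L e in auto)
    have 1: "norm ((\<integral>x. f x \<partial>\<nu> r) - (\<integral>x. f x \<partial>\<nu> t)) \<le> L * (e / 2)" by (rule *) (use rs \<epsilon> in auto)
    have 2: "norm ((\<integral>x. f x \<partial>\<nu> s) - (\<integral>x. f x \<partial>\<nu> t)) \<le> L * (e / 2)"
      by (rule *) (use rs in \<open>auto simp: dist_real_def\<close>)
    have "norm (((\<integral>x. f x \<partial>\<nu> r) - (\<integral>x. f x \<partial>\<nu> t)) - ((\<integral>x. f x \<partial>\<nu> s) - (\<integral>x. f x \<partial>\<nu> t))) \<le> L * (e / 2) + L * (e / 2)"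
      by (rule order_trans[OF norm_triangle_ineq4]) (use 1 2 in linarith)
    then show "norm ((\<integral>x. f x \<partial>\<nu> r) - (\<integral>x. f x \<partial>\<nu> s)) \<le> L * e" by simp
  qed (use \<epsilon> in auto)
qed

text \<open>For \<open>R \<ge> 0\<close> this is the distance to the centred ball of radius
  \<open>R\<close>. Being Lipschitz, it can replace \<open>norm x\<close> times the indicator of
  \<open>norm x > R\<close> as a measure of the tail, with an integral that is continuous along
  curves in Wasserstein space.\<close>

definition excess :: "real \<Rightarrow> 'a::euclidean_space \<Rightarrow> real" where
  "excess R x = max 0 (norm x - R)"

lemma excess_lipschitz: "1-lipschitz_on UNIV (excess R)"
proof (rule lipschitz_onI)
  fix x y :: 'a
  have "\<bar>norm x - norm y\<bar> \<le> norm (x - y)" by (rule norm_triangle_ineq3)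
  then show "dist (excess R x) (excess R y) \<le> 1 * dist x y"
    unfolding excess_def dist_real_def dist_norm by (auto simp: max_def)
qed simp

lemma excess_measurable[measurable]: "excess R \<in> borel_measurable borel"
  unfolding excess_def by measurable

lemma excess_nonneg: "0 \<le> excess R x" unfolding excess_def by auto

text \<open>At one time the tail vanishes by dominated convergence. A finite net of times has a
  common radius because \<open>excess\<close> decreases in \<open>R\<close>, and the uniform
  continuity of integrals of 1-Lipschitz functions carries it to the times between.\<close>

lemma wasserstein_uniformly_integrable:
  fixes \<nu> :: "real \<Rightarrow> 'a::euclidean_space measure"
  assumes \<nu>: "wasserstein_continuous_on 1 {0..T} \<nu>" and e: "e > 0"
  shows "\<exists>R\<ge>1. \<forall>t\<in>{0..T}. (\<integral>x. excess R x \<partial>\<nu> t) \<le> e"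
proof -
  have w: "\<nu> t \<in> wasserstein_space 1" if "t \<in> {0..T}" for t
    using \<nu> that unfolding wasserstein_continuous_on_def by auto
  obtain d where d: "d > 0" and dd: "\<forall>r\<in>{0..T}. \<forall>s\<in>{0..T}. \<bar>r - s\<bar> < d \<longrightarrow>
    (\<forall>L (f :: 'a \<Rightarrow> real). L-lipschitz_on UNIV f \<longrightarrow>
      norm ((\<integral>x. f x \<partial>\<nu> r) - (\<integral>x. f x \<partial>\<nu> s)) \<le> L * (e / 2))"
    using wasserstein_uniformly_continuous[where 'b = real, OF \<nu> half_gt_zero[OF e]] by blast
  have "\<exists>R. \<forall>S\<ge>R. (\<integral>x. excess S x \<partial>\<nu> t) \<le> e / 2" if t: "t \<in> {0..T}" for t
  proof -
    interpret prob_space "\<nu> t" using w[OF t] wasserstein_space_1_iff by auto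
    have [measurable_cong]: "sets (\<nu> t) = sets borel" and n: "integrable (\<nu> t) norm"
      using w[OF t] wasserstein_space_1_iff by auto
    have "(\<lambda>n. \<integral>x. excess (real n) x \<partial>\<nu> t) \<longlonglongrightarrow> (\<integral>x. 0 \<partial>\<nu> t)"
    proof (rule integral_dominated_convergence[where w = norm])
      show "AE x in \<nu> t. (\<lambda>n. excess (real n) x) \<longlonglongrightarrow> 0"
      proof (rule AE_I2)
        fix x :: 'a
        obtain k :: nat where k: "norm x \<le> real k" using real_arch_simple by blast
        have "eventually (\<lambda>n. excess (real n) x = 0) sequentially"
          by (rule eventually_sequentiallyI[of k]) (use k in \<open>auto simp: excess_def\<close>)
        then show "(\<lambda>n. excess (real n) x) \<longlonglongrightarrow> 0" by (rule tendsto_eventually)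
      qed
      show "AE x in \<nu> t. norm (excess (real n) x) \<le> norm x" for n
        by (auto simp: excess_def)
    qed (use n in auto)
    then have "eventually (\<lambda>n. (\<integral>x. excess (real n) x \<partial>\<nu> t) < e / 2) sequentially"
      using e by (intro order_tendstoD(2)) auto
    then obtain n where n: "(\<integral>x. excess (real n) x \<partial>\<nu> t) < e / 2"
      by (auto simp: eventually_sequentially)
    have "(\<integral>x. excess S x \<partial>\<nu> t) \<le> e / 2" if "S \<ge> real n" for S
    proof -
      have "(\<integral>x. excess S x \<partial>\<nu> t) \<le> (\<integral>x. excess (real n) x \<partial>\<nu> t)"
        by (intro integral_mono lipschitz_integrable[OF w[OF t] excess_lipschitz]) (use that in \<open>auto simp: excess_def\<close>)
      then show ?thesis using n by auto
    qed
    then show ?thesis by blast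
  qed
  then obtain R where R: "\<And>t S. t \<in> {0..T} \<Longrightarrow> S \<ge> R t \<Longrightarrow> (\<integral>x. excess S x \<partial>\<nu> t) \<le> e / 2" by metis
  obtain K where K: "K \<subseteq> {0..T}" "finite K" "{0..T} \<subseteq> (\<Union>t\<in>K. ball t d)"
    by (rule compactE_image[of "{0..T}" "{0..T}" "\<lambda>t. ball t d"]) (use d in auto)
  define S where "S = Max (insert 1 (R ` K))"
  have S: "S \<ge> 1" "\<And>t. t \<in> K \<Longrightarrow> S \<ge> R t" unfolding S_def using K(2) by auto
  have "(\<integral>x. excess S x \<partial>\<nu> t) \<le> e" if t: "t \<in> {0..T}" for t
  proof -
    obtain k where k: "k \<in> K" "\<bar>t - k\<bar> < d" using K(3) t by (auto simp: dist_real_def)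
    then have "norm ((\<integral>x. excess S x \<partial>\<nu> t) - (\<integral>x. excess S x \<partial>\<nu> k)) \<le> 1 * (e / 2)"
      using dd t K(1) excess_lipschitz[of S] by blast
    moreover have "(\<integral>x. excess S x \<partial>\<nu> k) \<le> e / 2" using R S k K(1) by blast
    ultimately show ?thesis unfolding real_norm_def by linarith
  qed
  then show ?thesis using S by blast
qed

lemma wasserstein_bounded_moment:
  fixes \<nu> :: "real \<Rightarrow> 'a::euclidean_space measure"
  assumes \<nu>: "wasserstein_continuous_on 1 {0..T} \<nu>"
  shows "\<exists>C\<ge>0. \<forall>t\<in>{0..T}. (\<integral>x. norm x \<partial>\<nu> t) \<le> C"
proof -
  obtain R where R: "R \<ge> 1" "\<And>t. t \<in> {0..T} \<Longrightarrow> (\<integral>x. excess R x \<partial>\<nu> t) \<le> 1"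
    using wasserstein_uniformly_integrable[OF \<nu>, of 1] by auto
  have "(\<integral>x. norm x \<partial>\<nu> t) \<le> R + 1" if t: "t \<in> {0..T}" for t
  proof -
    have w: "\<nu> t \<in> wasserstein_space 1" using \<nu> t unfolding wasserstein_continuous_on_def by auto
    interpret prob_space "\<nu> t" using w wasserstein_space_1_iff by auto
    have n: "integrable (\<nu> t) norm" using w wasserstein_space_1_iff by auto
    have i: "integrable (\<nu> t) (excess R)" by (rule lipschitz_integrable[OF w excess_lipschitz])
    have "(\<integral>x. norm x \<partial>\<nu> t) \<le> (\<integral>x. R + excess R x \<partial>\<nu> t)"
      by (rule integral_mono) (use n i in \<open>auto simp: excess_def\<close>)
    also have "\<dots> = R + (\<integral>x. excess R x \<partial>\<nu> t)" using i by (simp add: prob_space)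
    finally show ?thesis using R(2)[OF t] by simp
  qed
  then show ?thesis using R by (intro exI[of _ "R + 1"]) auto
qed

section \<open>Drifts generated by measures and leaders\<close>

text \<open>The modulus in time is uniform over all of space although \<open>b\<close> may be
  unbounded: in the intended drift, time enters through the leaders and through integrals of the
  kernel \<open>\<lambda>y. H (x - y)\<close>, whose Lipschitz constant does not depend on
  \<open>x\<close>.\<close>

definition regular_drift :: "real \<Rightarrow> real \<Rightarrow> (real \<Rightarrow> 'a::euclidean_space \<Rightarrow> 'a) \<Rightarrow> bool" where
  "regular_drift T L b \<longleftrightarrow> (\<forall>t\<in>{0..T}. L-lipschitz_on UNIV (b t)) \<and>
     (\<forall>e>0. \<exists>d>0. \<forall>r\<in>{0..T}. \<forall>s\<in>{0..T}. \<bar>r - s\<bar> < d \<longrightarrow> (\<forall>x. norm (b r x - b s x) \<le> e))"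

lemma regular_drift_growth:
  assumes "regular_drift T L b"
  shows "\<exists>C\<ge>0. \<forall>t\<in>{0..T}. \<forall>x. norm (b t x) \<le> C * (1 + norm x)"
proof -
  have lip: "L-lipschitz_on UNIV (b t)" if "t \<in> {0..T}" for t using assms that unfolding regular_drift_def by auto
  have "continuous_on {0..T} (\<lambda>t. b t 0)"
    unfolding continuous_on_iff
  proof (intro ballI allI impI)
    fix s e :: real assume s: "s \<in> {0..T}" and e: "e > 0"
    obtain d where d: "d > 0" "\<forall>r\<in>{0..T}. \<forall>s\<in>{0..T}. \<bar>r - s\<bar> < d \<longrightarrow> (\<forall>x. norm (b r x - b s x) \<le> e/2)"
      using assms e unfolding regular_drift_def by (metis half_gt_zero)
    have "dist (b r 0) (b s 0) < e" if "r \<in> {0..T}" "dist r s < d" for r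
    proof -
      have "norm (b r 0 - b s 0) \<le> e / 2" using d(2) s that unfolding dist_real_def by blast
      then show ?thesis using e unfolding dist_norm by linarith
    qed
    then show "\<exists>d>0. \<forall>x'\<in>{0..T}. dist x' s < d \<longrightarrow> dist (b x' 0) (b s 0) < e"
      using d(1) by blast
  qed
  then have "compact ((\<lambda>t. b t 0) ` {0..T})" by (intro compact_continuous_image) auto
  then obtain B where B: "\<And>t. t \<in> {0..T} \<Longrightarrow> norm (b t 0) \<le> B" using compact_imp_bounded bounded_iff by (metis imageI)
  have "norm (b t x) \<le> max (max B 0) \<bar>L\<bar> * (1 + norm x)" if t: "t \<in> {0..T}" for t x
  proof -
    have "norm (b t x - b t 0) \<le> L * norm x"
      using lipschitz_onD[OF lip[OF t], of x 0] by (simp add: dist_norm)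
    then have "norm (b t x) \<le> B + L * norm x" using B[OF t] norm_triangle_sub[of "b t x" "b t 0"] by linarith
    also have "\<dots> \<le> max (max B 0) \<bar>L\<bar> * 1 + max (max B 0) \<bar>L\<bar> * norm x"
      by (intro add_mono mult_right_mono) auto
    finally show ?thesis by (simp add: distrib_left)
  qed
  then show ?thesis by (intro exI[of _ "max (max B 0) \<bar>L\<bar>"]) auto
qed

lemma lipschitz_reflect:
  fixes H :: "'a::euclidean_space \<Rightarrow> 'b::euclidean_space"
  assumes H: "L-lipschitz_on UNIV H"
  shows "L-lipschitz_on UNIV (\<lambda>y. H (x - y))"
proof (rule lipschitz_onI)
  fix y z
  have "dist (x - y) (x - z) = dist y z" by (simp add: dist_norm norm_minus_commute)
  then show "dist (H (x - y)) (H (x - z)) \<le> L * dist y z"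
    using lipschitz_onD[OF H, of "x - y" "x - z"] by simp
qed (rule lipschitz_on_nonneg[OF H])

lemma conv_measure_lipschitz:
  assumes \<mu>: "\<mu> \<in> wasserstein_space 1" and H: "L-lipschitz_on UNIV H"
  shows "L-lipschitz_on UNIV (conv_measure H \<mu>)"
proof (rule lipschitz_onI)
  interpret prob_space \<mu> using \<mu> wasserstein_space_1_iff by auto
  have l: "L-lipschitz_on UNIV (\<lambda>y. H (x - y))" for x
    by (rule lipschitz_reflect[OF H])
  fix x y
  have i: "integrable \<mu> (\<lambda>z. H (x - z))" for x by (rule lipschitz_integrable[OF \<mu> l])
  have "dist (conv_measure H \<mu> x) (conv_measure H \<mu> y) = norm (\<integral>z. H (x - z) - H (y - z) \<partial>\<mu>)"
    unfolding conv_measure_def dist_norm using i by simp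
  also have "\<dots> \<le> (\<integral>z. norm (H (x - z) - H (y - z)) \<partial>\<mu>)" by (rule integral_norm_bound)
  also have "\<dots> \<le> (\<integral>z. L * dist x y \<partial>\<mu>)"
  proof (rule integral_mono)
    show "norm (H (x - z) - H (y - z)) \<le> L * dist x y" for z
      using lipschitz_onD[OF H, of "x - z" "y - z"] by (simp add: dist_norm)
  qed (use i in auto)
  finally show "dist (conv_measure H \<mu> x) (conv_measure H \<mu> y) \<le> L * dist x y" by (simp add: prob_space)
qed (rule lipschitz_on_nonneg[OF H])

lemma particle_drift_lipschitz:
  fixes y :: "'a::euclidean_space ^ 'm::finite"
  assumes \<mu>: "\<mu> \<in> wasserstein_space 1" and H: "L-lipschitz_on UNIV H" and K: "L'-lipschitz_on UNIV K"
  shows "(L + L')-lipschitz_on UNIV (particle_drift H K \<mu> y)"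
proof -
  have "(\<Sum>j\<in>(UNIV::'m set). L')-lipschitz_on UNIV (\<lambda>x. \<Sum>j\<in>UNIV. K (y $ j - x))"
  proof -
    have "(\<Sum>j\<in>A. L')-lipschitz_on UNIV (\<lambda>x. \<Sum>j\<in>A. K (y $ j - x))" if "finite A" for A :: "'m set"
      using that
    proof induction
      case empty
      then show ?case by (auto intro: lipschitz_on_constant)
    next
      case (insert a A)
      then show ?case using lipschitz_on_add[OF lipschitz_reflect[OF K] insert.IH, of "y $ a"] insert.hyps
        by (simp add: distrib_right)
    qed
    then show ?thesis by simp
  qed
  from lipschitz_on_cmult[OF this, of "1 / real CARD('m)"]
  have "L'-lipschitz_on UNIV (\<lambda>x. (1 / real CARD('m)) *\<^sub>R (\<Sum>j\<in>UNIV. K (y $ j - x)))"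
    by simp
  from lipschitz_on_add[OF conv_measure_lipschitz[OF \<mu> H] this]
  show ?thesis unfolding particle_drift_def .
qed

lemma mean_norm_le:
  fixes f :: "'m::finite \<Rightarrow> 'a::real_normed_vector"
  assumes "\<And>j. norm (f j) \<le> C"
  shows "norm ((1 / real CARD('m)) *\<^sub>R (\<Sum>j\<in>UNIV. f j)) \<le> C"
proof -
  have "norm (\<Sum>j\<in>UNIV. f j) \<le> real CARD('m) * C"
    using sum_norm_bound[of UNIV f C] assms by simp
  then show ?thesis by (simp add: field_simps)
qed

text \<open>The influence of the measure is kept as an abstract bound \<open>e\<close>, because it
  is supplied in two ways: by the modulus of continuity in time along one curve of measures, and by
  \<open>wasserstein 1 \<mu> \<nu>\<close> for two different curves.\<close>

lemma particle_drift_diff: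
  fixes y z :: "'a::euclidean_space ^ 'm::finite"
  assumes \<mu>: "\<mu> \<in> wasserstein_space 1" "\<nu> \<in> wasserstein_space 1"
    and H: "L-lipschitz_on UNIV H" and K: "L'-lipschitz_on UNIV K"
    and e: "\<And>f :: 'a \<Rightarrow> 'a. L-lipschitz_on UNIV f \<Longrightarrow> norm ((\<integral>x. f x \<partial>\<mu>) - (\<integral>x. f x \<partial>\<nu>)) \<le> e"
  shows "norm (particle_drift H K \<mu> y x - particle_drift H K \<nu> z x) \<le> e + L' * norm (y - z)"
proof -
  have "norm (conv_measure H \<mu> x - conv_measure H \<nu> x) \<le> e"
    unfolding conv_measure_def by (rule e) (rule lipschitz_reflect[OF H])
  moreover have "norm ((1 / real CARD('m)) *\<^sub>R (\<Sum>j\<in>UNIV. K (y $ j - x) - K (z $ j - x))) \<le> L' * norm (y - z)"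
  proof (rule mean_norm_le)
    fix j
    have "norm (K (y $ j - x) - K (z $ j - x)) \<le> L' * norm (y $ j - z $ j)"
      using lipschitz_onD[OF K, of "y $ j - x" "z $ j - x"] by (simp add: dist_norm)
    also have "\<dots> \<le> L' * norm (y - z)"
      using lipschitz_on_nonneg[OF K] Finite_Cartesian_Product.norm_nth_le[where x = "y - z" and i = j] by (intro mult_left_mono) auto
    finally show "norm (K (y $ j - x) - K (z $ j - x)) \<le> L' * norm (y - z)" .
  qed
  moreover have "particle_drift H K \<mu> y x - particle_drift H K \<nu> z x =
     (conv_measure H \<mu> x - conv_measure H \<nu> x) + (1 / real CARD('m)) *\<^sub>R (\<Sum>j\<in>UNIV. K (y $ j - x) - K (z $ j - x))"
    unfolding particle_drift_def by (simp add: sum_subtractf scaleR_diff_right)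
  ultimately show ?thesis by (simp only:) (rule norm_triangle_le, rule add_mono)
qed

lemma particle_drift_diff_wasserstein:
  fixes y z :: "'a::euclidean_space ^ 'm::finite"
  assumes \<mu>: "\<mu> \<in> wasserstein_space 1" "\<nu> \<in> wasserstein_space 1"
    and H: "L-lipschitz_on UNIV H" and K: "L'-lipschitz_on UNIV K"
  shows "norm (particle_drift H K \<mu> y x - particle_drift H K \<nu> z x) \<le> L * wasserstein 1 \<mu> \<nu> + L' * norm (y - z)"
  using particle_drift_diff[OF assms] wasserstein_lipschitz_bound[OF \<mu>] by blast

lemma regular_drift_particle:
  fixes Y :: "real \<Rightarrow> 'a::euclidean_space ^ 'm::finite"
  assumes \<nu>: "wasserstein_continuous_on 1 {0..T} \<nu>" and Y: "continuous_on {0..T} Y"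
    and H: "L-lipschitz_on UNIV H" and K: "L'-lipschitz_on UNIV K"
  shows "regular_drift T (L + L') (\<lambda>t. particle_drift H K (\<nu> t) (Y t))"
  unfolding regular_drift_def
proof (intro conjI ballI allI impI)
  have w: "\<nu> t \<in> wasserstein_space 1" if "t \<in> {0..T}" for t
    using \<nu> that unfolding wasserstein_continuous_on_def by auto
  show "(L + L')-lipschitz_on UNIV (particle_drift H K (\<nu> t) (Y t))" if "t \<in> {0..T}" for t
    by (rule particle_drift_lipschitz[OF w[OF that] H K])
  fix e :: real assume e: "e > 0"
  have L: "0 \<le> L" "0 \<le> L'" using lipschitz_on_nonneg H K by auto
  \<comment> \<open>Half of \<open>e\<close> is reserved for the measure and half for the leaders;
    \<open>L + 1\<close> guards against \<open>L = 0\<close>.\<close>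
  have pos: "e / (2 * (L + 1)) > 0" using e L by auto
  obtain d1 where d1: "d1 > 0" "\<forall>r\<in>{0..T}. \<forall>s\<in>{0..T}. \<bar>r - s\<bar> < d1 \<longrightarrow>
    (\<forall>M (f :: 'a \<Rightarrow> 'a). M-lipschitz_on UNIV f \<longrightarrow>
      norm ((\<integral>x. f x \<partial>\<nu> r) - (\<integral>x. f x \<partial>\<nu> s)) \<le> M * (e / (2 * (L + 1))))"
    using wasserstein_uniformly_continuous[where 'b = 'a, OF \<nu> pos]
    by (elim exE conjE) (rule that)
  have uc: "uniformly_continuous_on {0..T} Y" using Y by (intro compact_uniformly_continuous) auto
  have pos': "e / (2 * (L' + 1)) > 0" using e L by auto
  obtain d2 where d2: "d2 > 0" "\<And>r s. r \<in> {0..T} \<Longrightarrow> s \<in> {0..T} \<Longrightarrow> dist r s < d2 \<Longrightarrow> dist (Y r) (Y s) < e / (2 * (L' + 1))"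
    using uc[unfolded uniformly_continuous_on_def, rule_format, OF pos'] by metis
  show "\<exists>d>0. \<forall>r\<in>{0..T}. \<forall>s\<in>{0..T}. \<bar>r - s\<bar> < d \<longrightarrow>
     (\<forall>x. norm (particle_drift H K (\<nu> r) (Y r) x - particle_drift H K (\<nu> s) (Y s) x) \<le> e)"
  proof (intro exI[of _ "min d1 d2"] conjI ballI impI allI)
    fix r s x assume rs: "r \<in> {0..T}" "s \<in> {0..T}" "\<bar>r - s\<bar> < min d1 d2"
    have "norm (particle_drift H K (\<nu> r) (Y r) x - particle_drift H K (\<nu> s) (Y s) x) \<le> L * (e / (2 * (L + 1))) + L' * norm (Y r - Y s)"
      by (rule particle_drift_diff[OF w w H K]) (use d1 rs in auto)
    also have "\<dots> \<le> e / 2 + e / 2"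
    proof (intro add_mono)
      show "L * (e / (2 * (L + 1))) \<le> e / 2" using L e by (simp add: field_simps)
      have "norm (Y r - Y s) \<le> e / (2 * (L' + 1))" using d2(2)[of r s] rs by (auto simp: dist_norm dist_real_def)
      then have "L' * norm (Y r - Y s) \<le> L' * (e / (2 * (L' + 1)))" using L by (intro mult_left_mono) auto
      also have "\<dots> \<le> e / 2" using L e by (simp add: field_simps)
      finally show "L' * norm (Y r - Y s) \<le> e / 2" .
    qed
    finally show "norm (particle_drift H K (\<nu> r) (Y r) x - particle_drift H K (\<nu> s) (Y s) x) \<le> e" by simp
  qed (use d1 d2 in auto)
qed

text \<open>The factor \<open>CARD('m)\<close> comes from bounding the norm of a vector by the sum
  of its components, and \<open>2 * L'\<close> from \<open>H2\<close>, whose argument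
  \<open>y $ j - y $ i\<close> moves at both ends. The coarse form with the single factor
  \<open>wasserstein 1 \<mu> \<nu> + norm (y - z)\<close> is what the contraction argument
  uses.\<close>

lemma leader_field_diff:
  fixes y z :: "'a::euclidean_space ^ 'm::finite"
  assumes \<mu>: "\<mu> \<in> wasserstein_space 1" "\<nu> \<in> wasserstein_space 1"
    and K: "L-lipschitz_on UNIV K2" and H: "L'-lipschitz_on UNIV H2"
    and u: "\<And>i. dist (u i t \<mu>) (u i t \<nu>) \<le> l i * wasserstein 1 \<mu> \<nu>" and l: "\<And>i. 0 \<le> l i"
  shows "norm (leader_field K2 H2 u t \<mu> y - leader_field K2 H2 u t \<nu> z)
    \<le> (real CARD('m) * (L + 2 * L') + (\<Sum>i\<in>UNIV. l i)) * (wasserstein 1 \<mu> \<nu> + norm (y - z))"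
proof -
  let ?w = "wasserstein 1 \<mu> \<nu>" and ?n = "norm (y - z)"
  have L: "0 \<le> L" "0 \<le> L'" "0 \<le> ?w" using lipschitz_on_nonneg H K wasserstein_nonneg by auto
  have yz: "norm (y $ i - z $ i) \<le> ?n" for i using Finite_Cartesian_Product.norm_nth_le[where x = "y - z" and i = i] by simp
  have c: "norm ((leader_field K2 H2 u t \<mu> y - leader_field K2 H2 u t \<nu> z) $ i) \<le> (L * ?w + L * ?n) + 2 * L' * ?n + l i * ?w" for i
  proof -
    have "norm (conv_measure K2 \<mu> (y $ i) - conv_measure K2 \<nu> (y $ i)) \<le> L * ?w"
      unfolding conv_measure_def by (rule wasserstein_lipschitz_bound[OF \<mu> lipschitz_reflect[OF K]])
    moreover have "norm (conv_measure K2 \<nu> (y $ i) - conv_measure K2 \<nu> (z $ i)) \<le> L * ?n"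
      using lipschitz_onD[OF conv_measure_lipschitz[OF \<mu>(2) K], of "y $ i" "z $ i"] yz[of i] L
      by (simp add: dist_norm) (meson mult_left_mono order_trans)
    moreover have "norm ((1 / real CARD('m)) *\<^sub>R (\<Sum>j\<in>UNIV. H2 (y $ j - y $ i) - H2 (z $ j - z $ i))) \<le> 2 * L' * ?n"
    proof (rule mean_norm_le)
      fix j
      have "norm (H2 (y $ j - y $ i) - H2 (z $ j - z $ i)) \<le> L' * norm ((y $ j - z $ j) - (y $ i - z $ i))"
        using lipschitz_onD[OF H, of "y $ j - y $ i" "z $ j - z $ i"] by (simp add: dist_norm algebra_simps)
      also have "\<dots> \<le> L' * (2 * ?n)"
        using norm_triangle_ineq4[of "y $ j - z $ j" "y $ i - z $ i"] yz[of i] yz[of j] L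
        by (intro mult_left_mono) linarith+
      finally show "norm (H2 (y $ j - y $ i) - H2 (z $ j - z $ i)) \<le> 2 * L' * ?n" by simp
    qed
    moreover have "norm (u i t \<mu> - u i t \<nu>) \<le> l i * ?w" using u[of i] by (simp add: dist_norm)
    moreover have "(leader_field K2 H2 u t \<mu> y - leader_field K2 H2 u t \<nu> z) $ i =
       ((conv_measure K2 \<mu> (y $ i) - conv_measure K2 \<nu> (y $ i)) + (conv_measure K2 \<nu> (y $ i) - conv_measure K2 \<nu> (z $ i)))
       + (1 / real CARD('m)) *\<^sub>R (\<Sum>j\<in>UNIV. H2 (y $ j - y $ i) - H2 (z $ j - z $ i)) + (u i t \<mu> - u i t \<nu>)"
      unfolding leader_field_def by (simp add: sum_subtractf scaleR_diff_right)
    ultimately show ?thesis by (smt (verit) norm_triangle_ineq)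
  qed
  have "norm (leader_field K2 H2 u t \<mu> y - leader_field K2 H2 u t \<nu> z) \<le>
     (\<Sum>i\<in>UNIV. norm ((leader_field K2 H2 u t \<mu> y - leader_field K2 H2 u t \<nu> z) $ i))"
    unfolding norm_vec_def by (rule L2_set_le_sum) auto
  also have "\<dots> \<le> (\<Sum>i\<in>UNIV. (L * ?w + L * ?n) + 2 * L' * ?n + l i * ?w)" by (rule sum_mono) (rule c)
  also have "\<dots> \<le> (\<Sum>i\<in>(UNIV::'m set). (L + 2 * L' + l i) * (?w + ?n))"
  proof (rule sum_mono)
    fix i :: 'm
    have "0 \<le> L' * ?w" "0 \<le> l i * ?n" using L l by auto
    then show "(L * ?w + L * ?n) + 2 * L' * ?n + l i * ?w \<le> (L + 2 * L' + l i) * (?w + ?n)"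
      by (simp add: algebra_simps)
  qed
  also have "\<dots> = (real CARD('m) * (L + 2 * L') + (\<Sum>i\<in>UNIV. l i)) * (?w + ?n)"
    by (simp add: sum_distrib_right[symmetric] sum.distrib)
  finally show ?thesis .
qed

section \<open>Test functions and cutoffs\<close>

text \<open>The point comes last, so that \<open>dirder f v\<close> is again a function of the point
  and can be differentiated further.\<close>

definition dirder :: "('a::euclidean_space \<Rightarrow> real) \<Rightarrow> 'a \<Rightarrow> 'a \<Rightarrow> real" where
  "dirder f v x = frechet_derivative f (at x) v"

lemma dirderI: "(f has_derivative f') (at x) \<Longrightarrow> dirder f v x = f' v"
  unfolding dirder_def using frechet_derivative_at by metis

lemma has_derivative_dirder: "f differentiable (at x) \<Longrightarrow> (f has_derivative (\<lambda>v. dirder f v x)) (at x)"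
  unfolding dirder_def by (metis frechet_derivative_works eta_contract_eq)

lemma dirder_sum_Basis:
  assumes "f differentiable (at x)"
  shows "dirder f v x = (\<Sum>b\<in>Basis. (v \<bullet> b) * dirder f b x)"
proof -
  have "linear (\<lambda>v. dirder f v x)"
    using has_derivative_dirder[OF assms] has_derivative_linear by blast
  from Linear_Algebra.linear_componentwise[OF this, of v 1] show ?thesis by simp
qed

lemma grad_inner:
  assumes "f differentiable (at x)"
  shows "grad f x \<bullet> v = dirder f v x"
  unfolding dirder_sum_Basis[OF assms, of v] grad_def
  by (simp add: inner_sum_left dirder_def) (simp add: inner_commute[of v] mult.commute)

lemma laplacian_dirder: "laplacian f x = (\<Sum>b\<in>Basis. dirder (dirder f b) b x)"
  unfolding laplacian_def dirder_def ..

lemma C_k_Suc_dirder: "C_k (Suc k) f \<longleftrightarrow> (\<forall>x. f differentiable (at x)) \<and> (\<forall>v. C_k k (dirder f v))"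
  by (simp add: dirder_def[abs_def])

lemma C_k_of_Suc: "C_k (Suc k) f \<Longrightarrow> C_k k f"
proof (induction k arbitrary: f)
  case 0
  then show ?case
    by (auto intro!: continuous_at_imp_continuous_on differentiable_imp_continuous_within)
next
  case (Suc k)
  then show ?case unfolding C_k_Suc_dirder by blast
qed

definition smooth :: "('a::euclidean_space \<Rightarrow> real) \<Rightarrow> bool" where
  "smooth f \<longleftrightarrow> (\<forall>k. C_k k f)"

lemma smooth_differentiable: "smooth f \<Longrightarrow> f differentiable (at x)"
  unfolding smooth_def using C_k_Suc_dirder by blast

lemma smooth_dirder: "smooth f \<Longrightarrow> smooth (dirder f v)"
  unfolding smooth_def using C_k_Suc_dirder by blast

lemma smooth_continuous: "smooth f \<Longrightarrow> continuous_on UNIV f"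
  unfolding smooth_def by (metis C_k.simps(1))

lemma smooth_measurable: "smooth f \<Longrightarrow> f \<in> borel_measurable borel"
  by (rule borel_measurable_continuous_onI) (rule smooth_continuous)

lemma smoothI_class:
  assumes "\<And>f x. f \<in> S \<Longrightarrow> f differentiable (at x)" "\<And>f v. f \<in> S \<Longrightarrow> dirder f v \<in> S" "f \<in> S"
  shows "smooth f"
proof -
  have "C_k k f" if "f \<in> S" for k f using that
  proof (induction k arbitrary: f)
    case 0
    then show ?case using assms(1)
      by (auto intro!: continuous_at_imp_continuous_on differentiable_imp_continuous_within)
  next
    case (Suc k)
    then show ?case using assms unfolding C_k_Suc_dirder by blast
  qed
  then show ?thesis using assms(3) unfolding smooth_def by auto
qed

lemma dirder_add:
  assumes "f differentiable (at x)" "g differentiable (at x)"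
  shows "dirder (\<lambda>x. f x + g x) v x = dirder f v x + dirder g v x"
  by (rule dirderI[OF has_derivative_add[OF assms[THEN has_derivative_dirder]]])

lemma dirder_mult:
  assumes "f differentiable (at x)" "g differentiable (at x)"
  shows "dirder (\<lambda>x. f x * g x) v x = f x * dirder g v x + dirder f v x * g x"
  by (rule dirderI[OF has_derivative_mult[OF assms[THEN has_derivative_dirder]]])

lemma dirder_const: "dirder (\<lambda>x. c) v x = 0"
  by (rule dirderI[OF has_derivative_const])

lemma dirder_scale:
  assumes "\<And>x. f differentiable (at x)"
  shows "((\<lambda>x. f (c *\<^sub>R x)) has_derivative (\<lambda>v. c * dirder f v (c *\<^sub>R x))) (at x)"
proof -
  have "((\<lambda>x. c *\<^sub>R x) has_derivative (\<lambda>v. c *\<^sub>R v)) (at x)"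
    by (intro derivative_intros)
  from has_derivative_compose[OF this has_derivative_dirder[OF assms]]
  have "((\<lambda>x. f (c *\<^sub>R x)) has_derivative (\<lambda>v. dirder f (c *\<^sub>R v) (c *\<^sub>R x))) (at x)" .
  moreover have "dirder f (c *\<^sub>R v) (c *\<^sub>R x) = c * dirder f v (c *\<^sub>R x)" for v
    unfolding dirder_sum_Basis[OF assms, of "c *\<^sub>R v"] dirder_sum_Basis[OF assms, of v]
    by (simp add: sum_distrib_left mult.assoc)
  ultimately show ?thesis by simp
qed

lemma C_k_add: "C_k k f \<Longrightarrow> C_k k g \<Longrightarrow> C_k k (\<lambda>x. f x + g x)"
proof (induction k arbitrary: f g)
  case 0
  then show ?case by (auto intro: continuous_on_add)
next
  case (Suc k)
  then have d: "f differentiable (at x)" "g differentiable (at x)" for x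
    unfolding C_k_Suc_dirder by auto
  have "dirder (\<lambda>x. f x + g x) v = (\<lambda>x. dirder f v x + dirder g v x)" for v
    using dirder_add[OF d] by auto
  then show ?case using Suc d unfolding C_k_Suc_dirder by auto
qed

lemma smooth_mult: "smooth f \<Longrightarrow> smooth g \<Longrightarrow> smooth (\<lambda>x. f x * g x)"
proof -
  have "C_k k f \<Longrightarrow> C_k k g \<Longrightarrow> C_k k (\<lambda>x. f x * g x)" for k
  proof (induction k arbitrary: f g)
    case 0
    then show ?case by (auto intro: continuous_on_mult)
  next
    case (Suc k)
    then have d: "f differentiable (at x)" "g differentiable (at x)" for x
      unfolding C_k_Suc_dirder by auto
    have *: "C_k k f" "C_k k g" using Suc.prems C_k_of_Suc by auto
    have "dirder (\<lambda>x. f x * g x) v = (\<lambda>x. f x * dirder g v x + dirder f v x * g x)" for v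
      using dirder_mult[OF d] by auto
    then have "C_k k (dirder (\<lambda>x. f x * g x) v)" for v
      using Suc.IH[OF *(1)] Suc.IH[OF _ *(2)] Suc.prems unfolding C_k_Suc_dirder by (simp add: C_k_add)
    then show ?case using d unfolding C_k_Suc_dirder by auto
  qed
  then show "smooth f \<Longrightarrow> smooth g \<Longrightarrow> smooth (\<lambda>x. f x * g x)" unfolding smooth_def by blast
qed

lemma smooth_const: "smooth (\<lambda>x. c)"
proof (rule smoothI_class[where S = "{f. \<exists>c. f = (\<lambda>x. c)}"])
  fix f :: "'a \<Rightarrow> real" and v x assume "f \<in> {f. \<exists>c. f = (\<lambda>x. c)}"
  then obtain c where f: "f = (\<lambda>x. c)" by blast
  show "f differentiable (at x)" unfolding f by simp
  have "dirder f v = (\<lambda>x. 0)" unfolding f by (rule ext) (rule dirder_const)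
  then show "dirder f v \<in> {f. \<exists>c. f = (\<lambda>x. c)}" by blast
qed blast

lemma smooth_scale: "smooth f \<Longrightarrow> smooth (\<lambda>x. f (c *\<^sub>R x))"
proof -
  assume f: "smooth f"
  show ?thesis
  \<comment> \<open>Each differentiation produces a factor \<open>c\<close>; the scalar
    \<open>a\<close> in the class absorbs it.\<close>
  proof (rule smoothI_class[where S = "{\<lambda>x. a * g (c *\<^sub>R x) | a g. smooth g}"])
    fix h x assume "h \<in> {\<lambda>x. a * g (c *\<^sub>R x) | a g. smooth g}"
    then obtain a g where h: "h = (\<lambda>x. a * g (c *\<^sub>R x))" and g: "smooth g" by auto
    have D: "(h has_derivative (\<lambda>v. a * (c * dirder g v (c *\<^sub>R x)))) (at x)" for x
      unfolding h by (intro has_derivative_mult_right dirder_scale smooth_differentiable g)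
    then show "h differentiable (at x)" by (auto simp: differentiable_def)
    fix v
    have "dirder h v = (\<lambda>x. (a * c) * dirder g v (c *\<^sub>R x))"
      using dirderI[OF D] by (auto simp: mult.assoc)
    then show "dirder h v \<in> {\<lambda>x. a * g (c *\<^sub>R x) | a g. smooth g}" using smooth_dirder[OF g] by blast
  next
    show "(\<lambda>x. f (c *\<^sub>R x)) \<in> {\<lambda>x. a * g (c *\<^sub>R x) | a g. smooth g}"
      using f by (auto intro!: exI[of _ 1] exI[of _ f])
  qed
qed

lemma test_function_iff: "test_function \<phi> \<longleftrightarrow> smooth \<phi> \<and> compact (closure {x. \<phi> x \<noteq> 0})"
  unfolding test_function_def smooth_def ..

lemma test_function_dirder:
  assumes "test_function \<phi>"
  shows "test_function (dirder \<phi> v)"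
proof -
  have s: "smooth \<phi>" and c: "compact (closure {x. \<phi> x \<noteq> 0})" using assms test_function_iff by auto
  have "dirder \<phi> v x = 0" if x: "x \<notin> closure {x. \<phi> x \<noteq> 0}" for x
  proof (rule dirderI)
    have "((\<lambda>x. 0) has_derivative (\<lambda>v. 0)) (at x)" by simp
    then show "(\<phi> has_derivative (\<lambda>v. 0)) (at x)"
      by (rule has_derivative_transform_within_open[where s = "- closure {x. \<phi> x \<noteq> 0}"])
         (use x closure_subset[of "{x. \<phi> x \<noteq> 0}"] in auto)
  qed
  then have "closure {x. dirder \<phi> v x \<noteq> 0} \<subseteq> closure {x. \<phi> x \<noteq> 0}"
    by (intro closure_minimal) auto
  then have "compact (closure {x. dirder \<phi> v x \<noteq> 0})"
    using compact_Int_closed[OF c closed_closure] by (metis Int_absorb1)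
  then show ?thesis using smooth_dirder[OF s] test_function_iff by auto
qed

lemma test_function_bounded:
  assumes "test_function \<phi>"
  shows "bounded (range \<phi>)"
proof -
  have "compact (\<phi> ` closure {x. \<phi> x \<noteq> 0})"
    using assms test_function_iff smooth_continuous
    by (intro compact_continuous_image) (auto intro: continuous_on_subset)
  then have "bounded (insert 0 (\<phi> ` closure {x. \<phi> x \<noteq> 0}))" using compact_imp_bounded by auto
  moreover have "range \<phi> \<subseteq> insert 0 (\<phi> ` closure {x. \<phi> x \<noteq> 0})"
    using closure_subset[of "{x. \<phi> x \<noteq> 0}"] by auto
  ultimately show ?thesis by (rule bounded_subset)
qed

section \<open>Functions with bounded derivatives of all orders\<close>

primrec bounded_k :: "nat \<Rightarrow> ('a::euclidean_space \<Rightarrow> real) \<Rightarrow> bool" where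
  "bounded_k 0 f \<longleftrightarrow> bounded (range f)"
| "bounded_k (Suc k) f \<longleftrightarrow> bounded (range f) \<and> (\<forall>v. bounded_k k (dirder f v))"

text \<open>The natural domain of the heat semigroup: it contains the test functions, is invariant
  under the heat flow and under \<open>dirder\<close>, and every bounded measurable function enters
  it after a positive time.\<close>

definition bsmooth :: "('a::euclidean_space \<Rightarrow> real) \<Rightarrow> bool" where
  "bsmooth f \<longleftrightarrow> smooth f \<and> (\<forall>k. bounded_k k f)"

lemma bsmooth_smooth: "bsmooth f \<Longrightarrow> smooth f" unfolding bsmooth_def by auto

lemma bsmooth_dirder: "bsmooth f \<Longrightarrow> bsmooth (dirder f v)"
  unfolding bsmooth_def using smooth_dirder bounded_k.simps(2) by blast

lemma bsmooth_bounded: "bsmooth f \<Longrightarrow> bounded (range f)"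
  unfolding bsmooth_def using bounded_k.simps(1) by blast

lemma bsmoothI_class:
  assumes "\<And>f x. f \<in> S \<Longrightarrow> f differentiable (at x)" "\<And>f v. f \<in> S \<Longrightarrow> dirder f v \<in> S"
    "\<And>f. f \<in> S \<Longrightarrow> bounded (range f)" "f \<in> S"
  shows "bsmooth f"
proof -
  have "bounded_k k f" if "f \<in> S" for k f using that
    by (induction k arbitrary: f) (use assms in auto)
  then show ?thesis using smoothI_class[of S f] assms unfolding bsmooth_def by auto
qed

lemma test_function_bsmooth: "test_function \<phi> \<Longrightarrow> bsmooth \<phi>"
  by (rule bsmoothI_class[where S = "Collect test_function"])
     (auto intro: test_function_dirder test_function_bounded smooth_differentiable simp del: bounded_iff
        dest: test_function_iff[THEN iffD1])

lemma lipschitz_from_dirder: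
  assumes d: "\<And>x. f differentiable (at x)" and b: "\<And>x b. b \<in> Basis \<Longrightarrow> \<bar>dirder f b x\<bar> \<le> c b"
  shows "(\<Sum>b\<in>Basis. c b)-lipschitz_on UNIV f"
proof (rule lipschitz_onI)
  have c: "0 \<le> c b" if "b \<in> Basis" for b using b[OF that] by (meson abs_ge_zero order_trans)
  then show "0 \<le> (\<Sum>b\<in>Basis. c b)" by (rule sum_nonneg)
  fix x y
  have "norm (f x - f y) \<le> (\<Sum>b\<in>Basis. c b) * norm (x - y)"
  proof (rule differentiable_bound[where S = UNIV and f' = "\<lambda>x v. dirder f v x"])
    show "(f has_derivative (\<lambda>v. dirder f v x)) (at x within UNIV)" for x
      using has_derivative_dirder[OF d] by simp
    show "onorm (\<lambda>v. dirder f v x) \<le> (\<Sum>b\<in>Basis. c b)" for x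
    proof (rule onorm_le)
      fix v
      have "\<bar>dirder f v x\<bar> \<le> (\<Sum>b\<in>Basis. \<bar>v \<bullet> b\<bar> * \<bar>dirder f b x\<bar>)"
        unfolding dirder_sum_Basis[OF d, of v] by (rule order_trans[OF sum_abs]) (simp add: abs_mult)
      also have "\<dots> \<le> (\<Sum>b\<in>Basis. norm v * c b)"
        by (intro sum_mono mult_mono b Basis_le_norm) (use c in auto)
      finally show "norm (dirder f v x) \<le> (\<Sum>b\<in>Basis. c b) * norm v"
        by (simp add: sum_distrib_left[symmetric] mult.commute)
    qed
  qed auto
  then show "dist (f x) (f y) \<le> (\<Sum>b\<in>Basis. c b) * dist x y" by (simp add: dist_norm)
qed

lemma bsmooth_lipschitz:
  assumes "bsmooth f"
  shows "\<exists>L. L-lipschitz_on UNIV f"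
proof -
  have "\<exists>c. \<forall>x. \<bar>dirder f b x\<bar> \<le> c" for b
    using bsmooth_bounded[OF bsmooth_dirder[OF assms, of b]] by (auto simp: bounded_iff)
  then obtain c where "\<And>b x. \<bar>dirder f b x\<bar> \<le> c b" by metis
  from lipschitz_from_dirder[of f c, OF smooth_differentiable[OF bsmooth_smooth[OF assms]] this]
  show ?thesis by blast
qed

section \<open>Bump functions and cutoffs\<close>

definition flat :: "nat \<Rightarrow> real \<Rightarrow> real" where
  "flat j t = (if t \<le> 0 then 0 else (1 / t) ^ j * exp (- (1 / t)))"

lemma flat_tendsto: "(flat j \<longlongrightarrow> 0) (at 0)"
proof -
  have "((\<lambda>t. (inverse t) ^ j / exp (inverse t)) \<longlongrightarrow> 0) (at_right (0::real))"
    by (rule filterlim_compose[OF tendsto_power_div_exp_0 filterlim_inverse_at_top_right])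
  then have r: "(flat j \<longlongrightarrow> 0) (at_right 0)"
    by (rule Lim_transform_eventually)
       (auto simp: eventually_at_right_field flat_def exp_minus field_simps intro!: exI[of _ 1])
  have l: "(flat j \<longlongrightarrow> 0) (at_left 0)"
    by (rule tendsto_eventually) (auto simp: eventually_at_left_field flat_def intro!: exI[of _ "-1"])
  show ?thesis using l r by (simp add: filterlim_at_split)
qed

text \<open>\<open>flat 0\<close> is the classical function \<open>exp (- 1 / t)\<close> continued
  by 0. The extra powers of \<open>1 / t\<close> make the family closed under differentiation up to
  linear combinations, also at \<open>t = 0\<close>.\<close>

lemma flat_deriv: "(flat j has_field_derivative (flat (j + 2) t - real j * flat (j + 1) t)) (at t)"
proof -
  consider "t < 0" | "t = 0" | "t > 0" by linarith
  then show ?thesis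
  proof cases
    case 1
    have "((\<lambda>t. 0::real) has_field_derivative 0) (at t)" by simp
    then have "(flat j has_field_derivative 0) (at t)"
      by (rule has_field_derivative_transform_within_open[where S = "{..<0}"]) (use 1 in \<open>auto simp: flat_def\<close>)
    then show ?thesis using 1 by (simp add: flat_def)
  next
    case 2
    \<comment> \<open>At 0 the difference quotient of \<open>flat j\<close> is
      \<open>flat (Suc j)\<close> itself, on both sides.\<close>
    have "((\<lambda>h. (flat j (0 + h) - flat j 0) / h) \<longlongrightarrow> 0) (at 0)"
      by (rule Lim_transform_eventually[OF flat_tendsto[of "Suc j"]])
         (auto simp: flat_def eventually_at intro!: exI[of _ 1])
    then show ?thesis unfolding 2 DERIV_def by (simp add: flat_def)
  next
    case 3
    have "((\<lambda>t. (1 / t) ^ j * exp (- (1 / t))) has_field_derivative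
        (real j * (1 / t) ^ (j - 1) * (- (1 / t^2)) * exp (- (1 / t)) + (1 / t) ^ j * (exp (- (1 / t)) * (1 / t^2)))) (at t)"
      using 3 by (auto intro!: derivative_eq_intros simp: power2_eq_square)
    moreover have "real j * (1 / t) ^ (j - 1) * (- (1 / t^2)) * exp (- (1 / t)) + (1 / t) ^ j * (exp (- (1 / t)) * (1 / t^2))
       = flat (j + 2) t - real j * flat (j + 1) t"
      using 3 by (cases j) (auto simp: flat_def power2_eq_square field_simps)
    ultimately have "((\<lambda>t. (1 / t) ^ j * exp (- (1 / t))) has_field_derivative (flat (j + 2) t - real j * flat (j + 1) t)) (at t)"
      by simp
    then show ?thesis
      by (rule has_field_derivative_transform_within_open[where S = "{0<..}"]) (use 3 in \<open>auto simp: flat_def\<close>)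
  qed
qed

text \<open>The smallest algebra around \<open>flat j (1 - x \<bullet> x)\<close> that is closed
  under \<open>dirder\<close>; the linear functions are there because differentiating
  \<open>x \<bullet> x\<close> creates them.\<close>

inductive_set bump_class :: "('a::euclidean_space \<Rightarrow> real) set" where
  const: "(\<lambda>x. c) \<in> bump_class"
| inner: "(\<lambda>x. x \<bullet> v) \<in> bump_class"
| flat: "(\<lambda>x. flat j (1 - x \<bullet> x)) \<in> bump_class"
| add: "f \<in> bump_class \<Longrightarrow> g \<in> bump_class \<Longrightarrow> (\<lambda>x. f x + g x) \<in> bump_class"
| mult: "f \<in> bump_class \<Longrightarrow> g \<in> bump_class \<Longrightarrow> (\<lambda>x. f x * g x) \<in> bump_class"

lemma bump_class_dirder:
  assumes "f \<in> bump_class"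
  shows "(\<forall>x. f differentiable (at x)) \<and> (\<forall>v. dirder f v \<in> bump_class)"
  using assms
proof induction
  case (const c)
  have "dirder (\<lambda>x. c) v = (\<lambda>x::'a. 0)" for v by (simp add: fun_eq_iff dirder_const)
  then show ?case by (auto intro: bump_class.intros)
next
  case (inner w)
  have D: "((\<lambda>x. x \<bullet> w) has_derivative (\<lambda>v. v \<bullet> w)) (at x)" for x
    by (auto intro!: derivative_eq_intros)
  then have "dirder (\<lambda>x. x \<bullet> w) v = (\<lambda>x. v \<bullet> w)" for v using dirderI by blast
  then show ?case using D by (auto simp: differentiable_def intro: bump_class.intros)
next
  case (flat j)
  have D: "((\<lambda>x. flat j (1 - x \<bullet> x)) has_derivative
     (\<lambda>v. (flat (j + 2) (1 - x \<bullet> x) - real j * flat (j + 1) (1 - x \<bullet> x)) * (- 2 * (x \<bullet> v)))) (at x)" for x :: 'a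
    by (rule has_derivative_eq_rhs[OF has_derivative_compose[OF _ flat_deriv[unfolded has_field_derivative_def]]])
       (auto intro!: derivative_eq_intros simp: inner_commute)
  have e: "dirder (\<lambda>x::'a. flat j (1 - x \<bullet> x)) v =
     (\<lambda>x. (flat (j + 2) (1 - x \<bullet> x) + (- real j) * flat (j + 1) (1 - x \<bullet> x)) * (- 2 * (x \<bullet> v)))" for v
    using dirderI[OF D] by auto
  have "dirder (\<lambda>x::'a. flat j (1 - x \<bullet> x)) v \<in> bump_class" for v
    unfolding e by (intro bump_class.intros)
  then show ?case using D by (auto simp: differentiable_def)
next
  case (add f g)
  then have "dirder (\<lambda>x. f x + g x) v = (\<lambda>x. dirder f v x + dirder g v x)" for v
    using dirder_add by blast
  then show ?case using add by (auto intro: bump_class.intros)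
next
  case (mult f g)
  then have e: "dirder (\<lambda>x. f x * g x) v = (\<lambda>x. f x * dirder g v x + dirder f v x * g x)" for v
    using dirder_mult by blast
  have "dirder (\<lambda>x. f x * g x) v \<in> bump_class" for v
    unfolding e by (intro bump_class.add bump_class.mult) (use mult in auto)
  then show ?case using mult by auto
qed

text \<open>The factor \<open>exp 1\<close> normalises the value at the origin to 1. The function is
  not constant on a smaller ball; for the passage to the limit it is enough that its values lie
  between 0 and 1 and tend to 1 for each \<open>x\<close>, and that its derivatives are of order
  \<open>1 / R\<close>.\<close>

definition cutoff :: "real \<Rightarrow> 'a::euclidean_space \<Rightarrow> real" where
  "cutoff R x = exp 1 * flat 0 (1 - ((1 / R) *\<^sub>R x) \<bullet> ((1 / R) *\<^sub>R x))"

lemma smooth_cutoff: "smooth (cutoff R)"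
proof -
  have "smooth (\<lambda>x::'a. exp 1 * flat 0 (1 - x \<bullet> x))"
    by (rule smoothI_class[where S = bump_class]) (use bump_class_dirder in \<open>auto intro: bump_class.intros\<close>)
  from smooth_scale[OF this, of "1 / R"] show ?thesis unfolding cutoff_def[abs_def] .
qed

lemma cutoff_range: "0 \<le> cutoff R x \<and> cutoff R x \<le> 1"
proof -
  have "exp 1 * flat 0 (1 - y \<bullet> y) \<le> 1" for y :: 'a
  proof (cases "1 - y \<bullet> y \<le> 0")
    case False
    have "1 \<le> 1 / (1 - y \<bullet> y)" using False by (simp add: field_simps)
    then have "exp 1 * exp (- (1 / (1 - y \<bullet> y))) \<le> 1"
      by (simp add: exp_add[symmetric])
    then show ?thesis using False by (simp add: flat_def)
  qed (simp add: flat_def)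
  moreover have "0 \<le> flat 0 t" for t by (simp add: flat_def)
  ultimately show ?thesis unfolding cutoff_def by (simp only: mult_nonneg_nonneg exp_ge_zero)
qed

lemma cutoff_outside: "R > 0 \<Longrightarrow> norm x \<ge> R \<Longrightarrow> cutoff R x = 0"
proof -
  assume "R > 0" "norm x \<ge> R"
  then have "1 \<le> norm ((1 / R) *\<^sub>R x)" by (simp add: field_simps)
  then have "1 \<le> (norm ((1 / R) *\<^sub>R x))\<^sup>2" by (simp only: one_le_power)
  then show ?thesis unfolding cutoff_def flat_def by (simp only: power2_norm_eq_inner) simp
qed

lemma cutoff_tendsto: "(\<lambda>n. cutoff (real (Suc n)) x) \<longlonglongrightarrow> 1"
proof -
  have c: "isCont (flat 0) 1" using DERIV_isCont[OF flat_deriv] .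
  have "(\<lambda>n. (1 / real (Suc n)) *\<^sub>R x) \<longlonglongrightarrow> 0 *\<^sub>R x"
    using LIMSEQ_inverse_real_of_nat by (intro tendsto_intros) (simp add: inverse_eq_divide)
  then have "(\<lambda>n. 1 - ((1 / real (Suc n)) *\<^sub>R x) \<bullet> ((1 / real (Suc n)) *\<^sub>R x)) \<longlonglongrightarrow> 1 - 0 \<bullet> (0::'a)"
    by (intro tendsto_intros) auto
  then have "(\<lambda>n. exp 1 * flat 0 (1 - ((1 / real (Suc n)) *\<^sub>R x) \<bullet> ((1 / real (Suc n)) *\<^sub>R x))) \<longlonglongrightarrow> exp 1 * flat 0 1"
    by (intro tendsto_mult tendsto_const isCont_tendsto_compose[OF c]) simp
  then show ?thesis unfolding cutoff_def by (simp add: flat_def exp_add[symmetric])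
qed

lemma test_function_cutoff:
  assumes "R > 0" "smooth f"
  shows "test_function (\<lambda>x. cutoff R x * f x)"
proof -
  have "{x. cutoff R x * f x \<noteq> 0} \<subseteq> cball 0 R"
    using cutoff_outside[OF assms(1)] by (force simp: not_le)
  then have "bounded {x. cutoff R x * f x \<noteq> 0}" using bounded_cball bounded_subset by blast
  then show ?thesis using smooth_mult[OF smooth_cutoff assms(2)]
    unfolding test_function_iff by (simp only: compact_closure)
qed

lemma cutoff_dirder: "dirder (cutoff R) v x = (1 / R) * dirder (cutoff 1) v ((1 / R) *\<^sub>R x)"
proof -
  have "cutoff R = (\<lambda>x::'a. cutoff 1 ((1 / R) *\<^sub>R x))" unfolding cutoff_def by auto
  then show ?thesis using dirderI[OF dirder_scale[OF smooth_differentiable[OF smooth_cutoff]]] by metis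
qed

lemma test_function_cutoff_1: "test_function (cutoff 1)"
  using test_function_cutoff[of 1 "\<lambda>x. 1", OF _ smooth_const] by simp

text \<open>By scaling, first derivatives are of order \<open>1 / R\<close> and second ones of order
  \<open>1 / R^2\<close>, weakened to \<open>1 / R\<close> for \<open>R \<ge> 1\<close>. Against a
  drift of linear growth and a measure with finite first moment this makes all terms that hit the
  cutoff vanish in the limit.\<close>

lemma cutoff_derivative_bounds:
  "\<exists>C\<ge>0. \<forall>R\<ge>1. \<forall>(x::'a::euclidean_space). \<forall>b\<in>Basis. \<bar>dirder (cutoff R) b x\<bar> \<le> C / R \<and> \<bar>dirder (dirder (cutoff R) b) b x\<bar> \<le> C / R"
proof -
  have "\<exists>C\<ge>0. \<forall>x. \<bar>dirder (cutoff 1) b x\<bar> \<le> C \<and> \<bar>dirder (dirder (cutoff 1) b) b x\<bar> \<le> C" for b :: 'a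
  proof -
    obtain C1 where C1: "\<And>x. \<bar>dirder (cutoff 1) b x\<bar> \<le> C1"
      using test_function_bounded[OF test_function_dirder[OF test_function_cutoff_1], of b] by (auto simp: bounded_iff)
    obtain C2 where C2: "\<And>x. \<bar>dirder (dirder (cutoff 1) b) b x\<bar> \<le> C2"
      using test_function_bounded[OF test_function_dirder[OF test_function_dirder[OF test_function_cutoff_1]], of b b]
      by (auto simp: bounded_iff)
    show ?thesis
      by (rule exI[of _ "max 0 (max C1 C2)"]) (use C1 C2 in \<open>auto simp: le_max_iff_disj\<close>)
  qed
  then obtain C where C: "\<And>b::'a. C b \<ge> 0" "\<And>b x. \<bar>dirder (cutoff 1) b x\<bar> \<le> C b" "\<And>b x. \<bar>dirder (dirder (cutoff 1) b) b x\<bar> \<le> C b"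
    by metis
  have le: "C b \<le> sum C Basis" if "b \<in> Basis" for b using that C(1) by (intro member_le_sum) auto
  have "\<bar>dirder (cutoff R) b x\<bar> \<le> sum C Basis / R \<and> \<bar>dirder (dirder (cutoff R) b) b x\<bar> \<le> sum C Basis / R"
    if R: "R \<ge> 1" and b: "b \<in> Basis" for R and x b :: 'a
  proof
    have "\<bar>dirder (cutoff R) b x\<bar> = \<bar>dirder (cutoff 1) b ((1 / R) *\<^sub>R x)\<bar> / R"
      unfolding cutoff_dirder[of R] using R by (simp add: abs_mult)
    also have "\<dots> \<le> sum C Basis / R" using C(2) le[OF b] R by (intro divide_right_mono) (auto intro: order_trans)
    finally show "\<bar>dirder (cutoff R) b x\<bar> \<le> sum C Basis / R" .
    have "dirder (cutoff R) b = (\<lambda>x. (1 / R) * dirder (cutoff 1) b ((1 / R) *\<^sub>R x))" by (rule ext) (rule cutoff_dirder)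
    then have "dirder (dirder (cutoff R) b) b x = (1 / R) * ((1 / R) * dirder (dirder (cutoff 1) b) b ((1 / R) *\<^sub>R x))"
      using dirderI[OF has_derivative_mult_right[OF dirder_scale[OF smooth_differentiable[OF smooth_dirder[OF smooth_cutoff]]]]] by metis
    then have "\<bar>dirder (dirder (cutoff R) b) b x\<bar> = \<bar>dirder (dirder (cutoff 1) b) b ((1 / R) *\<^sub>R x)\<bar> / R / R"
      using R by (simp add: abs_mult)
    also have "\<dots> \<le> sum C Basis / R / R" using C(3) le[OF b] R by (intro divide_right_mono) (auto intro: order_trans)
    also have "\<dots> \<le> sum C Basis / R / 1" using C(1) R by (intro divide_left_mono) (auto intro!: divide_nonneg_nonneg sum_nonneg)
    finally show "\<bar>dirder (dirder (cutoff R) b) b x\<bar> \<le> sum C Basis / R" by simp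
  qed
  then show ?thesis using C(1) by (intro exI[of _ "sum C Basis"]) (auto intro: sum_nonneg)
qed

section \<open>The standard Gaussian measure\<close>

lemma dirder2_expand:
  assumes "\<And>x. f differentiable (at x)" "\<And>b x. dirder f b differentiable (at x)"
  shows "dirder (dirder f v) w x = (\<Sum>b\<in>Basis. \<Sum>c\<in>Basis. (v \<bullet> b) * (w \<bullet> c) * dirder (dirder f b) c x)"
proof -
  have e: "dirder f v = (\<lambda>x. \<Sum>b\<in>Basis. (v \<bullet> b) * dirder f b x)"
    by (rule ext) (rule dirder_sum_Basis[OF assms(1)])
  have "((\<lambda>x. \<Sum>b\<in>Basis. (v \<bullet> b) * dirder f b x) has_derivative (\<lambda>w. \<Sum>b\<in>Basis. (v \<bullet> b) * dirder (dirder f b) w x)) (at x)"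
    by (intro has_derivative_sum has_derivative_mult_right has_derivative_dirder assms)
  from dirderI[OF this] have "dirder (dirder f v) w x = (\<Sum>b\<in>Basis. (v \<bullet> b) * dirder (dirder f b) w x)"
    unfolding e .
  also have "\<dots> = (\<Sum>b\<in>Basis. \<Sum>c\<in>Basis. (v \<bullet> b) * (w \<bullet> c) * dirder (dirder f b) c x)"
    unfolding dirder_sum_Basis[OF assms(2), of _ w] by (simp add: sum_distrib_left mult.assoc)
  finally show ?thesis .
qed

lemma dirder2_bound:
  assumes "\<And>x. f differentiable (at x)" "\<And>b x. dirder f b differentiable (at x)"
  shows "\<bar>dirder (dirder f w) w x\<bar> \<le> (norm w)\<^sup>2 * (\<Sum>b\<in>Basis. \<Sum>c\<in>Basis. \<bar>dirder (dirder f b) c x\<bar>)"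
proof -
  have "\<bar>dirder (dirder f w) w x\<bar> \<le> (\<Sum>b\<in>Basis. \<bar>\<Sum>c\<in>Basis. (w \<bullet> b) * (w \<bullet> c) * dirder (dirder f b) c x\<bar>)"
    by (subst dirder2_expand[OF assms]) (rule sum_abs)
  also have "\<dots> \<le> (\<Sum>b\<in>Basis. \<Sum>c\<in>Basis. \<bar>(w \<bullet> b) * (w \<bullet> c) * dirder (dirder f b) c x\<bar>)"
    by (intro sum_mono sum_abs)
  also have "\<dots> = (\<Sum>b\<in>Basis. \<Sum>c\<in>Basis. \<bar>w \<bullet> b\<bar> * \<bar>w \<bullet> c\<bar> * \<bar>dirder (dirder f b) c x\<bar>)"
    by (simp add: abs_mult)
  also have "\<dots> \<le> (\<Sum>b\<in>Basis. \<Sum>c\<in>Basis. norm w * norm w * \<bar>dirder (dirder f b) c x\<bar>)"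
    by (intro sum_mono mult_mono mult_right_mono Basis_le_norm) auto
  also have "\<dots> = (norm w)\<^sup>2 * (\<Sum>b\<in>Basis. \<Sum>c\<in>Basis. \<bar>dirder (dirder f b) c x\<bar>)"
    by (simp add: power2_eq_square sum_distrib_left)
  finally show ?thesis .
qed

lemma line_derivative:
  assumes "\<And>x. f differentiable (at x)"
  shows "((\<lambda>\<theta>. f (x + \<theta> *\<^sub>R w)) has_field_derivative dirder f w (x + \<theta> *\<^sub>R w)) (at \<theta>)"
proof -
  have "((\<lambda>\<theta>. x + \<theta> *\<^sub>R w) has_derivative (\<lambda>h. h *\<^sub>R w)) (at \<theta>)"
    by (auto intro!: derivative_eq_intros)
  from has_derivative_compose[OF this has_derivative_dirder[OF assms]]
  have "((\<lambda>\<theta>. f (x + \<theta> *\<^sub>R w)) has_derivative (\<lambda>h. dirder f (h *\<^sub>R w) (x + \<theta> *\<^sub>R w))) (at \<theta>)" .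
  moreover have "dirder f (h *\<^sub>R w) y = dirder f w y * h" for h y
    unfolding dirder_sum_Basis[OF assms, of "h *\<^sub>R w"] dirder_sum_Basis[OF assms, of w]
    by (simp add: sum_distrib_left sum_distrib_right algebra_simps)
  ultimately show ?thesis unfolding has_field_derivative_def by simp
qed

text \<open>Second derivatives are controlled only on the segment from \<open>x\<close> to
  \<open>x + w\<close>. For a Gaussian kernel this keeps the decay at \<open>x\<close> in the
  remainder, which a global bound would lose.\<close>

lemma taylor_order2:
  assumes d: "\<And>x. f differentiable (at x)" "\<And>b x. dirder f b differentiable (at x)"
    and B: "\<And>\<theta>. 0 \<le> \<theta> \<Longrightarrow> \<theta> \<le> 1 \<Longrightarrow> (\<Sum>b\<in>Basis. \<Sum>c\<in>Basis. \<bar>dirder (dirder f b) c (x + \<theta> *\<^sub>R w)\<bar>) \<le> B"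
  shows "\<bar>f (x + w) - f x - dirder f w x\<bar> \<le> (norm w)\<^sup>2 * B"
proof -
  define diff where "diff m \<theta> = (if m = 0 then f (x + \<theta> *\<^sub>R w) else if m = 1 then dirder f w (x + \<theta> *\<^sub>R w)
     else dirder (dirder f w) w (x + \<theta> *\<^sub>R w))" for m :: nat and \<theta>
  have e: "dirder f w = (\<lambda>x. \<Sum>b\<in>Basis. (w \<bullet> b) * dirder f b x)"
    by (rule ext) (rule dirder_sum_Basis[OF d(1)])
  have d': "dirder f w differentiable (at x)" for x
    unfolding e using d(2) by (intro differentiable_sum differentiable_mult) auto
  have "\<exists>t. 0 < t \<and> t < 1 \<and> diff 0 1 = (\<Sum>m<2. (diff m 0 / fact m) * (1 - 0)^m) + (diff 2 t / fact 2) * (1 - 0)^2"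
  proof (rule Taylor_up)
    show "\<forall>m t. m < 2 \<and> 0 \<le> t \<and> t \<le> 1 \<longrightarrow> (diff m has_field_derivative diff (Suc m) t) (at t)"
    proof (intro allI impI)
      fix m :: nat and t :: real assume "m < 2 \<and> 0 \<le> t \<and> t \<le> 1"
      then consider "m = 0" | "m = 1" by linarith
      then show "(diff m has_field_derivative diff (Suc m) t) (at t)"
      proof cases
        case 1 then show ?thesis unfolding diff_def using line_derivative[OF d(1)] by simp
      next
        case 2 then show ?thesis unfolding diff_def using line_derivative[OF d'] by simp
      qed
    qed
  qed auto
  then obtain t where t: "0 < t" "t < 1" "f (x + w) = f x + dirder f w x + dirder (dirder f w) w (x + t *\<^sub>R w) / 2"
    by (auto simp: diff_def numeral_2_eq_2)
  have "\<bar>dirder (dirder f w) w (x + t *\<^sub>R w)\<bar> \<le> (norm w)\<^sup>2 * (\<Sum>b\<in>Basis. \<Sum>c\<in>Basis. \<bar>dirder (dirder f b) c (x + t *\<^sub>R w)\<bar>)"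
    by (rule dirder2_bound[OF d])
  also have "\<dots> \<le> (norm w)\<^sup>2 * B" using B[of t] t by (intro mult_left_mono) auto
  finally show ?thesis using t by linarith
qed

lemma bsmooth_taylor2:
  assumes f: "bsmooth f"
  shows "\<exists>K\<ge>0. \<forall>x w. \<bar>f (x + w) - f x - dirder f w x\<bar> \<le> K * (norm w)\<^sup>2"
proof -
  have "\<exists>C. \<forall>x. \<bar>dirder (dirder f b) c x\<bar> \<le> C" for b c
    using bsmooth_bounded[OF bsmooth_dirder[OF bsmooth_dirder[OF f]], of b c] by (auto simp: bounded_iff)
  then obtain C where C: "\<And>b c x. \<bar>dirder (dirder f b) c x\<bar> \<le> C b c" by metis
  have C0: "0 \<le> C b c" for b c using C[of b c undefined] by linarith
  have "\<bar>f (x + w) - f x - dirder f w x\<bar> \<le> (norm w)\<^sup>2 * (\<Sum>b\<in>Basis. \<Sum>c\<in>Basis. C b c)" for x w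
    by (rule taylor_order2) (use C f in \<open>auto intro!: sum_mono smooth_differentiable bsmooth_smooth bsmooth_dirder\<close>)
  then show ?thesis
    by (intro exI[of _ "\<Sum>b\<in>Basis. \<Sum>c\<in>Basis. C b c"]) (auto simp: mult.commute C0 intro!: sum_nonneg)
qed

text \<open>The third order is needed because the remainder must be o(h) after a Gaussian
  displacement of size sqrt h: \<open>norm w ^ 3\<close> then averages to order
  \<open>h * sqrt h\<close>.\<close>

lemma bsmooth_taylor3:
  assumes f: "bsmooth f"
  shows "\<exists>K\<ge>0. \<forall>x w. \<bar>f (x + w) - f x - dirder f w x - dirder (dirder f w) w x / 2\<bar> \<le> K * norm w ^ 3"
proof -
  have sm: "g differentiable (at x)" if "bsmooth g" for g :: "'a \<Rightarrow> real" and x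
    using that smooth_differentiable bsmooth_smooth by blast
  have "\<exists>C. \<forall>x. \<bar>dirder (dirder (dirder f b) c) e x\<bar> \<le> C" for b c e
    using bsmooth_bounded[OF bsmooth_dirder[OF bsmooth_dirder[OF bsmooth_dirder[OF f]]], of b c e] by (auto simp: bounded_iff)
  then obtain C where C: "\<And>b c e x. \<bar>dirder (dirder (dirder f b) c) e x\<bar> \<le> C b c e" by metis
  have C0: "0 \<le> C b c e" for b c e using C[of b c e undefined] by linarith
  define K where "K = (\<Sum>b\<in>Basis. \<Sum>c\<in>Basis. \<Sum>e\<in>Basis. C b c e)"
  have K0: "0 \<le> K" unfolding K_def by (intro sum_nonneg C0)
  \<comment> \<open>The innermost direction is expanded in the basis by linearity;
    \<open>dirder2_bound\<close> treats the other two.\<close>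
  have b3: "\<bar>dirder (dirder (dirder f w) w) w y\<bar> \<le> norm w ^ 3 * K" for w y
  proof -
    have e: "dirder f w = (\<lambda>x. \<Sum>b\<in>Basis. (w \<bullet> b) * dirder f b x)"
      by (rule ext) (rule dirder_sum_Basis[OF sm[OF f]])
    have "((\<lambda>x. \<Sum>b\<in>Basis. (w \<bullet> b) * dirder f b x) has_derivative (\<lambda>v. \<Sum>b\<in>Basis. (w \<bullet> b) * dirder (dirder f b) v x)) (at x)" for x
      by (intro has_derivative_sum has_derivative_mult_right has_derivative_dirder sm bsmooth_dirder f)
    from dirderI[OF this] have e2: "dirder (dirder f w) w = (\<lambda>x. \<Sum>b\<in>Basis. (w \<bullet> b) * dirder (dirder f b) w x)"
      unfolding e by auto
    have "((\<lambda>x. \<Sum>b\<in>Basis. (w \<bullet> b) * dirder (dirder f b) w x) has_derivative (\<lambda>v. \<Sum>b\<in>Basis. (w \<bullet> b) * dirder (dirder (dirder f b) w) v x)) (at x)" for x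
      by (intro has_derivative_sum has_derivative_mult_right has_derivative_dirder sm bsmooth_dirder f)
    from dirderI[OF this] have e3: "dirder (dirder (dirder f w) w) w y = (\<Sum>b\<in>Basis. (w \<bullet> b) * dirder (dirder (dirder f b) w) w y)"
      unfolding e2 by auto
    have "\<bar>dirder (dirder (dirder f w) w) w y\<bar> \<le> (\<Sum>b\<in>Basis. \<bar>w \<bullet> b\<bar> * \<bar>dirder (dirder (dirder f b) w) w y\<bar>)"
      unfolding e3 by (rule order_trans[OF sum_abs]) (simp add: abs_mult)
    also have "\<dots> \<le> (\<Sum>b\<in>Basis. norm w * ((norm w)\<^sup>2 * (\<Sum>c\<in>Basis. \<Sum>e\<in>Basis. C b c e)))"
    proof (intro sum_mono mult_mono Basis_le_norm)
      fix b
      have "\<bar>dirder (dirder (dirder f b) w) w y\<bar> \<le> (norm w)\<^sup>2 * (\<Sum>c\<in>Basis. \<Sum>e\<in>Basis. \<bar>dirder (dirder (dirder f b) c) e y\<bar>)"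
        by (rule dirder2_bound) (intro sm bsmooth_dirder f)+
      also have "\<dots> \<le> (norm w)\<^sup>2 * (\<Sum>c\<in>Basis. \<Sum>e\<in>Basis. C b c e)"
        by (intro mult_left_mono sum_mono C) auto
      finally show "\<bar>dirder (dirder (dirder f b) w) w y\<bar> \<le> (norm w)\<^sup>2 * (\<Sum>c\<in>Basis. \<Sum>e\<in>Basis. C b c e)" .
    qed (auto intro!: mult_nonneg_nonneg sum_nonneg C0)
    also have "\<dots> = norm w ^ 3 * K"
      unfolding K_def sum_distrib_left power3_eq_cube power2_eq_square by (simp add: mult.assoc)
    finally show ?thesis .
  qed
  have "\<bar>f (x + w) - f x - dirder f w x - dirder (dirder f w) w x / 2\<bar> \<le> K * norm w ^ 3" for x w
  proof -
    define diff where "diff m \<theta> = (if m = 0 then f (x + \<theta> *\<^sub>R w) else if m = 1 then dirder f w (x + \<theta> *\<^sub>R w)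
      else if m = 2 then dirder (dirder f w) w (x + \<theta> *\<^sub>R w) else dirder (dirder (dirder f w) w) w (x + \<theta> *\<^sub>R w))" for m :: nat and \<theta>
    have "\<exists>t. 0 < t \<and> t < 1 \<and> diff 0 1 = (\<Sum>m<3. (diff m 0 / fact m) * (1 - 0)^m) + (diff 3 t / fact 3) * (1 - 0)^3"
    proof (rule Taylor_up)
      show "\<forall>m t. m < 3 \<and> 0 \<le> t \<and> t \<le> 1 \<longrightarrow> (diff m has_field_derivative diff (Suc m) t) (at t)"
      proof (intro allI impI)
        fix m :: nat and t :: real assume "m < 3 \<and> 0 \<le> t \<and> t \<le> 1"
        then consider "m = 0" | "m = 1" | "m = 2" by linarith
        then show "(diff m has_field_derivative diff (Suc m) t) (at t)"
        proof cases
          case 1 then show ?thesis unfolding diff_def using line_derivative[OF sm[OF f]] by simp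
        next
          case 2 then show ?thesis unfolding diff_def using line_derivative[OF sm[OF bsmooth_dirder[OF f]]] by simp
        next
          case 3 then show ?thesis unfolding diff_def using line_derivative[OF sm[OF bsmooth_dirder[OF bsmooth_dirder[OF f]]]] by simp
        qed
      qed
    qed auto
    then obtain t where t: "f (x + w) = f x + dirder f w x + dirder (dirder f w) w x / 2 + dirder (dirder (dirder f w) w) w (x + t *\<^sub>R w) / 6"
      by (auto simp: diff_def numeral_3_eq_3 fact_numeral)
    show ?thesis unfolding t using b3[of w "x + t *\<^sub>R w"] by (simp add: mult.commute)
  qed
  then show ?thesis using K0 by blast
qed

text \<open>Here \<open>a\<close> is the standard deviation. The product over the basis matches the
  increment density in \<open>brownian_motion_on\<close>.\<close>

definition gauss_dens :: "real \<Rightarrow> 'a::euclidean_space \<Rightarrow> real" where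
  "gauss_dens a z = (\<Prod>b\<in>Basis. normal_density 0 a (z \<bullet> b))"

definition std_gauss :: "'a::euclidean_space measure" where
  "std_gauss = density lborel (\<lambda>z. ennreal (gauss_dens 1 z))"

lemma gauss_dens_measurable[measurable]: "gauss_dens a \<in> borel_measurable borel"
  unfolding gauss_dens_def[abs_def] by measurable

lemma gauss_dens_nonneg: "0 \<le> gauss_dens a z"
  unfolding gauss_dens_def by (intro prod_nonneg) auto

lemma gauss_dens_eq:
  "gauss_dens a (z::'a::euclidean_space) = (1 / sqrt (2 * pi * a\<^sup>2)) ^ DIM('a) * exp (- (z \<bullet> z) / (2 * a\<^sup>2))"
proof -
  have "(\<Sum>b\<in>Basis. - (z \<bullet> b)\<^sup>2 / (2 * a\<^sup>2)) = - (z \<bullet> z) / (2 * a\<^sup>2)"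
    unfolding euclidean_inner[of z z] by (simp add: sum_negf[symmetric] sum_divide_distrib power2_eq_square)
  then show ?thesis
    unfolding gauss_dens_def normal_density_def prod.distrib by (simp add: exp_sum[symmetric])
qed

lemma prob_space_gauss_dens:
  assumes "0 < a"
  shows "prob_space (density lborel (\<lambda>z. ennreal (gauss_dens a z)))"
proof
  have "(\<integral>\<^sup>+z. (\<Prod>b\<in>Basis. ennreal (normal_density 0 a ((z::'a) \<bullet> b))) \<partial>lborel) = (\<Prod>b\<in>(Basis::'a set). (\<integral>\<^sup>+x. ennreal (normal_density 0 a x) \<partial>lborel))"
    by (rule nn_integral_lborel_prod) auto
  also have "\<dots> = 1" using assms by (simp add: nn_integral_eq_integral)
  finally show "emeasure (density lborel (\<lambda>z::'a. ennreal (gauss_dens a z))) (space (density lborel (\<lambda>z. ennreal (gauss_dens a z)))) = 1"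
    unfolding gauss_dens_def by (simp add: emeasure_density prod_ennreal)
qed

lemma sets_std_gauss[simp, measurable_cong]: "sets std_gauss = sets borel"
  unfolding std_gauss_def by simp

lemma space_std_gauss[simp]: "space std_gauss = UNIV"
  unfolding std_gauss_def by simp

lemma prob_space_std_gauss: "prob_space std_gauss"
  unfolding std_gauss_def by (rule prob_space_gauss_dens) simp

interpretation std_gauss: prob_space std_gauss
  by (rule prob_space_std_gauss)

lemma gauss_dens_integrable: "0 < a \<Longrightarrow> integrable lborel (gauss_dens a)"
proof -
  assume a: "0 < a"
  interpret prob_space "density lborel (\<lambda>z::'a. ennreal (gauss_dens a z))" by (rule prob_space_gauss_dens[OF a])
  have "integrable (density lborel (\<lambda>z::'a. ennreal (gauss_dens a z))) (\<lambda>z. 1::real)" by simp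
  then show ?thesis by (subst (asm) integrable_density) (auto simp: gauss_dens_nonneg)
qed

text \<open>Lebesgue measure is the image of the product of one-dimensional ones under the basis
  expansion, so product integrands factor. With the Gaussian density this becomes the independence
  of the coordinates.\<close>

lemma lborel_integral_prod:
  fixes f :: "'a::euclidean_space \<Rightarrow> real \<Rightarrow> real"
  assumes i: "\<And>b. b \<in> Basis \<Longrightarrow> integrable lborel (f b)"
  shows "integrable lborel (\<lambda>z::'a. \<Prod>b\<in>Basis. f b (z \<bullet> b))"
    and "(\<integral>z. (\<Prod>b\<in>Basis. f b (z \<bullet> b)) \<partial>(lborel::'a measure)) = (\<Prod>b\<in>Basis. \<integral>t. f b t \<partial>lborel)"
proof -
  interpret product_sigma_finite "\<lambda>_::'a. lborel::real measure" ..
  have m: "(\<lambda>g. \<Sum>b\<in>Basis. g b *\<^sub>R b) \<in> (\<Pi>\<^sub>M b\<in>(Basis::'a set). lborel) \<rightarrow>\<^sub>M (borel::'a measure)"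
    by measurable
  have [measurable]: "f b \<in> borel_measurable borel" if "b \<in> Basis" for b
    using borel_measurable_integrable[OF i[OF that]] by simp
  have m2: "(\<lambda>z::'a. \<Prod>b\<in>Basis. f b (z \<bullet> b)) \<in> borel_measurable borel" by measurable
  have c: "(\<Prod>b\<in>Basis. f b ((\<Sum>c\<in>Basis. g c *\<^sub>R c) \<bullet> b)) = (\<Prod>b\<in>Basis. f b (g b))" for g :: "'a \<Rightarrow> real"
    by (intro prod.cong refl) simp
  show "integrable lborel (\<lambda>z::'a. \<Prod>b\<in>Basis. f b (z \<bullet> b))"
    by (subst lborel_eq, subst integrable_distr_eq[OF m m2])
       (simp only: c, rule product_integrable_prod[OF finite_Basis i])
  show "(\<integral>z. (\<Prod>b\<in>Basis. f b (z \<bullet> b)) \<partial>(lborel::'a measure)) = (\<Prod>b\<in>Basis. \<integral>t. f b t \<partial>lborel)"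
    by (subst lborel_eq, subst integral_distr[OF m m2])
       (simp only: c, rule product_integral_prod[OF finite_Basis i])
qed

lemma std_gauss_integral_prod:
  fixes h :: "'a::euclidean_space \<Rightarrow> real \<Rightarrow> real"
  assumes i: "\<And>b. b \<in> Basis \<Longrightarrow> integrable lborel (\<lambda>t. std_normal_density t * h b t)"
    and h[measurable]: "\<And>b. h b \<in> borel_measurable borel"
  shows "integrable std_gauss (\<lambda>z::'a. \<Prod>b\<in>Basis. h b (z \<bullet> b))"
    and "(\<integral>z. (\<Prod>b\<in>Basis. h b (z \<bullet> b)) \<partial>(std_gauss::'a measure)) = (\<Prod>b\<in>Basis. \<integral>t. std_normal_density t * h b t \<partial>lborel)"
proof -
  have e: "gauss_dens 1 z *\<^sub>R (\<Prod>b\<in>Basis. h b (z \<bullet> b)) = (\<Prod>b\<in>Basis. std_normal_density (z \<bullet> b) * h b (z \<bullet> b))" for z :: 'a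
    unfolding gauss_dens_def by (simp add: prod.distrib)
  show "integrable std_gauss (\<lambda>z::'a. \<Prod>b\<in>Basis. h b (z \<bullet> b))"
    unfolding std_gauss_def using lborel_integral_prod(1)[of "\<lambda>b t. std_normal_density t * h b t", OF i]
    by (subst integrable_density) (simp_all add: gauss_dens_nonneg e del: real_scaleR_def)
  show "(\<integral>z. (\<Prod>b\<in>Basis. h b (z \<bullet> b)) \<partial>(std_gauss::'a measure)) = (\<Prod>b\<in>Basis. \<integral>t. std_normal_density t * h b t \<partial>lborel)"
    unfolding std_gauss_def using lborel_integral_prod(2)[of "\<lambda>b t. std_normal_density t * h b t", OF i]
    by (subst integral_density) (simp_all add: gauss_dens_nonneg e del: real_scaleR_def)
qed

lemma std_gauss_coordinate:
  fixes b :: "'a::euclidean_space"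
  assumes b: "b \<in> Basis" and i: "integrable lborel (\<lambda>t. std_normal_density t * h t)" and [measurable]: "h \<in> borel_measurable borel"
  shows "integrable std_gauss (\<lambda>z::'a. h (z \<bullet> b))"
    and "(\<integral>z. h (z \<bullet> b) \<partial>std_gauss) = (\<integral>t. std_normal_density t * h t \<partial>lborel)"
proof -
  \<comment> \<open>One coordinate is isolated by filling up the product with 1; the remaining
    factors integrate to 1.\<close>
  let ?h = "\<lambda>c t. if c = b then h t else 1"
  have p: "(\<Prod>c\<in>Basis. ?h c (z \<bullet> c)) = h (z \<bullet> b)" for z :: 'a
    using b by (simp add: prod.remove[OF finite_Basis b])
  have i': "integrable lborel (\<lambda>t. std_normal_density t * ?h c t)" if "c \<in> Basis" for c
    using i integrable_std_normal_moment[of 0] by (cases "c = b") simp_all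
  show "integrable std_gauss (\<lambda>z::'a. h (z \<bullet> b))"
    using std_gauss_integral_prod(1)[of ?h, OF i'] unfolding p by simp
  have "(\<integral>z. h (z \<bullet> b) \<partial>std_gauss) = (\<Prod>c\<in>Basis. \<integral>t. std_normal_density t * ?h c t \<partial>lborel)"
    using std_gauss_integral_prod(2)[of ?h, OF i'] unfolding p by simp
  also have "\<dots> = (\<integral>t. std_normal_density t * h t \<partial>lborel)"
    using b by (simp add: prod.remove[OF finite_Basis b])
  finally show "(\<integral>z. h (z \<bullet> b) \<partial>std_gauss) = (\<integral>t. std_normal_density t * h t \<partial>lborel)" .
qed

lemma std_gauss_moment_1:
  fixes b :: "'a::euclidean_space"
  assumes b: "b \<in> Basis"
  shows "integrable std_gauss (\<lambda>z::'a. z \<bullet> b)" "(\<integral>z. z \<bullet> b \<partial>std_gauss) = 0"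
  using std_gauss_coordinate[OF b, of "\<lambda>t. t"] integrable_std_normal_moment[of 1] integral_std_normal_moment_odd[of 0]
  by auto

lemma std_gauss_moment_2:
  fixes b c :: "'a::euclidean_space"
  assumes b: "b \<in> Basis" and c: "c \<in> Basis"
  shows "integrable std_gauss (\<lambda>z::'a. (z \<bullet> b) * (z \<bullet> c))" "(\<integral>z. (z \<bullet> b) * (z \<bullet> c) \<partial>std_gauss) = (if b = c then 1 else 0)"
proof -
  have "integrable std_gauss (\<lambda>z::'a. (z \<bullet> b) * (z \<bullet> c)) \<and> (\<integral>z. (z \<bullet> b) * (z \<bullet> c) \<partial>std_gauss) = (if b = c then 1 else 0)"
  proof (cases "b = c")
    case True
    then show ?thesis
      using std_gauss_coordinate[OF b, of "\<lambda>t. t * t"] integrable_std_normal_moment[of 2] integral_std_normal_moment_even[of 1]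
      by (simp add: power2_eq_square)
  next
    case False
    let ?h = "\<lambda>e t. if e = b \<or> e = c then t else 1 :: real"
    have "(\<Prod>e\<in>Basis. g e) = g b * g c * (\<Prod>e\<in>Basis - {b} - {c}. g e)" for g :: "'a \<Rightarrow> real"
      using b c False by (simp add: prod.remove[OF finite_Basis b] prod.remove[of "Basis - {b}" c] mult.assoc)
    then have p: "(\<Prod>e\<in>Basis. ?h e (z \<bullet> e)) = (z \<bullet> b) * (z \<bullet> c)" for z :: 'a
      by (simp add: prod.neutral)
    have i': "integrable lborel (\<lambda>t. std_normal_density t * ?h e t)" if "e \<in> Basis" for e
      using integrable_std_normal_moment[of 1] integrable_std_normal_moment[of 0] by (cases "e = b \<or> e = c") simp_all
    have "integrable std_gauss (\<lambda>z::'a. (z \<bullet> b) * (z \<bullet> c))"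
      using std_gauss_integral_prod(1)[of ?h, OF i'] unfolding p by simp
    moreover have "(\<integral>z. (z \<bullet> b) * (z \<bullet> c) \<partial>std_gauss) = (\<Prod>e\<in>Basis. \<integral>t. std_normal_density t * ?h e t \<partial>lborel)"
      using std_gauss_integral_prod(2)[of ?h, OF i'] unfolding p by simp
    moreover have "(\<integral>t. std_normal_density t * ?h b t \<partial>lborel) = 0"
      using integral_std_normal_moment_odd[of 0] by simp
    then have "(\<Prod>e\<in>Basis. \<integral>t. std_normal_density t * ?h e t \<partial>lborel) = 0"
      using b by (intro prod_zero) (auto intro!: bexI[of _ b])
    ultimately show ?thesis using False by simp
  qed
  then show "integrable std_gauss (\<lambda>z::'a. (z \<bullet> b) * (z \<bullet> c))" "(\<integral>z. (z \<bullet> b) * (z \<bullet> c) \<partial>std_gauss) = (if b = c then 1 else 0)"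
    by auto
qed

lemma std_gauss_norm_power:
  assumes "k > 0"
  shows "integrable std_gauss (\<lambda>z::'a::euclidean_space. norm z ^ k)"
proof -
  have i: "integrable std_gauss (\<lambda>z::'a. \<bar>z \<bullet> b\<bar> ^ k)" if "b \<in> Basis" for b
    by (rule std_gauss_coordinate(1)[OF that, of "\<lambda>t. \<bar>t\<bar> ^ k"]) (use integrable_std_normal_moment_abs in auto)
  have "integrable std_gauss (\<lambda>z::'a. real DIM('a) ^ k * (\<Sum>b\<in>Basis. \<bar>z \<bullet> b\<bar> ^ k))"
    using i by auto
  then show ?thesis
  proof (rule Bochner_Integration.integrable_bound)
    show "AE z in std_gauss. norm (norm z ^ k) \<le> norm (real DIM('a) ^ k * (\<Sum>b\<in>Basis. \<bar>(z::'a) \<bullet> b\<bar> ^ k))"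
    proof (rule AE_I2)
      fix z :: 'a
      \<comment> \<open>The largest coordinate satisfies \<open>norm z \<le> DIM('a) * m\<close>,
        and \<open>m ^ k\<close> is one of the summands.\<close>
      define m where "m = Max ((\<lambda>b. \<bar>z \<bullet> b\<bar>) ` Basis)"
      have m: "\<bar>z \<bullet> b\<bar> \<le> m" if "b \<in> Basis" for b unfolding m_def using that by (intro Max_ge) auto
      have "m \<in> (\<lambda>b. \<bar>z \<bullet> b\<bar>) ` Basis" unfolding m_def by (intro Max_in) auto
      then obtain b where b: "b \<in> Basis" "m = \<bar>z \<bullet> b\<bar>" by auto
      have "norm z \<le> (\<Sum>b\<in>Basis. \<bar>z \<bullet> b\<bar>)" by (rule norm_le_l1)
      also have "\<dots> \<le> real DIM('a) * m" using m by (intro sum_bounded_above) auto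
      finally have "norm z ^ k \<le> (real DIM('a) * m) ^ k" by (intro power_mono) auto
      also have "\<dots> = real DIM('a) ^ k * \<bar>z \<bullet> b\<bar> ^ k" using b by (simp add: power_mult_distrib)
      also have "\<dots> \<le> real DIM('a) ^ k * (\<Sum>b\<in>Basis. \<bar>z \<bullet> b\<bar> ^ k)"
        using b by (intro mult_left_mono member_le_sum) auto
      finally show "norm (norm z ^ k) \<le> norm (real DIM('a) ^ k * (\<Sum>b\<in>Basis. \<bar>z \<bullet> b\<bar> ^ k))"
        by (simp add: abs_mult sum_nonneg)
    qed
  qed simp
qed

lemma distr_std_gauss_scale:
  assumes a: "0 < a"
  shows "distr std_gauss borel (\<lambda>z::'a::euclidean_space. a *\<^sub>R z) = density lborel (\<lambda>z. ennreal (gauss_dens a z))"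
proof (rule measure_eqI)
  fix A :: "'a set" assume "A \<in> sets (distr std_gauss borel (\<lambda>z::'a. a *\<^sub>R z))"
  then have [measurable]: "A \<in> sets borel" by simp
  \<comment> \<open>The factor \<open>a ^ DIM('a)\<close> is the Jacobian that
    \<open>lborel_affine\<close> brings in below.\<close>
  have g: "gauss_dens 1 z = a ^ DIM('a) * gauss_dens a (a *\<^sub>R z)" for z :: 'a
    using a by (simp add: gauss_dens_eq power_mult_distrib[symmetric] real_sqrt_mult power2_eq_square)
  have "emeasure (distr std_gauss borel (\<lambda>z::'a. a *\<^sub>R z)) A = (\<integral>\<^sup>+z. indicator A (a *\<^sub>R z) \<partial>std_gauss)"
    by (subst nn_integral_indicator[symmetric], simp) (subst nn_integral_distr, auto)
  also have "\<dots> = (\<integral>\<^sup>+z. ennreal (gauss_dens 1 z) * indicator A (a *\<^sub>R z) \<partial>lborel)"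
    unfolding std_gauss_def by (subst nn_integral_density) auto
  also have "\<dots> = (\<integral>\<^sup>+z. ennreal (a ^ DIM('a)) * (ennreal (gauss_dens a (a *\<^sub>R z)) * indicator A (a *\<^sub>R z)) \<partial>lborel)"
    unfolding g using a by (simp add: ennreal_mult gauss_dens_nonneg mult.assoc)
  also have "\<dots> = (\<integral>\<^sup>+z. ennreal (gauss_dens a z) * indicator A z \<partial>lborel)"
    using a by (subst (2) lborel_affine[of a 0]) (simp_all add: nn_integral_density nn_integral_distr)
  also have "\<dots> = emeasure (density lborel (\<lambda>z. ennreal (gauss_dens a z))) A"
    by (simp add: emeasure_density)
  finally show "emeasure (distr std_gauss borel (\<lambda>z::'a. a *\<^sub>R z)) A = emeasure (density lborel (\<lambda>z. ennreal (gauss_dens a z))) A" .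
qed simp

lemma gauss_dens_convolution:
  fixes w :: "'a::euclidean_space"
  assumes "0 < a" "0 < b"
  shows "(\<integral>\<^sup>+x. ennreal (gauss_dens a (w - x)) * ennreal (gauss_dens b x) \<partial>lborel) = ennreal (gauss_dens (sqrt (a\<^sup>2 + b\<^sup>2)) w)"
proof -
  have "(\<integral>\<^sup>+x. ennreal (gauss_dens a (w - x)) * ennreal (gauss_dens b x) \<partial>lborel) =
     (\<integral>\<^sup>+x. (\<Prod>e\<in>Basis. ennreal (normal_density 0 a (w \<bullet> e - x \<bullet> e) * normal_density 0 b (x \<bullet> e))) \<partial>lborel)"
    unfolding gauss_dens_def by (simp add: prod_ennreal prod_nonneg ennreal_mult[symmetric] prod.distrib[symmetric] inner_diff_left)
  also have "\<dots> = (\<Prod>e\<in>Basis. \<integral>\<^sup>+t. ennreal (normal_density 0 a (w \<bullet> e - t) * normal_density 0 b t) \<partial>lborel)"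
    by (rule nn_integral_lborel_prod) auto
  also have "\<dots> = (\<Prod>e\<in>Basis. ennreal (normal_density 0 (sqrt (a\<^sup>2 + b\<^sup>2)) (w \<bullet> e)))"
    using fun_cong[OF conv_normal_density_zero_mean[OF assms]] by simp
  also have "\<dots> = ennreal (gauss_dens (sqrt (a\<^sup>2 + b\<^sup>2)) w)"
    unfolding gauss_dens_def by (simp add: prod_ennreal)
  finally show ?thesis .
qed

text \<open>Variances add under convolution, coordinate by coordinate. Read for the heat flow this
  is its semigroup law, which is why it is put as an identity of image measures of standard
  Gaussians.\<close>

lemma gauss_sum_distr:
  assumes a: "0 < a" and b: "0 < b"
  shows "distr (std_gauss \<Otimes>\<^sub>M std_gauss) borel (\<lambda>(x, y). a *\<^sub>R x + b *\<^sub>R y :: 'a::euclidean_space)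
    = distr std_gauss borel (\<lambda>z. sqrt (a\<^sup>2 + b\<^sup>2) *\<^sub>R z)"
proof (rule measure_eqI)
  let ?D = "distr (std_gauss \<Otimes>\<^sub>M std_gauss) borel (\<lambda>(x, y). a *\<^sub>R x + b *\<^sub>R y :: 'a)"
  interpret P: pair_prob_space "std_gauss :: 'a measure" "std_gauss :: 'a measure" ..
  fix A :: "'a set" assume "A \<in> sets ?D"
  then have [measurable]: "A \<in> sets borel" by simp
  have m[measurable]: "(\<lambda>(x, y). a *\<^sub>R x + b *\<^sub>R y :: 'a) \<in> std_gauss \<Otimes>\<^sub>M std_gauss \<rightarrow>\<^sub>M borel"
    by (simp add: split_beta') measurable
  have s: "(\<integral>\<^sup>+z. h (e *\<^sub>R z) \<partial>std_gauss) = (\<integral>\<^sup>+z. ennreal (gauss_dens e z) * h z \<partial>lborel)"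
    if "0 < e" "h \<in> borel_measurable borel" for e and h :: "'a \<Rightarrow> ennreal"
  proof -
    have "(\<integral>\<^sup>+z. h (e *\<^sub>R z) \<partial>std_gauss) = (\<integral>\<^sup>+z. h z \<partial>distr std_gauss borel (\<lambda>z. e *\<^sub>R z))"
      using that by (subst nn_integral_distr) auto
    also have "\<dots> = (\<integral>\<^sup>+z. ennreal (gauss_dens e z) * h z \<partial>lborel)"
      unfolding distr_std_gauss_scale[OF that(1)] using that by (subst nn_integral_density) auto
    finally show ?thesis .
  qed
  have "emeasure ?D A
      = (\<integral>\<^sup>+p. indicator A (a *\<^sub>R fst p + b *\<^sub>R snd p) \<partial>(std_gauss \<Otimes>\<^sub>M std_gauss))"
    by (subst nn_integral_indicator[symmetric], simp) (subst nn_integral_distr[OF m], auto simp: split_beta')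
  also have "\<dots> = (\<integral>\<^sup>+x. \<integral>\<^sup>+y. indicator A (a *\<^sub>R x + b *\<^sub>R y) \<partial>std_gauss \<partial>std_gauss)"
    by (subst std_gauss.nn_integral_fst[symmetric]) auto
  also have "\<dots> = (\<integral>\<^sup>+x. \<integral>\<^sup>+y. ennreal (gauss_dens b y) * indicator A (a *\<^sub>R x + y) \<partial>lborel \<partial>std_gauss)"
    by (intro nn_integral_cong s b) simp
  also have "\<dots> = (\<integral>\<^sup>+x. ennreal (gauss_dens a x) * (\<integral>\<^sup>+y. ennreal (gauss_dens b y) * indicator A (x + y) \<partial>lborel) \<partial>lborel)"
    by (rule s[OF a]) measurable
  also have "\<dots> = (\<integral>\<^sup>+x. \<integral>\<^sup>+y. ennreal (gauss_dens a x) * (ennreal (gauss_dens b y) * indicator A (x + y)) \<partial>lborel \<partial>lborel)"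
    by (simp add: nn_integral_cmult)
  also have "\<dots> = (\<integral>\<^sup>+y. \<integral>\<^sup>+x. ennreal (gauss_dens a x) * (ennreal (gauss_dens b y) * indicator A (x + y)) \<partial>lborel \<partial>lborel)"
    by (rule lborel_pair.Fubini'[symmetric]) measurable
  \<comment> \<open>Translation by \<open>y\<close> turns the double integral into the convolution
    of the two densities at \<open>w\<close>.\<close>
  also have "\<dots> = (\<integral>\<^sup>+y. \<integral>\<^sup>+w. ennreal (gauss_dens a (w - y)) * (ennreal (gauss_dens b y) * indicator A w) \<partial>lborel \<partial>lborel)"
  proof (rule nn_integral_cong)
    fix y :: 'a
    show "(\<integral>\<^sup>+x. ennreal (gauss_dens a x) * (ennreal (gauss_dens b y) * indicator A (x + y)) \<partial>lborel)
      = (\<integral>\<^sup>+w. ennreal (gauss_dens a (w - y)) * (ennreal (gauss_dens b y) * indicator A w) \<partial>lborel)"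
      by (subst (2) lborel_distr_plus[symmetric, of y]) (simp add: nn_integral_distr add.commute)
  qed
  also have "\<dots> = (\<integral>\<^sup>+w. \<integral>\<^sup>+y. ennreal (gauss_dens a (w - y)) * (ennreal (gauss_dens b y) * indicator A w) \<partial>lborel \<partial>lborel)"
    by (rule lborel_pair.Fubini') measurable
  also have "\<dots> = (\<integral>\<^sup>+w. ennreal (gauss_dens (sqrt (a\<^sup>2 + b\<^sup>2)) w) * indicator A w \<partial>lborel)"
  proof (rule nn_integral_cong)
    fix w :: 'a
    have "(\<integral>\<^sup>+y. ennreal (gauss_dens a (w - y)) * (ennreal (gauss_dens b y) * indicator A w) \<partial>lborel)
       = (\<integral>\<^sup>+y. (ennreal (gauss_dens a (w - y)) * ennreal (gauss_dens b y)) * indicator A w \<partial>lborel)"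
      by (simp add: mult.assoc)
    also have "\<dots> = (\<integral>\<^sup>+y. ennreal (gauss_dens a (w - y)) * ennreal (gauss_dens b y) \<partial>lborel) * indicator A w"
      by (rule nn_integral_multc) measurable
    finally show "(\<integral>\<^sup>+y. ennreal (gauss_dens a (w - y)) * (ennreal (gauss_dens b y) * indicator A w) \<partial>lborel)
       = ennreal (gauss_dens (sqrt (a\<^sup>2 + b\<^sup>2)) w) * indicator A w"
      unfolding gauss_dens_convolution[OF a b] .
  qed
  also have "\<dots> = emeasure (density lborel (\<lambda>z. ennreal (gauss_dens (sqrt (a\<^sup>2 + b\<^sup>2)) z))) A"
    by (simp add: emeasure_density)
  also have "\<dots> = emeasure (distr std_gauss borel (\<lambda>z. sqrt (a\<^sup>2 + b\<^sup>2) *\<^sub>R z)) A"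
    using a b by (subst distr_std_gauss_scale) (auto intro: add_pos_pos)
  finally show "emeasure ?D A
     = emeasure (distr std_gauss borel (\<lambda>z. sqrt (a\<^sup>2 + b\<^sup>2) *\<^sub>R z)) A" .
qed simp

section \<open>The heat semigroup\<close>

text \<open>Polynomials times the Gaussian density: closed under derivatives and with Gaussian decay,
  which is what differentiating convolutions under the integral sign needs.\<close>

inductive_set gauss_class :: "('a::euclidean_space \<Rightarrow> real) set" where
  base: "gauss_dens 1 \<in> gauss_class"
| inner: "k \<in> gauss_class \<Longrightarrow> (\<lambda>z. (z \<bullet> v) * k z) \<in> gauss_class"
| add: "k \<in> gauss_class \<Longrightarrow> l \<in> gauss_class \<Longrightarrow> (\<lambda>z. k z + l z) \<in> gauss_class"
| cmult: "k \<in> gauss_class \<Longrightarrow> (\<lambda>z. c * k z) \<in> gauss_class"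

lemma gauss_dens_derivative:
  "(gauss_dens 1 has_derivative (\<lambda>v. - (z \<bullet> v) * gauss_dens 1 z)) (at (z::'a::euclidean_space))"
proof -
  have e: "gauss_dens 1 = (\<lambda>z::'a. (1 / sqrt (2 * pi)) ^ DIM('a) * exp (- (z \<bullet> z) / 2))"
    by (auto simp: gauss_dens_eq)
  show ?thesis unfolding e
    by (auto intro!: derivative_eq_intros simp: inner_commute)
qed

lemma gauss_dens_dirder: "dirder (gauss_dens 1) v z = - (z \<bullet> v) * gauss_dens 1 z"
  by (rule dirderI[OF gauss_dens_derivative])

lemma gauss_class_dirder:
  assumes "k \<in> gauss_class"
  shows "(\<forall>x. k differentiable (at x)) \<and> (\<forall>v. dirder k v \<in> gauss_class)"
  using assms
proof induction
  case base
  have e: "dirder (gauss_dens 1) v = (\<lambda>z::'a. (-1) * ((z \<bullet> v) * gauss_dens 1 z))" for v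
    by (auto simp: gauss_dens_dirder)
  have "dirder (gauss_dens 1) v \<in> gauss_class" for v :: 'a
    unfolding e by (intro gauss_class.intros)
  then show ?case using gauss_dens_derivative by (auto simp: differentiable_def)
next
  case (inner k w)
  then have d: "k differentiable (at x)" for x by auto
  have D: "((\<lambda>z. (z \<bullet> w) * k z) has_derivative (\<lambda>v. (x \<bullet> w) * dirder k v x + (v \<bullet> w) * k x)) (at x)" for x
    by (intro has_derivative_mult has_derivative_dirder[OF d]) (auto intro!: derivative_eq_intros)
  have e: "dirder (\<lambda>z. (z \<bullet> w) * k z) v = (\<lambda>x. (x \<bullet> w) * dirder k v x + (v \<bullet> w) * k x)" for v
    using dirderI[OF D] by auto
  have "dirder (\<lambda>z. (z \<bullet> w) * k z) v \<in> gauss_class" for v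
    unfolding e by (intro gauss_class.add gauss_class.inner gauss_class.cmult) (use inner in auto)
  then show ?case using D by (auto simp: differentiable_def)
next
  case (add k l)
  then have e: "dirder (\<lambda>z. k z + l z) v = (\<lambda>z. dirder k v z + dirder l v z)" for v
    using dirder_add by blast
  have "dirder (\<lambda>z. k z + l z) v \<in> gauss_class" for v
    unfolding e by (intro gauss_class.add) (use add in auto)
  then show ?case using add by auto
next
  case (cmult k c)
  then have D: "((\<lambda>z. c * k z) has_derivative (\<lambda>v. c * dirder k v x)) (at x)" for x
    by (intro has_derivative_mult_right has_derivative_dirder) auto
  have e: "dirder (\<lambda>z. c * k z) v = (\<lambda>z. c * dirder k v z)" for v
    using dirderI[OF D] by auto
  have "dirder (\<lambda>z. c * k z) v \<in> gauss_class" for v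
    unfolding e by (intro gauss_class.cmult) (use cmult in auto)
  then show ?case using D by (auto simp: differentiable_def)
qed

lemma gauss_class_measurable:
  assumes "k \<in> gauss_class"
  shows "k \<in> borel_measurable borel"
  using gauss_class_dirder[OF assms]
  by (intro borel_measurable_continuous_onI continuous_at_imp_continuous_on) (auto intro: differentiable_imp_continuous_within)

text \<open>Every rate below 1/2 is allowed since the induction must give up a little at each
  polynomial factor: \<open>z \<bullet> v\<close> is absorbed by the gap between the rate
  \<open>c\<close> and the midpoint of \<open>c\<close> and 1/2.\<close>

lemma gauss_class_bound:
  assumes "k \<in> gauss_class"
  shows "\<forall>c. 0 < c \<and> c < 1/2 \<longrightarrow> (\<exists>C\<ge>0. \<forall>z. \<bar>k z\<bar> \<le> C * exp (- c * (z \<bullet> z)))"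
  using assms
proof induction
  case base
  show ?case
  proof (intro allI impI)
    fix c :: real assume c: "0 < c \<and> c < 1/2"
    have "\<bar>gauss_dens 1 z\<bar> \<le> (1 / sqrt (2 * pi)) ^ DIM('a) * exp (- c * (z \<bullet> z))" for z :: 'a
    proof -
      have "c * (z \<bullet> z) \<le> 1/2 * (z \<bullet> z)" using c by (intro mult_right_mono) auto
      then have "exp (- (z \<bullet> z) / 2) \<le> exp (- c * (z \<bullet> z))" by simp
      then show ?thesis using gauss_dens_nonneg[of 1 z]
        unfolding gauss_dens_eq by (simp add: abs_mult mult_left_mono)
    qed
    then show "\<exists>C\<ge>0. \<forall>z::'a. \<bar>gauss_dens 1 z\<bar> \<le> C * exp (- c * (z \<bullet> z))"
      by (intro exI[of _ "(1 / sqrt (2 * pi)) ^ DIM('a)"]) auto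
  qed
next
  case (inner k v)
  show ?case
  proof (intro allI impI)
    fix c :: real assume c: "0 < c \<and> c < 1/2"
    define c' where "c' = (c + 1/2) / 2"
    have c': "0 < c'" "c' < 1/2" "c < c'" unfolding c'_def using c by auto
    then obtain C where C: "C \<ge> 0" "\<And>z. \<bar>k z\<bar> \<le> C * exp (- c' * (z \<bullet> z))" using inner by blast
    define d where "d = c' - c"
    have d: "d > 0" unfolding d_def using c' by simp
    have "\<bar>(z \<bullet> v) * k z\<bar> \<le> (norm v * (1 + 1 / d) * C) * exp (- c * (z \<bullet> z))" for z
    proof -
      have n: "norm z \<le> (1 + 1 / d) * exp (d * (z \<bullet> z))"
      proof -
        have "norm z \<le> 1 + z \<bullet> z"
        proof (cases "norm z \<le> 1")
          case False
          then have "norm z * 1 \<le> norm z * norm z" by (intro mult_left_mono) auto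
          then show ?thesis by (simp add: norm_eq_sqrt_inner)
        qed (auto intro: order_trans)
        also have "\<dots> \<le> (1 + 1 / d) * (1 + d * (z \<bullet> z))"
          using d by (simp add: algebra_simps)
        also have "\<dots> \<le> (1 + 1 / d) * exp (d * (z \<bullet> z))"
          using d by (intro mult_left_mono exp_ge_add_one_self) auto
        finally show ?thesis .
      qed
      have "\<bar>(z \<bullet> v) * k z\<bar> \<le> (norm z * norm v) * (C * exp (- c' * (z \<bullet> z)))"
        unfolding abs_mult using C by (intro mult_mono Cauchy_Schwarz_ineq2) auto
      also have "\<dots> \<le> ((1 + 1 / d) * exp (d * (z \<bullet> z)) * norm v) * (C * exp (- c' * (z \<bullet> z)))"
        using C n by (intro mult_right_mono) auto
      also have "\<dots> = (norm v * (1 + 1 / d) * C) * (exp (d * (z \<bullet> z)) * exp (- c' * (z \<bullet> z)))" by (simp add: mult_ac)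
      also have "exp (d * (z \<bullet> z)) * exp (- c' * (z \<bullet> z)) = exp (- c * (z \<bullet> z))"
        unfolding d_def exp_add[symmetric] by (simp add: algebra_simps)
      finally show ?thesis .
    qed
    then show "\<exists>C\<ge>0. \<forall>z. \<bar>(z \<bullet> v) * k z\<bar> \<le> C * exp (- c * (z \<bullet> z))"
      using C d by (intro exI[of _ "norm v * (1 + 1 / d) * C"]) auto
  qed
next
  case (add k l)
  show ?case
  proof (intro allI impI)
    fix c :: real assume "0 < c \<and> c < 1/2"
    with add obtain C D where C: "C \<ge> 0" "\<And>z. \<bar>k z\<bar> \<le> C * exp (- c * (z \<bullet> z))"
      and D: "D \<ge> 0" "\<And>z. \<bar>l z\<bar> \<le> D * exp (- c * (z \<bullet> z))" by metis
    have "\<bar>k z + l z\<bar> \<le> (C + D) * exp (- c * (z \<bullet> z))" for z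
      using C(2)[of z] D(2)[of z] abs_triangle_ineq[of "k z" "l z"] unfolding distrib_right by linarith
    then show "\<exists>C\<ge>0. \<forall>z. \<bar>k z + l z\<bar> \<le> C * exp (- c * (z \<bullet> z))" using C D by (intro exI[of _ "C + D"]) auto
  qed
next
  case (cmult k e)
  show ?case
  proof (intro allI impI)
    fix c :: real assume "0 < c \<and> c < 1/2"
    with cmult obtain C where C: "C \<ge> 0" "\<And>z. \<bar>k z\<bar> \<le> C * exp (- c * (z \<bullet> z))" by metis
    have "\<bar>e * k z\<bar> \<le> (\<bar>e\<bar> * C) * exp (- c * (z \<bullet> z))" for z
      unfolding abs_mult mult.assoc using C by (intro mult_left_mono) auto
    then show "\<exists>C\<ge>0. \<forall>z. \<bar>e * k z\<bar> \<le> C * exp (- c * (z \<bullet> z))" using C by (intro exI[of _ "\<bar>e\<bar> * C"]) auto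
  qed
qed

lemma integrable_exp_inner:
  assumes "c > 0"
  shows "integrable lborel (\<lambda>z::'a::euclidean_space. exp (- c * (z \<bullet> z)))"
proof -
  \<comment> \<open>The standard deviation for which \<open>gauss_dens a\<close> is a multiple of
    the given function.\<close>
  define a where "a = 1 / sqrt (2 * c)"
  have a: "a > 0" "a\<^sup>2 = 1 / (2 * c)" unfolding a_def using assms by (auto simp: power_divide)
  define C where "C = (1 / sqrt (2 * pi * a\<^sup>2)) ^ DIM('a)"
  have C: "C > 0" unfolding C_def using a(1) by auto
  have "integrable lborel (\<lambda>z::'a. (1 / C) * gauss_dens a z)"
    using gauss_dens_integrable[OF a(1)] by auto
  moreover have "(1 / C) * gauss_dens a z = exp (- c * (z \<bullet> z))" for z :: 'a
    unfolding gauss_dens_eq C_def[symmetric] using C assms by (simp add: a(2) mult.commute)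
  ultimately show ?thesis by simp
qed

lemma lborel_translate:
  fixes F :: "'a::euclidean_space \<Rightarrow> real"
  assumes [measurable]: "F \<in> borel_measurable borel"
  shows "integrable lborel (\<lambda>w. F (w - y)) \<longleftrightarrow> integrable lborel F"
    and "(\<integral>w. F (w - y) \<partial>lborel) = (\<integral>w. F w \<partial>lborel)"
proof -
  have e: "F (w - y) = F ((+) (- y) w)" for w by simp
  show "integrable lborel (\<lambda>w. F (w - y)) \<longleftrightarrow> integrable lborel F"
    unfolding e by (subst (2) lborel_distr_plus[symmetric, of "- y"], subst integrable_distr_eq) auto
  show "(\<integral>w. F (w - y) \<partial>lborel) = (\<integral>w. F w \<partial>lborel)"
    unfolding e by (subst (2) lborel_distr_plus[symmetric, of "- y"], subst integral_distr) auto
qed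

lemma gauss_class_integrable: "k \<in> gauss_class \<Longrightarrow> integrable lborel k"
proof -
  assume k: "k \<in> gauss_class"
  obtain C where C: "\<And>z. \<bar>k z\<bar> \<le> C * exp (- (1/4) * (z \<bullet> z))"
    using gauss_class_bound[OF k, rule_format, of "1/4"] by auto
  have "integrable lborel (\<lambda>z::'a. C * exp (- (1/4) * (z \<bullet> z)))"
    by (intro integrable_mult_right integrable_exp_inner) simp
  then show ?thesis
  proof (rule Bochner_Integration.integrable_bound)
    show "AE z in lborel. norm (k z) \<le> norm (C * exp (- (1/4) * (z \<bullet> z)))"
      using C by (intro AE_I2) (metis abs_ge_self order_trans real_norm_def)
  qed (use gauss_class_measurable[OF k] in auto)
qed

text \<open>A correlation instead of a convolution: \<open>y\<close> sits in the kernel only, so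
  that derivatives fall on \<open>k\<close>, and \<open>g\<close> need only be bounded and
  measurable. The argument \<open>w - y\<close> is responsible for the minus sign in
  \<open>kernel_conv_derivative\<close>.\<close>

definition kernel_conv :: "('a::euclidean_space \<Rightarrow> real) \<Rightarrow> ('a \<Rightarrow> real) \<Rightarrow> 'a \<Rightarrow> real" where
  "kernel_conv g k y = (\<integral>w. g w * k (w - y) \<partial>lborel)"

lemma kernel_conv_integrable:
  fixes g k :: "'a::euclidean_space \<Rightarrow> real"
  assumes g[measurable]: "g \<in> borel_measurable borel" and A: "\<And>x. \<bar>g x\<bar> \<le> A" and k: "integrable lborel k"
  shows "integrable lborel (\<lambda>w. g w * k (w - y))"
proof -
  have [measurable]: "k \<in> borel_measurable borel" using borel_measurable_integrable[OF k] by simp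
  have "integrable lborel (\<lambda>w. A * \<bar>k (w - y)\<bar>)"
    using lborel_translate(1)[of "\<lambda>w. \<bar>k w\<bar>" y] k by auto
  then show ?thesis
  proof (rule Bochner_Integration.integrable_bound)
    show "AE w in lborel. norm (g w * k (w - y)) \<le> norm (A * \<bar>k (w - y)\<bar>)"
      using A by (intro AE_I2) (auto simp: abs_mult intro!: mult_right_mono intro: order_trans[OF _ abs_ge_self])
  qed simp
qed

lemma kernel_conv_bound:
  assumes g[measurable]: "g \<in> borel_measurable borel" and A: "\<And>x. \<bar>g x\<bar> \<le> A" and k: "integrable lborel k"
  shows "\<bar>kernel_conv g k y\<bar> \<le> A * (\<integral>z. \<bar>k z\<bar> \<partial>lborel)"
proof -
  have [measurable]: "k \<in> borel_measurable borel" using borel_measurable_integrable[OF k] by simp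
  have "\<bar>kernel_conv g k y\<bar> \<le> (\<integral>w. \<bar>g w * k (w - y)\<bar> \<partial>lborel)"
    unfolding kernel_conv_def using integral_norm_bound[of lborel "\<lambda>w. g w * k (w - y)"] by simp
  also have "\<dots> \<le> (\<integral>w. A * \<bar>k (w - y)\<bar> \<partial>lborel)"
  proof (rule integral_mono)
    show "integrable lborel (\<lambda>w. \<bar>g w * k (w - y)\<bar>)"
      using kernel_conv_integrable[OF assms] by (intro integrable_abs)
    show "integrable lborel (\<lambda>w. A * \<bar>k (w - y)\<bar>)"
      using lborel_translate(1)[of "\<lambda>w. \<bar>k w\<bar>" y] k by auto
    show "\<bar>g w * k (w - y)\<bar> \<le> A * \<bar>k (w - y)\<bar>" for w
      using A by (auto simp: abs_mult intro!: mult_right_mono)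
  qed
  also have "\<dots> = A * (\<integral>z. \<bar>k z\<bar> \<partial>lborel)"
    using lborel_translate(2)[of "\<lambda>w. \<bar>k w\<bar>" y] by simp
  finally show ?thesis .
qed

lemma has_derivative_quadratic:
  fixes f :: "'a::euclidean_space \<Rightarrow> real"
  assumes L: "linear L" and K: "\<And>v. norm v \<le> 1 \<Longrightarrow> \<bar>f (x + v) - f x - L v\<bar> \<le> K * (norm v)\<^sup>2"
  shows "(f has_derivative L) (at x)"
  unfolding has_derivative_at
proof
  show "bounded_linear L" using L linear_conv_bounded_linear by blast
  show "(\<lambda>h. norm (f (x + h) - f x - L h) / norm h) \<midarrow>0\<rightarrow> 0"
  proof (rule tendsto_sandwich[OF _ _ tendsto_const[of 0]])
    show "\<forall>\<^sub>F h in at 0. 0 \<le> norm (f (x + h) - f x - L h) / norm h" by auto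
    show "\<forall>\<^sub>F h in at 0. norm (f (x + h) - f x - L h) / norm h \<le> K * norm h"
      unfolding eventually_at
    proof (intro exI[of _ 1] conjI ballI impI)
      fix h :: 'a assume h: "h \<noteq> 0 \<and> dist h 0 < 1"
      then have "norm (f (x + h) - f x - L h) \<le> K * norm h * norm h"
        using K[of h] by (simp add: power2_eq_square mult.assoc)
      then show "norm (f (x + h) - f x - L h) / norm h \<le> K * norm h"
        using h by (simp add: pos_divide_le_eq)
    qed simp
    have "((\<lambda>h::'a. K * norm h) \<longlongrightarrow> K * norm (0::'a)) (at 0)"
      by (intro tendsto_intros)
    then show "((\<lambda>h::'a. K * norm h) \<longlongrightarrow> 0) (at 0)" by simp
  qed
qed

lemma linear_sum_inner: "linear (\<lambda>v::'a::euclidean_space. \<Sum>b\<in>Basis. (v \<bullet> b) * (c b :: real))"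
  by (rule linearI) (simp_all add: inner_add_left distrib_right sum.distrib sum_distrib_left mult.assoc)

text \<open>The quadratic Taylor remainder of \<open>k\<close> is integrated: for all
  \<open>v\<close> in the unit ball it is at most the square of \<open>norm v\<close> times one
  fixed integrable function, which is all that \<open>has_derivative_quadratic\<close> asks
  for.\<close>

lemma kernel_conv_derivative:
  assumes g[measurable]: "g \<in> borel_measurable borel" and A: "\<And>x. \<bar>g x\<bar> \<le> A" and k: "k \<in> gauss_class"
  shows "(kernel_conv g k has_derivative (\<lambda>v. - kernel_conv g (dirder k v) y)) (at y)"
proof -
  have cl: "dirder k v \<in> gauss_class" "dirder (dirder k v) w \<in> gauss_class" for v w
    using gauss_class_dirder k by auto
  have df: "l differentiable (at x)" if "l \<in> gauss_class" for l :: "'a \<Rightarrow> real" and x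
    using gauss_class_dirder[OF that] by auto
  have int: "integrable lborel (\<lambda>w. g w * l (w - y))" if "l \<in> gauss_class" for l y
    by (rule kernel_conv_integrable[OF g A gauss_class_integrable[OF that]])
  have A0: "0 \<le> A" using A[of 0] by linarith
  obtain C where C: "\<And>b c. C b c \<ge> 0" "\<And>b c z. \<bar>dirder (dirder k b) c z\<bar> \<le> C b c * exp (- (1/4) * (z \<bullet> z))"
    using gauss_class_bound[OF cl(2), rule_format, of "1/4"] by (simp, metis)
  define D where "D = (\<Sum>b\<in>Basis. \<Sum>c\<in>Basis. C b c)"
  have D0: "D \<ge> 0" unfolding D_def by (intro sum_nonneg C)
  \<comment> \<open>The decay rate 1/4 of the second derivatives at \<open>z + u\<close> becomes the
    rate 1/8 at \<open>z\<close>, at the price \<open>exp (1/4)\<close>, by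
    \<open>z \<bullet> z \<le> 2 * ((z + u) \<bullet> (z + u)) + 2\<close> for
    \<open>norm u \<le> 1\<close>.\<close>
  define h where "h z = exp (1/4) * D * exp (- (1/8) * (z \<bullet> z))" for z :: 'a
  have hi: "integrable lborel h" unfolding h_def
    by (intro integrable_mult_right integrable_exp_inner) simp
  have rem: "\<bar>k (z - v) - k z + dirder k v z\<bar> \<le> (norm v)\<^sup>2 * h z" if v: "norm v \<le> 1" for z v
  proof -
    have "\<bar>k (z + (- v)) - k z - dirder k (- v) z\<bar> \<le> (norm (- v))\<^sup>2 * h z"
    proof (rule taylor_order2)
      fix \<theta> :: real assume t: "0 \<le> \<theta>" "\<theta> \<le> 1"
      let ?u = "\<theta> *\<^sub>R (- v)"
      have "norm ?u \<le> 1" using t v by (simp add: mult_le_one)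
      then have u: "?u \<bullet> ?u \<le> 1" unfolding dot_square_norm by (simp add: power_le_one)
      \<comment> \<open>Parallelogram law for \<open>z + u\<close> and \<open>u\<close>: their sum
        is \<open>z + 2 u\<close> and their difference is \<open>z\<close>.\<close>
      have "z \<bullet> z + (2 *\<^sub>R ?u + z) \<bullet> (2 *\<^sub>R ?u + z) = 2 * ((z + ?u) \<bullet> (z + ?u)) + 2 * (?u \<bullet> ?u)"
        by (simp add: inner_add_left inner_add_right inner_diff_left inner_diff_right inner_commute algebra_simps)
      then have "z \<bullet> z \<le> 2 * ((z + ?u) \<bullet> (z + ?u)) + 2" using u inner_ge_zero[of "2 *\<^sub>R ?u + z"] by linarith
      then have e: "exp (- (1/4) * ((z + ?u) \<bullet> (z + ?u))) \<le> exp (1/4) * exp (- (1/8) * (z \<bullet> z))"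
        unfolding exp_add[symmetric] by simp
      have "(\<Sum>b\<in>Basis. \<Sum>c\<in>Basis. \<bar>dirder (dirder k b) c (z + ?u)\<bar>) \<le> (\<Sum>b\<in>Basis. \<Sum>c\<in>Basis. C b c * exp (- (1/4) * ((z + ?u) \<bullet> (z + ?u))))"
        by (intro sum_mono C)
      also have "\<dots> = D * exp (- (1/4) * ((z + ?u) \<bullet> (z + ?u)))" unfolding D_def by (simp add: sum_distrib_right)
      also have "\<dots> \<le> D * (exp (1/4) * exp (- (1/8) * (z \<bullet> z)))" using e D0 by (rule mult_left_mono)
      finally show "(\<Sum>b\<in>Basis. \<Sum>c\<in>Basis. \<bar>dirder (dirder k b) c (z + ?u)\<bar>) \<le> h z" unfolding h_def by (simp add: mult_ac)
    qed (use df k cl in auto)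
    moreover have "dirder k (- v) z = - dirder k v z"
      unfolding dirder_sum_Basis[OF df[OF k], of "- v"] dirder_sum_Basis[OF df[OF k], of v] by (simp add: sum_negf)
    ultimately show ?thesis by simp
  qed
  have lin: "- kernel_conv g (dirder k v) y = (\<Sum>b\<in>Basis. (v \<bullet> b) * (- kernel_conv g (dirder k b) y))" for v
  proof -
    have "kernel_conv g (dirder k v) y = (\<integral>w. (\<Sum>b\<in>Basis. (v \<bullet> b) * (g w * dirder k b (w - y))) \<partial>lborel)"
      unfolding kernel_conv_def dirder_sum_Basis[OF df[OF k], of v] by (simp add: sum_distrib_left mult_ac)
    also have "\<dots> = (\<Sum>b\<in>Basis. \<integral>w. (v \<bullet> b) * (g w * dirder k b (w - y)) \<partial>lborel)"
      by (rule Bochner_Integration.integral_sum) (intro integrable_mult_right int cl)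
    also have "\<dots> = (\<Sum>b\<in>Basis. (v \<bullet> b) * kernel_conv g (dirder k b) y)"
      unfolding kernel_conv_def by simp
    finally show ?thesis by (simp add: sum_negf)
  qed
  show ?thesis
  proof (rule has_derivative_quadratic)
    have "(\<lambda>v. - kernel_conv g (dirder k v) y) = (\<lambda>v. \<Sum>b\<in>Basis. (v \<bullet> b) * (- kernel_conv g (dirder k b) y))"
      by (rule ext) (rule lin)
    then show "linear (\<lambda>v. - kernel_conv g (dirder k v) y)"
      by (simp only: linear_sum_inner)
    fix v :: 'a assume v: "norm v \<le> 1"
    have sh: "w - (y + v) = (w - y) - v" for w by simp
    let ?r = "\<lambda>w. g w * (k ((w - y) - v) - k (w - y) + dirder k v (w - y))"
    let ?d = "kernel_conv g k (y + v) - kernel_conv g k y - - kernel_conv g (dirder k v) y"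
    have e: "?d =
       (\<integral>w. ?r w \<partial>lborel)"
      unfolding kernel_conv_def
      using int[OF k, of y] int[OF k, of "y + v"] int[OF cl(1)[of v], of y]
      by (simp add: distrib_left right_diff_distrib sh[symmetric])
    have "\<bar>?d\<bar>
       \<le> (\<integral>w. \<bar>?r w\<bar> \<partial>lborel)"
      unfolding e using integral_norm_bound[of lborel "?r"] by simp
    also have "\<dots> \<le> (\<integral>w. A * ((norm v)\<^sup>2 * h (w - y)) \<partial>lborel)"
    proof (rule integral_mono)
      have "integrable lborel (?r)"
        using int[OF k, of y] int[OF k, of "y + v"] int[OF cl(1)[of v], of y]
        by (simp add: distrib_left right_diff_distrib sh[symmetric])
      then show "integrable lborel (\<lambda>w. \<bar>?r w\<bar>)" by (rule integrable_abs)
      show "integrable lborel (\<lambda>w. A * ((norm v)\<^sup>2 * h (w - y)))"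
        using lborel_translate(1)[of h y] hi borel_measurable_integrable[OF hi] by (intro integrable_mult_right) auto
      show "\<bar>?r w\<bar> \<le> A * ((norm v)\<^sup>2 * h (w - y))" for w
        unfolding abs_mult by (intro mult_mono A rem v A0) auto
    qed
    also have "\<dots> = (A * (\<integral>z. h z \<partial>lborel)) * (norm v)\<^sup>2"
      using lborel_translate(2)[of h y] borel_measurable_integrable[OF hi] by simp
    finally show "\<bar>?d\<bar> \<le> (A * (\<integral>z. h z \<partial>lborel)) * (norm v)\<^sup>2" .
  qed
qed

section \<open>The heat flow as a Gaussian average\<close>

lemma measure_std_gauss_UNIV[simp]: "measure std_gauss UNIV = 1"
  using std_gauss.prob_space by simp

text \<open>The parameter is the standard deviation of the displacement, not the time: the semigroup
  of \<sigma> \<Delta> at time \<tau> has \<open>a = sqrt (2 * \<sigma>) * sqrt \<tau>\<close>, and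
  under composition the squares of the parameters add.\<close>

definition heat :: "real \<Rightarrow> ('a::euclidean_space \<Rightarrow> real) \<Rightarrow> 'a \<Rightarrow> real" where
  "heat a f x = (\<integral>z. f (x + a *\<^sub>R z) \<partial>std_gauss)"

lemma heat_0[simp]: "heat 0 f = f"
  unfolding heat_def by (auto simp: std_gauss.prob_space)

lemma heat_integrable:
  fixes f :: "'a::euclidean_space \<Rightarrow> real"
  assumes [measurable]: "f \<in> borel_measurable borel" and A: "\<And>x. \<bar>f x\<bar> \<le> A"
  shows "integrable std_gauss (\<lambda>z. f (x + a *\<^sub>R z))"
  by (rule std_gauss.integrable_const_bound[of _ A]) (use A in auto)

lemma heat_bound:
  fixes f :: "'a::euclidean_space \<Rightarrow> real"
  assumes [measurable]: "f \<in> borel_measurable borel" and A: "\<And>x. \<bar>f x\<bar> \<le> A"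
  shows "\<bar>heat a f x\<bar> \<le> A"
proof -
  have "\<bar>heat a f x\<bar> \<le> (\<integral>z. \<bar>f (x + a *\<^sub>R z)\<bar> \<partial>std_gauss)"
    unfolding heat_def using integral_norm_bound[of std_gauss "\<lambda>z. f (x + a *\<^sub>R z)"] by simp
  also have "\<dots> \<le> (\<integral>z. A \<partial>(std_gauss::'a measure))"
    by (rule integral_mono) (use A heat_integrable[OF assms] in auto)
  finally show ?thesis by (simp add: std_gauss.prob_space)
qed

lemma heat_lipschitz:
  fixes f :: "'a::euclidean_space \<Rightarrow> real"
  assumes f: "L-lipschitz_on UNIV f" and A: "\<And>x. \<bar>f x\<bar> \<le> A"
  shows "L-lipschitz_on UNIV (heat a f)"
proof (rule lipschitz_onI)
  have m: "f \<in> borel_measurable borel" by (rule lipschitz_measurable[OF f])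
  fix x y
  have "\<bar>heat a f x - heat a f y\<bar> = \<bar>\<integral>z. f (x + a *\<^sub>R z) - f (y + a *\<^sub>R z) \<partial>std_gauss\<bar>"
    unfolding heat_def using heat_integrable[OF m A] by simp
  also have "\<dots> \<le> (\<integral>z. \<bar>f (x + a *\<^sub>R z) - f (y + a *\<^sub>R z)\<bar> \<partial>std_gauss)"
    using integral_norm_bound[of std_gauss "\<lambda>z. f (x + a *\<^sub>R z) - f (y + a *\<^sub>R z)"] by simp
  also have "\<dots> \<le> (\<integral>z. L * dist x y \<partial>(std_gauss::'a measure))"
  proof (rule integral_mono)
    show "\<bar>f (x + a *\<^sub>R z) - f (y + a *\<^sub>R z)\<bar> \<le> L * dist x y" for z
      using lipschitz_onD[OF f, of "x + a *\<^sub>R z" "y + a *\<^sub>R z"] by (simp add: dist_real_def)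
  qed (use heat_integrable[OF m A] in auto)
  finally show "dist (heat a f x) (heat a f y) \<le> L * dist x y" by (simp add: std_gauss.prob_space dist_real_def)
qed (rule lipschitz_on_nonneg[OF f])

lemma heat_approx:
  fixes f :: "'a::euclidean_space \<Rightarrow> real"
  assumes f: "L-lipschitz_on UNIV f" and A: "\<And>x. \<bar>f x\<bar> \<le> A"
  shows "\<bar>heat a f x - f x\<bar> \<le> L * \<bar>a\<bar> * (\<integral>z. norm z \<partial>(std_gauss::'a measure))"
proof -
  have m: "f \<in> borel_measurable borel" by (rule lipschitz_measurable[OF f])
  have n: "integrable (std_gauss::'a measure) norm" using std_gauss_norm_power[of 1] by simp
  have "\<bar>heat a f x - f x\<bar> = \<bar>\<integral>z. f (x + a *\<^sub>R z) - f x \<partial>std_gauss\<bar>"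
    unfolding heat_def using heat_integrable[OF m A] by (simp add: std_gauss.prob_space)
  also have "\<dots> \<le> (\<integral>z. \<bar>f (x + a *\<^sub>R z) - f x\<bar> \<partial>std_gauss)"
    using integral_norm_bound[of std_gauss "\<lambda>z. f (x + a *\<^sub>R z) - f x"] by simp
  also have "\<dots> \<le> (\<integral>z. (L * \<bar>a\<bar>) * norm z \<partial>(std_gauss::'a measure))"
  proof (rule integral_mono)
    show "\<bar>f (x + a *\<^sub>R z) - f x\<bar> \<le> L * \<bar>a\<bar> * norm z" for z
      using lipschitz_onD[OF f, of "x + a *\<^sub>R z" x] by (simp add: dist_real_def dist_norm mult.assoc)
  qed (use heat_integrable[OF m A] n in auto)
  also have "\<dots> = L * \<bar>a\<bar> * (\<integral>z. norm z \<partial>(std_gauss::'a measure))"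
    by simp
  finally show ?thesis .
qed

text \<open>After rescaling by \<open>a\<close> the Gaussian average is a correlation with the fixed
  kernel \<open>gauss_dens 1\<close>. The weight \<open>q\<close> is 1 for the heat flow and
  \<open>- (z \<bullet> v)\<close> for its derivative.\<close>

lemma heat_kernel_conv:
  fixes f :: "'a::euclidean_space \<Rightarrow> real"
  assumes [measurable]: "f \<in> borel_measurable borel" and a: "a > 0" and [measurable]: "q \<in> borel_measurable borel"
  shows "kernel_conv (\<lambda>w. f (a *\<^sub>R w)) (\<lambda>z. q z * gauss_dens 1 z) ((1 / a) *\<^sub>R x) = (\<integral>z. f (x + a *\<^sub>R z) * q z \<partial>std_gauss)"
proof -
  let ?F = "\<lambda>w. f (a *\<^sub>R (w + (1 / a) *\<^sub>R x)) * (q w * gauss_dens 1 w)"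
  have "kernel_conv (\<lambda>w. f (a *\<^sub>R w)) (\<lambda>z. q z * gauss_dens 1 z) ((1 / a) *\<^sub>R x) = (\<integral>w. ?F (w - (1 / a) *\<^sub>R x) \<partial>lborel)"
    unfolding kernel_conv_def by simp
  also have "\<dots> = (\<integral>w. ?F w \<partial>lborel)" by (rule lborel_translate(2)) measurable
  also have "\<dots> = (\<integral>w. gauss_dens 1 w *\<^sub>R (f (x + a *\<^sub>R w) * q w) \<partial>lborel)"
    using a by (intro Bochner_Integration.integral_cong) (auto simp: scaleR_add_right add.commute mult_ac)
  also have "\<dots> = (\<integral>z. f (x + a *\<^sub>R z) * q z \<partial>std_gauss)"
    unfolding std_gauss_def by (subst integral_density) (auto simp: gauss_dens_nonneg)
  finally show ?thesis .
qed

text \<open>Smoothing: derivatives fall on the Gaussian, whose polynomial multiples form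
  \<open>gauss_class\<close>. The formula for \<open>dirder\<close> is Gaussian integration by parts
  and involves no derivative of \<open>f\<close>; the minus signs of
  \<open>kernel_conv_derivative\<close> and \<open>gauss_dens_dirder\<close> cancel.\<close>

lemma bsmooth_heat:
  fixes f :: "'a::euclidean_space \<Rightarrow> real"
  assumes f[measurable]: "f \<in> borel_measurable borel" and A: "\<And>x. \<bar>f x\<bar> \<le> A" and a: "a > 0"
  shows "bsmooth (heat a f)"
    and "dirder (heat a f) v x = (1 / a) * (\<integral>z. f (x + a *\<^sub>R z) * (z \<bullet> v) \<partial>std_gauss)"
proof -
  define g where "g w = f (a *\<^sub>R w)" for w
  have g[measurable]: "g \<in> borel_measurable borel" unfolding g_def by measurable
  have gA: "\<bar>g w\<bar> \<le> A" for w unfolding g_def by (rule A)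
  let ?S = "{\<lambda>x. \<alpha> * kernel_conv g k ((1 / a) *\<^sub>R x) | \<alpha> k. k \<in> gauss_class}"
  have D: "((\<lambda>x. \<alpha> * kernel_conv g k ((1 / a) *\<^sub>R x)) has_derivative (\<lambda>v. (- \<alpha> / a) * kernel_conv g (dirder k v) ((1 / a) *\<^sub>R x))) (at x)"
    if k: "k \<in> gauss_class" for \<alpha> k x
  proof -
    have d: "kernel_conv g k differentiable (at y)" for y
      using kernel_conv_derivative[OF g gA k] by (auto simp: differentiable_def)
    have "dirder (kernel_conv g k) v y = - kernel_conv g (dirder k v) y" for v y
      by (rule dirderI[OF kernel_conv_derivative[OF g gA k]])
    then show ?thesis
      using has_derivative_mult_right[OF dirder_scale[OF d], of \<alpha> "1 / a" x] by (simp add: mult_ac)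
  qed
  have h: "heat a f = (\<lambda>x. 1 * kernel_conv g (gauss_dens 1) ((1 / a) *\<^sub>R x))"
    using heat_kernel_conv[OF f a, of "\<lambda>_. 1"] by (simp add: heat_def g_def[abs_def] fun_eq_iff)
  show "bsmooth (heat a f)"
  proof (rule bsmoothI_class[where S = ?S])
    show "heat a f \<in> ?S" unfolding h using gauss_class.base by blast
    fix F assume "F \<in> ?S"
    then obtain \<alpha> k where F: "F = (\<lambda>x. \<alpha> * kernel_conv g k ((1 / a) *\<^sub>R x))" and k: "k \<in> gauss_class" by auto
    show "F differentiable (at x)" for x using D[OF k] F by (auto simp: differentiable_def)
    show "dirder F v \<in> ?S" for v
    proof -
      have "dirder F v = (\<lambda>x. (- \<alpha> / a) * kernel_conv g (dirder k v) ((1 / a) *\<^sub>R x))"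
        unfolding F using dirderI[OF D[OF k]] by auto
      then show ?thesis using gauss_class_dirder[OF k] by blast
    qed
    show "bounded (range F)"
      unfolding bounded_iff F
      using kernel_conv_bound[OF g gA gauss_class_integrable[OF k]]
      by (intro exI[of _ "\<bar>\<alpha>\<bar> * (A * (\<integral>z. \<bar>k z\<bar> \<partial>lborel))"]) (auto simp: abs_mult intro!: mult_left_mono)
  qed
  have "dirder (heat a f) v x = (- 1 / a) * kernel_conv g (dirder (gauss_dens 1) v) ((1 / a) *\<^sub>R x)"
    unfolding h using dirderI[OF D[OF gauss_class.base, of 1]] by simp
  also have "dirder (gauss_dens 1) v = (\<lambda>z. (- (z \<bullet> v)) * gauss_dens 1 z)" by (rule ext) (rule gauss_dens_dirder)
  also have "kernel_conv g (\<lambda>z. (- (z \<bullet> v)) * gauss_dens 1 z) ((1 / a) *\<^sub>R x) = (\<integral>z. f (x + a *\<^sub>R z) * (- (z \<bullet> v)) \<partial>std_gauss)"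
    unfolding g_def by (rule heat_kernel_conv[OF f a]) measurable
  also have "\<dots> = - (\<integral>z. f (x + a *\<^sub>R z) * (z \<bullet> v) \<partial>std_gauss)" by simp
  finally show "dirder (heat a f) v x = (1 / a) * (\<integral>z. f (x + a *\<^sub>R z) * (z \<bullet> v) \<partial>std_gauss)" by simp
qed

lemma heat_measurable:
  assumes "f \<in> borel_measurable borel" "\<And>x. \<bar>f x\<bar> \<le> A" "a \<ge> 0"
  shows "heat a f \<in> borel_measurable borel"
  using assms bsmooth_heat(1)[of f A a] by (cases "a = 0") (auto intro!: smooth_measurable bsmooth_smooth)

text \<open>Integration by parts pays for the derivative and the Lipschitz bound of \<open>f\<close>
  for the difference, so the constant is only of order \<open>1 / a\<close>, that is
  \<open>1 / sqrt \<tau>\<close> in time. The Duhamel argument can afford this integrable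
  singularity.\<close>

lemma heat_dirder_lipschitz:
  fixes f :: "'a::euclidean_space \<Rightarrow> real"
  assumes f: "L-lipschitz_on UNIV f" and A: "\<And>x. \<bar>f x\<bar> \<le> A" and a: "a > 0"
  shows "\<bar>dirder (heat a f) v x - dirder (heat a f) v y\<bar> \<le> L * norm v * (\<integral>z. norm z \<partial>(std_gauss::'a measure)) / a * norm (x - y)"
proof -
  have m[measurable]: "f \<in> borel_measurable borel" by (rule lipschitz_measurable[OF f])
  have n: "integrable (std_gauss::'a measure) norm" using std_gauss_norm_power[of 1] by simp
  have i: "integrable std_gauss (\<lambda>z. f (x + a *\<^sub>R z) * (z \<bullet> v))" for x
  proof -
    have "integrable (std_gauss::'a measure) (\<lambda>z. A * norm v * norm z)" using n by auto
    then show ?thesis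
    proof (rule Bochner_Integration.integrable_bound)
      show "AE z in std_gauss. norm (f (x + a *\<^sub>R z) * (z \<bullet> v)) \<le> norm (A * norm v * norm z)"
      proof (rule AE_I2)
        fix z
        have "\<bar>f (x + a *\<^sub>R z)\<bar> * \<bar>z \<bullet> v\<bar> \<le> A * (norm z * norm v)"
          using A[of "x + a *\<^sub>R z"] by (intro mult_mono Cauchy_Schwarz_ineq2) auto
        also have "\<dots> \<le> \<bar>A * norm v * norm z\<bar>" by (simp add: mult_ac)
        finally show "norm (f (x + a *\<^sub>R z) * (z \<bullet> v)) \<le> norm (A * norm v * norm z)" by (simp add: abs_mult)
      qed
    qed simp
  qed
  have e: "\<bar>dirder (heat a f) v x - dirder (heat a f) v y\<bar> = (1 / a) * \<bar>\<integral>z. (f (x + a *\<^sub>R z) - f (y + a *\<^sub>R z)) * (z \<bullet> v) \<partial>std_gauss\<bar>"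
    unfolding bsmooth_heat(2)[OF m A a] using i a by (simp add: left_diff_distrib diff_divide_distrib[symmetric] abs_divide)
  have "\<bar>\<integral>z. (f (x + a *\<^sub>R z) - f (y + a *\<^sub>R z)) * (z \<bullet> v) \<partial>std_gauss\<bar>
     \<le> (\<integral>z. \<bar>(f (x + a *\<^sub>R z) - f (y + a *\<^sub>R z)) * (z \<bullet> v)\<bar> \<partial>std_gauss)"
    using integral_norm_bound[of std_gauss "\<lambda>z. (f (x + a *\<^sub>R z) - f (y + a *\<^sub>R z)) * (z \<bullet> v)"] by simp
  also have "\<dots> \<le> (\<integral>z. (L * norm (x - y) * norm v) * norm z \<partial>(std_gauss::'a measure))"
  proof (rule integral_mono)
    show "integrable std_gauss (\<lambda>z. \<bar>(f (x + a *\<^sub>R z) - f (y + a *\<^sub>R z)) * (z \<bullet> v)\<bar>)"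
      using i by (intro integrable_abs) (simp add: left_diff_distrib)
    show "\<bar>(f (x + a *\<^sub>R z) - f (y + a *\<^sub>R z)) * (z \<bullet> v)\<bar> \<le> L * norm (x - y) * norm v * norm z" for z
    proof -
      have "\<bar>f (x + a *\<^sub>R z) - f (y + a *\<^sub>R z)\<bar> \<le> L * norm (x - y)"
        using lipschitz_onD[OF f, of "x + a *\<^sub>R z" "y + a *\<^sub>R z"] by (simp add: dist_real_def dist_norm)
      then have "\<bar>f (x + a *\<^sub>R z) - f (y + a *\<^sub>R z)\<bar> * \<bar>z \<bullet> v\<bar> \<le> (L * norm (x - y)) * (norm z * norm v)"
        using lipschitz_on_nonneg[OF f] by (intro mult_mono Cauchy_Schwarz_ineq2) auto
      then show ?thesis by (simp add: abs_mult mult_ac)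
    qed
  qed (use n in auto)
  finally have "\<bar>\<integral>z. (f (x + a *\<^sub>R z) - f (y + a *\<^sub>R z)) * (z \<bullet> v) \<partial>std_gauss\<bar>
     \<le> L * norm (x - y) * norm v * (\<integral>z. norm z \<partial>(std_gauss::'a measure))" by simp
  from mult_left_mono[OF this, of "1 / a"] show ?thesis unfolding e using a by (simp add: mult_ac)
qed

lemma lipschitz_dirder_bound:
  assumes f: "L-lipschitz_on UNIV f" and d: "f differentiable (at x)"
  shows "\<bar>dirder f v x\<bar> \<le> L * norm v"
proof -
  have "((\<lambda>\<theta>. x + \<theta> *\<^sub>R v) has_derivative (\<lambda>h. h *\<^sub>R v)) (at 0)"
    by (auto intro!: derivative_eq_intros)
  moreover have "(f has_derivative (\<lambda>v. dirder f v x)) (at (x + 0 *\<^sub>R v))" using has_derivative_dirder[OF d] by simp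
  ultimately have "((\<lambda>\<theta>. f (x + \<theta> *\<^sub>R v)) has_derivative (\<lambda>h. dirder f (h *\<^sub>R v) x)) (at 0)"
    by (rule has_derivative_compose)
  moreover have "dirder f (h *\<^sub>R v) x = dirder f v x * h" for h
    unfolding dirder_sum_Basis[OF d, of "h *\<^sub>R v"] dirder_sum_Basis[OF d, of v]
    by (simp add: sum_distrib_left sum_distrib_right algebra_simps)
  ultimately have "((\<lambda>\<theta>. f (x + \<theta> *\<^sub>R v)) has_field_derivative dirder f v x) (at 0)"
    unfolding has_field_derivative_def by simp
  then have "((\<lambda>h. (f (x + (0 + h) *\<^sub>R v) - f (x + 0 *\<^sub>R v)) / h) \<longlongrightarrow> dirder f v x) (at 0)"
    unfolding DERIV_def .
  then have l: "((\<lambda>h. \<bar>(f (x + (0 + h) *\<^sub>R v) - f (x + 0 *\<^sub>R v)) / h\<bar>) \<longlongrightarrow> \<bar>dirder f v x\<bar>) (at 0)"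
    by (rule tendsto_rabs)
  show ?thesis
  proof (rule tendsto_upperbound[OF l])
    show "\<forall>\<^sub>F h in at 0. \<bar>(f (x + (0 + h) *\<^sub>R v) - f (x + 0 *\<^sub>R v)) / h\<bar> \<le> L * norm v"
      unfolding eventually_at
    proof (intro exI[of _ 1] conjI ballI impI)
      fix h :: real assume h: "h \<noteq> 0 \<and> dist h 0 < 1"
      have "\<bar>f (x + h *\<^sub>R v) - f x\<bar> \<le> L * norm v * \<bar>h\<bar>"
        using lipschitz_onD[OF f, of "x + h *\<^sub>R v" x] by (simp add: dist_real_def dist_norm mult_ac)
      then show "\<bar>(f (x + (0 + h) *\<^sub>R v) - f (x + 0 *\<^sub>R v)) / h\<bar> \<le> L * norm v"
        using h by (simp add: abs_divide pos_divide_le_eq)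
    qed simp
  qed simp
qed

lemma heat_semigroup:
  fixes f :: "'a::euclidean_space \<Rightarrow> real"
  assumes f[measurable]: "f \<in> borel_measurable borel" and A: "\<And>x. \<bar>f x\<bar> \<le> A" and ab: "a \<ge> 0" "b \<ge> 0"
  shows "heat a (heat b f) x = heat (sqrt (a\<^sup>2 + b\<^sup>2)) f x"
\<comment> \<open>A vanishing parameter has no density and is treated separately.\<close>
proof (cases "a = 0 \<or> b = 0")
  case True
  then show ?thesis using ab by auto
next
  case False
  then have ab: "a > 0" "b > 0" using ab by auto
  interpret P: pair_prob_space "std_gauss :: 'a measure" "std_gauss :: 'a measure" ..
  have m: "(\<lambda>(y, z). a *\<^sub>R y + b *\<^sub>R z :: 'a) \<in> std_gauss \<Otimes>\<^sub>M std_gauss \<rightarrow>\<^sub>M borel"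
    by (simp add: split_beta') measurable
  have "heat (sqrt (a\<^sup>2 + b\<^sup>2)) f x = (\<integral>w. f (x + w) \<partial>distr std_gauss borel (\<lambda>z. sqrt (a\<^sup>2 + b\<^sup>2) *\<^sub>R z))"
    unfolding heat_def by (subst integral_distr) auto
  also have "\<dots> = (\<integral>p. f (x + (a *\<^sub>R fst p + b *\<^sub>R snd p)) \<partial>(std_gauss \<Otimes>\<^sub>M std_gauss))"
    unfolding gauss_sum_distr[OF ab, symmetric] by (subst integral_distr[OF m]) (auto simp: split_beta')
  also have "\<dots> = (\<integral>y. (\<integral>z. f (x + (a *\<^sub>R y + b *\<^sub>R z)) \<partial>std_gauss) \<partial>std_gauss)"
  proof -
    have "integrable (std_gauss \<Otimes>\<^sub>M std_gauss) (\<lambda>(y, z). f (x + (a *\<^sub>R y + b *\<^sub>R z)))"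
      by (rule P.integrable_const_bound[of _ A]) (use A in \<open>auto simp: split_beta'\<close>)
    from P.integral_fst'[OF this] show ?thesis by (simp add: split_beta')
  qed
  also have "\<dots> = heat a (heat b f) x" unfolding heat_def by (simp add: add.assoc)
  finally show ?thesis by simp
qed

text \<open>For smooth data the derivative falls on \<open>g\<close>, which gives bounds independent
  of \<open>a\<close>, whereas \<open>bsmooth_heat\<close> pays a factor \<open>1 / a\<close> for
  each derivative.\<close>

lemma heat_bsmooth:
  assumes g: "bsmooth g"
  shows "bsmooth (heat a g)" and "dirder (heat a g) v x = heat a (dirder g v) x"
proof -
  have D: "(heat a g has_derivative (\<lambda>v. heat a (dirder g v) x)) (at x)" if g: "bsmooth g" for g :: "'a \<Rightarrow> real" and x
  proof -
    have bd: "\<exists>A. \<forall>x. \<bar>h x\<bar> \<le> A" "h \<in> borel_measurable borel" if "bsmooth h" for h :: "'a \<Rightarrow> real"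
      using bsmooth_bounded[OF that] smooth_measurable[OF bsmooth_smooth[OF that]] by (auto simp: bounded_iff)
    have int: "integrable std_gauss (\<lambda>z. h (x + a *\<^sub>R z))" if "bsmooth h" for h :: "'a \<Rightarrow> real" and x
      using bd[OF that] heat_integrable by blast
    have d: "g differentiable (at y)" for y using g smooth_differentiable bsmooth_smooth by blast
    have lin: "heat a (dirder g v) x = (\<Sum>b\<in>Basis. (v \<bullet> b) * heat a (dirder g b) x)" for v
    proof -
      have "heat a (dirder g v) x = (\<integral>z. (\<Sum>b\<in>Basis. (v \<bullet> b) * dirder g b (x + a *\<^sub>R z)) \<partial>std_gauss)"
        unfolding heat_def dirder_sum_Basis[OF d, of v] ..
      also have "\<dots> = (\<Sum>b\<in>Basis. \<integral>z. (v \<bullet> b) * dirder g b (x + a *\<^sub>R z) \<partial>std_gauss)"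
        by (rule Bochner_Integration.integral_sum) (intro integrable_mult_right int bsmooth_dirder g)
      finally show ?thesis unfolding heat_def by simp
    qed
    obtain K where K: "\<And>x w. \<bar>g (x + w) - g x - dirder g w x\<bar> \<le> K * (norm w)\<^sup>2"
      using bsmooth_taylor2[OF g] by blast
    show ?thesis
    proof (rule has_derivative_quadratic[where K = K])
    have "(\<lambda>v. heat a (dirder g v) x) = (\<lambda>v. \<Sum>b\<in>Basis. (v \<bullet> b) * heat a (dirder g b) x)"
      by (rule ext) (rule lin)
    then show "linear (\<lambda>v. heat a (dirder g v) x)"
      by (simp only: linear_sum_inner)
    fix v :: 'a
    have e: "heat a g (x + v) - heat a g x - heat a (dirder g v) x = (\<integral>z. g (x + v + a *\<^sub>R z) - g (x + a *\<^sub>R z) - dirder g v (x + a *\<^sub>R z) \<partial>std_gauss)"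
      unfolding heat_def using int[OF g] int[OF bsmooth_dirder[OF g]] by simp
    have "\<bar>heat a g (x + v) - heat a g x - heat a (dirder g v) x\<bar> \<le> (\<integral>z. \<bar>g (x + v + a *\<^sub>R z) - g (x + a *\<^sub>R z) - dirder g v (x + a *\<^sub>R z)\<bar> \<partial>std_gauss)"
      unfolding e using integral_norm_bound[of std_gauss "\<lambda>z. g (x + v + a *\<^sub>R z) - g (x + a *\<^sub>R z) - dirder g v (x + a *\<^sub>R z)"] by simp
    also have "\<dots> \<le> (\<integral>z. K * (norm v)\<^sup>2 \<partial>(std_gauss::'a measure))"
    proof (rule integral_mono)
      show "\<bar>g (x + v + a *\<^sub>R z) - g (x + a *\<^sub>R z) - dirder g v (x + a *\<^sub>R z)\<bar> \<le> K * (norm v)\<^sup>2" for z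
        using K[of "x + a *\<^sub>R z" v] by (simp add: add_ac)
      show "integrable std_gauss (\<lambda>z. \<bar>g (x + v + a *\<^sub>R z) - g (x + a *\<^sub>R z) - dirder g v (x + a *\<^sub>R z)\<bar>)"
        using int[OF g] int[OF bsmooth_dirder[OF g]] by (intro integrable_abs Bochner_Integration.integrable_diff)
    qed auto
    finally show "\<bar>heat a g (x + v) - heat a g x - heat a (dirder g v) x\<bar> \<le> K * (norm v)\<^sup>2"
      by (simp add: std_gauss.prob_space)
    qed
  qed
  show "dirder (heat a g) v x = heat a (dirder g v) x" by (rule dirderI[OF D[OF g]])
  show "bsmooth (heat a g)"
  proof (rule bsmoothI_class[where S = "heat a ` Collect bsmooth"])
    show "heat a g \<in> heat a ` Collect bsmooth" using g by auto
    fix F :: "'a \<Rightarrow> real" assume "F \<in> heat a ` Collect bsmooth"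
    then obtain h where h: "bsmooth h" "F = heat a h" by auto
    show "F differentiable (at x)" for x using D[OF h(1)] h(2) by (auto simp: differentiable_def)
    have "dirder F v = heat a (dirder h v)" for v using dirderI[OF D[OF h(1)]] h(2) by auto
    then show "dirder F v \<in> heat a ` Collect bsmooth" for v using bsmooth_dirder[OF h(1)] by auto
    obtain A where "\<And>x. \<bar>h x\<bar> \<le> A" using bsmooth_bounded[OF h(1)] by (auto simp: bounded_iff)
    then have "\<bar>heat a h x\<bar> \<le> A" for x
      by (rule heat_bound[OF smooth_measurable[OF bsmooth_smooth[OF h(1)]]])
    then show "bounded (range F)" using h(2) by (auto simp: bounded_iff)
  qed
qed

text \<open>First moments of the Gaussian vanish and second moments form the identity matrix, so the
  second-order term averages to the Laplacian and the third-order remainder to \<open>a ^ 3\<close>.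
  With \<open>a = c * sqrt h\<close> this says that \<sigma> \<Delta> generates the flow, with an
  error of order \<open>h * sqrt h\<close>.\<close>

lemma heat_taylor:
  fixes g :: "'a::euclidean_space \<Rightarrow> real"
  assumes g: "bsmooth g"
  shows "\<exists>K\<ge>0. \<forall>a\<ge>0. \<forall>x. \<bar>heat a g x - g x - a\<^sup>2 / 2 * laplacian g x\<bar> \<le> K * a ^ 3"
proof -
  obtain K where K: "K \<ge> 0" "\<And>x w. \<bar>g (x + w) - g x - dirder g w x - dirder (dirder g w) w x / 2\<bar> \<le> K * norm w ^ 3"
    using bsmooth_taylor3[OF g] by blast
  let ?m3 = "\<integral>z. norm z ^ 3 \<partial>(std_gauss::'a measure)"
  have d: "h differentiable (at y)" if "bsmooth h" for h :: "'a \<Rightarrow> real" and y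
    using that smooth_differentiable bsmooth_smooth by blast
  obtain A where A: "\<And>x. \<bar>g x\<bar> \<le> A" using bsmooth_bounded[OF g] by (auto simp: bounded_iff)
  have int: "integrable std_gauss (\<lambda>z. g (x + a *\<^sub>R z))" for x a
    by (rule heat_integrable[OF smooth_measurable[OF bsmooth_smooth[OF g]] A])
  have n: "integrable (std_gauss::'a measure) (\<lambda>z. norm z ^ 3)" by (rule std_gauss_norm_power) simp
  have "\<bar>heat a g x - g x - a\<^sup>2 / 2 * laplacian g x\<bar> \<le> (K * ?m3) * a ^ 3" if a: "a \<ge> 0" for a x
  proof -
    have e1: "dirder g (a *\<^sub>R z) x = (\<Sum>b\<in>Basis. a * dirder g b x * (z \<bullet> b))" for z
      unfolding dirder_sum_Basis[OF d[OF g], of "a *\<^sub>R z"] by (simp add: mult_ac)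
    have i1: "integrable std_gauss (\<lambda>z. dirder g (a *\<^sub>R z) x)"
      unfolding e1 by (intro Bochner_Integration.integrable_sum integrable_mult_right std_gauss_moment_1)
    have v1: "(\<integral>z. dirder g (a *\<^sub>R z) x \<partial>std_gauss) = 0"
      unfolding e1 by (subst Bochner_Integration.integral_sum) (auto simp: std_gauss_moment_1)
    have e2: "dirder (dirder g (a *\<^sub>R z)) (a *\<^sub>R z) x = (\<Sum>b\<in>Basis. \<Sum>c\<in>Basis. (a\<^sup>2 * dirder (dirder g b) c x) * ((z \<bullet> b) * (z \<bullet> c)))" for z
      by (subst dirder2_expand) (auto simp: mult_ac power2_eq_square intro!: d g bsmooth_dirder)
    have i2: "integrable std_gauss (\<lambda>z. dirder (dirder g (a *\<^sub>R z)) (a *\<^sub>R z) x)"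
      unfolding e2 by (intro Bochner_Integration.integrable_sum integrable_mult_right std_gauss_moment_2)
    have "(\<integral>z. dirder (dirder g (a *\<^sub>R z)) (a *\<^sub>R z) x \<partial>std_gauss) =
       (\<Sum>b\<in>Basis. \<Sum>c\<in>Basis. (a\<^sup>2 * dirder (dirder g b) c x) * (if b = c then 1 else 0))"
      unfolding e2
      by (subst Bochner_Integration.integral_sum, intro Bochner_Integration.integrable_sum integrable_mult_right std_gauss_moment_2, assumption, assumption,
          intro sum.cong refl,
          subst Bochner_Integration.integral_sum, intro integrable_mult_right std_gauss_moment_2, assumption, assumption)
         (auto simp: std_gauss_moment_2 intro!: sum.cong)
    also have "\<dots> = a\<^sup>2 * laplacian g x"
      unfolding laplacian_dirder sum_distrib_left by (intro sum.cong refl) (simp add: if_distrib sum.delta cong: if_cong)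
    finally have v2: "(\<integral>z. dirder (dirder g (a *\<^sub>R z)) (a *\<^sub>R z) x \<partial>std_gauss) = a\<^sup>2 * laplacian g x" .
    have e: "heat a g x - g x - a\<^sup>2 / 2 * laplacian g x =
      (\<integral>z. g (x + a *\<^sub>R z) - g x - dirder g (a *\<^sub>R z) x - dirder (dirder g (a *\<^sub>R z)) (a *\<^sub>R z) x / 2 \<partial>std_gauss)"
      unfolding heat_def using int[of x a] i1 i2 v1 v2 by (simp add: std_gauss.prob_space)
    have "\<bar>heat a g x - g x - a\<^sup>2 / 2 * laplacian g x\<bar> \<le> (\<integral>z. \<bar>g (x + a *\<^sub>R z) - g x - dirder g (a *\<^sub>R z) x - dirder (dirder g (a *\<^sub>R z)) (a *\<^sub>R z) x / 2\<bar> \<partial>std_gauss)"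
      unfolding e using integral_norm_bound[of std_gauss "\<lambda>z. g (x + a *\<^sub>R z) - g x - dirder g (a *\<^sub>R z) x - dirder (dirder g (a *\<^sub>R z)) (a *\<^sub>R z) x / 2"] by simp
    also have "\<dots> \<le> (\<integral>z. (K * a ^ 3) * norm z ^ 3 \<partial>(std_gauss::'a measure))"
    proof (rule integral_mono)
      show "integrable std_gauss (\<lambda>z. \<bar>g (x + a *\<^sub>R z) - g x - dirder g (a *\<^sub>R z) x - dirder (dirder g (a *\<^sub>R z)) (a *\<^sub>R z) x / 2\<bar>)"
        using int[of x a] i1 i2 by auto
      show "\<bar>g (x + a *\<^sub>R z) - g x - dirder g (a *\<^sub>R z) x - dirder (dirder g (a *\<^sub>R z)) (a *\<^sub>R z) x / 2\<bar> \<le> (K * a ^ 3) * norm z ^ 3" for z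
        using K(2)[of x "a *\<^sub>R z"] a by (simp add: power_mult_distrib mult.assoc)
    qed (use n in auto)
    also have "\<dots> = (K * ?m3) * a ^ 3" by simp
    finally show ?thesis .
  qed
  moreover have "0 \<le> K * ?m3" using K(1) by auto
  ultimately show ?thesis by blast
qed

section \<open>Fokker--Planck equations with regular drift\<close>

lemma grad_norm_le:
  assumes "f differentiable (at x)" "\<And>v. dirder f v x \<le> K * norm v" "K \<ge> 0"
  shows "norm (grad f x) \<le> K"
proof (cases "grad f x = 0")
  case False
  have "norm (grad f x) * norm (grad f x) \<le> K * norm (grad f x)"
    using grad_inner[OF assms(1), of "grad f x"] assms(2)[of "grad f x"] by (simp add: dot_square_norm power2_eq_square)
  then show ?thesis using False by simp
qed (use assms in auto)

lemma grad_diff_norm_le: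
  assumes "f differentiable (at x)" "f differentiable (at y)"
    "\<And>v. dirder f v x - dirder f v y \<le> K * norm v" "K \<ge> 0"
  shows "norm (grad f x - grad f y) \<le> K"
proof (cases "grad f x - grad f y = 0")
  case False
  let ?d = "grad f x - grad f y"
  have "norm ?d * norm ?d = grad f x \<bullet> ?d - grad f y \<bullet> ?d"
    by (simp add: inner_diff_left[symmetric] dot_square_norm power2_eq_square)
  also have "\<dots> \<le> K * norm ?d"
    unfolding grad_inner[OF assms(1)] grad_inner[OF assms(2)] by (rule assms(3))
  finally show ?thesis using False by simp
qed (use assms in auto)

lemma inner_lipschitz:
  fixes p q :: "'a::euclidean_space \<Rightarrow> 'a"
  assumes p: "\<And>x. norm (p x) \<le> P" "\<Lambda>-lipschitz_on UNIV p" and q: "\<And>x. norm (q x) \<le> Q" "L-lipschitz_on UNIV q"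
  shows "(P * L + Q * \<Lambda>)-lipschitz_on UNIV (\<lambda>x. p x \<bullet> q x)"
proof (rule lipschitz_onI)
  have PQ: "0 \<le> P" "0 \<le> Q" using p(1) q(1) by (meson norm_ge_zero order_trans)+
  then show "0 \<le> P * L + Q * \<Lambda>" using lipschitz_on_nonneg[OF p(2)] lipschitz_on_nonneg[OF q(2)] by auto
  fix x y
  have "p x \<bullet> q x - p y \<bullet> q y = p x \<bullet> (q x - q y) + (p x - p y) \<bullet> q y"
    by (simp add: inner_diff_left inner_diff_right)
  also have "\<bar>\<dots>\<bar> \<le> norm (p x) * norm (q x - q y) + norm (p x - p y) * norm (q y)"
    by (meson Cauchy_Schwarz_ineq2 abs_triangle_ineq add_mono order_trans)
  also have "\<dots> \<le> P * (L * dist x y) + (\<Lambda> * dist x y) * Q"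
    using p(1) q(1) lipschitz_onD[OF p(2), of x y] lipschitz_onD[OF q(2), of x y] PQ lipschitz_on_nonneg[OF p(2)]
    by (intro add_mono mult_mono) (auto simp: dist_norm)
  finally show "dist (p x \<bullet> q x) (p y \<bullet> q y) \<le> (P * L + Q * \<Lambda>) * dist x y"
    by (simp add: dist_real_def algebra_simps)
qed

text \<open>Unlike multiplication of the drift by a cutoff, composition with the nearest-point
  projection leaves the Lipschitz constant of the drift unchanged, and it moves \<open>x\<close> by
  at most \<open>excess R x\<close>.\<close>

definition cball_proj :: "real \<Rightarrow> 'a::euclidean_space \<Rightarrow> 'a" where
  "cball_proj R x = closest_point (cball 0 R) x"

lemma cball_proj_props:
  fixes x y :: "'a::euclidean_space"
  assumes R: "R \<ge> 0"
  shows "norm (cball_proj R x) \<le> R" "norm x \<le> R \<Longrightarrow> cball_proj R x = x" "dist (cball_proj R x) (cball_proj R y) \<le> dist x y"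
    "dist x (cball_proj R x) \<le> excess R x"
proof -
  have c: "convex (cball (0::'a) R)" "closed (cball (0::'a) R)" "cball (0::'a) R \<noteq> {}" using R by auto
  have "cball_proj R x \<in> cball 0 R" unfolding cball_proj_def by (rule closest_point_in_set[OF c(2,3)])
  then show "norm (cball_proj R x) \<le> R" by simp
  show s: "norm x \<le> R \<Longrightarrow> cball_proj R x = x" unfolding cball_proj_def by (rule closest_point_self) simp
  show "dist (cball_proj R x) (cball_proj R y) \<le> dist x y" unfolding cball_proj_def by (rule closest_point_lipschitz[OF c])
  show "dist x (cball_proj R x) \<le> excess R x"
  proof (cases "norm x \<le> R")
    case True
    then show ?thesis using s excess_nonneg[of R x] by simp
  next
    case False
    define y where "y = (R / norm x) *\<^sub>R x"
    have n: "norm x > 0" using False R by linarith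
    have "y \<in> cball 0 R" unfolding y_def using n R by simp
    then have "dist x (cball_proj R x) \<le> dist x y" unfolding cball_proj_def by (rule closest_point_le[OF c(2)])
    also have "x - y = (1 - R / norm x) *\<^sub>R x" unfolding y_def by (simp add: scaleR_diff_left)
    then have "dist x y = \<bar>1 - R / norm x\<bar> * norm x" by (simp add: dist_norm)
    also have "\<dots> = norm x - R" using False n by (simp add: abs_if field_simps)
    also have "\<dots> \<le> excess R x" unfolding excess_def by simp
    finally show ?thesis .
  qed
qed

lemma bsmooth_add:
  assumes "bsmooth f" "bsmooth g" shows "bsmooth (\<lambda>x. f x + g x)"
proof (rule bsmoothI_class[where S = "{\<lambda>x. f x + g x | f g. bsmooth f \<and> bsmooth g}"])
  fix F :: "'a \<Rightarrow> real" assume "F \<in> {\<lambda>x. f x + g x | f g. bsmooth f \<and> bsmooth g}"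
  then obtain f g where F: "F = (\<lambda>x. f x + g x)" "bsmooth f" "bsmooth g" by auto
  then have d: "f differentiable (at x)" "g differentiable (at x)" for x
    using smooth_differentiable bsmooth_smooth by auto
  then show "F differentiable (at x)" for x unfolding F by auto
  have "dirder F v = (\<lambda>x. dirder f v x + dirder g v x)" for v unfolding F using dirder_add[OF d] by auto
  then show "dirder F v \<in> {\<lambda>x. f x + g x | f g. bsmooth f \<and> bsmooth g}" for v
    using F(2,3) bsmooth_dirder by blast
  show "bounded (range F)"
    unfolding F by (rule bounded_plus_comp) (use bsmooth_bounded F in auto)
qed (use assms in auto)

lemma bsmooth_zero: "bsmooth (\<lambda>x. 0)"
proof (rule bsmoothI_class[where S = "{\<lambda>x. 0}"])
  show "dirder f v \<in> {\<lambda>x. 0}" if "f \<in> {\<lambda>x. 0}" for f and v :: 'a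
  proof -
    have "dirder f v = (\<lambda>x. 0)" using that by (auto simp: dirder_const)
    then show ?thesis by simp
  qed
qed auto

lemma bsmooth_laplacian:
  fixes g :: "'a::euclidean_space \<Rightarrow> real"
  assumes "bsmooth g" shows "bsmooth (laplacian g)"
proof -
  have "bsmooth (\<lambda>x. \<Sum>b\<in>B. dirder (dirder g b) b x)" if "finite B" for B :: "'a set"
    using that by induction (auto intro!: bsmooth_add bsmooth_zero bsmooth_dirder assms)
  from this[OF finite_Basis] show ?thesis unfolding laplacian_dirder[abs_def] .
qed

lemma bsmoothD:
  assumes "bsmooth g"
  shows "\<exists>A\<ge>0. \<forall>x. \<bar>g x\<bar> \<le> A" "g \<in> borel_measurable borel" "g differentiable (at x)"
proof -
  obtain A where A: "\<And>x. \<bar>g x\<bar> \<le> A" using bsmooth_bounded[OF assms] by (auto simp: bounded_iff)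
  moreover have "0 \<le> A" using A[of undefined] by linarith
  ultimately show "\<exists>A\<ge>0. \<forall>x. \<bar>g x\<bar> \<le> A" by blast
  show "g \<in> borel_measurable borel" using smooth_measurable[OF bsmooth_smooth[OF assms]] .
  show "g differentiable (at x)" using smooth_differentiable[OF bsmooth_smooth[OF assms]] .
qed

lemma laplacian_heat:
  assumes g: "bsmooth g"
  shows "laplacian (heat a g) x = heat a (laplacian g) x"
proof -
  have e: "dirder (heat a g) b = heat a (dirder g b)" for b by (rule ext) (rule heat_bsmooth(2)[OF g])
  have i: "integrable std_gauss (\<lambda>z. dirder (dirder g b) b (x + a *\<^sub>R z))" for b
  proof -
    obtain A where "\<And>x. \<bar>dirder (dirder g b) b x\<bar> \<le> A"
      using bsmoothD(1)[OF bsmooth_dirder[OF bsmooth_dirder[OF g]], of b b] by auto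
    then show ?thesis by (rule heat_integrable[OF bsmoothD(2)[OF bsmooth_dirder[OF bsmooth_dirder[OF g]]]])
  qed
  have "laplacian (heat a g) x = (\<Sum>b\<in>Basis. heat a (dirder (dirder g b) b) x)"
    unfolding laplacian_dirder e heat_bsmooth(2)[OF bsmooth_dirder[OF g]] ..
  also have "\<dots> = heat a (laplacian g) x"
    unfolding heat_def laplacian_dirder by (rule Bochner_Integration.integral_sum[symmetric]) (rule i)
  finally show ?thesis .
qed

lemma laplacian_mult:
  assumes f: "smooth f" and g: "smooth g"
  shows "laplacian (\<lambda>x. f x * g x) x = f x * laplacian g x + 2 * (\<Sum>b\<in>Basis. dirder f b x * dirder g b x) + laplacian f x * g x"
proof -
  note d = smooth_differentiable[OF f] smooth_differentiable[OF g]
    smooth_differentiable[OF smooth_dirder[OF f]] smooth_differentiable[OF smooth_dirder[OF g]]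
  have e: "dirder (\<lambda>x. f x * g x) b = (\<lambda>x. f x * dirder g b x + dirder f b x * g x)" for b
    by (rule ext) (rule dirder_mult[OF d(1,2)])
  have "dirder (dirder (\<lambda>x. f x * g x) b) b x = f x * dirder (dirder g b) b x + dirder f b x * dirder g b x
     + (dirder f b x * dirder g b x + dirder (dirder f b) b x * g x)" for b
    unfolding e by (subst dirder_add) (auto intro!: differentiable_mult d simp: dirder_mult d)
  then show ?thesis
    unfolding laplacian_dirder by (simp add: sum.distrib sum_distrib_left sum_distrib_right)
qed

lemma grad_mult:
  assumes "f differentiable (at x)" "g differentiable (at x)"
  shows "grad (\<lambda>x. f x * g x) x \<bullet> v = f x * (grad g x \<bullet> v) + g x * (grad f x \<bullet> v)"
  by (subst (1 2 3) grad_inner) (use assms in \<open>auto simp: dirder_mult\<close>)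

locale drift_measure =
  fixes T \<sigma> L :: real and b :: "real \<Rightarrow> 'a::euclidean_space \<Rightarrow> 'a" and \<nu> :: "real \<Rightarrow> 'a measure"
  assumes sigma_pos: "\<sigma> > 0"
    and reg: "regular_drift T L b"
    and wcont: "wasserstein_continuous_on 1 {0..T} \<nu>"
begin

definition "c = sqrt (2 * \<sigma>)"
definition "gm = (\<integral>z. norm z \<partial>(std_gauss::'a measure))"

lemma c_pos: "c > 0" unfolding c_def using sigma_pos by simp
lemma c_sq: "c\<^sup>2 = 2 * \<sigma>" unfolding c_def using sigma_pos by simp
lemma gm_nonneg: "gm \<ge> 0" unfolding gm_def by simp

lemma nu_w: "t \<in> {0..T} \<Longrightarrow> \<nu> t \<in> wasserstein_space 1"
  using wcont unfolding wasserstein_continuous_on_def by auto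
lemma nu_prob: "t \<in> {0..T} \<Longrightarrow> prob_space (\<nu> t)"
  using nu_w wasserstein_space_1_iff by auto
lemma nu_sets: "t \<in> {0..T} \<Longrightarrow> sets (\<nu> t) = sets borel"
  using nu_w wasserstein_space_1_iff by auto
lemma nu_norm: "t \<in> {0..T} \<Longrightarrow> integrable (\<nu> t) norm"
  using nu_w wasserstein_space_1_iff by auto

lemma b_lip: "t \<in> {0..T} \<Longrightarrow> L-lipschitz_on UNIV (b t)"
  using reg unfolding regular_drift_def by auto

lemma b_measurable: "t \<in> {0..T} \<Longrightarrow> b t \<in> borel_measurable borel" by (rule lipschitz_measurable[OF b_lip])

text \<open>Fixed by choice, so that later constants such as \<open>bm\<close> can be definitions of
  the locale.\<close>

definition "growth = (SOME C. C \<ge> 0 \<and> (\<forall>t\<in>{0..T}. \<forall>x. norm (b t x) \<le> C * (1 + norm x)))"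
lemma growth: "growth \<ge> 0" "t \<in> {0..T} \<Longrightarrow> norm (b t x) \<le> growth * (1 + norm x)"
  using someI_ex[of "\<lambda>C. C \<ge> 0 \<and> (\<forall>t\<in>{0..T}. \<forall>x. norm (b t x) \<le> C * (1 + norm x))"] regular_drift_growth[OF reg]
  unfolding growth_def[symmetric] by blast+

definition "mom = (SOME C. C \<ge> 0 \<and> (\<forall>t\<in>{0..T}. (\<integral>x. norm x \<partial>\<nu> t) \<le> C))"
lemma mom: "mom \<ge> 0" "t \<in> {0..T} \<Longrightarrow> (\<integral>x. norm x \<partial>\<nu> t) \<le> mom"
  using someI_ex[of "\<lambda>C. C \<ge> 0 \<and> (\<forall>t\<in>{0..T}. (\<integral>x. norm x \<partial>\<nu> t) \<le> C)"] wasserstein_bounded_moment[OF wcont]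
  unfolding mom_def[symmetric] by blast+

text \<open>A bound for the integral of \<open>norm (b t x)\<close> against \<open>\<nu> t\<close>,
  uniform in time.\<close>

definition "bm = growth * (1 + mom)"
lemma bm_nonneg: "bm \<ge> 0" unfolding bm_def using growth mom by auto

lemma nu_integrable_bounded:
  fixes f :: "'a \<Rightarrow> real"
  assumes "t \<in> {0..T}" "f \<in> borel_measurable borel" "\<And>x. \<bar>f x\<bar> \<le> A"
  shows "integrable (\<nu> t) f"
proof -
  interpret prob_space "\<nu> t" using nu_prob assms by auto
  show ?thesis
    by (rule integrable_const_bound[of _ A]) (use assms in \<open>auto simp: measurable_cong_sets[OF nu_sets refl]\<close>)
qed

lemma nu_integral_bound:
  fixes f :: "'a \<Rightarrow> real"
  assumes "t \<in> {0..T}" "f \<in> borel_measurable borel" "\<And>x. \<bar>f x\<bar> \<le> A"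
  shows "\<bar>\<integral>x. f x \<partial>\<nu> t\<bar> \<le> A"
proof -
  interpret prob_space "\<nu> t" using nu_prob assms by auto
  have "\<bar>\<integral>x. f x \<partial>\<nu> t\<bar> \<le> (\<integral>x. \<bar>f x\<bar> \<partial>\<nu> t)"
    using integral_norm_bound[of "\<nu> t" f] by simp
  also have "\<dots> \<le> (\<integral>x. A \<partial>\<nu> t)"
    by (rule integral_mono) (use nu_integrable_bounded[OF assms] assms in auto)
  finally show ?thesis by (simp add: prob_space)
qed

lemma nu_integrable_linear:
  fixes f :: "'a \<Rightarrow> real"
  assumes "t \<in> {0..T}" "f \<in> borel_measurable borel" "\<And>x. \<bar>f x\<bar> \<le> A * (1 + norm x)" "A \<ge> 0"
  shows "integrable (\<nu> t) f" "\<bar>\<integral>x. f x \<partial>\<nu> t\<bar> \<le> A * (1 + mom)"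
proof -
  interpret prob_space "\<nu> t" using nu_prob assms by auto
  have n: "integrable (\<nu> t) (\<lambda>x. A * (1 + norm x))" using nu_norm[OF assms(1)] by auto
  show i: "integrable (\<nu> t) f"
    by (rule Bochner_Integration.integrable_bound[OF n])
       (use assms in \<open>auto simp: measurable_cong_sets[OF nu_sets refl] intro: order_trans[OF _ abs_ge_self]\<close>)
  have "\<bar>\<integral>x. f x \<partial>\<nu> t\<bar> \<le> (\<integral>x. \<bar>f x\<bar> \<partial>\<nu> t)"
    using integral_norm_bound[of "\<nu> t" f] by simp
  also have "\<dots> \<le> (\<integral>x. A * (1 + norm x) \<partial>\<nu> t)"
    by (rule integral_mono) (use i n assms in auto)
  also have "\<dots> = A * (1 + (\<integral>x. norm x \<partial>\<nu> t))" using nu_norm[OF assms(1)] by (simp add: prob_space distrib_left)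
  also have "\<dots> \<le> A * (1 + mom)" using mom(2)[OF assms(1)] assms(4) by (intro mult_left_mono) auto
  finally show "\<bar>\<integral>x. f x \<partial>\<nu> t\<bar> \<le> A * (1 + mom)" .
qed

text \<open>The change of the integrand and the change of the measure are separated; the second is
  controlled by the common Lipschitz constant.\<close>

lemma integral_family_continuous:
  fixes g :: "real \<Rightarrow> 'a \<Rightarrow> real"
  assumes lip: "\<And>q. q \<in> {0..T} \<Longrightarrow> K-lipschitz_on UNIV (g q)"
    and unif: "\<And>e. e > 0 \<Longrightarrow> \<exists>d>0. \<forall>q\<in>{0..T}. \<forall>r\<in>{0..T}. \<bar>q - r\<bar> < d \<longrightarrow> (\<forall>x. \<bar>g q x - g r x\<bar> \<le> e)"
  shows "continuous_on {0..T} (\<lambda>q. \<integral>x. g q x \<partial>\<nu> q)"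
  unfolding continuous_on_iff
proof (intro ballI allI impI)
  fix r e :: real assume r: "r \<in> {0..T}" and e: "e > 0"
  have K: "0 \<le> K" using lipschitz_on_nonneg[OF lip[OF r]] .
  obtain d1 where d1: "d1 > 0" "\<And>q x. q \<in> {0..T} \<Longrightarrow> \<bar>q - r\<bar> < d1 \<Longrightarrow> \<bar>g q x - g r x\<bar> \<le> e / 3"
    using unif[of "e / 3"] e r by (meson divide_pos_pos zero_less_numeral)
  have pos: "e / (3 * (K + 1)) > 0" using e K by auto
  obtain d2 where d2: "d2 > 0" "\<forall>q\<in>{0..T}. \<forall>s\<in>{0..T}. \<bar>q - s\<bar> < d2 \<longrightarrow>
    (\<forall>M (f :: 'a \<Rightarrow> real). M-lipschitz_on UNIV f \<longrightarrow>
      norm ((\<integral>x. f x \<partial>\<nu> q) - (\<integral>x. f x \<partial>\<nu> s)) \<le> M * (e / (3 * (K + 1))))"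
    using wasserstein_uniformly_continuous[where 'b = real, OF wcont pos]
    by (elim exE conjE) (rule that)
  show "\<exists>d>0. \<forall>q\<in>{0..T}. dist q r < d \<longrightarrow> dist (\<integral>x. g q x \<partial>\<nu> q) (\<integral>x. g r x \<partial>\<nu> r) < e"
  proof (intro exI[of _ "min d1 d2"] conjI ballI impI)
    fix q assume q: "q \<in> {0..T}" "dist q r < min d1 d2"
    then have q1: "\<bar>q - r\<bar> < d1" "\<bar>q - r\<bar> < d2" by (auto simp: dist_real_def)
    interpret prob_space "\<nu> q" using nu_prob q by auto
    have i: "integrable (\<nu> q) (g q)" "integrable (\<nu> q) (g r)"
      using lipschitz_integrable[OF nu_w[OF q(1)]] lip q(1) r by blast+
    have "\<bar>(\<integral>x. g q x \<partial>\<nu> q) - (\<integral>x. g r x \<partial>\<nu> q)\<bar> = \<bar>\<integral>x. g q x - g r x \<partial>\<nu> q\<bar>"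
      using i by simp
    also have "\<dots> \<le> (\<integral>x. \<bar>g q x - g r x\<bar> \<partial>\<nu> q)"
      using integral_norm_bound[of "\<nu> q" "\<lambda>x. g q x - g r x"] by simp
    also have "\<dots> \<le> (\<integral>x. e / 3 \<partial>\<nu> q)"
      by (rule integral_mono) (use i d1(2)[OF q(1) q1(1)] in auto)
    finally have 1: "\<bar>(\<integral>x. g q x \<partial>\<nu> q) - (\<integral>x. g r x \<partial>\<nu> q)\<bar> \<le> e / 3" by (simp add: prob_space)
    have "norm ((\<integral>x. g r x \<partial>\<nu> q) - (\<integral>x. g r x \<partial>\<nu> r)) \<le> K * (e / (3 * (K + 1)))"
      using d2(2) q(1) r q1(2) lip[OF r] by blast
    also have "\<dots> \<le> e / 3" using K e by (simp add: field_simps)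
    finally show "dist (\<integral>x. g q x \<partial>\<nu> q) (\<integral>x. g r x \<partial>\<nu> r) < e"
      using 1 e unfolding real_norm_def dist_real_def by linarith
  qed (use d1 d2 in auto)
qed

lemma lipschitz_integral_continuous:
  fixes f :: "'a \<Rightarrow> real"
  assumes "K-lipschitz_on UNIV f"
  shows "continuous_on {0..T} (\<lambda>q. \<integral>x. f x \<partial>\<nu> q)"
  by (rule integral_family_continuous[OF assms]) (auto intro!: exI[of _ 1])

definition "gen \<phi> r x = grad \<phi> x \<bullet> b r x + \<sigma> * laplacian \<phi> x"

lemma grad_bsmooth:
  fixes \<phi> :: "'a \<Rightarrow> real"
  assumes "bsmooth \<phi>"
  shows "\<exists>K\<ge>0. (\<forall>x. norm (grad \<phi> x) \<le> K) \<and> K-lipschitz_on UNIV (grad \<phi>)"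
proof -
  note d = bsmoothD(3)[OF assms]
  have "\<exists>\<Lambda>\<ge>0. (\<forall>x. \<bar>dirder \<phi> b x\<bar> \<le> \<Lambda>) \<and> (\<forall>x y. \<bar>dirder \<phi> b x - dirder \<phi> b y\<bar> \<le> \<Lambda> * norm (x - y))" for b
  proof -
    obtain \<Lambda> where 1: "\<Lambda>-lipschitz_on UNIV (dirder \<phi> b)" using bsmooth_lipschitz[OF bsmooth_dirder[OF assms]] by blast
    obtain A where 2: "A \<ge> 0" "\<And>x. \<bar>dirder \<phi> b x\<bar> \<le> A" using bsmoothD(1)[OF bsmooth_dirder[OF assms]] by blast
    have "\<bar>dirder \<phi> b x - dirder \<phi> b y\<bar> \<le> max A \<Lambda> * norm (x - y)" for x y
    proof -
      have "\<bar>dirder \<phi> b x - dirder \<phi> b y\<bar> \<le> \<Lambda> * norm (x - y)" using lipschitz_onD[OF 1, of x y] by (simp add: dist_norm)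
      also have "\<dots> \<le> max A \<Lambda> * norm (x - y)" by (intro mult_right_mono) auto
      finally show ?thesis .
    qed
    then show ?thesis using 2 by (intro exI[of _ "max A \<Lambda>"]) (auto intro: le_max_iff_disj[THEN iffD2])
  qed
  then obtain \<Lambda> where \<Lambda>: "\<And>b. \<Lambda> b \<ge> 0" "\<And>b x. \<bar>dirder \<phi> b x\<bar> \<le> \<Lambda> b" "\<And>b x y. \<bar>dirder \<phi> b x - dirder \<phi> b y\<bar> \<le> \<Lambda> b * norm (x - y)"
    by metis
  define K where "K = sum \<Lambda> Basis"
  have K: "K \<ge> 0" unfolding K_def using \<Lambda> by (auto intro: sum_nonneg)
  have g: "dirder \<phi> b x = grad \<phi> x \<bullet> b" for b x using grad_inner[OF d] by simp
  have 1: "norm (grad \<phi> x) \<le> K" for x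
    unfolding K_def by (rule order_trans[OF norm_le_l1]) (rule sum_mono, use \<Lambda>(2) in \<open>simp add: g\<close>)
  have "norm (grad \<phi> x - grad \<phi> y) \<le> K * norm (x - y)" for x y
    unfolding K_def sum_distrib_right
    by (rule order_trans[OF norm_le_l1]) (rule sum_mono, use \<Lambda>(3) in \<open>simp add: g inner_diff_left\<close>)
  then have "K-lipschitz_on UNIV (grad \<phi>)" using K by (intro lipschitz_onI) (auto simp: dist_norm)
  then show ?thesis using 1 K by blast
qed

lemma test_grad_support:
  assumes \<phi>: "test_function (\<phi> :: 'a \<Rightarrow> real)"
  shows "\<exists>R>0. \<forall>x. norm x \<ge> R \<longrightarrow> grad \<phi> x = 0"
proof -
  note d = bsmoothD(3)[OF test_function_bsmooth[OF \<phi>]]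
  have "bounded (\<Union>b\<in>Basis. {x. dirder \<phi> b x \<noteq> 0})"
    using test_function_dirder[OF \<phi>] by (intro bounded_UN) (auto simp: test_function_iff compact_closure)
  then obtain R where R: "R > 0" "\<And>x. x \<in> (\<Union>b\<in>Basis. {x. dirder \<phi> b x \<noteq> 0}) \<Longrightarrow> norm x < R"
    unfolding bounded_pos_less by auto
  have "grad \<phi> x = 0" if "norm x \<ge> R" for x
  proof (rule euclidean_eqI)
    fix e :: 'a assume "e \<in> Basis"
    then have "dirder \<phi> e x = 0" using R(2)[of x] that by force
    then show "grad \<phi> x \<bullet> e = 0 \<bullet> e" using grad_inner[OF d] by simp
  qed
  then show ?thesis using R(1) by blast
qed

text \<open>Where the projection moves \<open>x\<close>, the gradient of \<phi> vanishes. Hence on a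
  test function the unbounded drift may be replaced by a bounded Lipschitz one, which makes
  \<open>gen \<phi> r\<close> itself bounded and Lipschitz, uniformly in \<open>r\<close>.\<close>

lemma gen_clamp:
  assumes "\<And>x. norm x \<ge> R0 \<Longrightarrow> grad \<phi> x = 0" "0 < R0" "R0 \<le> R"
  shows "gen \<phi> r x = grad \<phi> x \<bullet> b r (cball_proj R x) + \<sigma> * laplacian \<phi> x"
  using assms(1)[of x] cball_proj_props(2)[of R x] assms(2,3) unfolding gen_def by (cases "norm x \<ge> R0") auto

lemma cball_proj_lipschitz: "R \<ge> 0 \<Longrightarrow> 1-lipschitz_on UNIV (cball_proj R)"
  using cball_proj_props(3)[of R] by (intro lipschitz_onI) auto

lemma clamped_drift:
  assumes R: "R \<ge> 0" and t: "t \<in> {0..T}"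
  shows "L-lipschitz_on UNIV (\<lambda>x. b t (cball_proj R x))" "norm (b t (cball_proj R x)) \<le> growth * (1 + R)"
proof -
  show "L-lipschitz_on UNIV (\<lambda>x. b t (cball_proj R x))"
    using lipschitz_on_compose[OF cball_proj_lipschitz[OF R] lipschitz_on_subset[OF b_lip[OF t]]] by (simp add: o_def)
  show "norm (b t (cball_proj R x)) \<le> growth * (1 + R)"
    using growth(2)[OF t, of "cball_proj R x"] cball_proj_props(1)[OF R, of x] growth(1)
    by (meson add_left_mono mult_left_mono order_trans)
qed

lemma gen_test_lipschitz:
  assumes \<phi>: "test_function \<phi>"
  shows "\<exists>\<Lambda> A. \<forall>r\<in>{0..T}. \<Lambda>-lipschitz_on UNIV (gen \<phi> r) \<and> (\<forall>x. \<bar>gen \<phi> r x\<bar> \<le> A)"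
proof -
  have bs: "bsmooth \<phi>" by (rule test_function_bsmooth[OF \<phi>])
  obtain K where K: "K \<ge> 0" "\<And>x. norm (grad \<phi> x) \<le> K" "K-lipschitz_on UNIV (grad \<phi>)"
    using grad_bsmooth[OF bs] by blast
  obtain \<Lambda> where \<Lambda>: "\<Lambda>-lipschitz_on UNIV (laplacian \<phi>)" using bsmooth_lipschitz[OF bsmooth_laplacian[OF bs]] by blast
  obtain A where A: "\<And>x. \<bar>laplacian \<phi> x\<bar> \<le> A" using bsmoothD(1)[OF bsmooth_laplacian[OF bs]] by blast
  obtain R where R: "R > 0" "\<And>x. norm x \<ge> R \<Longrightarrow> grad \<phi> x = 0" using test_grad_support[OF \<phi>] by blast
  have e: "gen \<phi> r = (\<lambda>x. grad \<phi> x \<bullet> b r (cball_proj R x) + \<sigma> * laplacian \<phi> x)" for r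
    by (rule ext) (rule gen_clamp[OF R(2) R(1) order_refl])
  have "((K * L + growth * (1 + R) * K) + \<bar>\<sigma>\<bar> * \<Lambda>)-lipschitz_on UNIV (gen \<phi> q) \<and> (\<forall>x. \<bar>gen \<phi> q x\<bar> \<le> K * (growth * (1 + R)) + \<sigma> * A)"
    if q: "q \<in> {0..T}" for q
  proof
    have "(\<bar>\<sigma>\<bar> * \<Lambda>)-lipschitz_on UNIV (\<lambda>x. \<sigma> * laplacian \<phi> x)" by (rule lipschitz_on_cmult_real[OF \<Lambda>])
    from lipschitz_on_add[OF inner_lipschitz[OF K(2,3) clamped_drift(2)[OF less_imp_le[OF R(1)] q] clamped_drift(1)[OF less_imp_le[OF R(1)] q]] this]
    show "((K * L + growth * (1 + R) * K) + \<bar>\<sigma>\<bar> * \<Lambda>)-lipschitz_on UNIV (gen \<phi> q)" unfolding e .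
    show "\<forall>x. \<bar>gen \<phi> q x\<bar> \<le> K * (growth * (1 + R)) + \<sigma> * A"
    proof
      fix x
      have "\<bar>grad \<phi> x \<bullet> b q (cball_proj R x)\<bar> \<le> norm (grad \<phi> x) * norm (b q (cball_proj R x))" by (rule Cauchy_Schwarz_ineq2)
      also have "\<dots> \<le> K * (growth * (1 + R))"
        using K(1,2) clamped_drift(2)[OF less_imp_le[OF R(1)] q] by (intro mult_mono) auto
      finally have 1: "\<bar>grad \<phi> x \<bullet> b q (cball_proj R x)\<bar> \<le> K * (growth * (1 + R))" .
      have 2: "\<bar>\<sigma> * laplacian \<phi> x\<bar> \<le> \<sigma> * A" using A[of x] sigma_pos by (simp add: abs_mult)
      show "\<bar>gen \<phi> q x\<bar> \<le> K * (growth * (1 + R)) + \<sigma> * A" unfolding e using 1 2 by linarith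
    qed
  qed
  then show ?thesis by blast
qed

lemma gen_test_continuous:
  assumes \<phi>: "test_function \<phi>"
  shows "continuous_on {0..T} (\<lambda>r. \<integral>x. gen \<phi> r x \<partial>\<nu> r)"
proof -
  have bs: "bsmooth \<phi>" by (rule test_function_bsmooth[OF \<phi>])
  obtain K where K: "K \<ge> 0" "\<And>x. norm (grad \<phi> x) \<le> K" using grad_bsmooth[OF bs] by blast
  obtain \<Lambda> where \<Lambda>: "\<And>r. r \<in> {0..T} \<Longrightarrow> \<Lambda>-lipschitz_on UNIV (gen \<phi> r)" using gen_test_lipschitz[OF \<phi>] by blast
  show ?thesis
  proof (rule integral_family_continuous[OF \<Lambda>])
    fix e :: real assume e: "e > 0"
    then have pos: "e / (K + 1) > 0" using K(1) by auto
    obtain dd where dd: "dd > 0" "\<forall>q\<in>{0..T}. \<forall>r\<in>{0..T}. \<bar>q - r\<bar> < dd \<longrightarrow> (\<forall>x. norm (b q x - b r x) \<le> e / (K + 1))"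
      using reg[unfolded regular_drift_def, THEN conjunct2, THEN spec, THEN mp, OF pos] by (elim exE conjE) (rule that)
    show "\<exists>d>0. \<forall>q\<in>{0..T}. \<forall>r\<in>{0..T}. \<bar>q - r\<bar> < d \<longrightarrow> (\<forall>x. \<bar>gen \<phi> q x - gen \<phi> r x\<bar> \<le> e)"
    proof (intro exI[of _ dd] conjI ballI impI allI dd(1))
      fix q r x assume qr: "q \<in> {0..T}" "r \<in> {0..T}" "\<bar>q - r\<bar> < dd"
      have "\<bar>gen \<phi> q x - gen \<phi> r x\<bar> = \<bar>grad \<phi> x \<bullet> (b q x - b r x)\<bar>"
        unfolding gen_def by (simp add: inner_diff_right)
      also have "\<dots> \<le> norm (grad \<phi> x) * norm (b q x - b r x)" by (rule Cauchy_Schwarz_ineq2)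
      also have "\<dots> \<le> K * (e / (K + 1))" using K dd(2) qr by (intro mult_mono) auto
      also have "\<dots> \<le> e" using K(1) e by (simp add: field_simps)
      finally show "\<bar>gen \<phi> q x - gen \<phi> r x\<bar> \<le> e" .
    qed
  qed
qed

end

section \<open>Duhamel's formula for weak solutions\<close>

locale fp_solution = drift_measure +
  assumes fp: "weak_fokker_planck T \<sigma> b \<nu>"
begin

text \<open>For test functions the integrand in time is continuous, so the integral form of the weak
  equation can be differentiated; at the ends of the interval the derivative is one-sided.\<close>

lemma test_derivative:
  assumes \<phi>: "test_function \<phi>" and r: "r \<in> {0..T}"
  shows "((\<lambda>t. \<integral>x. \<phi> x \<partial>\<nu> t) has_real_derivative (\<integral>x. gen \<phi> r x \<partial>\<nu> r)) (at r within {0..T})"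
proof -
  let ?Q = "\<lambda>s. \<integral>x. gen \<phi> s x \<partial>\<nu> s"
  have c: "continuous_on {0..T} ?Q" by (rule gen_test_continuous[OF \<phi>])
  have "((\<lambda>t. integral {0..t} ?Q) has_vector_derivative ?Q r) (at r within {0..T})"
    by (rule integral_has_vector_derivative[OF c r])
  then have "((\<lambda>t. (\<integral>x. \<phi> x \<partial>\<nu> 0) + integral {0..t} ?Q) has_vector_derivative 0 + ?Q r) (at r within {0..T})"
    by (intro has_vector_derivative_add has_vector_derivative_const)
  then have D: "((\<lambda>t. (\<integral>x. \<phi> x \<partial>\<nu> 0) + integral {0..t} ?Q) has_real_derivative ?Q r) (at r within {0..T})"
    by (simp add: has_real_derivative_iff_has_vector_derivative)
  have e: "(\<integral>x. \<phi> x \<partial>\<nu> t) = (\<integral>x. \<phi> x \<partial>\<nu> 0) + integral {0..t} ?Q" if t: "t \<in> {0..T}" for t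
  proof -
    have "?Q absolutely_integrable_on {0..t}"
      using t by (intro absolutely_integrable_continuous_real continuous_on_subset[OF c]) auto
    then have i: "(LINT s:{0..t}|lebesgue. ?Q s) = integral {0..t} ?Q"
      by (rule set_lebesgue_integral_eq_integral(2))
    have "(\<integral>x. \<phi> x \<partial>\<nu> t) = (\<integral>x. \<phi> x \<partial>\<nu> 0) + (LINT s:{0..t}|lebesgue. ?Q s)"
      using fp[unfolded weak_fokker_planck_def, rule_format, OF \<phi> t] unfolding gen_def .
    then show ?thesis unfolding i .
  qed
  show ?thesis
    by (rule has_field_derivative_transform_within[OF D zero_less_one r]) (rule e[symmetric])
qed

end

lemma heat_linear:
  fixes p q r :: "'a::euclidean_space \<Rightarrow> real"
  assumes "bsmooth p" "bsmooth q" "bsmooth r"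
  shows "heat a (\<lambda>x. p x - q x - k * r x) y = heat a p y - heat a q y - k * heat a r y"
proof -
  have i: "integrable std_gauss (\<lambda>z. h (y + a *\<^sub>R z))" if "bsmooth h" for h :: "'a \<Rightarrow> real"
    using bsmoothD(1,2)[OF that] heat_integrable by blast
  show ?thesis unfolding heat_def using i[OF assms(1)] i[OF assms(2)] i[OF assms(3)] by simp
qed

lemma taylor_lipschitz_gradient:
  assumes d: "\<And>x. F differentiable (at x)" and \<Lambda>: "\<And>x y. \<bar>dirder F v x - dirder F v y\<bar> \<le> \<Lambda> * norm v * norm (x - y)" and "\<Lambda> \<ge> 0"
  shows "\<bar>F (x + v) - F x - dirder F v x\<bar> \<le> \<Lambda> * (norm v)\<^sup>2"
proof -
  have "\<exists>z>0. z < 1 \<and> F (x + 1 *\<^sub>R v) - F (x + 0 *\<^sub>R v) = (1 - 0) * dirder F v (x + z *\<^sub>R v)"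
    by (rule MVT2) (auto intro: line_derivative[OF d])
  then obtain z where z: "0 < z" "z < 1" "F (x + v) - F x = dirder F v (x + z *\<^sub>R v)" by auto
  have "\<bar>dirder F v (x + z *\<^sub>R v) - dirder F v x\<bar> \<le> \<Lambda> * norm v * (z * norm v)"
    using \<Lambda>[of "x + z *\<^sub>R v" x] z by simp
  also have "\<dots> \<le> \<Lambda> * norm v * (1 * norm v)" using z assms(3) by (intro mult_left_mono mult_right_mono) auto
  finally show ?thesis unfolding z(3) by (simp add: power2_eq_square mult.assoc)
qed

context fp_solution
begin

text \<open>The heat semigroup of \<sigma> \<Delta> in the time variable: since the square of
  \<open>c\<close> is \<open>2 * \<sigma>\<close>, half the squared displacement parameter is
  \<open>\<sigma> * \<tau>\<close>, and adding squares becomes adding times.\<close>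

definition S :: "real \<Rightarrow> ('a \<Rightarrow> real) \<Rightarrow> 'a \<Rightarrow> real" where
  "S \<tau> f = heat (c * sqrt \<tau>) f"

lemma S_0[simp]: "S 0 f = f" unfolding S_def by simp

lemma S_add:
  assumes "f \<in> borel_measurable borel" "\<And>x. \<bar>f x\<bar> \<le> A" "\<tau> \<ge> 0" "\<eta> \<ge> 0"
  shows "S \<tau> (S \<eta> f) = S (\<tau> + \<eta>) f"
proof -
  have "sqrt ((c * sqrt \<tau>)\<^sup>2 + (c * sqrt \<eta>)\<^sup>2) = c * sqrt (\<tau> + \<eta>)"
    using assms(3,4) c_pos by (simp add: power_mult_distrib distrib_left[symmetric] real_sqrt_mult)
  then show ?thesis unfolding S_def using heat_semigroup[OF assms(1,2), of "c * sqrt \<tau>" "c * sqrt \<eta>"] assms c_pos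
    by (auto simp: fun_eq_iff)
qed

lemma S_bsmooth: "bsmooth g \<Longrightarrow> bsmooth (S \<tau> g)"
  unfolding S_def by (rule heat_bsmooth)

lemma S_bound: "f \<in> borel_measurable borel \<Longrightarrow> (\<And>x. \<bar>f x\<bar> \<le> A) \<Longrightarrow> \<bar>S \<tau> f x\<bar> \<le> A"
  unfolding S_def by (rule heat_bound)

lemma S_lipschitz: "\<kappa>-lipschitz_on UNIV f \<Longrightarrow> (\<And>x. \<bar>f x\<bar> \<le> A) \<Longrightarrow> \<kappa>-lipschitz_on UNIV (S \<tau> f)"
  unfolding S_def by (rule heat_lipschitz)

lemma S_approx:
  assumes "\<kappa>-lipschitz_on UNIV f" "\<And>x. \<bar>f x\<bar> \<le> A" "\<tau> \<ge> 0"
  shows "\<bar>S \<tau> f x - f x\<bar> \<le> \<kappa> * c * gm * sqrt \<tau>"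
  using heat_approx[OF assms(1,2), of "c * sqrt \<tau>" x] c_pos assms(3)
  unfolding S_def gm_def[symmetric] by (simp add: abs_mult mult_ac)

lemma S_measurable: "f \<in> borel_measurable borel \<Longrightarrow> (\<And>x. \<bar>f x\<bar> \<le> A) \<Longrightarrow> \<tau> \<ge> 0 \<Longrightarrow> S \<tau> f \<in> borel_measurable borel"
  unfolding S_def by (rule heat_measurable) (use c_pos in auto)

text \<open>The backward heat equation for \<open>S (t0 - q) g\<close> as a function of
  \<open>q\<close>, with an error uniform in \<open>x\<close> and in both times, as needed to
  integrate it against a measure that moves with \<open>q\<close>. For \<open>q > r\<close> the
  expansion starts at the other end, and the Laplacian is moved back at the cost of
  \<open>sqrt (q - r)\<close>.\<close>

lemma S_increment:
  assumes g: "bsmooth g"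
  shows "\<exists>K\<ge>0. \<forall>t0 q r x. q \<le> t0 \<longrightarrow> r \<le> t0 \<longrightarrow>
    \<bar>S (t0 - q) g x - S (t0 - r) g x + (q - r) * \<sigma> * laplacian (S (t0 - r) g) x\<bar> \<le> K * \<bar>q - r\<bar> * sqrt \<bar>q - r\<bar>"
proof -
  obtain K1 where K1: "K1 \<ge> 0" "\<And>a x. a \<ge> 0 \<Longrightarrow> \<bar>heat a g x - g x - a\<^sup>2 / 2 * laplacian g x\<bar> \<le> K1 * a ^ 3"
    using heat_taylor[OF g] by blast
  have bl: "bsmooth (laplacian g)" by (rule bsmooth_laplacian[OF g])
  obtain \<Lambda> where \<Lambda>: "\<Lambda>-lipschitz_on UNIV (laplacian g)" using bsmooth_lipschitz[OF bl] by blast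
  have \<Lambda>0: "\<Lambda> \<ge> 0" by (rule lipschitz_on_nonneg[OF \<Lambda>])
  obtain A where A: "\<And>x. \<bar>g x\<bar> \<le> A" using bsmoothD(1)[OF g] by blast
  obtain B where B: "\<And>x. \<bar>laplacian g x\<bar> \<le> B" using bsmoothD(1)[OF bl] by blast
  have L: "laplacian (S \<tau> g) x = S \<tau> (laplacian g) x" for \<tau> x unfolding S_def by (rule laplacian_heat[OF g])
  have 1: "\<bar>S (\<tau> + \<eta>) g x - S \<tau> g x - \<eta> * \<sigma> * S \<tau> (laplacian g) x\<bar> \<le> K1 * c ^ 3 * (\<eta> * sqrt \<eta>)" if "\<tau> \<ge> 0" "\<eta> \<ge> 0" for \<tau> \<eta> x
  proof -
    \<comment> \<open>The Taylor error of the step \<eta>. As \<open>S \<tau>\<close> is linear and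
      a contraction in the supremum norm, applying it to \<open>h\<close> gives the expansion at
      \<tau> with the same bound.\<close>
    define h where "h x = S \<eta> g x - g x - (\<eta> * \<sigma>) * laplacian g x" for x
    have hb: "\<bar>h x\<bar> \<le> K1 * c ^ 3 * (\<eta> * sqrt \<eta>)" for x
    proof -
      have "\<bar>heat (c * sqrt \<eta>) g x - g x - (c * sqrt \<eta>)\<^sup>2 / 2 * laplacian g x\<bar> \<le> K1 * (c * sqrt \<eta>) ^ 3"
        by (rule K1(2)) (use c_pos that in auto)
      moreover have "(c * sqrt \<eta>)\<^sup>2 / 2 = \<eta> * \<sigma>" using that c_sq by (simp add: power_mult_distrib)
      moreover have "(c * sqrt \<eta>) ^ 3 = c ^ 3 * (\<eta> * sqrt \<eta>)" using that by (simp add: power_mult_distrib power3_eq_cube)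
      ultimately show ?thesis unfolding h_def S_def by (simp add: mult.assoc)
    qed
    have hm: "h \<in> borel_measurable borel" unfolding h_def[abs_def]
      using bsmoothD(2)[OF S_bsmooth[OF g, of \<eta>]] bsmoothD(2)[OF g] bsmoothD(2)[OF bl] by measurable
    have "S \<tau> h x = S \<tau> (S \<eta> g) x - S \<tau> g x - \<eta> * \<sigma> * S \<tau> (laplacian g) x"
      unfolding S_def[of \<tau>] h_def[abs_def] by (rule heat_linear[OF S_bsmooth[OF g] g bl])
    also have "S \<tau> (S \<eta> g) = S (\<tau> + \<eta>) g" by (rule S_add[OF bsmoothD(2)[OF g] A that])
    finally show ?thesis using S_bound[OF hm hb, of \<tau> x] by simp
  qed
  have 2: "\<bar>S (\<tau> + \<eta>) (laplacian g) x - S \<tau> (laplacian g) x\<bar> \<le> \<Lambda> * c * gm * sqrt \<eta>" if "\<tau> \<ge> 0" "\<eta> \<ge> 0" for \<tau> \<eta> x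
  proof -
    have "S (\<tau> + \<eta>) (laplacian g) = S \<eta> (S \<tau> (laplacian g))"
      using S_add[OF bsmoothD(2)[OF bl] B that(2,1)] by (simp add: add.commute)
    moreover have "\<bar>S \<eta> (S \<tau> (laplacian g)) x - S \<tau> (laplacian g) x\<bar> \<le> \<Lambda> * c * gm * sqrt \<eta>"
      by (rule S_approx[OF S_lipschitz[OF \<Lambda> B] S_bound[OF bsmoothD(2)[OF bl] B] that(2)])
    ultimately show ?thesis by simp
  qed
  define K where "K = K1 * c ^ 3 + \<sigma> * \<Lambda> * c * gm"
  have K: "K \<ge> 0" "K1 * c ^ 3 \<le> K" unfolding K_def using K1(1) c_pos sigma_pos \<Lambda>0 gm_nonneg by auto
  have "\<bar>S (t0 - q) g x - S (t0 - r) g x + (q - r) * \<sigma> * laplacian (S (t0 - r) g) x\<bar> \<le> K * \<bar>q - r\<bar> * sqrt \<bar>q - r\<bar>"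
    if "q \<le> t0" "r \<le> t0" for t0 q r x
  proof (cases "q \<le> r")
    case True
    have "\<bar>S (t0 - q) g x - S (t0 - r) g x - (r - q) * \<sigma> * S (t0 - r) (laplacian g) x\<bar> \<le> K1 * c ^ 3 * ((r - q) * sqrt (r - q))"
      using 1[of "t0 - r" "r - q" x] that True by simp
    also have "\<dots> \<le> K * ((r - q) * sqrt (r - q))" using K True by (intro mult_right_mono) auto
    finally show ?thesis using True unfolding L by (simp add: algebra_simps abs_minus_commute)
  next
    case False
    let ?\<tau> = "t0 - q" and ?\<eta> = "q - r"
    have e: "t0 - r = ?\<tau> + ?\<eta>" by simp
    have p: "?\<tau> \<ge> 0" "?\<eta> \<ge> 0" using that False by auto
    have "\<bar>?\<eta> * \<sigma> * (S (?\<tau> + ?\<eta>) (laplacian g) x - S ?\<tau> (laplacian g) x)\<bar> \<le> ?\<eta> * \<sigma> * (\<Lambda> * c * gm * sqrt ?\<eta>)"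
      using 2[OF p, of x] p sigma_pos unfolding abs_mult by (intro mult_mono) auto
    then have "\<bar>S ?\<tau> g x - S (?\<tau> + ?\<eta>) g x + ?\<eta> * \<sigma> * S (?\<tau> + ?\<eta>) (laplacian g) x\<bar>
       \<le> K1 * c ^ 3 * (?\<eta> * sqrt ?\<eta>) + ?\<eta> * \<sigma> * (\<Lambda> * c * gm * sqrt ?\<eta>)"
      using 1[OF p, of x] by (simp add: right_diff_distrib abs_le_iff)
    also have "\<dots> = K * \<bar>q - r\<bar> * sqrt \<bar>q - r\<bar>" unfolding K_def using False by (simp add: algebra_simps)
    finally show ?thesis unfolding L e .
  qed
  then show ?thesis using K by blast
qed

lemma grad_measurable: "bsmooth (\<phi> :: 'a \<Rightarrow> real) \<Longrightarrow> grad \<phi> \<in> borel_measurable borel"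
  using grad_bsmooth[of \<phi>] lipschitz_on_continuous_on[of _ UNIV "grad \<phi>"] borel_measurable_continuous_onI[of "grad \<phi>"] by blast

lemma inner_drift_bound:
  assumes r: "r \<in> {0..T}" and p: "norm p \<le> K"
  shows "\<bar>p \<bullet> b r x\<bar> \<le> K * growth * (1 + norm x)"
proof -
  have "\<bar>p \<bullet> b r x\<bar> \<le> norm p * norm (b r x)" by (rule Cauchy_Schwarz_ineq2)
  also have "\<dots> \<le> K * (growth * (1 + norm x))"
    using growth(2)[OF r] p order_trans[OF norm_ge_zero p] by (intro mult_mono) auto
  finally show ?thesis by (simp add: mult.assoc)
qed

lemma inner_drift_integrable:
  assumes r: "r \<in> {0..T}" and p: "\<And>x. norm (p x) \<le> K" "p \<in> borel_measurable borel"
  shows "integrable (\<nu> r) (\<lambda>x. p x \<bullet> b r x)" "\<bar>\<integral>x. p x \<bullet> b r x \<partial>\<nu> r\<bar> \<le> K * bm"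
proof -
  have K: "K \<ge> 0" using p(1)[of undefined] norm_ge_zero order_trans by blast
  have m: "(\<lambda>x. p x \<bullet> b r x) \<in> borel_measurable borel" using p(2) b_measurable[OF r] by measurable
  note * = nu_integrable_linear[OF r m inner_drift_bound[OF r p(1)]]
  show "integrable (\<nu> r) (\<lambda>x. p x \<bullet> b r x)" "\<bar>\<integral>x. p x \<bullet> b r x \<partial>\<nu> r\<bar> \<le> K * bm"
    using * K growth(1) unfolding bm_def by (auto simp: mult.assoc)
qed

lemma gen_integrable:
  assumes "bsmooth \<phi>" and r: "r \<in> {0..T}"
  shows "integrable (\<nu> r) (gen \<phi> r)"
proof -
  obtain K where K: "\<And>x. norm (grad \<phi> x) \<le> K" using grad_bsmooth[OF assms(1)] by blast
  note bl = bsmooth_laplacian[OF assms(1)]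
  obtain B where B: "\<And>x. \<bar>laplacian \<phi> x\<bar> \<le> B" using bsmoothD(1)[OF bl] by blast
  show ?thesis unfolding gen_def
    by (intro Bochner_Integration.integrable_add integrable_mult_right inner_drift_integrable(1)[OF r K grad_measurable[OF assms(1)]]
        nu_integrable_bounded[OF r bsmoothD(2)[OF bl] B])
qed

text \<open>Product rule for a test function that itself depends on time. The increment of
  \<open>S (t0 - q) g\<close> is integrated against \<open>\<nu> q\<close> and handled by
  \<open>S_increment\<close>; for the function frozen at \<open>r\<close> the weak equation applies.
  The cutoff is there because the heat flow need not have compact support.\<close>

lemma cutoff_derivative:
  assumes g: "bsmooth g" and t0: "t0 \<in> {0..T}" and r: "r \<in> {0..t0}" and R: "R > 0"
  shows "((\<lambda>q. \<integral>x. cutoff R x * S (t0 - q) g x \<partial>\<nu> q) has_real_derivative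
     (\<integral>x. gen (\<lambda>x. cutoff R x * S (t0 - r) g x) r x \<partial>\<nu> r) - \<sigma> * (\<integral>x. cutoff R x * laplacian (S (t0 - r) g) x \<partial>\<nu> r)) (at r within {0..t0})"
proof -
  let ?u = "\<lambda>q. S (t0 - q) g" and ?\<chi> = "cutoff R :: 'a \<Rightarrow> real"
  have sub: "{0..t0} \<subseteq> {0..T}" and rT: "r \<in> {0..T}" using t0 r by auto
  have bu: "bsmooth (?u q)" for q by (rule S_bsmooth[OF g])
  have tf: "test_function (\<lambda>x. ?\<chi> x * h x)" if "bsmooth h" for h
    by (rule test_function_cutoff[OF R bsmooth_smooth[OF that]])
  have int: "integrable (\<nu> q) (\<lambda>x. ?\<chi> x * h x)" if "bsmooth h" "q \<in> {0..T}" for h q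
    using bsmoothD(1,2)[OF test_function_bsmooth[OF tf[OF that(1)]]] nu_integrable_bounded[OF that(2)] by blast
  have D2: "((\<lambda>q. \<integral>x. ?\<chi> x * ?u r x \<partial>\<nu> q) has_real_derivative (\<integral>x. gen (\<lambda>x. ?\<chi> x * ?u r x) r x \<partial>\<nu> r)) (at r within {0..t0})"
    by (rule DERIV_subset[OF test_derivative[OF tf[OF bu] rT] sub])
  obtain K where K: "K \<ge> 0" "\<And>q x. q \<le> t0 \<Longrightarrow> \<bar>?u q x - ?u r x + (q - r) * \<sigma> * laplacian (?u r) x\<bar> \<le> K * \<bar>q - r\<bar> * sqrt \<bar>q - r\<bar>"
    using S_increment[OF g] r by (metis atLeastAtMost_iff)
  let ?m = "\<lambda>q. \<integral>x. ?\<chi> x * laplacian (?u r) x \<partial>\<nu> q"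
  let ?f = "\<lambda>q. \<integral>x. ?\<chi> x * (?u q x - ?u r x) \<partial>\<nu> q"
  have bl: "bsmooth (laplacian (?u r))" by (rule bsmooth_laplacian[OF bu])
  have mc: "(?m \<longlongrightarrow> ?m r) (at r within {0..t0})"
  proof -
    obtain \<Lambda> where "\<Lambda>-lipschitz_on UNIV (\<lambda>x. ?\<chi> x * laplacian (?u r) x)"
      using bsmooth_lipschitz[OF test_function_bsmooth[OF tf[OF bl]]] by blast
    from lipschitz_integral_continuous[OF this] have "continuous_on {0..t0} ?m" by (rule continuous_on_subset) (rule sub)
    then show ?thesis using r unfolding continuous_on_def by blast
  qed
  have est: "\<bar>?f q / (q - r) + \<sigma> * ?m q\<bar> \<le> K * sqrt \<bar>q - r\<bar>" if q: "q \<in> {0..t0}" "q \<noteq> r" for q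
  proof -
    have qT: "q \<in> {0..T}" using q sub by auto
    have i1: "integrable (\<nu> q) (\<lambda>x. ?\<chi> x * (?u q x - ?u r x))"
      unfolding right_diff_distrib by (intro Bochner_Integration.integrable_diff int bu qT)
    have "?f q + (q - r) * \<sigma> * ?m q = (\<integral>x. ?\<chi> x * (?u q x - ?u r x) + ((q - r) * \<sigma>) * (?\<chi> x * laplacian (?u r) x) \<partial>\<nu> q)"
      by (subst Bochner_Integration.integral_add) (auto intro!: i1 integrable_mult_right int bl qT)
    also have "\<dots> = (\<integral>x. ?\<chi> x * (?u q x - ?u r x + (q - r) * \<sigma> * laplacian (?u r) x) \<partial>\<nu> q)"
      by (simp add: algebra_simps)
    also have "\<bar>\<dots>\<bar> \<le> K * \<bar>q - r\<bar> * sqrt \<bar>q - r\<bar>"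
    proof (rule nu_integral_bound[OF qT])
      show "(\<lambda>x. ?\<chi> x * (?u q x - ?u r x + (q - r) * \<sigma> * laplacian (?u r) x)) \<in> borel_measurable borel"
        using bsmoothD(2)[OF bu[of q]] bsmoothD(2)[OF bu[of r]] bsmoothD(2)[OF bl] smooth_measurable[OF smooth_cutoff[of R]]
        by measurable
      fix x
      have "\<bar>?\<chi> x\<bar> * \<bar>?u q x - ?u r x + (q - r) * \<sigma> * laplacian (?u r) x\<bar> \<le> 1 * (K * \<bar>q - r\<bar> * sqrt \<bar>q - r\<bar>)"
        using K(2)[of q x] q cutoff_range[of R x] by (intro mult_mono) auto
      then show "\<bar>?\<chi> x * (?u q x - ?u r x + (q - r) * \<sigma> * laplacian (?u r) x)\<bar> \<le> K * \<bar>q - r\<bar> * sqrt \<bar>q - r\<bar>"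
        by (simp add: abs_mult)
    qed
    finally have *: "\<bar>?f q + (q - r) * \<sigma> * ?m q\<bar> \<le> K * \<bar>q - r\<bar> * sqrt \<bar>q - r\<bar>" .
    have "?f q / (q - r) + \<sigma> * ?m q = (?f q + (q - r) * \<sigma> * ?m q) / (q - r)"
      using q by (simp add: field_simps)
    then have "\<bar>?f q / (q - r) + \<sigma> * ?m q\<bar> = \<bar>?f q + (q - r) * \<sigma> * ?m q\<bar> / \<bar>q - r\<bar>" by (simp only: abs_divide)
    also have "\<dots> \<le> (K * \<bar>q - r\<bar> * sqrt \<bar>q - r\<bar>) / \<bar>q - r\<bar>" using * by (rule divide_right_mono) simp
    also have "\<dots> = K * sqrt \<bar>q - r\<bar>" using q by simp
    finally show ?thesis .
  qed
  have "((\<lambda>q. ?f q / (q - r) + \<sigma> * ?m q) \<longlongrightarrow> 0) (at r within {0..t0})"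
  proof (rule Lim_null_comparison)
    show "\<forall>\<^sub>F q in at r within {0..t0}. norm (?f q / (q - r) + \<sigma> * ?m q) \<le> K * sqrt \<bar>q - r\<bar>"
      unfolding eventually_at using est by (intro exI[of _ 1]) auto
    have "((\<lambda>q. K * sqrt \<bar>q - r\<bar>) \<longlongrightarrow> K * sqrt \<bar>r - r\<bar>) (at r within {0..t0})"
      by (intro tendsto_intros)
    then show "((\<lambda>q. K * sqrt \<bar>q - r\<bar>) \<longlongrightarrow> 0) (at r within {0..t0})" by simp
  qed
  from tendsto_diff[OF this tendsto_mult[OF tendsto_const[of \<sigma>] mc]]
  have "((\<lambda>q. (?f q - ?f r) / (q - r)) \<longlongrightarrow> - \<sigma> * ?m r) (at r within {0..t0})" by simp
  then have D1: "(?f has_real_derivative - \<sigma> * ?m r) (at r within {0..t0})"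
    unfolding has_field_derivative_iff .
  have D: "((\<lambda>q. ?f q + (\<integral>x. ?\<chi> x * ?u r x \<partial>\<nu> q)) has_real_derivative
     - \<sigma> * ?m r + (\<integral>x. gen (\<lambda>x. ?\<chi> x * ?u r x) r x \<partial>\<nu> r)) (at r within {0..t0})"
    by (rule DERIV_add[OF D1 D2])
  have e: "?f q + (\<integral>x. ?\<chi> x * ?u r x \<partial>\<nu> q) = (\<integral>x. ?\<chi> x * ?u q x \<partial>\<nu> q)" if "q \<in> {0..t0}" for q
  proof -
    have qT: "q \<in> {0..T}" using that sub by auto
    show ?thesis using int[OF bu qT, of q] int[OF bu qT, of r] by (simp add: right_diff_distrib)
  qed
  have "((\<lambda>q. \<integral>x. ?\<chi> x * ?u q x \<partial>\<nu> q) has_real_derivative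
     - \<sigma> * ?m r + (\<integral>x. gen (\<lambda>x. ?\<chi> x * ?u r x) r x \<partial>\<nu> r)) (at r within {0..t0})"
    by (rule has_field_derivative_transform_within[OF D zero_less_one r]) (rule e)
  then show ?thesis by (simp add: add.commute)
qed

definition "drift_term u r = (\<integral>x. grad u x \<bullet> b r x \<partial>\<nu> r)"

text \<open>The diffusion term of the weak equation cancels against the time derivative of the heat
  flow, so that only the drift survives. What the cutoff adds is of order \<open>1 / R\<close> and
  disappears as \<open>R\<close> grows.\<close>

lemma heat_mild_bsmooth:
  assumes g: "bsmooth g" and t: "0 \<le> r1" "r1 \<le> r2" "r2 \<le> t0" "t0 \<le> T"
  shows "((\<lambda>r. drift_term (S (t0 - r) g) r) has_integral
      ((\<integral>x. S (t0 - r2) g x \<partial>\<nu> r2) - (\<integral>x. S (t0 - r1) g x \<partial>\<nu> r1))) {r1..r2}"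
proof -
  let ?u = "\<lambda>q. S (t0 - q) g" and ?\<chi> = "\<lambda>n. cutoff (real (Suc n)) :: 'a \<Rightarrow> real"
  let ?D = "\<lambda>n r. (\<integral>x. gen (\<lambda>x. ?\<chi> n x * ?u r x) r x \<partial>\<nu> r) - \<sigma> * (\<integral>x. ?\<chi> n x * laplacian (?u r) x \<partial>\<nu> r)"
  let ?s = "\<lambda>n r x. \<Sum>b\<in>Basis. dirder (?\<chi> n) b x * dirder (?u r) b x"
    and ?p = "\<lambda>n r x. ?\<chi> n x * (grad (?u r) x \<bullet> b r x)" and ?v = "\<lambda>n r x. ?u r x * (grad (?\<chi> n) x \<bullet> b r x)"
  let ?G = "\<lambda>n r x. gen (\<lambda>x. ?\<chi> n x * ?u r x) r x - \<sigma> * (?\<chi> n x * laplacian (?u r) x) - ?p n r x"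
  let ?J = "\<lambda>n r. \<integral>x. ?p n r x \<partial>\<nu> r" and ?H = "\<lambda>n r x. 2 * ?s n r x + laplacian (?\<chi> n) x * ?u r x"
  have bu: "bsmooth (?u q)" for q by (rule S_bsmooth[OF g])
  obtain A where A: "A \<ge> 0" "\<And>x. \<bar>g x\<bar> \<le> A" using bsmoothD(1)[OF g] by blast
  obtain \<kappa> where \<kappa>: "\<kappa>-lipschitz_on UNIV g" using bsmooth_lipschitz[OF g] by blast
  have \<kappa>0: "\<kappa> \<ge> 0" by (rule lipschitz_on_nonneg[OF \<kappa>])
  have uA: "\<bar>?u r x\<bar> \<le> A" for r x by (rule S_bound[OF bsmoothD(2)[OF g] A(2)])
  have ul: "\<kappa>-lipschitz_on UNIV (?u r)" for r by (rule S_lipschitz[OF \<kappa> A(2)])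
  have ud: "\<bar>dirder (?u r) v x\<bar> \<le> \<kappa> * norm v" for r v x by (rule lipschitz_dirder_bound[OF ul bsmoothD(3)[OF bu]])
  have ud1: "\<bar>dirder (?u r) b x\<bar> \<le> \<kappa>" if "b \<in> Basis" for r b x
    using ud[of r b x] that by simp
  have ug: "norm (grad (?u r) x) \<le> \<kappa>" for r x
    by (rule grad_norm_le[OF bsmoothD(3)[OF bu] _ \<kappa>0]) (use ud in \<open>meson abs_ge_self order_trans\<close>)
  obtain C where C: "C \<ge> 0" "\<And>R (x::'a) b. R \<ge> 1 \<Longrightarrow> b \<in> Basis \<Longrightarrow> \<bar>dirder (cutoff R) b x\<bar> \<le> C / R"
     "\<And>R (x::'a) b. R \<ge> 1 \<Longrightarrow> b \<in> Basis \<Longrightarrow> \<bar>dirder (dirder (cutoff R) b) b x\<bar> \<le> C / R"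
    using cutoff_derivative_bounds[where 'a = 'a] by blast
  define d where "d = real DIM('a)"
  \<comment> \<open>The three summands belong to the three terms in which the cutoff is
    differentiated: its gradient times the drift, the mixed gradients, and its Laplacian. The factor
    \<open>d * C\<close> bounds the sums over the basis.\<close>
  define C' where "C' = d * C * (A * growth + 2 * \<sigma> * \<kappa> + \<sigma> * A)"
  have C': "C' \<ge> 0" unfolding C'_def d_def using C(1) A(1) growth(1) sigma_pos \<kappa>0 by auto
  have sT: "{r1..r2} \<subseteq> {0..T}" "{r1..r2} \<subseteq> {0..t0}" using t by auto
  have cg: "\<bar>grad (cutoff R) x \<bullet> v\<bar> \<le> d * C / R * norm v" if "R \<ge> 1" for R and x v :: 'a
  proof -
    have "grad (cutoff R) x \<bullet> v = (\<Sum>b\<in>Basis. (v \<bullet> b) * dirder (cutoff R) b x)"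
      unfolding grad_inner[OF smooth_differentiable[OF smooth_cutoff]]
      by (rule dirder_sum_Basis[OF smooth_differentiable[OF smooth_cutoff]])
    also have "\<bar>\<dots>\<bar> \<le> (\<Sum>b\<in>(Basis::'a set). norm v * (C / R))"
      by (rule order_trans[OF sum_abs], rule sum_mono, unfold abs_mult, intro mult_mono Basis_le_norm C(2) that) auto
    finally show ?thesis unfolding d_def by (simp add: mult_ac)
  qed
  have main: "\<bar>?D n r - ?J n r\<bar> \<le> C' * (1 + mom) / real (Suc n)" if r: "r \<in> {r1..r2}" for n r
  proof -
    let ?R = "real (Suc n)"
    have R: "?R \<ge> 1" by simp
    have rT: "r \<in> {0..T}" using r sT by auto
    have tf: "bsmooth (\<lambda>x. ?\<chi> n x * h x)" if "bsmooth h" for h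
      by (rule test_function_bsmooth[OF test_function_cutoff[OF _ bsmooth_smooth[OF that]]]) simp
    have bl: "bsmooth (laplacian (?u r))" by (rule bsmooth_laplacian[OF bu])
    have i1: "integrable (\<nu> r) (gen (\<lambda>x. ?\<chi> n x * ?u r x) r)" by (rule gen_integrable[OF tf[OF bu] rT])
    have i2: "integrable (\<nu> r) (\<lambda>x. ?\<chi> n x * laplacian (?u r) x)"
      using bsmoothD(1,2)[OF tf[OF bl]] nu_integrable_bounded[OF rT] by blast
    have i3: "integrable (\<nu> r) (\<lambda>x. ?p n r x)"
    proof -
      have "integrable (\<nu> r) (\<lambda>x. (?\<chi> n x *\<^sub>R grad (?u r) x) \<bullet> b r x)"
      proof (rule inner_drift_integrable(1)[OF rT])
        show "norm (?\<chi> n x *\<^sub>R grad (?u r) x) \<le> \<kappa>" for x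
          using cutoff_range[of ?R x] mult_mono[of "\<bar>?\<chi> n x\<bar>" 1 "norm (grad (?u r) x)" \<kappa>] ug[of r x] \<kappa>0 by auto
        show "(\<lambda>x. ?\<chi> n x *\<^sub>R grad (?u r) x) \<in> borel_measurable borel"
          using grad_measurable[OF bu] smooth_measurable[OF smooth_cutoff] by measurable
      qed
      then show ?thesis by simp
    qed
    have e: "?G n r x
        = ?v n r x + \<sigma> * ?H n r x" for x
      unfolding gen_def grad_mult[OF smooth_differentiable[OF smooth_cutoff] bsmoothD(3)[OF bu]]
        laplacian_mult[OF smooth_cutoff bsmooth_smooth[OF bu]] by (simp add: algebra_simps)
    have bnd: "\<bar>?v n r x + \<sigma> * ?H n r x\<bar>
        \<le> C' / ?R * (1 + norm x)" for x
    proof -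
      have 1: "\<bar>?v n r x\<bar> \<le> A * (d * C / ?R * (growth * (1 + norm x)))"
        unfolding abs_mult
      proof (intro mult_mono uA A(1))
        show "\<bar>grad (?\<chi> n) x \<bullet> b r x\<bar> \<le> d * C / ?R * (growth * (1 + norm x))"
          by (rule order_trans[OF cg[OF R]]) (intro mult_left_mono growth(2) rT, simp add: d_def C)
      qed simp
      have "\<bar>?s n r x\<bar> \<le> (\<Sum>b\<in>(Basis::'a set). C / ?R * \<kappa>)"
        by (rule order_trans[OF sum_abs], rule sum_mono, unfold abs_mult, intro mult_mono C(2)[OF R] ud1) (auto simp: C(1))
      then have 2: "\<bar>?s n r x\<bar> \<le> d * C / ?R * \<kappa>" unfolding d_def by (simp add: mult_ac)
      have "\<bar>laplacian (?\<chi> n) x\<bar> \<le> (\<Sum>b\<in>(Basis::'a set). C / ?R)"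
        unfolding laplacian_dirder by (rule order_trans[OF sum_abs]) (intro sum_mono C(3)[OF R])
      then have "\<bar>laplacian (?\<chi> n) x\<bar> \<le> d * C / ?R" unfolding d_def by simp
      then have 3: "\<bar>laplacian (?\<chi> n) x * ?u r x\<bar> \<le> d * C / ?R * A"
        unfolding abs_mult using A(1) uA by (intro mult_mono) (auto simp: d_def intro: C(1))
      have "\<bar>?H n r x\<bar> \<le> 2 * (d * C / ?R * \<kappa>) + d * C / ?R * A"
        using 2 3 by linarith
      then have 4: "\<bar>\<sigma> * ?H n r x\<bar> \<le> \<sigma> * (2 * (d * C / ?R * \<kappa>) + d * C / ?R * A)"
        unfolding abs_mult using sigma_pos by simp
      have "\<sigma> * (2 * (d * C / ?R * \<kappa>) + d * C / ?R * A) * 1 \<le> \<sigma> * (2 * (d * C / ?R * \<kappa>) + d * C / ?R * A) * (1 + norm x)"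
        using sigma_pos C(1) \<kappa>0 A(1) by (intro mult_left_mono) (auto simp: d_def intro!: mult_nonneg_nonneg add_nonneg_nonneg)
      with 1 4 have "\<bar>?v n r x\<bar> + \<bar>\<sigma> * ?H n r x\<bar>
        \<le> A * (d * C / ?R * (growth * (1 + norm x))) + \<sigma> * (2 * (d * C / ?R * \<kappa>) + d * C / ?R * A) * (1 + norm x)" by linarith
      also have "\<dots> = C' / ?R * (1 + norm x)" unfolding C'_def by (simp add: algebra_simps add_divide_distrib)
      finally show ?thesis by (rule order_trans[OF abs_triangle_ineq])
    qed
    have "?D n r - ?J n r =
       (\<integral>x. ?G n r x \<partial>\<nu> r)"
      using i1 i2 i3 by simp
    moreover have "\<bar>\<integral>x. ?G n r x \<partial>\<nu> r\<bar> \<le> C' / ?R * (1 + mom)"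
    proof (rule nu_integrable_linear(2)[OF rT])
      show "(\<lambda>x. ?G n r x) \<in> borel_measurable borel"
        using borel_measurable_integrable[OF i1] borel_measurable_integrable[OF i2] borel_measurable_integrable[OF i3]
        unfolding measurable_cong_sets[OF nu_sets[OF rT] refl] by measurable
      show "\<bar>?G n r x\<bar> \<le> C' / ?R * (1 + norm x)" for x
        unfolding e by (rule bnd)
      show "0 \<le> C' / ?R" using C' by simp
    qed
    ultimately show ?thesis by simp
  qed
  have chi_b: "\<bar>?J n r\<bar> \<le> \<kappa> * bm"
    and chi_lim: "(\<lambda>n. ?J n r) \<longlonglongrightarrow> drift_term (?u r) r" if r: "r \<in> {r1..r2}" for n r
  proof -
    have rT: "r \<in> {0..T}" using r sT by auto
    have m: "(\<lambda>x. ?\<chi> n x *\<^sub>R grad (?u r) x) \<in> borel_measurable borel" for n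
      using grad_measurable[OF bu] smooth_measurable[OF smooth_cutoff] by measurable
    have nb: "norm (?\<chi> n x *\<^sub>R grad (?u r) x) \<le> \<kappa>" for n x
      using cutoff_range[of "real (Suc n)" x] mult_mono[of "\<bar>?\<chi> n x\<bar>" 1 "norm (grad (?u r) x)" \<kappa>] ug[of r x] \<kappa>0 by auto
    show "\<bar>?J n r\<bar> \<le> \<kappa> * bm"
      using inner_drift_integrable(2)[OF rT nb m, of n] by simp
    have i: "integrable (\<nu> r) (\<lambda>x. grad (?u r) x \<bullet> b r x)"
      by (rule inner_drift_integrable(1)[OF rT ug grad_measurable[OF bu]])
    have i': "integrable (\<nu> r) (\<lambda>x. (?\<chi> n x *\<^sub>R grad (?u r) x) \<bullet> b r x)" for n
      by (rule inner_drift_integrable(1)[OF rT nb m])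
    show "(\<lambda>n. ?J n r) \<longlonglongrightarrow> drift_term (?u r) r"
      unfolding drift_term_def
    proof (rule integral_dominated_convergence[where w = "\<lambda>x. \<bar>grad (?u r) x \<bullet> b r x\<bar>"])
      show "AE x in \<nu> r. (\<lambda>n. ?p n r x) \<longlonglongrightarrow> grad (?u r) x \<bullet> b r x"
        using tendsto_mult[OF cutoff_tendsto tendsto_const] by (intro AE_I2) fastforce
      show "AE x in \<nu> r. norm (?p n r x) \<le> \<bar>grad (?u r) x \<bullet> b r x\<bar>" for n
      proof (rule AE_I2)
        fix x
        show "norm (?p n r x) \<le> \<bar>grad (?u r) x \<bullet> b r x\<bar>"
          using cutoff_range[of "real (Suc n)" x] mult_right_mono[of "\<bar>?\<chi> n x\<bar>" 1 "\<bar>grad (?u r) x \<bullet> b r x\<bar>"]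
          by (simp add: abs_mult)
      qed
      show "(\<lambda>x. ?p n r x) \<in> borel_measurable (\<nu> r)" for n
        using borel_measurable_integrable[OF i'[of n]] by simp
    qed (use i in auto)
  qed
  have Dlim: "(\<lambda>n. ?D n r) \<longlonglongrightarrow> drift_term (?u r) r" if r: "r \<in> {r1..r2}" for r
  proof -
    have "(\<lambda>n. ?D n r - ?J n r) \<longlonglongrightarrow> 0"
    proof (rule Lim_null_comparison)
      show "\<forall>\<^sub>F n in sequentially. norm (?D n r - ?J n r) \<le> C' * (1 + mom) * inverse (real (Suc n))"
        using main[OF r] by (intro always_eventually) (simp add: divide_inverse del: of_nat_Suc)
      show "(\<lambda>n. C' * (1 + mom) * inverse (real (Suc n))) \<longlonglongrightarrow> 0"
        using tendsto_mult[OF tendsto_const LIMSEQ_inverse_real_of_nat, of "C' * (1 + mom)"] by simp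
    qed
    from tendsto_add[OF this chi_lim[OF r]] show ?thesis by simp
  qed
  have Db: "norm (?D n r) \<le> C' * (1 + mom) + \<kappa> * bm" if r: "r \<in> {r1..r2}" for n r
  proof -
    have "C' * (1 + mom) / real (Suc n) \<le> C' * (1 + mom) / 1"
      using C' mom(1) by (intro divide_left_mono) auto
    then show ?thesis using main[OF r, of n] chi_b[OF r, of n] unfolding real_norm_def div_by_1 by linarith
  qed
  have FTC: "(?D n has_integral ((\<integral>x. ?\<chi> n x * ?u r2 x \<partial>\<nu> r2) - (\<integral>x. ?\<chi> n x * ?u r1 x \<partial>\<nu> r1))) {r1..r2}" for n
  proof (rule fundamental_theorem_of_calculus[OF t(2)])
    fix r assume r: "r \<in> {r1..r2}"
    have "((\<lambda>q. \<integral>x. ?\<chi> n x * ?u q x \<partial>\<nu> q) has_real_derivative ?D n r) (at r within {0..t0})"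
      by (rule cutoff_derivative[OF g]) (use t r in auto)
    then have "((\<lambda>q. \<integral>x. ?\<chi> n x * ?u q x \<partial>\<nu> q) has_real_derivative ?D n r) (at r within {r1..r2})"
      by (rule DERIV_subset) (rule sT)
    then show "((\<lambda>q. \<integral>x. ?\<chi> n x * ?u q x \<partial>\<nu> q) has_vector_derivative ?D n r) (at r within {r1..r2})"
      by (simp add: has_real_derivative_iff_has_vector_derivative)
  qed
  have ends: "(\<lambda>n. \<integral>x. ?\<chi> n x * ?u r x \<partial>\<nu> r) \<longlonglongrightarrow> (\<integral>x. ?u r x \<partial>\<nu> r)" if r: "r \<in> {0..T}" for r
  proof (rule integral_dominated_convergence[where w = "\<lambda>x. A"])
    interpret prob_space "\<nu> r" using nu_prob r by auto
    have m: "?u r \<in> borel_measurable borel" by (rule bsmoothD(2)[OF bu])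
    show "?u r \<in> borel_measurable (\<nu> r)" using m unfolding measurable_cong_sets[OF nu_sets[OF r] refl] .
    show "(\<lambda>x. ?\<chi> n x * ?u r x) \<in> borel_measurable (\<nu> r)" for n
      unfolding measurable_cong_sets[OF nu_sets[OF r] refl] using m smooth_measurable[OF smooth_cutoff] by measurable
    show "integrable (\<nu> r) (\<lambda>x. A)" by simp
    show "AE x in \<nu> r. (\<lambda>n. ?\<chi> n x * ?u r x) \<longlonglongrightarrow> ?u r x"
      using tendsto_mult[OF cutoff_tendsto tendsto_const] by (intro AE_I2) fastforce
    show "AE x in \<nu> r. norm (?\<chi> n x * ?u r x) \<le> A" for n
    proof (rule AE_I2)
      fix x
      show "norm (?\<chi> n x * ?u r x) \<le> A"
        using cutoff_range[of "real (Suc n)" x] mult_mono[of "\<bar>?\<chi> n x\<bar>" 1 "\<bar>?u r x\<bar>" A] uA[of r x] A(1) by (simp add: abs_mult)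
    qed
  qed
  have int: "?D n integrable_on {r1..r2}" for n using FTC by (rule has_integral_integrable)
  have hint: "(\<lambda>r::real. C' * (1 + mom) + \<kappa> * bm) integrable_on {r1..r2}" by (rule integrable_const_ivl)
  \<comment> \<open>Integrability in time of the drift term is obtained along with the limit; its
    continuity in \<open>r\<close> never has to be shown.\<close>
  have dc1: "(\<lambda>r. drift_term (?u r) r) integrable_on {r1..r2}"
    by (rule dominated_convergence(1)[OF int hint Db Dlim])
  have dc2: "(\<lambda>n. integral {r1..r2} (?D n)) \<longlonglongrightarrow> integral {r1..r2} (\<lambda>r. drift_term (?u r) r)"
    by (rule dominated_convergence(2)[OF int hint Db Dlim])
  have "(\<lambda>n. integral {r1..r2} (?D n)) \<longlonglongrightarrow> (\<integral>x. ?u r2 x \<partial>\<nu> r2) - (\<integral>x. ?u r1 x \<partial>\<nu> r1)"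
    unfolding integral_unique[OF FTC] by (intro tendsto_diff ends) (use t in auto)
  then have "integral {r1..r2} (\<lambda>r. drift_term (?u r) r) = (\<integral>x. ?u r2 x \<partial>\<nu> r2) - (\<integral>x. ?u r1 x \<partial>\<nu> r1)"
    by (rule LIMSEQ_unique[OF dc2])
  then show ?thesis unfolding has_integral_iff by (rule conjI[OF dc1])
qed

end

section \<open>The heat flow along a weak solution\<close>

context fp_solution
begin

lemma S_bsmooth_pos:
  assumes "f \<in> borel_measurable borel" "\<And>x. \<bar>f x\<bar> \<le> A" "\<tau> > 0"
  shows "bsmooth (S \<tau> f)"
  unfolding S_def by (rule bsmooth_heat(1)[OF assms(1,2)]) (use c_pos assms in auto)

lemma S_grad:
  assumes f: "\<kappa>-lipschitz_on UNIV f" and A: "\<And>x. \<bar>f x\<bar> \<le> A" and \<tau>: "\<tau> > 0"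
  shows "norm (grad (S \<tau> f) x) \<le> \<kappa>"
    and "\<bar>dirder (S \<tau> f) v x - dirder (S \<tau> f) v y\<bar> \<le> (\<kappa> * gm / (c * sqrt \<tau>)) * norm v * norm (x - y)"
    and "(\<kappa> * gm / (c * sqrt \<tau>))-lipschitz_on UNIV (grad (S \<tau> f))"
proof -
  have fm: "f \<in> borel_measurable borel" by (rule lipschitz_measurable[OF f])
  have \<kappa>: "\<kappa> \<ge> 0" by (rule lipschitz_on_nonneg[OF f])
  have bs: "bsmooth (S \<tau> f)" by (rule S_bsmooth_pos[OF fm A \<tau>])
  note d = bsmoothD(3)[OF bs]
  have "dirder (S \<tau> f) v x \<le> \<kappa> * norm v" for v x
    using lipschitz_dirder_bound[OF S_lipschitz[OF f A] d, of v] by (simp add: abs_le_iff)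
  then show "norm (grad (S \<tau> f) x) \<le> \<kappa>" by (intro grad_norm_le d \<kappa>)
  have a: "c * sqrt \<tau> > 0" using c_pos \<tau> by simp
  show *: "\<bar>dirder (S \<tau> f) v x - dirder (S \<tau> f) v y\<bar> \<le> (\<kappa> * gm / (c * sqrt \<tau>)) * norm v * norm (x - y)" for v x y
    using heat_dirder_lipschitz[OF f A a, of v x y] unfolding S_def gm_def[symmetric] by (simp add: mult_ac)
  have k: "\<kappa> * gm / (c * sqrt \<tau>) \<ge> 0" using \<kappa> gm_nonneg a by auto
  show "(\<kappa> * gm / (c * sqrt \<tau>))-lipschitz_on UNIV (grad (S \<tau> f))"
  proof (rule lipschitz_onI[OF _ k])
    fix x y
    have "norm (grad (S \<tau> f) x - grad (S \<tau> f) y) \<le> \<kappa> * gm / (c * sqrt \<tau>) * norm (x - y)"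
    proof (rule grad_diff_norm_le[OF d d])
      show "dirder (S \<tau> f) v x - dirder (S \<tau> f) v y \<le> \<kappa> * gm / (c * sqrt \<tau>) * norm (x - y) * norm v" for v
        using *[of v x y] by (simp add: abs_le_iff mult_ac)
    qed (rule mult_nonneg_nonneg[OF k norm_ge_zero])
    then show "dist (grad (S \<tau> f) x) (grad (S \<tau> f) y) \<le> \<kappa> * gm / (c * sqrt \<tau>) * dist x y" by (simp add: dist_norm)
  qed
qed

text \<open>By the semigroup law \<open>S (t - r) f\<close> is, up to time \<open>r2\<close>, the
  flow of the smooth function \<open>S (t - r2) f\<close>; stopping strictly before \<open>t\<close>
  is what allows \<open>f\<close> to be merely bounded and measurable.\<close>

lemma heat_mild:
  assumes fm: "f \<in> borel_measurable borel" and A: "\<And>x. \<bar>f x\<bar> \<le> A" and t: "0 \<le> r1" "r1 \<le> r2" "r2 < t" "t \<le> T"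
  shows "((\<lambda>r. drift_term (S (t - r) f) r) has_integral
      ((\<integral>x. S (t - r2) f x \<partial>\<nu> r2) - (\<integral>x. S (t - r1) f x \<partial>\<nu> r1))) {r1..r2}"
proof -
  let ?g = "S (t - r2) f"
  have g: "bsmooth ?g" by (rule S_bsmooth_pos[OF fm A]) (use t in auto)
  have e: "S (r2 - r) ?g = S (t - r) f" if "r \<le> r2" for r
    using S_add[OF fm A, of "r2 - r" "t - r2"] that t by simp
  have "((\<lambda>r. drift_term (S (r2 - r) ?g) r) has_integral
      ((\<integral>x. S (r2 - r2) ?g x \<partial>\<nu> r2) - (\<integral>x. S (r2 - r1) ?g x \<partial>\<nu> r1))) {r1..r2}"
    by (rule heat_mild_bsmooth[OF g]) (use t in auto)
  then have "((\<lambda>r. drift_term (S (r2 - r) ?g) r) has_integral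
      ((\<integral>x. S (t - r2) f x \<partial>\<nu> r2) - (\<integral>x. S (t - r1) f x \<partial>\<nu> r1))) {r1..r2}"
    using e[OF t(2)] by simp
  then show ?thesis by (rule has_integral_eq[rotated]) (use e in auto)
qed

lemma heat_mild_endpoint:
  assumes f: "\<kappa>-lipschitz_on UNIV f" and A: "\<And>x. \<bar>f x\<bar> \<le> A" and t: "0 < t" "t \<le> T"
  shows "((\<lambda>q. \<integral>x. S (t - q) f x \<partial>\<nu> q) \<longlongrightarrow> (\<integral>x. f x \<partial>\<nu> t)) (at_left t)"
proof -
  have fm: "f \<in> borel_measurable borel" by (rule lipschitz_measurable[OF f])
  have "continuous_on {0..t} (\<lambda>q. \<integral>x. f x \<partial>\<nu> q)"
    using lipschitz_integral_continuous[OF f] by (rule continuous_on_subset) (use t in auto)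
  then have "((\<lambda>q. \<integral>x. f x \<partial>\<nu> q) \<longlongrightarrow> (\<integral>x. f x \<partial>\<nu> t)) (at t within {0..t})"
    using t unfolding continuous_on_def by auto
  then have l: "((\<lambda>q. \<integral>x. f x \<partial>\<nu> q) \<longlongrightarrow> (\<integral>x. f x \<partial>\<nu> t)) (at_left t)"
    using t by (simp add: at_within_Icc_at_left)
  have "((\<lambda>q. (\<integral>x. S (t - q) f x \<partial>\<nu> q) - (\<integral>x. f x \<partial>\<nu> q)) \<longlongrightarrow> 0) (at_left t)"
  proof (rule Lim_null_comparison)
    have "\<bar>(\<integral>x. S (t - q) f x \<partial>\<nu> q) - (\<integral>x. f x \<partial>\<nu> q)\<bar> \<le> \<kappa> * c * gm * sqrt (t - q)" if q: "0 < q" "q < t" for q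
    proof -
      have qT: "q \<in> {0..T}" using q t by auto
      have m: "S (t - q) f \<in> borel_measurable borel" by (rule S_measurable[OF fm A]) (use q in auto)
      have "(\<integral>x. S (t - q) f x \<partial>\<nu> q) - (\<integral>x. f x \<partial>\<nu> q) = (\<integral>x. S (t - q) f x - f x \<partial>\<nu> q)"
        using nu_integrable_bounded[OF qT m S_bound[OF fm A]] nu_integrable_bounded[OF qT fm A] by simp
      moreover have "\<bar>\<integral>x. S (t - q) f x - f x \<partial>\<nu> q\<bar> \<le> \<kappa> * c * gm * sqrt (t - q)"
        by (rule nu_integral_bound[OF qT]) (use m fm q in \<open>auto intro!: S_approx[OF f A]\<close>)
      ultimately show ?thesis by simp
    qed
    then show "\<forall>\<^sub>F q in at_left t. norm ((\<integral>x. S (t - q) f x \<partial>\<nu> q) - (\<integral>x. f x \<partial>\<nu> q)) \<le> \<kappa> * c * gm * sqrt (t - q)"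
      using t by (auto simp: eventually_at_left_field intro!: exI[of _ 0])
    have "((\<lambda>q. \<kappa> * c * gm * sqrt (t - q)) \<longlongrightarrow> \<kappa> * c * gm * sqrt (t - t)) (at_left t)"
      by (intro tendsto_intros)
    then show "((\<lambda>q. \<kappa> * c * gm * sqrt (t - q)) \<longlongrightarrow> 0) (at_left t)" by simp
  qed
  from tendsto_add[OF this l] show ?thesis by simp
qed

text \<open>Duhamel with a crude bound of the drift term: the gradient of the heat flow never
  exceeds \<kappa>, and \<open>bm\<close> bounds the mean drift. It lets \<nu> at a later time be
  replaced by the pure heat flow of \<nu> at an earlier one.\<close>

lemma mild_bound:
  assumes f: "\<kappa>-lipschitz_on UNIV f" and A: "\<And>x. \<bar>f x\<bar> \<le> A" and t: "0 \<le> s" "s \<le> t" "t \<le> T"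
  shows "\<bar>(\<integral>x. f x \<partial>\<nu> t) - (\<integral>x. S (t - s) f x \<partial>\<nu> s)\<bar> \<le> \<kappa> * bm * (t - s)"
proof (cases "s = t")
  case False
  then have st: "s < t" using t by auto
  have fm: "f \<in> borel_measurable borel" by (rule lipschitz_measurable[OF f])
  have \<kappa>: "\<kappa> \<ge> 0" by (rule lipschitz_on_nonneg[OF f])
  have b: "\<bar>(\<integral>x. S (t - q) f x \<partial>\<nu> q) - (\<integral>x. S (t - s) f x \<partial>\<nu> s)\<bar> \<le> \<kappa> * bm * (t - s)" if q: "s < q" "q < t" for q
  proof -
    have hi: "((\<lambda>r. drift_term (S (t - r) f) r) has_integral ((\<integral>x. S (t - q) f x \<partial>\<nu> q) - (\<integral>x. S (t - s) f x \<partial>\<nu> s))) (cbox s q)"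
      using heat_mild[OF fm A, of s q t] q t by simp
    have "norm ((\<integral>x. S (t - q) f x \<partial>\<nu> q) - (\<integral>x. S (t - s) f x \<partial>\<nu> s)) \<le> \<kappa> * bm * measure lborel (cbox s q)"
    proof (rule has_integral_bound[OF _ hi])
      fix r assume "r \<in> cbox s q"
      then have r: "r \<in> {0..T}" "t - r > 0" using q t by auto
      show "norm (drift_term (S (t - r) f) r) \<le> \<kappa> * bm"
        unfolding drift_term_def real_norm_def
        by (rule inner_drift_integrable(2)[OF r(1) S_grad(1)[OF f A r(2)] grad_measurable[OF S_bsmooth_pos[OF fm A r(2)]]])
    qed (use \<kappa> bm_nonneg in auto)
    also have "\<dots> \<le> \<kappa> * bm * (t - s)" using q \<kappa> bm_nonneg by (intro mult_left_mono) auto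
    finally show ?thesis by simp
  qed
  have l: "((\<lambda>q. \<bar>(\<integral>x. S (t - q) f x \<partial>\<nu> q) - (\<integral>x. S (t - s) f x \<partial>\<nu> s)\<bar>) \<longlongrightarrow> \<bar>(\<integral>x. f x \<partial>\<nu> t) - (\<integral>x. S (t - s) f x \<partial>\<nu> s)\<bar>) (at_left t)"
    by (intro tendsto_intros heat_mild_endpoint[OF f A]) (use st t in auto)
  show ?thesis
    by (rule tendsto_upperbound[OF l]) (use st b in \<open>auto simp: eventually_at_left_field intro!: exI[of _ s]\<close>)
qed simp

text \<open>The summands are, in this order, the constants of the estimates \<open>a1\<close> to
  \<open>a4\<close> at the end of \<open>local_error\<close>.\<close>

definition "err_const = L * bm * sqrt T + L * c * gm + 2 * gm * bm / c + gm / c"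

lemma L_nonneg: "t \<in> {0..T} \<Longrightarrow> L \<ge> 0"
  using b_lip lipschitz_on_nonneg by blast

text \<open>One step of the dual Euler scheme. By Duhamel the integral at \<open>t\<close> is that
  of the heat flow at \<open>s\<close> plus the drift terms accumulated in between. Each of these is
  close to the constant \<open>I0\<close>, and \<open>h * I0\<close> is also the first-order effect
  of shifting the argument of the heat flow by \<open>h\<close> times the drift.\<close>

lemma local_error:
  assumes f: "\<kappa>-lipschitz_on UNIV f" and A: "\<And>x. \<bar>f x\<bar> \<le> A" and st: "0 \<le> s" "s < t" "t \<le> T" and R: "R \<ge> 0"
    and B: "\<And>x. norm (b s (cball_proj R x)) \<le> B"
    and \<omega>: "\<And>r x. r \<in> {s..t} \<Longrightarrow> norm (b r x - b s x) \<le> \<omega>"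
    and \<eta>: "\<And>r. r \<in> {s..t} \<Longrightarrow> (\<integral>x. excess R x \<partial>\<nu> r) \<le> \<eta>"
  shows "\<bar>(\<integral>x. f x \<partial>\<nu> t) - (\<integral>x. S (t - s) f (x + (t - s) *\<^sub>R b s (cball_proj R x)) \<partial>\<nu> s)\<bar>
    \<le> \<kappa> * (t - s) * (\<omega> + L * \<eta> + err_const * (1 + B)\<^sup>2 * sqrt (t - s))"
proof -
  define h where "h = t - s"
  have h: "h > 0" "h \<le> T" unfolding h_def using st by auto
  have fm: "f \<in> borel_measurable borel" by (rule lipschitz_measurable[OF f])
  have \<kappa>: "\<kappa> \<ge> 0" by (rule lipschitz_on_nonneg[OF f])
  have sT: "s \<in> {0..T}" using st by auto
  have L0: "L \<ge> 0" by (rule L_nonneg[OF sT])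
  have B0: "B \<ge> 0" using B[of 0] norm_ge_zero order_trans by blast
  define bt where "bt x = b s (cball_proj R x)" for x
  have btB: "norm (bt x) \<le> B" for x unfolding bt_def by (rule B)
  have btL: "L-lipschitz_on UNIV bt" unfolding bt_def[abs_def] by (rule clamped_drift(1)[OF R sT])
  have btm: "bt \<in> borel_measurable borel" by (rule lipschitz_measurable[OF btL])
  define I0 where "I0 = (\<integral>x. grad (S h f) x \<bullet> bt x \<partial>\<nu> s)"
  \<comment> \<open>\<alpha> collects the bounded errors of the integrand at time \<open>r\<close>,
    and \<open>\<beta> / sqrt (t - r)\<close> the singular one, caused by the Lipschitz constant of
    the gradient.\<close>
  define \<alpha> where "\<alpha> = \<kappa> * (\<omega> + L * \<eta>) + \<kappa> * L * bm * h + \<kappa> * L * c * gm * sqrt h"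
  define \<beta> where "\<beta> = \<kappa> * B * gm * bm * h / c"
  have \<beta>: "\<beta> \<ge> 0" unfolding \<beta>_def using \<kappa> B0 gm_nonneg bm_nonneg h c_pos by auto
  have gb: "\<bar>p \<bullet> bt x\<bar> \<le> \<kappa> * B" if "norm p \<le> \<kappa>" for p x
    by (rule order_trans[OF Cauchy_Schwarz_ineq2]) (use that btB \<kappa> in \<open>auto intro!: mult_mono\<close>)
  have main: "\<bar>drift_term (S (t - r) f) r - I0\<bar> \<le> \<alpha> + \<beta> / sqrt (t - r)" if r: "s \<le> r" "r < t" for r
  proof -
    have rT: "r \<in> {0..T}" and rst: "r \<in> {s..t}" and tr: "t - r > 0" using r st by auto
    let ?u = "S (t - r) f"
    have bu: "bsmooth ?u" by (rule S_bsmooth_pos[OF fm A tr])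
    have um: "grad ?u \<in> borel_measurable borel" by (rule grad_measurable[OF bu])
    note ug = S_grad(1)[OF f A tr] and uL = S_grad(3)[OF f A tr]
    let ?g = "\<lambda>x. grad ?u x \<bullet> bt x"
    have gm': "?g \<in> borel_measurable borel" using um btm by measurable
    have gA: "\<bar>?g x\<bar> \<le> \<kappa> * B" for x by (rule gb[OF ug])
    \<comment> \<open>First replacement: the drift at \<open>r\<close> and \<open>x\<close> by the
      drift at \<open>s\<close> and the projected point; \<omega> pays for the time and
      \<open>L * \<eta>\<close> for the projection.\<close>
    have 1: "\<bar>drift_term ?u r - (\<integral>x. ?g x \<partial>\<nu> r)\<bar> \<le> \<kappa> * (\<omega> + L * \<eta>)"
    proof -
      interpret prob_space "\<nu> r" by (rule nu_prob[OF rT])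
      have ie: "integrable (\<nu> r) (excess R)" by (rule lipschitz_integrable[OF nu_w[OF rT] excess_lipschitz])
      have i1: "integrable (\<nu> r) (\<lambda>x. grad ?u x \<bullet> b r x)" by (rule inner_drift_integrable(1)[OF rT ug um])
      have i2: "integrable (\<nu> r) ?g" by (rule nu_integrable_bounded[OF rT gm' gA])
      have "drift_term ?u r - (\<integral>x. ?g x \<partial>\<nu> r) = (\<integral>x. grad ?u x \<bullet> b r x - ?g x \<partial>\<nu> r)"
        unfolding drift_term_def using i1 i2 by simp
      then have "\<bar>drift_term ?u r - (\<integral>x. ?g x \<partial>\<nu> r)\<bar> \<le> (\<integral>x. \<bar>grad ?u x \<bullet> b r x - ?g x\<bar> \<partial>\<nu> r)"
        using integral_norm_bound[of "\<nu> r" "\<lambda>x. grad ?u x \<bullet> b r x - ?g x"] by simp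
      also have "\<dots> \<le> (\<integral>x. \<kappa> * (\<omega> + L * excess R x) \<partial>\<nu> r)"
      proof (rule integral_mono)
        fix x
        have "norm (b s x - bt x) \<le> L * dist x (cball_proj R x)"
          unfolding bt_def dist_norm[symmetric] using lipschitz_onD[OF b_lip[OF sT]] by blast
        also have "\<dots> \<le> L * excess R x" using cball_proj_props(4)[OF R] L0 by (intro mult_left_mono) auto
        finally have "norm (b r x - bt x) \<le> \<omega> + L * excess R x"
          using \<omega>[OF rst, of x] norm_triangle_ineq[of "b r x - b s x" "b s x - bt x"] by simp
        moreover have "\<bar>grad ?u x \<bullet> b r x - ?g x\<bar> \<le> norm (grad ?u x) * norm (b r x - bt x)"
          unfolding inner_diff_right[symmetric] by (rule Cauchy_Schwarz_ineq2)
        ultimately show "\<bar>grad ?u x \<bullet> b r x - ?g x\<bar> \<le> \<kappa> * (\<omega> + L * excess R x)"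
          using ug[of x] \<kappa> by (meson mult_mono norm_ge_zero order_trans)
      qed (use i1 i2 ie in auto)
      also have "\<dots> = \<kappa> * (\<omega> + L * (\<integral>x. excess R x \<partial>\<nu> r))" using ie by (simp add: prob_space)
      also have "\<dots> \<le> \<kappa> * (\<omega> + L * \<eta>)" using \<eta>[OF rst] L0 \<kappa> by (intro mult_left_mono add_left_mono) auto
      finally show ?thesis .
    qed
    let ?\<Lambda> = "\<kappa> * gm / (c * sqrt (t - r))"
    have \<Lambda>0: "?\<Lambda> \<ge> 0" by (rule lipschitz_on_nonneg[OF uL])
    have gL: "(\<kappa> * L + B * ?\<Lambda>)-lipschitz_on UNIV ?g" by (rule inner_lipschitz[OF ug uL btB btL])
    \<comment> \<open>Second replacement: \<nu> at time \<open>r\<close> by the heat flow of \<nu>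
      at time \<open>s\<close>. Here the Lipschitz constant of the gradient enters.\<close>
    have "\<bar>(\<integral>x. ?g x \<partial>\<nu> r) - (\<integral>x. S (r - s) ?g x \<partial>\<nu> s)\<bar> \<le> (\<kappa> * L + B * ?\<Lambda>) * bm * (r - s)"
      by (rule mild_bound[OF gL gA]) (use r st in auto)
    also have "\<dots> \<le> (\<kappa> * L + B * ?\<Lambda>) * bm * h"
      unfolding h_def using r by (intro mult_left_mono mult_nonneg_nonneg add_nonneg_nonneg \<kappa> L0 B0 \<Lambda>0 bm_nonneg) auto
    finally have 2: "\<bar>(\<integral>x. ?g x \<partial>\<nu> r) - (\<integral>x. S (r - s) ?g x \<partial>\<nu> s)\<bar> \<le> (\<kappa> * L + B * ?\<Lambda>) * bm * h" .
    have Shf: "S h f = S (r - s) ?u" using S_add[OF fm A, of "r - s" "t - r"] r unfolding h_def by simp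
    have bSh: "bsmooth (S h f)" by (rule S_bsmooth_pos[OF fm A h(1)])
    \<comment> \<open>Third replacement: the heat flow is taken past the factor \<open>bt\<close>.
      Since derivatives commute with \<open>S\<close>, only the oscillation of \<open>bt\<close>
      over a Gaussian displacement of size \<open>c * sqrt (r - s)\<close> is left.\<close>
    have pt: "\<bar>S (r - s) ?g x - grad (S h f) x \<bullet> bt x\<bar> \<le> \<kappa> * L * c * gm * sqrt h" for x
    proof -
      let ?a = "c * sqrt (r - s)"
      let ?y = "\<lambda>z. x + ?a *\<^sub>R z"
      have a: "?a \<ge> 0" "?a \<le> c * sqrt h" using c_pos r unfolding h_def by auto
      have "grad (S h f) x \<bullet> bt x = dirder (S h f) (bt x) x" by (rule grad_inner[OF bsmoothD(3)[OF bSh]])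
      also have "\<dots> = heat ?a (dirder ?u (bt x)) x" unfolding Shf unfolding S_def[of "r - s"] by (rule heat_bsmooth(2)[OF bu])
      also have "\<dots> = (\<integral>z. grad ?u (?y z) \<bullet> bt x \<partial>std_gauss)"
        unfolding heat_def grad_inner[OF bsmoothD(3)[OF bu]] ..
      finally have e: "grad (S h f) x \<bullet> bt x = (\<integral>z. grad ?u (?y z) \<bullet> bt x \<partial>std_gauss)" .
      have n: "integrable (std_gauss::'a measure) norm" using std_gauss_norm_power[of 1] by simp
      have i1: "integrable std_gauss (\<lambda>z. ?g (?y z))" by (rule heat_integrable[OF gm' gA])
      have i2: "integrable std_gauss (\<lambda>z. grad ?u (?y z) \<bullet> bt x)"
        by (rule std_gauss.integrable_const_bound[of _ "\<kappa> * B"]) (use gb[OF ug] um in \<open>auto\<close>)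
      have "\<bar>S (r - s) ?g x - grad (S h f) x \<bullet> bt x\<bar> = \<bar>\<integral>z. ?g (?y z) - grad ?u (?y z) \<bullet> bt x \<partial>std_gauss\<bar>"
        unfolding e S_def[of "r - s"] heat_def using i1 i2 by simp
      also have "\<dots> \<le> (\<integral>z. \<bar>?g (?y z) - grad ?u (?y z) \<bullet> bt x\<bar> \<partial>std_gauss)"
        using integral_norm_bound[of std_gauss "\<lambda>z. ?g (?y z) - grad ?u (?y z) \<bullet> bt x"] by simp
      also have "\<dots> \<le> (\<integral>z. (\<kappa> * L * ?a) * norm z \<partial>(std_gauss::'a measure))"
      proof (rule integral_mono)
        fix z
        have "norm (bt (?y z) - bt x) \<le> L * norm (?a *\<^sub>R z)"
          using lipschitz_onD[OF btL, of "x + ?a *\<^sub>R z" x] by (simp add: dist_norm)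
        also have "norm (?a *\<^sub>R z) = ?a * norm z" using a(1) by simp
        finally have "norm (grad ?u (?y z)) * norm (bt (?y z) - bt x) \<le> \<kappa> * (L * (?a * norm z))"
          using ug \<kappa> by (intro mult_mono) auto
        moreover have "\<bar>?g (?y z) - grad ?u (?y z) \<bullet> bt x\<bar> \<le> norm (grad ?u (?y z)) * norm (bt (?y z) - bt x)"
          unfolding inner_diff_right[symmetric] by (rule Cauchy_Schwarz_ineq2)
        ultimately show "\<bar>?g (?y z) - grad ?u (?y z) \<bullet> bt x\<bar> \<le> (\<kappa> * L * ?a) * norm z" by (simp add: mult_ac)
      qed (use i1 i2 n in auto)
      also have "\<dots> = \<kappa> * L * ?a * gm" unfolding gm_def by simp
      also have "\<dots> \<le> \<kappa> * L * (c * sqrt h) * gm" by (intro mult_right_mono mult_left_mono a(2)) (use \<kappa> L0 gm_nonneg in auto)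
      finally show ?thesis by (simp add: mult_ac)
    qed
    have Sgm: "S (r - s) ?g \<in> borel_measurable borel" by (rule S_measurable[OF gm' gA]) (use r in auto)
    have hm: "(\<lambda>x. grad (S h f) x \<bullet> bt x) \<in> borel_measurable borel" using grad_measurable[OF bSh] btm by measurable
    have 3: "\<bar>(\<integral>x. S (r - s) ?g x \<partial>\<nu> s) - I0\<bar> \<le> \<kappa> * L * c * gm * sqrt h"
    proof -
      have "(\<integral>x. S (r - s) ?g x \<partial>\<nu> s) - I0 = (\<integral>x. S (r - s) ?g x - grad (S h f) x \<bullet> bt x \<partial>\<nu> s)"
        unfolding I0_def using nu_integrable_bounded[OF sT Sgm S_bound[OF gm' gA]]
          nu_integrable_bounded[OF sT hm gb[OF S_grad(1)[OF f A h(1)]]] by simp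
      moreover have "\<bar>\<integral>x. S (r - s) ?g x - grad (S h f) x \<bullet> bt x \<partial>\<nu> s\<bar> \<le> \<kappa> * L * c * gm * sqrt h"
        by (rule nu_integral_bound[OF sT _ pt]) (use Sgm hm in measurable)
      ultimately show ?thesis by simp
    qed
    have "\<bar>drift_term ?u r - I0\<bar> \<le> \<kappa> * (\<omega> + L * \<eta>) + (\<kappa> * L + B * ?\<Lambda>) * bm * h + \<kappa> * L * c * gm * sqrt h"
      using 1 2 3 by linarith
    also have "\<dots> = \<alpha> + \<beta> / sqrt (t - r)" unfolding \<alpha>_def \<beta>_def by (simp add: algebra_simps)
    finally show ?thesis .
  qed
  have step: "\<bar>(\<integral>x. S (t - q) f x \<partial>\<nu> q) - (\<integral>x. S h f x \<partial>\<nu> s) - (q - s) * I0\<bar> \<le> \<alpha> * (q - s) + 2 * \<beta> * sqrt h" if q: "s < q" "q < t" for q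
  proof -
    have hi: "((\<lambda>r. drift_term (S (t - r) f) r) has_integral ((\<integral>x. S (t - q) f x \<partial>\<nu> q) - (\<integral>x. S (t - s) f x \<partial>\<nu> s))) {s..q}"
      using heat_mild[OF fm A, of s q t] q st by simp
    have hc: "((\<lambda>r. I0) has_integral (q - s) * I0) {s..q}"
      using has_integral_const_real[of I0 s q] q by simp
    note hd = has_integral_diff[OF hi hc]
    \<comment> \<open>The singularity at \<open>t\<close> integrates to at most
      \<open>2 * \<beta> * sqrt h\<close>. Duhamel is available only up to \<open>q < t\<close>,
      hence the passage to the limit afterwards.\<close>
    have he: "((\<lambda>r. \<alpha> + \<beta> / sqrt (t - r)) has_integral ((\<alpha> * q - 2 * \<beta> * sqrt (t - q)) - (\<alpha> * s - 2 * \<beta> * sqrt (t - s)))) {s..q}"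
    proof (rule fundamental_theorem_of_calculus)
      fix r assume r: "r \<in> {s..q}"
      have "((\<lambda>r. \<alpha> * r - 2 * \<beta> * sqrt (t - r)) has_real_derivative \<alpha> + \<beta> / sqrt (t - r)) (at r)"
        using r q by (auto intro!: derivative_eq_intros simp: field_simps)
      then show "((\<lambda>r. \<alpha> * r - 2 * \<beta> * sqrt (t - r)) has_vector_derivative \<alpha> + \<beta> / sqrt (t - r)) (at r within {s..q})"
        by (simp add: has_real_derivative_iff_has_vector_derivative has_vector_derivative_at_within)
    qed (use q in auto)
    have "norm (integral {s..q} (\<lambda>r. drift_term (S (t - r) f) r - I0)) \<le> integral {s..q} (\<lambda>r. \<alpha> + \<beta> / sqrt (t - r))"
      by (rule integral_norm_bound_integral[OF has_integral_integrable[OF hd] has_integral_integrable[OF he]]) (use main q in auto)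
    then have "\<bar>(\<integral>x. S (t - q) f x \<partial>\<nu> q) - (\<integral>x. S (t - s) f x \<partial>\<nu> s) - (q - s) * I0\<bar> \<le> (\<alpha> * q - 2 * \<beta> * sqrt (t - q)) - (\<alpha> * s - 2 * \<beta> * sqrt (t - s))"
      unfolding integral_unique[OF hd] integral_unique[OF he] by simp
    also have "\<dots> \<le> \<alpha> * (q - s) + 2 * \<beta> * sqrt h"
      using \<beta> q unfolding h_def by (simp add: algebra_simps)
    finally show ?thesis unfolding h_def .
  qed
  have l1: "((\<lambda>q. \<bar>(\<integral>x. S (t - q) f x \<partial>\<nu> q) - (\<integral>x. S h f x \<partial>\<nu> s) - (q - s) * I0\<bar>) \<longlongrightarrow> \<bar>(\<integral>x. f x \<partial>\<nu> t) - (\<integral>x. S h f x \<partial>\<nu> s) - (t - s) * I0\<bar>) (at_left t)"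
    by (intro tendsto_intros heat_mild_endpoint[OF f A]) (use st in auto)
  have l2: "((\<lambda>q. \<alpha> * (q - s) + 2 * \<beta> * sqrt h) \<longlongrightarrow> \<alpha> * (t - s) + 2 * \<beta> * sqrt h) (at_left t)"
    by (intro tendsto_intros)
  have E1: "\<bar>(\<integral>x. f x \<partial>\<nu> t) - (\<integral>x. S h f x \<partial>\<nu> s) - h * I0\<bar> \<le> \<alpha> * h + 2 * \<beta> * sqrt h"
    unfolding h_def[symmetric]
  proof -
    have "\<bar>(\<integral>x. f x \<partial>\<nu> t) - (\<integral>x. S h f x \<partial>\<nu> s) - (t - s) * I0\<bar> \<le> \<alpha> * (t - s) + 2 * \<beta> * sqrt h"
      by (rule tendsto_le[OF _ l2 l1]) (use st step in \<open>auto simp: eventually_at_left_field intro!: exI[of _ s]\<close>)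
    then show "\<bar>(\<integral>x. f x \<partial>\<nu> t) - (\<integral>x. S h f x \<partial>\<nu> s) - h * I0\<bar> \<le> \<alpha> * h + 2 * \<beta> * sqrt h" unfolding h_def .
  qed
  let ?F = "S h f"
  have bF: "bsmooth ?F" by (rule S_bsmooth_pos[OF fm A h(1)])
  let ?\<Lambda> = "\<kappa> * gm / (c * sqrt h)"
  have \<Lambda>0: "?\<Lambda> \<ge> 0" using \<kappa> gm_nonneg c_pos h by auto
  have FA: "\<bar>?F x\<bar> \<le> A" for x by (rule S_bound[OF fm A])
  have Fm: "?F \<in> borel_measurable borel" by (rule bsmoothD(2)[OF bF])
  have Fm2: "(\<lambda>x. ?F (x + h *\<^sub>R bt x)) \<in> borel_measurable borel" using Fm btm by measurable
  have hm: "(\<lambda>x. grad ?F x \<bullet> bt x) \<in> borel_measurable borel" using grad_measurable[OF bF] btm by measurable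
  \<comment> \<open>First-order expansion of the heat flow in the shift. The Lipschitz constant of
    its gradient is of order \<open>1 / sqrt h\<close>, so the error is of order
    \<open>h * sqrt h\<close>.\<close>
  have pt: "\<bar>?F (x + h *\<^sub>R bt x) - ?F x - h * (grad ?F x \<bullet> bt x)\<bar> \<le> ?\<Lambda> * (h * B)\<^sup>2" for x
  proof -
    have "\<bar>?F (x + h *\<^sub>R bt x) - ?F x - dirder ?F (h *\<^sub>R bt x) x\<bar> \<le> ?\<Lambda> * (norm (h *\<^sub>R bt x))\<^sup>2"
      by (rule taylor_lipschitz_gradient[OF bsmoothD(3)[OF bF] S_grad(2)[OF f A h(1)] \<Lambda>0])
    also have "\<dots> \<le> ?\<Lambda> * (h * B)\<^sup>2"
      using btB[of x] h \<Lambda>0 by (intro mult_left_mono power_mono) auto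
    also have "dirder ?F (h *\<^sub>R bt x) x = h * (grad ?F x \<bullet> bt x)"
      unfolding grad_inner[OF bsmoothD(3)[OF bF], symmetric] by simp
    finally show ?thesis .
  qed
  have E2: "\<bar>(\<integral>x. ?F (x + h *\<^sub>R bt x) \<partial>\<nu> s) - (\<integral>x. ?F x \<partial>\<nu> s) - h * I0\<bar> \<le> ?\<Lambda> * (h * B)\<^sup>2"
  proof -
    have "(\<integral>x. ?F (x + h *\<^sub>R bt x) \<partial>\<nu> s) - (\<integral>x. ?F x \<partial>\<nu> s) - h * I0 = (\<integral>x. ?F (x + h *\<^sub>R bt x) - ?F x - h * (grad ?F x \<bullet> bt x) \<partial>\<nu> s)"
      unfolding I0_def using nu_integrable_bounded[OF sT Fm2 FA] nu_integrable_bounded[OF sT Fm FA]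
        nu_integrable_bounded[OF sT hm gb[OF S_grad(1)[OF f A h(1)]]] by simp
    moreover have "\<bar>\<integral>x. ?F (x + h *\<^sub>R bt x) - ?F x - h * (grad ?F x \<bullet> bt x) \<partial>\<nu> s\<bar> \<le> ?\<Lambda> * (h * B)\<^sup>2"
      by (rule nu_integral_bound[OF sT _ pt]) (use Fm Fm2 hm in measurable)
    ultimately show ?thesis by simp
  qed
  have hh: "h * h = h * sqrt h * sqrt h" using h by (simp add: mult.assoc)
  have "\<bar>(\<integral>x. f x \<partial>\<nu> t) - (\<integral>x. ?F (x + h *\<^sub>R bt x) \<partial>\<nu> s)\<bar> \<le> \<alpha> * h + 2 * \<beta> * sqrt h + ?\<Lambda> * (h * B)\<^sup>2"
    using E1 E2 by linarith
  also have "\<dots> \<le> \<kappa> * h * (\<omega> + L * \<eta> + err_const * (1 + B)\<^sup>2 * sqrt h)"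
  proof -
    \<comment> \<open>All four errors are brought to the form \<open>\<kappa> * h * sqrt h\<close>
      times a constant times the square of \<open>1 + B\<close>, which dominates 1, \<open>B\<close>
      and the square of \<open>B\<close>.\<close>
    let ?hs = "h * sqrt h" and ?B = "(1 + B)\<^sup>2"
    have B1: "1 \<le> ?B" "B \<le> ?B" "B\<^sup>2 \<le> ?B" using B0 by (auto simp: power2_eq_square algebra_simps)
    have q0: "0 \<le> ?hs" using h by auto
    have a1: "\<kappa> * L * bm * (h * h) \<le> (\<kappa> * ?hs) * (L * bm * sqrt T * ?B)"
    proof -
      have "\<kappa> * L * bm * (h * h) = (\<kappa> * ?hs) * ((L * bm * sqrt h) * 1)" unfolding hh by (simp add: mult_ac)
      also have "\<dots> \<le> (\<kappa> * ?hs) * ((L * bm * sqrt T) * ?B)"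
        using \<kappa> L0 bm_nonneg h B1 by (intro mult_left_mono mult_mono) auto
      finally show ?thesis .
    qed
    have a2: "\<kappa> * L * c * gm * ?hs \<le> (\<kappa> * ?hs) * (L * c * gm * ?B)"
    proof -
      have "\<kappa> * L * c * gm * ?hs = (\<kappa> * ?hs) * ((L * c * gm) * 1)" by (simp add: mult_ac)
      also have "\<dots> \<le> (\<kappa> * ?hs) * ((L * c * gm) * ?B)"
        using \<kappa> L0 gm_nonneg c_pos h B1 by (intro mult_left_mono) auto
      finally show ?thesis .
    qed
    have a3: "2 * \<beta> * sqrt h \<le> (\<kappa> * ?hs) * (2 * gm * bm / c * ?B)"
    proof -
      have "2 * \<beta> * sqrt h = (\<kappa> * ?hs) * (2 * gm * bm / c * B)" unfolding \<beta>_def by (simp add: mult_ac)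
      also have "\<dots> \<le> (\<kappa> * ?hs) * (2 * gm * bm / c * ?B)"
        using \<kappa> bm_nonneg gm_nonneg c_pos h B1 by (intro mult_left_mono) auto
      finally show ?thesis .
    qed
    have a4: "?\<Lambda> * (h * B)\<^sup>2 \<le> (\<kappa> * ?hs) * (gm / c * ?B)"
    proof -
      have "h\<^sup>2 / sqrt h = ?hs" using h hh by (simp add: power2_eq_square real_div_sqrt) (simp add: field_simps)
      moreover have "?\<Lambda> * (h * B)\<^sup>2 = (\<kappa> * (gm / c) * B\<^sup>2) * (h\<^sup>2 / sqrt h)" by (simp add: power_mult_distrib mult_ac)
      ultimately have "?\<Lambda> * (h * B)\<^sup>2 = (\<kappa> * ?hs) * (gm / c * B\<^sup>2)" by (simp add: mult_ac)
      also have "\<dots> \<le> (\<kappa> * ?hs) * (gm / c * ?B)"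
        using \<kappa> gm_nonneg c_pos h B1 by (intro mult_left_mono) auto
      finally show ?thesis .
    qed
    have "\<alpha> * h + 2 * \<beta> * sqrt h + ?\<Lambda> * (h * B)\<^sup>2 = \<kappa> * h * (\<omega> + L * \<eta>) + \<kappa> * L * bm * (h * h) + \<kappa> * L * c * gm * ?hs + 2 * \<beta> * sqrt h + ?\<Lambda> * (h * B)\<^sup>2"
      unfolding \<alpha>_def by (simp add: algebra_simps)
    also have "\<dots> \<le> \<kappa> * h * (\<omega> + L * \<eta>) + (\<kappa> * ?hs) * (L * bm * sqrt T * ?B) + (\<kappa> * ?hs) * (L * c * gm * ?B)
       + (\<kappa> * ?hs) * (2 * gm * bm / c * ?B) + (\<kappa> * ?hs) * (gm / c * ?B)"
      using a1 a2 a3 a4 by linarith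
    also have "\<dots> = \<kappa> * h * (\<omega> + L * \<eta> + err_const * ?B * sqrt h)"
      unfolding err_const_def by (simp only: distrib_left distrib_right mult_ac)
    finally show ?thesis .
  qed
  finally show ?thesis unfolding h_def bt_def .
qed

text \<open>\<open>euler_dual h R j k f x\<close> is the expectation of \<open>f\<close> after \<open>j\<close> Euler steps that start in \<open>x\<close> at
  time \<open>k h\<close>.\<close>

primrec euler_dual :: "real \<Rightarrow> real \<Rightarrow> nat \<Rightarrow> nat \<Rightarrow> ('a \<Rightarrow> real) \<Rightarrow> 'a \<Rightarrow> real" where
  "euler_dual h R 0 k f = f"
| "euler_dual h R (Suc j) k f = (\<lambda>x. S h (euler_dual h R j (Suc k) f) (x + h *\<^sub>R b (real k * h) (cball_proj R x)))"

text \<open>The shift by \<open>h\<close> times the clamped drift expands distances by at most the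
  factor \<open>1 + h * L\<close>, and the heat flow does not expand them; the supremum bound
  survives both.\<close>

lemma euler_dual_lipschitz:
  assumes f: "\<kappa>-lipschitz_on UNIV f" and A: "\<And>x. \<bar>f x\<bar> \<le> A" and h: "h \<ge> 0" and R: "R \<ge> 0" and L: "L \<ge> 0"
  shows "real (k + j) * h \<le> T \<Longrightarrow> (\<kappa> * (1 + h * L) ^ j)-lipschitz_on UNIV (euler_dual h R j k f) \<and> (\<forall>x. \<bar>euler_dual h R j k f x\<bar> \<le> A)"
proof (induction j arbitrary: k)
  case 0
  then show ?case using f A by simp
next
  case (Suc j)
  let ?F = "euler_dual h R j (Suc k) f"
  have IH: "(\<kappa> * (1 + h * L) ^ j)-lipschitz_on UNIV ?F" "\<And>x. \<bar>?F x\<bar> \<le> A"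
    using Suc.IH[of "Suc k"] Suc.prems by auto
  have Fm: "?F \<in> borel_measurable borel" by (rule lipschitz_measurable[OF IH(1)])
  have "real k * h \<le> real (k + Suc j) * h" using h by (intro mult_right_mono) auto
  then have kT: "real k * h \<in> {0..T}" using Suc.prems h by auto
  have "(1 + h * L)-lipschitz_on UNIV (\<lambda>x. x + h *\<^sub>R b (real k * h) (cball_proj R x))"
    using lipschitz_on_add[OF lipschitz_on_id[of UNIV] lipschitz_on_cmult[OF clamped_drift(1)[OF R kT], of h]] h by simp
  from lipschitz_on_compose[OF this lipschitz_on_subset[OF S_lipschitz[OF IH(1) IH(2), of h]]]
  have "(\<kappa> * (1 + h * L) ^ Suc j)-lipschitz_on UNIV (euler_dual h R (Suc j) k f)"
    by (simp add: o_def mult_ac)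
  then show ?case using S_bound[OF Fm IH(2)] by simp
qed

text \<open>Telescoping: the steps still to come turn \<open>f\<close> into another bounded
  Lipschitz function, to which \<open>local_error\<close> applies. The number of steps is of order
  \<open>1 / h\<close>, so an error of \<open>h * \<epsilon>\<close> per step is affordable.\<close>

lemma euler_dual_error:
  assumes f: "\<kappa>-lipschitz_on UNIV f" and A: "\<And>x. \<bar>f x\<bar> \<le> A" and h: "h > 0" and R: "R \<ge> 0" and L: "L \<ge> 0"
    and B: "\<And>s x. s \<in> {0..T} \<Longrightarrow> norm (b s (cball_proj R x)) \<le> B"
    and \<omega>: "\<And>r s x. r \<in> {0..T} \<Longrightarrow> s \<in> {0..T} \<Longrightarrow> \<bar>r - s\<bar> \<le> h \<Longrightarrow> norm (b r x - b s x) \<le> \<omega>"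
    and \<eta>: "\<And>r. r \<in> {0..T} \<Longrightarrow> (\<integral>x. excess R x \<partial>\<nu> r) \<le> \<eta>"
    and \<epsilon>: "\<omega> + L * \<eta> + err_const * (1 + B)\<^sup>2 * sqrt h \<le> \<epsilon>" "\<epsilon> \<ge> 0"
  shows "real (k + j) * h \<le> T \<Longrightarrow> \<bar>(\<integral>x. f x \<partial>\<nu> (real (k + j) * h)) - (\<integral>x. euler_dual h R j k f x \<partial>\<nu> (real k * h))\<bar> \<le> real j * (\<kappa> * h * (1 + h * L) ^ j * \<epsilon>)"
proof (induction j arbitrary: k)
  case 0
  then show ?case by simp
next
  case (Suc j)
  let ?F = "euler_dual h R j (Suc k) f"
  have \<kappa>: "\<kappa> \<ge> 0" by (rule lipschitz_on_nonneg[OF f])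
  have hL: "h * L \<ge> 0" using h L by auto
  have F: "(\<kappa> * (1 + h * L) ^ j)-lipschitz_on UNIV ?F" "\<And>x. \<bar>?F x\<bar> \<le> A"
    using euler_dual_lipschitz[OF f A _ R L, of h "Suc k" j] h Suc.prems by auto
  have le: "real (Suc k) * h \<le> real (k + Suc j) * h" using h by (intro mult_right_mono) auto
  have st: "0 \<le> real k * h" "real k * h < real (Suc k) * h" "real (Suc k) * h \<le> T"
    using order_trans[OF le Suc.prems] h by auto
  have d: "real (Suc k) * h - real k * h = h" by (simp add: algebra_simps)
  have 1: "\<bar>(\<integral>x. f x \<partial>\<nu> (real (k + Suc j) * h)) - (\<integral>x. ?F x \<partial>\<nu> (real (Suc k) * h))\<bar> \<le> real j * (\<kappa> * h * (1 + h * L) ^ j * \<epsilon>)"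
    using Suc.IH[of "Suc k"] Suc.prems by simp
  have "\<bar>(\<integral>x. ?F x \<partial>\<nu> (real (Suc k) * h)) - (\<integral>x. S (real (Suc k) * h - real k * h) ?F (x + (real (Suc k) * h - real k * h) *\<^sub>R b (real k * h) (cball_proj R x)) \<partial>\<nu> (real k * h))\<bar>
     \<le> (\<kappa> * (1 + h * L) ^ j) * (real (Suc k) * h - real k * h) * (\<omega> + L * \<eta> + err_const * (1 + B)\<^sup>2 * sqrt (real (Suc k) * h - real k * h))"
  proof (rule local_error[OF F st R])
    have rT: "r \<in> {0..T}" if "r \<in> {real k * h..real (Suc k) * h}" for r
      using that st unfolding atLeastAtMost_iff by linarith
    have kT: "real k * h \<in> {0..T}" by (rule rT) (use st in auto)
    show "norm (b (real k * h) (cball_proj R x)) \<le> B" for x by (rule B[OF kT])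
    show "norm (b r x - b (real k * h) x) \<le> \<omega>" if "r \<in> {real k * h..real (Suc k) * h}" for r x
      by (rule \<omega>[OF rT[OF that] kT]) (use that d in \<open>simp only: atLeastAtMost_iff; linarith\<close>)
    show "(\<integral>x. excess R x \<partial>\<nu> r) \<le> \<eta>" if "r \<in> {real k * h..real (Suc k) * h}" for r
      by (rule \<eta>[OF rT[OF that]])
  qed
  then have "\<bar>(\<integral>x. ?F x \<partial>\<nu> (real (Suc k) * h)) - (\<integral>x. euler_dual h R (Suc j) k f x \<partial>\<nu> (real k * h))\<bar>
     \<le> (\<kappa> * (1 + h * L) ^ j) * h * (\<omega> + L * \<eta> + err_const * (1 + B)\<^sup>2 * sqrt h)"
    unfolding d by simp
  also have "\<dots> \<le> (\<kappa> * (1 + h * L) ^ j) * h * \<epsilon>" using \<epsilon>(1) \<kappa> h hL by (intro mult_left_mono) auto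
  finally have "\<bar>(\<integral>x. f x \<partial>\<nu> (real (k + Suc j) * h)) - (\<integral>x. euler_dual h R (Suc j) k f x \<partial>\<nu> (real k * h))\<bar>
     \<le> real j * (\<kappa> * h * (1 + h * L) ^ j * \<epsilon>) + (\<kappa> * (1 + h * L) ^ j) * h * \<epsilon>" using 1 by linarith
  also have "\<dots> = real (Suc j) * (\<kappa> * h * \<epsilon> * (1 + h * L) ^ j)" by (simp add: algebra_simps)
  also have "\<dots> \<le> real (Suc j) * (\<kappa> * h * \<epsilon> * (1 + h * L) ^ Suc j)"
    using \<kappa> h \<epsilon>(2) hL by (intro mult_left_mono power_increasing) auto
  finally show ?case by (simp only: mult_ac)
qed

text \<open>The radius \<open>n\<^sup>1\<^sup>/\<^sup>8\<close> tends to infinity, but so slowly that the error \<open>(1 + R)\<^sup>2 sqrt h\<close> still vanishes.\<close>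

lemma euler_dual_limit:
  assumes f: "\<kappa>-lipschitz_on UNIV f" and A: "\<And>x. \<bar>f x\<bar> \<le> A" and t: "0 < t" "t \<le> T"
  shows "(\<lambda>n. \<integral>x. euler_dual (t / real n) (real n powr (1/8)) n 0 f x \<partial>\<nu> 0) \<longlonglongrightarrow> (\<integral>x. f x \<partial>\<nu> t)"
proof (rule LIMSEQ_I)
  fix e :: real assume e: "e > 0"
  have tT: "t \<in> {0..T}" using t by auto
  have L: "L \<ge> 0" by (rule L_nonneg[OF tT])
  have \<kappa>: "\<kappa> \<ge> 0" by (rule lipschitz_on_nonneg[OF f])
  \<comment> \<open>\<open>D * \<epsilon>\<close> is the error accumulated over \<open>n\<close>
    steps, by \<open>(1 + h * L) ^ n \<le> exp (L * t)\<close>; \<epsilon> is then shared equally by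
    the time modulus, the tail and the local error.\<close>
  define D where "D = t * \<kappa> * exp (L * t)"
  have D: "D \<ge> 0" unfolding D_def using t \<kappa> by auto
  define \<epsilon> where "\<epsilon> = e / (2 * (D + 1))"
  have \<epsilon>: "\<epsilon> > 0" "D * \<epsilon> < e" unfolding \<epsilon>_def using e D by (auto simp: field_simps intro: add_nonneg_pos)
  have \<epsilon>3: "\<epsilon> / 3 > 0" using \<epsilon>(1) by simp
  obtain d where d: "d > 0" "\<forall>r\<in>{0..T}. \<forall>s\<in>{0..T}. \<bar>r - s\<bar> < d \<longrightarrow> (\<forall>x. norm (b r x - b s x) \<le> \<epsilon> / 3)"
    using reg[unfolded regular_drift_def, THEN conjunct2, THEN spec, THEN mp, OF \<epsilon>3] by (elim exE conjE) (rule that)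
  have "\<epsilon> / (3 * (L + 1)) > 0" using \<epsilon> L by auto
  then obtain R0 where R0: "R0 \<ge> 1" "\<forall>t\<in>{0..T}. (\<integral>x. excess R0 x \<partial>\<nu> t) \<le> \<epsilon> / (3 * (L + 1))"
    using wasserstein_uniformly_integrable[OF wcont] by blast
  define K where "K = err_const"
  define G where "G = growth"
  have ev1: "eventually (\<lambda>n. t / real n < d) sequentially" using t(1) d(1) by real_asymp
  have ev2: "eventually (\<lambda>n. real n powr (1/8) \<ge> R0) sequentially" using R0(1) by real_asymp
  have "(\<lambda>n. (1 + G * (1 + real n powr (1/8)))\<^sup>2 * sqrt (t / real n)) \<longlonglongrightarrow> 0"
  \<comment> \<open>The growth rate of the square changes when \<open>G = 0\<close>, where it is
    constant.\<close>
  proof (cases "G = 0")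
    case True
    have "(\<lambda>n. sqrt (t / real n)) \<longlonglongrightarrow> 0" using t(1) by real_asymp
    then show ?thesis using True by simp
  next
    case False
    then have "G > 0" unfolding G_def using growth(1) by simp
    then show ?thesis using t(1) by real_asymp
  qed
  from tendsto_mult[OF tendsto_const this, of K]
  have "(\<lambda>n. K * (1 + G * (1 + real n powr (1/8)))\<^sup>2 * sqrt (t / real n)) \<longlonglongrightarrow> 0"
    by (simp add: mult.assoc)
  then have ev3: "eventually (\<lambda>n. K * (1 + G * (1 + real n powr (1/8)))\<^sup>2 * sqrt (t / real n) < \<epsilon> / 3) sequentially"
    using \<epsilon>(1) by (intro order_tendstoD(2)[where y = 0]) auto
  have "eventually (\<lambda>n. norm ((\<integral>x. euler_dual (t / real n) (real n powr (1/8)) n 0 f x \<partial>\<nu> 0) - (\<integral>x. f x \<partial>\<nu> t)) < e) sequentially"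
    using ev1 ev2 ev3 eventually_gt_at_top[of 0]
  proof eventually_elim
    case (elim n)
    define h where "h = t / real n"
    define R where "R = real n powr (1/8)"
    have h: "h > 0" "real n * h = t" unfolding h_def using elim t by auto
    have R: "R \<ge> 0" "R \<ge> R0" unfolding R_def using elim by auto
    have "\<bar>(\<integral>x. f x \<partial>\<nu> (real (0 + n) * h)) - (\<integral>x. euler_dual h R n 0 f x \<partial>\<nu> (real 0 * h))\<bar> \<le> real n * (\<kappa> * h * (1 + h * L) ^ n * \<epsilon>)"
    proof (rule euler_dual_error[OF f A h(1) R(1) L])
      show "norm (b s (cball_proj R x)) \<le> G * (1 + R)" if "s \<in> {0..T}" for s x
        using growth(2)[OF that, of "cball_proj R x"] cball_proj_props(1)[OF R(1), of x] growth(1) unfolding G_def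
        by (meson add_left_mono mult_left_mono order_trans)
      show "norm (b r x - b s x) \<le> \<epsilon> / 3" if "r \<in> {0..T}" "s \<in> {0..T}" "\<bar>r - s\<bar> \<le> h" for r s x
        using d(2) that elim(1) unfolding h_def by (meson order_le_less_trans)
      show "(\<integral>x. excess R x \<partial>\<nu> r) \<le> \<epsilon> / (3 * (L + 1))" if r: "r \<in> {0..T}" for r
      proof -
        have "(\<integral>x. excess R x \<partial>\<nu> r) \<le> (\<integral>x. excess R0 x \<partial>\<nu> r)"
          by (intro integral_mono lipschitz_integrable[OF nu_w[OF r] excess_lipschitz]) (use R in \<open>auto simp: excess_def\<close>)
        then show ?thesis using R0(2) r by force
      qed
      have "L * (\<epsilon> / (3 * (L + 1))) \<le> \<epsilon> / 3" using L \<epsilon> by (simp add: field_simps)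
      then show "\<epsilon> / 3 + L * (\<epsilon> / (3 * (L + 1))) + err_const * (1 + G * (1 + R))\<^sup>2 * sqrt h \<le> \<epsilon>"
        using elim(3) unfolding K_def[symmetric] h_def R_def by linarith
    qed (use \<epsilon> h t in auto)
    also have "\<dots> = (t * \<kappa> * \<epsilon>) * (1 + h * L) ^ n" using h(2) by (simp add: mult_ac)
    also have "\<dots> \<le> (t * \<kappa> * \<epsilon>) * exp (L * t)"
    proof (rule mult_left_mono)
      have "(1 + h * L) ^ n \<le> exp (h * L) ^ n" using h L by (intro power_mono exp_ge_add_one_self) auto
      also have "\<dots> = exp (real n * (h * L))" by (rule exp_of_nat_mult[symmetric])
      also have "real n * (h * L) = L * t" unfolding h(2)[symmetric] by (simp add: mult_ac)
      finally show "(1 + h * L) ^ n \<le> exp (L * t)" .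
    qed (use t \<kappa> \<epsilon> in auto)
    also have "\<dots> = D * \<epsilon>" unfolding D_def by (simp add: mult_ac)
    finally have "\<bar>(\<integral>x. f x \<partial>\<nu> t) - (\<integral>x. euler_dual h R n 0 f x \<partial>\<nu> 0)\<bar> < e" using h(2) \<epsilon>(2) by simp
    then show ?case unfolding h_def R_def by (simp add: abs_minus_commute)
  qed
  then show "\<exists>no. \<forall>n\<ge>no. norm ((\<integral>x. euler_dual (t / real n) (real n powr (1/8)) n 0 f x \<partial>\<nu> 0) - (\<integral>x. f x \<partial>\<nu> t)) < e"
    unfolding eventually_sequentially .
qed

end

section \<open>The Euler scheme and weak solutions\<close>

text \<open>A deterministic recursion along an arbitrary path \<open>w\<close>, so that the same
  object can be studied for one fixed \<omega> and as a random variable.\<close>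

primrec euler_path :: "(real \<Rightarrow> 'a::euclidean_space \<Rightarrow> 'a) \<Rightarrow> real \<Rightarrow> real \<Rightarrow> real \<Rightarrow> 'a \<Rightarrow> (real \<Rightarrow> 'a) \<Rightarrow> nat \<Rightarrow> 'a" where
  "euler_path b c h R x w 0 = x"
| "euler_path b c h R x w (Suc k) = euler_path b c h R x w k + h *\<^sub>R b (real k * h) (cball_proj R (euler_path b c h R x w k))
     + c *\<^sub>R (w (real (Suc k) * h) - w (real k * h))"

section \<open>Brownian increments and adaptedness of the scheme\<close>

locale brownian = prob_space M for M :: "'w measure" +
  fixes F :: "real \<Rightarrow> 'w measure" and W :: "real \<Rightarrow> 'w \<Rightarrow> 'a::euclidean_space" and T :: real
  assumes T_pos: "T > 0" and filt: "filtration_on {0..T} M F" and bm: "brownian_motion_on {0..T} M F W"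
begin

lemma subalg: "t \<in> {0..T} \<Longrightarrow> subalgebra M (F t)"
  using filt unfolding filtration_on_def by auto

lemma F_mono: "s \<in> {0..T} \<Longrightarrow> t \<in> {0..T} \<Longrightarrow> s \<le> t \<Longrightarrow> f \<in> borel_measurable (F s) \<Longrightarrow> f \<in> borel_measurable (F t)"
  using filt unfolding filtration_on_def by (blast intro: measurable_from_subalg)

lemma F_M: "t \<in> {0..T} \<Longrightarrow> f \<in> borel_measurable (F t) \<Longrightarrow> f \<in> borel_measurable M"
  using subalg by (blast intro: measurable_from_subalg)

lemma W_F: "t \<in> {0..T} \<Longrightarrow> W t \<in> borel_measurable (F t)"
  using bm unfolding brownian_motion_on_def by auto

lemma W_M: "t \<in> {0..T} \<Longrightarrow> W t \<in> borel_measurable M"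
  using W_F F_M by blast

lemma increment_distr:
  assumes st: "s \<in> {0..T}" "t \<in> {0..T}" "s < t"
  shows "distr M borel (\<lambda>\<omega>. W t \<omega> - W s \<omega>) = distr std_gauss borel (\<lambda>z. sqrt (t - s) *\<^sub>R z)"
proof -
  have d: "distributed M lborel (\<lambda>\<omega>. W t \<omega> - W s \<omega>) (\<lambda>x. \<Prod>b\<in>Basis. ennreal (normal_density 0 (sqrt (t - s)) (x \<bullet> b)))"
    using bm st unfolding brownian_motion_on_def by blast
  have "distr M borel (\<lambda>\<omega>. W t \<omega> - W s \<omega>) = distr M lborel (\<lambda>\<omega>. W t \<omega> - W s \<omega>)" by (rule distr_cong) auto
  also have "\<dots> = density lborel (\<lambda>x. \<Prod>b\<in>Basis. ennreal (normal_density 0 (sqrt (t - s)) (x \<bullet> b)))"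
    by (rule distributed_distr_eq_density[OF d])
  also have "\<dots> = density lborel (\<lambda>x. ennreal (gauss_dens (sqrt (t - s)) x))"
    unfolding gauss_dens_def by (simp add: prod_ennreal)
  also have "\<dots> = distr std_gauss borel (\<lambda>z. sqrt (t - s) *\<^sub>R z)"
    using st by (subst distr_std_gauss_scale) auto
  finally show ?thesis .
qed

lemma increment_indep:
  assumes st: "s \<in> {0..T}" "t \<in> {0..T}" "s < t" and A: "A \<in> borel_measurable (F s)"
  shows "indep_var borel A borel (\<lambda>\<omega>. W t \<omega> - W s \<omega>)"
  unfolding indep_var_eq
proof (intro conjI)
  let ?D = "\<lambda>\<omega>. W t \<omega> - W s \<omega>"
  show AM: "random_variable borel A" by (rule F_M[OF st(1) A])
  show DM: "random_variable borel ?D" using W_M st by measurable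
  have i: "indep_set (sets (F s)) (sets (vimage_algebra (space M) ?D borel))"
    using bm st unfolding brownian_motion_on_def by blast
  have sp: "space (F s) = space M" using subalg[OF st(1)] unfolding subalgebra_def by auto
  have 1: "sigma_sets (space M) {A -` B \<inter> space M |B. B \<in> sets borel} \<subseteq> sets (F s)"
  proof -
    have "{A -` B \<inter> space M |B. B \<in> sets borel} \<subseteq> sets (F s)"
      using measurable_sets[OF A] unfolding sp by auto
    then show ?thesis using sets.sigma_sets_subset[of _ "F s"] unfolding sp by blast
  qed
  have 2: "sigma_sets (space M) {?D -` B \<inter> space M |B. B \<in> sets borel} \<subseteq> sets (vimage_algebra (space M) ?D borel)"
    unfolding sets_vimage_algebra by (auto intro!: sigma_sets_mono')
  show "indep_set (sigma_sets (space M) {A -` B \<inter> space M |B. B \<in> sets borel}) (sigma_sets (space M) {?D -` B \<inter> space M |B. B \<in> sets borel})"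
    using i unfolding indep_set_def
    by (rule indep_sets_mono_sets) (use 1 2 in \<open>auto split: bool.split\<close>)
qed

text \<open>Independence makes the joint law of \<open>A\<close> and the increment a product, and
  the inner Gaussian integral is the heat flow. Independence of the increments is used here and
  nowhere else.\<close>

lemma brownian_step:
  fixes f :: "'a \<Rightarrow> real"
  assumes st: "s \<in> {0..T}" "t \<in> {0..T}" "s < t" and A: "A \<in> borel_measurable (F s)"
    and f[measurable]: "f \<in> borel_measurable borel" and C: "\<And>x. \<bar>f x\<bar> \<le> C"
  shows "(\<integral>\<omega>. f (A \<omega> + c *\<^sub>R (W t \<omega> - W s \<omega>)) \<partial>M) = (\<integral>\<omega>. heat (c * sqrt (t - s)) f (A \<omega>) \<partial>M)"
proof -
  let ?D = "\<lambda>\<omega>. W t \<omega> - W s \<omega>"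
  have AM[measurable]: "A \<in> borel_measurable M" by (rule F_M[OF st(1) A])
  have DM[measurable]: "?D \<in> borel_measurable M" using W_M st by measurable
  have id: "distr M borel A \<Otimes>\<^sub>M distr M borel ?D = distr M (borel \<Otimes>\<^sub>M borel) (\<lambda>x. (A x, ?D x))"
    using increment_indep[OF st A] unfolding indep_var_distribution_eq by auto
  interpret PA: prob_space "distr M borel A" by (rule prob_space_distr) simp
  interpret PD: prob_space "distr M borel ?D" by (rule prob_space_distr) simp
  interpret PP: pair_prob_space "distr M borel A" "distr M borel ?D" ..
  have m: "(\<lambda>p. f (fst p + c *\<^sub>R snd p)) \<in> borel_measurable (borel \<Otimes>\<^sub>M borel)" by measurable
  have "(\<integral>\<omega>. f (A \<omega> + c *\<^sub>R ?D \<omega>) \<partial>M) = (\<integral>p. f (fst p + c *\<^sub>R snd p) \<partial>distr M (borel \<Otimes>\<^sub>M borel) (\<lambda>x. (A x, ?D x)))"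
    by (subst integral_distr) (auto simp: m)
  also have "\<dots> = (\<integral>p. f (fst p + c *\<^sub>R snd p) \<partial>(distr M borel A \<Otimes>\<^sub>M distr M borel ?D))" unfolding id ..
  also have "\<dots> = (\<integral>a. (\<integral>d. f (a + c *\<^sub>R d) \<partial>distr M borel ?D) \<partial>distr M borel A)"
  proof -
    have "integrable (distr M borel A \<Otimes>\<^sub>M distr M borel ?D) (\<lambda>(a, d). f (a + c *\<^sub>R d))"
      by (rule PP.integrable_const_bound[of _ C]) (use C in \<open>auto simp: split_beta'\<close>)
    from PP.integral_fst'[OF this] show ?thesis by (simp add: split_beta')
  qed
  also have "\<dots> = (\<integral>a. heat (c * sqrt (t - s)) f a \<partial>distr M borel A)"
    unfolding increment_distr[OF st] heat_def by (subst integral_distr) auto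
  also have "\<dots> = (\<integral>\<omega>. heat (c * sqrt (t - s)) f (A \<omega>) \<partial>M)"
  proof (rule integral_distr)
    show "heat (c * sqrt (t - s)) f \<in> borel_measurable borel"
    proof -
      have "(\<lambda>p::'a \<times> 'a. f (fst p + (c * sqrt (t - s)) *\<^sub>R snd p)) \<in> borel_measurable (borel \<Otimes>\<^sub>M std_gauss)" by measurable
      then have "(\<lambda>x. \<integral>z. f (x + (c * sqrt (t - s)) *\<^sub>R z) \<partial>std_gauss) \<in> borel_measurable borel"
        by (intro std_gauss.borel_measurable_lebesgue_integral) (simp add: split_beta')
      then show ?thesis unfolding heat_def[abs_def] .
    qed
  qed simp
  finally show ?thesis .
qed

lemma increment_norm:
  assumes st: "s \<in> {0..T}" "t \<in> {0..T}" "s \<le> t"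
  shows "(\<integral>\<^sup>+\<omega>. ennreal (norm (W t \<omega> - W s \<omega>)) \<partial>M) = ennreal (sqrt (t - s) * (\<integral>z. norm z \<partial>(std_gauss::'a measure)))"
proof (cases "s = t")
  case False
  then have l: "s < t" using st by auto
  have DM[measurable]: "(\<lambda>\<omega>. W t \<omega> - W s \<omega>) \<in> borel_measurable M" using W_M st by measurable
  have n: "integrable (std_gauss::'a measure) norm" using std_gauss_norm_power[of 1] by simp
  have "(\<integral>\<^sup>+\<omega>. ennreal (norm (W t \<omega> - W s \<omega>)) \<partial>M) = (\<integral>\<^sup>+x. ennreal (norm x) \<partial>distr M borel (\<lambda>\<omega>. W t \<omega> - W s \<omega>))"
    by (subst nn_integral_distr) auto
  also have "\<dots> = (\<integral>\<^sup>+z. ennreal (norm (sqrt (t - s) *\<^sub>R z)) \<partial>(std_gauss::'a measure))"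
    unfolding increment_distr[OF st(1,2) l] by (subst nn_integral_distr) auto
  also have "\<dots> = ennreal (\<integral>z. norm (sqrt (t - s) *\<^sub>R z) \<partial>(std_gauss::'a measure))"
    by (rule nn_integral_eq_integral) (use n in auto)
  also have "(\<integral>z. norm (sqrt (t - s) *\<^sub>R z) \<partial>(std_gauss::'a measure)) = sqrt (t - s) * (\<integral>z. norm z \<partial>(std_gauss::'a measure))"
    using l by simp
  finally show ?thesis .
qed simp

text \<open>Adaptedness and not just measurability, because \<open>brownian_step\<close> requires
  the present position to be independent of the next increment.\<close>

lemma euler_measurable:
  assumes b: "\<And>t. t \<in> {0..T} \<Longrightarrow> L-lipschitz_on UNIV (b t)" and R: "R \<ge> 0" and h: "h > 0"
    and X0: "X0 \<in> borel_measurable (F 0)"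
  shows "real k * h \<le> T \<Longrightarrow> (\<lambda>\<omega>. euler_path b c h R (X0 \<omega>) (\<lambda>t. W t \<omega>) k) \<in> borel_measurable (F (real k * h))"
proof (induction k)
  case 0
  then show ?case using X0 by simp
next
  case (Suc k)
  have le: "real k * h \<le> real (Suc k) * h" using h by (intro mult_right_mono) auto
  then have k: "real k * h \<in> {0..T}" "real (Suc k) * h \<in> {0..T}"
    using order_trans[OF le Suc.prems] Suc.prems h by auto
  have cl: "1-lipschitz_on UNIV (cball_proj R)"
    using cball_proj_props(3)[of R] R by (intro lipschitz_onI) auto
  have [measurable]: "cball_proj R \<in> borel_measurable borel" by (rule lipschitz_measurable[OF cl])
  have [measurable]: "b (real k * h) \<in> borel_measurable borel" by (rule lipschitz_measurable[OF b[OF k(1)]])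
  have [measurable]: "(\<lambda>\<omega>. euler_path b c h R (X0 \<omega>) (\<lambda>t. W t \<omega>) k) \<in> borel_measurable (F (real (Suc k) * h))"
    by (rule F_mono[OF k le Suc.IH]) (use k in auto)
  have [measurable]: "W (real k * h) \<in> borel_measurable (F (real (Suc k) * h))" by (rule F_mono[OF k le W_F[OF k(1)]])
  have [measurable]: "W (real (Suc k) * h) \<in> borel_measurable (F (real (Suc k) * h))" by (rule W_F[OF k(2)])
  show ?case unfolding euler_path.simps by measurable
qed

end

locale euler_scheme = drift_measure T \<sigma> L b \<nu> + brownian M F W T
  for T \<sigma> L :: real and b :: "real \<Rightarrow> 'a::euclidean_space \<Rightarrow> 'a" and \<nu> and M :: "'w measure" and F
    and W :: "real \<Rightarrow> 'w \<Rightarrow> 'a" +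
  fixes X0 :: "'w \<Rightarrow> 'a"
  assumes X0: "X0 \<in> borel_measurable (F 0)"
begin

definition "euler_rv h R k \<omega> = euler_path b c h R (X0 \<omega>) (\<lambda>t. W t \<omega>) k"

lemma euler_rv_F: "R \<ge> 0 \<Longrightarrow> h > 0 \<Longrightarrow> real k * h \<le> T \<Longrightarrow> euler_rv h R k \<in> borel_measurable (F (real k * h))"
  unfolding euler_rv_def[abs_def] by (rule euler_measurable[OF b_lip _ _ X0])

lemma euler_rv_M: "R \<ge> 0 \<Longrightarrow> h > 0 \<Longrightarrow> real k * h \<le> T \<Longrightarrow> euler_rv h R k \<in> borel_measurable M"
  by (rule F_M[OF _ euler_rv_F]) auto

end

text \<open>The competitor \<nu> comes without a process. It is placed beside the given
  \<open>W\<close> and \<open>X0\<close>, with which it shares the initial law, so that a process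
  for it can be built there.\<close>

locale fp_brownian = fp_solution T \<sigma> L b \<nu> + euler_scheme T \<sigma> L b \<nu> M F W X0
  for T \<sigma> L :: real and b :: "real \<Rightarrow> 'a::euclidean_space \<Rightarrow> 'a" and \<nu> and M :: "'w measure" and F W X0 +
  assumes nu0: "\<nu> 0 = distr M borel X0"
begin

text \<open>Duality of the forward scheme and the backward recursion: the first of the remaining
  steps is integrated out by \<open>brownian_step\<close>, and the induction runs over the steps
  still to come, with \<open>k\<close> free.\<close>

lemma euler_rv_expectation:
  assumes f: "\<kappa>-lipschitz_on UNIV f" and A: "\<And>x. \<bar>f x\<bar> \<le> A" and h: "h > 0" and R: "R \<ge> 0"
  shows "real (k + j) * h \<le> T \<Longrightarrow> (\<integral>\<omega>. f (euler_rv h R (k + j) \<omega>) \<partial>M) = (\<integral>\<omega>. euler_dual h R j k f (euler_rv h R k \<omega>) \<partial>M)"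
proof (induction j arbitrary: k)
  case 0
  then show ?case by simp
next
  case (Suc j)
  have L: "L \<ge> 0" using L_nonneg[of 0] T_pos by auto
  let ?F = "euler_dual h R j (Suc k) f"
  have F: "(\<kappa> * (1 + h * L) ^ j)-lipschitz_on UNIV ?F" "\<And>x. \<bar>?F x\<bar> \<le> A"
    using euler_dual_lipschitz[OF f A _ R L, of h "Suc k" j] h Suc.prems by auto
  have Fm: "?F \<in> borel_measurable borel" by (rule lipschitz_measurable[OF F(1)])
  have le: "real k * h < real (Suc k) * h" "real (Suc k) * h \<le> real (k + Suc j) * h"
    using h by (auto intro!: mult_right_mono)
  have k: "real k * h \<in> {0..T}" "real (Suc k) * h \<in> {0..T}"
    using order_trans[OF less_imp_le[OF le(1)] order_trans[OF le(2) Suc.prems]] order_trans[OF le(2) Suc.prems] h by auto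
  have cl: "1-lipschitz_on UNIV (cball_proj R)"
    using cball_proj_props(3)[of R] R by (intro lipschitz_onI) auto
  have [measurable]: "cball_proj R \<in> borel_measurable borel" by (rule lipschitz_measurable[OF cl])
  have [measurable]: "b (real k * h) \<in> borel_measurable borel" by (rule b_measurable[OF k(1)])
  have [measurable]: "euler_rv h R k \<in> borel_measurable (F (real k * h))" by (rule euler_rv_F[OF R h]) (use k in auto)
  have Am: "(\<lambda>\<omega>. euler_rv h R k \<omega> + h *\<^sub>R b (real k * h) (cball_proj R (euler_rv h R k \<omega>))) \<in> borel_measurable (F (real k * h))"
    by measurable
  have d: "real (Suc k) * h - real k * h = h" by (simp add: algebra_simps)
  have "(\<integral>\<omega>. f (euler_rv h R (k + Suc j) \<omega>) \<partial>M) = (\<integral>\<omega>. ?F (euler_rv h R (Suc k) \<omega>) \<partial>M)"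
    using Suc.IH[of "Suc k"] Suc.prems by simp
  also have "\<dots> = (\<integral>\<omega>. ?F ((euler_rv h R k \<omega> + h *\<^sub>R b (real k * h) (cball_proj R (euler_rv h R k \<omega>))) + c *\<^sub>R (W (real (Suc k) * h) \<omega> - W (real k * h) \<omega>)) \<partial>M)"
    unfolding euler_rv_def euler_path.simps ..
  also have "\<dots> = (\<integral>\<omega>. heat (c * sqrt (real (Suc k) * h - real k * h)) ?F (euler_rv h R k \<omega> + h *\<^sub>R b (real k * h) (cball_proj R (euler_rv h R k \<omega>))) \<partial>M)"
    by (rule brownian_step[OF k le(1) Am Fm F(2)])
  also have "\<dots> = (\<integral>\<omega>. euler_dual h R (Suc j) k f (euler_rv h R k \<omega>) \<partial>M)"
    unfolding d S_def[symmetric] by simp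
  finally show ?case .
qed

lemma euler_rv_limit:
  fixes f :: "'a \<Rightarrow> real"
  assumes f: "\<kappa>-lipschitz_on UNIV f" and A: "\<And>x. \<bar>f x\<bar> \<le> A" and t: "0 < t" "t \<le> T"
  shows "(\<lambda>n. \<integral>\<omega>. f (euler_rv (t / real n) (real n powr (1/8)) n \<omega>) \<partial>M) \<longlonglongrightarrow> (\<integral>x. f x \<partial>\<nu> t)"
proof (rule Lim_transform_eventually[OF euler_dual_limit[OF f A t]])
  have L: "L \<ge> 0" using L_nonneg[of 0] T_pos by auto
  have X0M: "X0 \<in> borel_measurable M" by (rule F_M[OF _ X0]) (use T_pos in auto)
  show "\<forall>\<^sub>F n in sequentially. (\<integral>x. euler_dual (t / real n) (real n powr (1/8)) n 0 f x \<partial>\<nu> 0) = (\<integral>\<omega>. f (euler_rv (t / real n) (real n powr (1/8)) n \<omega>) \<partial>M)"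
    using eventually_gt_at_top[of 0]
  proof eventually_elim
    case (elim n)
    let ?h = "t / real n" and ?R = "real n powr (1/8)"
    have h: "?h > 0" "real (0 + n) * ?h \<le> T" using elim t by auto
    have F: "(\<kappa> * (1 + ?h * L) ^ n)-lipschitz_on UNIV (euler_dual ?h ?R n 0 f)"
      using euler_dual_lipschitz[OF f A _ _ L, of ?h ?R 0 n] h by auto
    have Fm: "euler_dual ?h ?R n 0 f \<in> borel_measurable borel" by (rule lipschitz_measurable[OF F])
    have "(\<integral>\<omega>. f (euler_rv ?h ?R n \<omega>) \<partial>M) = (\<integral>\<omega>. euler_dual ?h ?R n 0 f (X0 \<omega>) \<partial>M)"
      using euler_rv_expectation[OF f A h(1) _ h(2), of ?R] by (simp add: euler_rv_def)
    also have "\<dots> = (\<integral>x. euler_dual ?h ?R n 0 f x \<partial>\<nu> 0)"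
      unfolding nu0 by (rule integral_distr[symmetric, OF X0M Fm])
    finally show ?case by simp
  qed
qed

end

section \<open>Pathwise convergence of the Euler scheme\<close>

lemma discrete_gronwall:
  fixes d e :: "nat \<Rightarrow> real"
  assumes "\<And>k. k < n \<Longrightarrow> d (Suc k) \<le> (1 + a) * d k + e k" and "a \<ge> 0" "\<And>k. e k \<ge> 0" "d 0 \<ge> 0"
  shows "k \<le> n \<Longrightarrow> d k \<le> exp (real k * a) * (d 0 + (\<Sum>j<k. e j))"
proof (induction k)
  case (Suc k)
  have s: "0 \<le> d 0 + (\<Sum>j<k. e j)" using assms by (auto intro!: add_nonneg_nonneg sum_nonneg)
  have "d (Suc k) \<le> (1 + a) * d k + e k" using assms(1) Suc.prems by auto
  also have "\<dots> \<le> exp a * (exp (real k * a) * (d 0 + (\<Sum>j<k. e j))) + exp (real (Suc k) * a) * e k"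
  proof (rule add_mono)
    have "(1 + a) * d k \<le> (1 + a) * (exp (real k * a) * (d 0 + (\<Sum>j<k. e j)))"
      using Suc assms(2) by (intro mult_left_mono) auto
    also have "\<dots> \<le> exp a * (exp (real k * a) * (d 0 + (\<Sum>j<k. e j)))"
      by (intro mult_right_mono exp_ge_add_one_self mult_nonneg_nonneg s) simp
    finally show "(1 + a) * d k \<le> exp a * (exp (real k * a) * (d 0 + (\<Sum>j<k. e j)))" .
    have "1 \<le> exp (real (Suc k) * a)" using assms(2) by simp
    from mult_right_mono[OF this assms(3)] show "e k \<le> exp (real (Suc k) * a) * e k" by simp
  qed
  also have "\<dots> = exp (real (Suc k) * a) * (d 0 + (\<Sum>j<Suc k. e j))"
  proof -
    have "exp (real (Suc k) * a) = exp a * exp (real k * a)" by (simp add: exp_add[symmetric] distrib_right)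
    then show ?thesis by (simp add: distrib_left add.assoc mult_ac)
  qed
  finally show ?case .
qed simp

text \<open>Two sequences are compared by how far they miss the same recursion; a common noise is
  contained in both defects and cancels. The tolerance may depend on the step, so that an error
  present only late costs only its share of the time.\<close>

lemma euler_stability_sum:
  fixes a a' :: "nat \<Rightarrow> 'a::euclidean_space"
  assumes b: "\<And>k. k < n \<Longrightarrow> L-lipschitz_on UNIV (\<beta> k)" and h: "h \<ge> 0" and L: "L \<ge> 0" and \<epsilon>: "\<And>k. \<epsilon> k \<ge> 0"
    and d: "\<And>k. k < n \<Longrightarrow> norm ((a (Suc k) - a k - h *\<^sub>R \<beta> k (a k)) - (a' (Suc k) - a' k - h *\<^sub>R \<beta> k (a' k))) \<le> h * \<epsilon> k"
    and 0: "a 0 = a' 0" and T: "real n * h \<le> T" and k: "k \<le> n"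
  shows "norm (a k - a' k) \<le> exp (L * T) * (\<Sum>j<k. h * \<epsilon> j)"
proof -
  have kT: "real k * h \<le> T" using mult_right_mono[of "real k" "real n" h] k h T by simp
  have "norm (a k - a' k) \<le> exp (real k * (h * L)) * (norm (a 0 - a' 0) + (\<Sum>j<k. h * \<epsilon> j))"
  proof (rule discrete_gronwall[where n = n and d = "\<lambda>k. norm (a k - a' k)"])
    fix k assume k: "k < n"
    have eq: "a (Suc k) - a' (Suc k) = (a k - a' k) + h *\<^sub>R (\<beta> k (a k) - \<beta> k (a' k)) + ((a (Suc k) - a k - h *\<^sub>R \<beta> k (a k)) - (a' (Suc k) - a' k - h *\<^sub>R \<beta> k (a' k)))"
      by (simp add: scaleR_diff_right)
    have "norm (a (Suc k) - a' (Suc k)) \<le> norm (a k - a' k) + norm (h *\<^sub>R (\<beta> k (a k) - \<beta> k (a' k))) + h * \<epsilon> k"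
      unfolding eq by (intro norm_triangle_le add_mono norm_triangle_ineq d[OF k])
    also have "norm (h *\<^sub>R (\<beta> k (a k) - \<beta> k (a' k))) \<le> h * (L * norm (a k - a' k))"
      using lipschitz_onD[OF b[OF k], of "a k" "a' k"] h by (auto simp: dist_norm intro!: mult_left_mono)
    finally show "norm (a (Suc k) - a' (Suc k)) \<le> (1 + h * L) * norm (a k - a' k) + h * \<epsilon> k"
      by (simp add: algebra_simps)
  qed (use h L \<epsilon> k in auto)
  also have "\<dots> \<le> exp (L * T) * (\<Sum>j<k. h * \<epsilon> j)"
  proof -
    have "(real k * h) * L \<le> T * L" by (rule mult_right_mono[OF kT L])
    then have "exp (real k * (h * L)) \<le> exp (L * T)" by (simp add: mult_ac)
    then show ?thesis using 0 h \<epsilon> by (auto intro!: mult_right_mono sum_nonneg)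
  qed
  finally show ?thesis .
qed

lemma euler_stability:
  fixes a a' :: "nat \<Rightarrow> 'a::euclidean_space"
  assumes b: "\<And>k. k < n \<Longrightarrow> L-lipschitz_on UNIV (\<beta> k)" and h: "h \<ge> 0" and L: "L \<ge> 0" and \<epsilon>: "\<epsilon> \<ge> 0"
    and d: "\<And>k. k < n \<Longrightarrow> norm ((a (Suc k) - a k - h *\<^sub>R \<beta> k (a k)) - (a' (Suc k) - a' k - h *\<^sub>R \<beta> k (a' k))) \<le> h * \<epsilon>"
    and 0: "a 0 = a' 0" and T: "real n * h \<le> T" and k: "k \<le> n"
  shows "norm (a k - a' k) \<le> exp (L * T) * (T * \<epsilon>)"
proof -
  have kT: "real k * h \<le> T" using mult_right_mono[of "real k" "real n" h] k h T by simp
  have "norm (a k - a' k) \<le> exp (L * T) * (\<Sum>j<k. h * \<epsilon>)"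
    by (rule euler_stability_sum[OF b h L \<epsilon> d 0 T k])
  also have "(\<Sum>j<k. h * \<epsilon>) = (real k * h) * \<epsilon>" by simp
  also have "exp (L * T) * \<dots> \<le> exp (L * T) * (T * \<epsilon>)"
    using kT \<epsilon> by (intro mult_left_mono mult_right_mono) auto
  finally show ?thesis .
qed

lemma grid_le: "j \<le> k \<Longrightarrow> 0 \<le> h \<Longrightarrow> real k * h \<le> T \<Longrightarrow> real j * h \<le> T"
  by (rule order_trans[OF mult_right_mono]) auto

text \<open>One sample path: \<open>w\<close> is any continuous function, and all thresholds below
  may depend on it. Almost sure statements follow by interpreting the locale for a fixed
  \<omega>.\<close>

locale euler_analysis =
  fixes T L C :: real and b :: "real \<Rightarrow> 'a::euclidean_space \<Rightarrow> 'a" and c :: real and w :: "real \<Rightarrow> 'a" and x0 :: 'a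
  assumes T: "T > 0" and reg: "regular_drift T L b" and C: "C \<ge> 0" "\<And>t x. t \<in> {0..T} \<Longrightarrow> norm (b t x) \<le> C * (1 + norm x)"
    and w: "continuous_on {0..T} w"
begin

lemma b_lip: "t \<in> {0..T} \<Longrightarrow> L-lipschitz_on UNIV (b t)"
  using reg unfolding regular_drift_def by auto

lemma L_nonneg: "L \<ge> 0"
  using lipschitz_on_nonneg[OF b_lip[of 0]] T by auto

definition "wb = (SOME B. B \<ge> 0 \<and> (\<forall>t\<in>{0..T}. norm (c *\<^sub>R (w t - w 0)) \<le> B))"

lemma wb: "wb \<ge> 0" "t \<in> {0..T} \<Longrightarrow> norm (c *\<^sub>R (w t - w 0)) \<le> wb"
proof -
  have "compact ((\<lambda>t. c *\<^sub>R (w t - w 0)) ` {0..T})"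
    by (intro compact_continuous_image continuous_intros w) auto
  then obtain B where B: "\<And>t. t \<in> {0..T} \<Longrightarrow> norm (c *\<^sub>R (w t - w 0)) \<le> B"
    using compact_imp_bounded bounded_iff by (metis (no_types, lifting) imageI)
  have "\<exists>B. B \<ge> 0 \<and> (\<forall>t\<in>{0..T}. norm (c *\<^sub>R (w t - w 0)) \<le> B)"
    using B by (intro exI[of _ "max B 0"]) (auto simp: le_max_iff_disj)
  from someI_ex[OF this] show "wb \<ge> 0" "t \<in> {0..T} \<Longrightarrow> norm (c *\<^sub>R (w t - w 0)) \<le> wb"
    unfolding wb_def[symmetric] by auto
qed

text \<open>An a priori bound for the scheme that depends neither on the step size nor on
  \<open>R\<close>. Hence the projection is inactive as soon as \<open>R \<ge> pb\<close>.\<close>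

definition "pb = exp (C * T) * (1 + wb + norm x0)"

lemma pb_nonneg: "pb \<ge> 0" unfolding pb_def using wb(1) by auto

abbreviation "e h R k \<equiv> euler_path b c h R x0 w k"

lemma euler_bound:
  assumes h: "h > 0" and R: "R \<ge> 0" and k: "real k * h \<le> T"
  shows "norm (e h R k) \<le> pb"
proof -
  \<comment> \<open>Subtracting the noise leaves a sequence whose increments are \<open>h\<close>
    times the drift, so that Gronwall's inequality applies although \<open>w\<close> may have
    unbounded variation.\<close>
  define y where "y k = e h R k - c *\<^sub>R (w (real k * h) - w 0)" for k
  have le: "real j * h \<le> T" if "j \<le> k" for j
    by (rule grid_le[OF that _ k]) (use h in simp)
  have ey: "norm (e h R j) \<le> norm (y j) + wb" if "j \<le> k" for j
  proof -
    have "e h R j = y j + c *\<^sub>R (w (real j * h) - w 0)" unfolding y_def by simp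
    then show ?thesis using wb(2)[of "real j * h"] le[OF that] h norm_triangle_ineq[of "y j" "c *\<^sub>R (w (real j * h) - w 0)"] by auto
  qed
  \<comment> \<open>Adding \<open>1 + wb\<close> makes the linear growth bound homogeneous.\<close>
  have "1 + wb + norm (y k) \<le> exp (real k * (h * C)) * (1 + wb + norm (y 0) + (\<Sum>j<k. 0))"
  proof (rule discrete_gronwall[where n = k and d = "\<lambda>k. 1 + wb + norm (y k)"])
    fix j assume j: "j < k"
    have jT: "real j * h \<in> {0..T}" using le[of j] j h by auto
    have cl: "norm (cball_proj R (e h R j)) \<le> norm (e h R j)"
    proof (cases "norm (e h R j) \<le> R")
      case True
      then show ?thesis by (simp add: cball_proj_props(2)[OF R True])
    next
      case False
      then show ?thesis using cball_proj_props(1)[OF R, of "e h R j"] by linarith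
    qed
    have "y (Suc j) = y j + h *\<^sub>R b (real j * h) (cball_proj R (e h R j))"
      unfolding y_def by (simp add: scaleR_diff_right)
    then have "norm (y (Suc j)) \<le> norm (y j) + norm (h *\<^sub>R b (real j * h) (cball_proj R (e h R j)))"
      by (metis norm_triangle_ineq)
    also have "norm (h *\<^sub>R b (real j * h) (cball_proj R (e h R j))) = h * norm (b (real j * h) (cball_proj R (e h R j)))" using h by simp
    also have "norm (b (real j * h) (cball_proj R (e h R j))) \<le> C * (1 + norm (cball_proj R (e h R j)))" by (rule C(2)[OF jT])
    also have "\<dots> \<le> C * (1 + (norm (y j) + wb))" using cl ey[of j] j C(1) by (intro mult_left_mono) auto
    finally have "norm (y (Suc j)) \<le> norm (y j) + h * (C * (1 + (norm (y j) + wb)))" using h by simp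
    then show "1 + wb + norm (y (Suc j)) \<le> (1 + h * C) * (1 + wb + norm (y j)) + 0" by (simp add: algebra_simps)
  qed (use h C(1) wb(1) in auto)
  also have "\<dots> \<le> exp (C * T) * (1 + wb + norm x0)"
  proof -
    have "(real k * h) * C \<le> T * C" by (rule mult_right_mono[OF k C(1)])
    then have "exp (real k * (h * C)) \<le> exp (C * T)" by (simp add: mult_ac)
    then show ?thesis unfolding y_def using wb(1) by (auto intro!: mult_right_mono)
  qed
  finally show ?thesis using ey[of k] unfolding pb_def by linarith
qed

lemma euler_unclamped:
  assumes h: "h > 0" and R: "R \<ge> pb" and k: "real k * h \<le> T"
  shows "e h R (Suc k) = e h R k + h *\<^sub>R b (real k * h) (e h R k) + c *\<^sub>R (w (real (Suc k) * h) - w (real k * h))"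
proof -
  have "R \<ge> 0" using R pb_nonneg by linarith
  then have "cball_proj R (e h R k) = e h R k" using cball_proj_props(2)[of R "e h R k"] euler_bound[OF h _ k] R by (meson order_trans)
  then show ?thesis by simp
qed

lemma drift_modulus:
  assumes "\<epsilon> > 0"
  shows "\<exists>d>0. \<forall>r\<in>{0..T}. \<forall>s\<in>{0..T}. \<bar>r - s\<bar> \<le> d \<longrightarrow> (\<forall>x. norm (b r x - b s x) \<le> \<epsilon>)"
proof -
  obtain d where d: "d > 0" "\<forall>r\<in>{0..T}. \<forall>s\<in>{0..T}. \<bar>r - s\<bar> < d \<longrightarrow> (\<forall>x. norm (b r x - b s x) \<le> \<epsilon>)"
    using reg[unfolded regular_drift_def, THEN conjunct2, THEN spec, THEN mp, OF assms] by (elim exE conjE) (rule that)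
  show ?thesis
    by (rule exI[of _ "d / 2"]) (use d in auto)
qed

lemma path_modulus:
  fixes X :: "real \<Rightarrow> 'a"
  assumes "\<epsilon> > 0" "continuous_on {0..T} X"
  shows "\<exists>d>0. \<forall>r\<in>{0..T}. \<forall>s\<in>{0..T}. \<bar>r - s\<bar> \<le> d \<longrightarrow> norm (X r - X s) \<le> \<epsilon>"
proof -
  have "uniformly_continuous_on {0..T} X" using assms(2) by (intro compact_uniformly_continuous) auto
  then obtain d where d: "d > 0" "\<forall>s\<in>{0..T}. \<forall>r\<in>{0..T}. dist r s < d \<longrightarrow> dist (X r) (X s) < \<epsilon>"
    unfolding uniformly_continuous_on_def using assms(1) by blast
  show ?thesis
    by (rule exI[of _ "d / 2"]) (use d in \<open>auto simp: dist_real_def dist_norm intro!: less_imp_le\<close>)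
qed

text \<open>Within one coarse step of length \<open>h\<close> neither the time nor the position of
  the finer scheme changes much, however large \<open>m\<close> is, so its \<open>m\<close> drift
  values all agree with the first one up to \<epsilon>.\<close>

lemma euler_defect:
  assumes \<epsilon>: "\<epsilon> > 0"
  shows "\<exists>d>0. \<forall>h R m k. 0 < h \<longrightarrow> h \<le> d \<longrightarrow> R \<ge> pb \<longrightarrow> m > 0 \<longrightarrow> real (Suc k) * h \<le> T \<longrightarrow>
    norm (e (h / real m) R (m * Suc k) - e (h / real m) R (m * k) - h *\<^sub>R b (real k * h) (e (h / real m) R (m * k))
      - c *\<^sub>R (w (real (Suc k) * h) - w (real k * h))) \<le> h * \<epsilon>"
proof -
  have L: "L \<ge> 0" by (rule L_nonneg)
  let ?\<delta> = "\<epsilon> / (3 * (L + 1) * (\<bar>c\<bar> + 1))"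
  obtain d1 where d1: "d1 > 0" "\<forall>r\<in>{0..T}. \<forall>s\<in>{0..T}. \<bar>r - s\<bar> \<le> d1 \<longrightarrow> (\<forall>x. norm (b r x - b s x) \<le> \<epsilon> / 3)"
    using drift_modulus[of "\<epsilon> / 3"] \<epsilon> by auto
  have p: "?\<delta> > 0" using \<epsilon> L by auto
  obtain d2 where d2: "d2 > 0" "\<forall>r\<in>{0..T}. \<forall>s\<in>{0..T}. \<bar>r - s\<bar> \<le> d2 \<longrightarrow> norm (w r - w s) \<le> ?\<delta>"
    using path_modulus[OF p w] by blast
  define B where "B = C * (1 + pb)"
  have B: "B \<ge> 0" unfolding B_def using C(1) pb_nonneg by auto
  \<comment> \<open>Thirds of \<epsilon>: one for the drift in time, one for the displacement by the
    drift, at most \<open>h * B\<close>, and one for the displacement by the noise.\<close>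
  define d where "d = min (min d1 d2) (\<epsilon> / (3 * (L + 1) * (B + 1)))"
  have d: "d > 0" unfolding d_def using d1 d2 \<epsilon> L B by auto
  have "norm (e (h / real m) R (m * Suc k) - e (h / real m) R (m * k) - h *\<^sub>R b (real k * h) (e (h / real m) R (m * k))
      - c *\<^sub>R (w (real (Suc k) * h) - w (real k * h))) \<le> h * \<epsilon>"
    if h: "0 < h" "h \<le> d" and R: "R \<ge> pb" and m: "m > 0" and kT: "real (Suc k) * h \<le> T" for h R m k
  proof -
    define g where "g = h / real m"
    have g: "g > 0" "real m * g = h" unfolding g_def using h m by auto
    have R0: "R \<ge> 0" using R pb_nonneg by linarith
    have tm: "real (m * k + j) * g = real k * h + real j * g" for j
      unfolding g(2)[symmetric] by (simp add: algebra_simps)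
    have jh: "real j * g \<le> h" if "j \<le> m" for j using mult_right_mono[of "real j" "real m" g] that g by simp
    have jT: "real (m * k + j) * g \<in> {0..T}" if "j \<le> m" for j
    proof -
      have "real k * h + real j * g \<le> real k * h + h" using jh[OF that] by simp
      also have "\<dots> \<le> T" using kT by (simp add: algebra_simps)
      finally show ?thesis unfolding tm using h g by auto
    qed
    have kk: "real k * h \<in> {0..T}" using jT[of 0, unfolded tm] by simp
    let ?E = "\<lambda>j. e g R (m * k + j)"
    let ?b = "\<lambda>j. b (real (m * k + j) * g)" and ?W = "\<lambda>j. w (real (m * k + j) * g) - w (real (m * k) * g)"
    have bnd: "norm (?b j (?E j)) \<le> B" if "j \<le> m" for j
    proof -
      have "norm (?E j) \<le> pb" by (rule euler_bound[OF g(1) R0]) (use jT[OF that] in auto)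
      then have "C * (1 + norm (?E j)) \<le> B" unfolding B_def using C(1) by (intro mult_left_mono) auto
      then show ?thesis using C(2)[OF jT[OF that], of "?E j"] by linarith
    qed
    have sumE: "?E j - ?E 0 = (\<Sum>i<j. g *\<^sub>R ?b i (?E i)) + c *\<^sub>R ?W j" if "j \<le> m" for j
      using that
    proof (induction j)
      case (Suc j)
      have st: "?E (Suc j) = ?E j + g *\<^sub>R ?b j (?E j) + c *\<^sub>R (w (real (m * k + Suc j) * g) - w (real (m * k + j) * g))"
        using euler_unclamped[OF g(1) R, of "m * k + j"] jT[of j] Suc.prems by auto
      have IH: "?E j - ?E 0 = (\<Sum>i<j. g *\<^sub>R ?b i (?E i)) + c *\<^sub>R ?W j"
        by (rule Suc.IH) (use Suc.prems in auto)
      have grp: "x' - x1 = (s + p) + q" if "x' = x + p + q1" "x - x1 = s + q0" "q1 + q0 = q" for x x' x1 p q q0 q1 s :: 'a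
        using that by (simp add: algebra_simps)
      show ?case unfolding sum.lessThan_Suc
        by (rule grp[OF st IH]) (simp add: scaleR_add_right[symmetric])
    qed simp
    have dev: "norm (?E j - ?E 0) \<le> h * B + \<bar>c\<bar> * ?\<delta>" if j: "j \<le> m" for j
    proof -
      have "norm (\<Sum>i<j. g *\<^sub>R ?b i (?E i)) \<le> (\<Sum>i<j. g * B)"
        by (rule order_trans[OF norm_sum], rule sum_mono) (use g bnd j in \<open>auto intro!: mult_left_mono\<close>)
      also have "\<dots> = (real j * g) * B" by simp
      also have "\<dots> \<le> h * B" using jh[OF j] B by (rule mult_right_mono)
      finally have 1: "norm (\<Sum>i<j. g *\<^sub>R ?b i (?E i)) \<le> h * B" .
      have "norm (?W j) \<le> ?\<delta>"
      proof -
        have "\<bar>real (m * k + j) * g - real (m * k) * g\<bar> \<le> d2"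
          using jh[OF j] h(2) g(1) unfolding d_def by (simp add: algebra_simps)
        then show ?thesis using d2(2) jT[OF j] jT[of 0] by simp
      qed
      then have "norm (c *\<^sub>R ?W j) \<le> \<bar>c\<bar> * ?\<delta>"
        unfolding norm_scaleR by (intro mult_left_mono) auto
      then show ?thesis unfolding sumE[OF j] using 1 by (meson add_mono norm_triangle_ineq order_trans)
    qed
    have canc: "p * ((\<epsilon> / (3 * p * q)) * q) = \<epsilon> / 3" if "p \<noteq> 0" "q \<noteq> 0" for p q
      using that by (simp add: field_simps)
    have pt: "norm (?b i (?E i) - b (real k * h) (?E 0)) \<le> \<epsilon>" if i: "i < m" for i
    proof -
      have i': "i \<le> m" using i by simp
      have "\<bar>real (m * k + i) * g - real k * h\<bar> \<le> d1" unfolding tm using jh[OF i'] h(2) g(1) unfolding d_def by simp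
      then have 1: "norm (?b i (?E i) - b (real k * h) (?E i)) \<le> \<epsilon> / 3" using d1(2) jT[OF i'] kk by blast
      have "norm (b (real k * h) (?E i) - b (real k * h) (?E 0)) \<le> L * norm (?E i - ?E 0)"
        using lipschitz_onD[OF b_lip[OF kk], of "?E i" "?E 0"] by (simp add: dist_norm)
      also have "\<dots> \<le> L * (h * B + \<bar>c\<bar> * ?\<delta>)" using dev[OF i'] L by (rule mult_left_mono)
      also have "\<dots> = L * (h * B) + L * (\<bar>c\<bar> * ?\<delta>)" by (rule distrib_left)
      also have "\<dots> \<le> \<epsilon> / 3 + \<epsilon> / 3"
      proof (rule add_mono)
        have "L * (h * B) \<le> (L + 1) * ((\<epsilon> / (3 * (L + 1) * (B + 1))) * (B + 1))"
          using L B h \<epsilon> unfolding d_def by (intro mult_mono) auto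
        also have "\<dots> = \<epsilon> / 3" by (rule canc) (use L B in auto)
        finally show "L * (h * B) \<le> \<epsilon> / 3" .
        have "L * (\<bar>c\<bar> * ?\<delta>) \<le> (L + 1) * ((\<bar>c\<bar> + 1) * ?\<delta>)"
          using L \<epsilon> by (intro mult_mono mult_nonneg_nonneg) auto
        also have "\<dots> = (L + 1) * (?\<delta> * (\<bar>c\<bar> + 1))" by (simp only: mult.commute)
        also have "\<dots> = \<epsilon> / 3" by (rule canc) (use L in auto)
        finally show "L * (\<bar>c\<bar> * ?\<delta>) \<le> \<epsilon> / 3" .
      qed
      finally have 2: "norm (b (real k * h) (?E i) - b (real k * h) (?E 0)) \<le> \<epsilon> / 3 + \<epsilon> / 3" .
      show ?thesis using norm_triangle_ineq[of "?b i (?E i) - b (real k * h) (?E i)" "b (real k * h) (?E i) - b (real k * h) (?E 0)"] 1 2 by simp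
    qed
    have "?E m - ?E 0 - h *\<^sub>R b (real k * h) (?E 0) - c *\<^sub>R ?W m
        = (\<Sum>i<m. g *\<^sub>R (?b i (?E i) - b (real k * h) (?E 0)))"
    proof -
      have "(\<Sum>i<m. g *\<^sub>R b (real k * h) (?E 0)) = h *\<^sub>R b (real k * h) (?E 0)"
        unfolding g(2)[symmetric] by (simp only: sum_constant_scaleR card_lessThan scaleR_scaleR)
      then show ?thesis using sumE[of m] by (simp add: scaleR_diff_right sum_subtractf)
    qed
    also have "norm \<dots> \<le> (\<Sum>i<m. g * \<epsilon>)"
      by (rule order_trans[OF norm_sum], rule sum_mono) (use g pt in \<open>auto intro!: mult_left_mono\<close>)
    also have "\<dots> = h * \<epsilon>" using g(2) by simp
    finally have fin: "norm (?E m - ?E 0 - h *\<^sub>R b (real k * h) (?E 0) - c *\<^sub>R ?W m) \<le> h * \<epsilon>" .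
    have "real (m * k + m) * g = real (Suc k) * h" "real (m * k) * g = real k * h"
      using tm[of m] tm[of 0] g(2) by (auto simp: algebra_simps)
    then show ?thesis using fin unfolding g_def by (simp add: add.commute)
  qed
  then show ?thesis using d by blast
qed

text \<open>The defect and \<open>euler_stability\<close> together make nested grids close to each
  other. This gives a Cauchy sequence along dyadic steps without a solution being at hand.\<close>

lemma euler_refinement:
  assumes \<epsilon>: "\<epsilon> > 0"
  shows "\<exists>d>0. \<forall>h R R' n m. 0 < h \<longrightarrow> h \<le> d \<longrightarrow> R \<ge> pb \<longrightarrow> R' \<ge> pb \<longrightarrow> m > 0 \<longrightarrow> real n * h \<le> T \<longrightarrow>
    norm (e (h / real m) R' (m * n) - e h R n) \<le> exp (L * T) * (T * \<epsilon>)"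
proof -
  obtain d where d: "d > 0" "\<And>h R m k. 0 < h \<Longrightarrow> h \<le> d \<Longrightarrow> R \<ge> pb \<Longrightarrow> m > 0 \<Longrightarrow> real (Suc k) * h \<le> T \<Longrightarrow>
    norm (e (h / real m) R (m * Suc k) - e (h / real m) R (m * k) - h *\<^sub>R b (real k * h) (e (h / real m) R (m * k))
      - c *\<^sub>R (w (real (Suc k) * h) - w (real k * h))) \<le> h * \<epsilon>"
    using euler_defect[OF \<epsilon>] by blast
  have "norm (e (h / real m) R' (m * n) - e h R n) \<le> exp (L * T) * (T * \<epsilon>)"
    if h: "0 < h" "h \<le> d" and R: "R \<ge> pb" "R' \<ge> pb" and m: "m > 0" and nT: "real n * h \<le> T" for h R R' n m
  proof (rule euler_stability[where a = "\<lambda>k. e (h / real m) R' (m * k)" and \<beta> = "\<lambda>k. b (real k * h)" and n = n])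
    fix k assume k: "k < n"
    have kT: "real (Suc k) * h \<le> T" by (rule grid_le[OF _ _ nT]) (use k h in auto)
    have "real k * h \<le> real (Suc k) * h" using h by (intro mult_right_mono) auto
    then have kT': "real k * h \<le> T" using kT by linarith
    show "L-lipschitz_on UNIV (b (real k * h))" by (rule b_lip) (use kT' h in auto)
    have eq: "e h R (Suc k) - e h R k - h *\<^sub>R b (real k * h) (e h R k) = c *\<^sub>R (w (real (Suc k) * h) - w (real k * h))"
      unfolding euler_unclamped[OF h(1) R(1) kT'] by simp
    show "norm ((e (h / real m) R' (m * Suc k) - e (h / real m) R' (m * k) - h *\<^sub>R b (real k * h) (e (h / real m) R' (m * k))) - (e h R (Suc k) - e h R k - h *\<^sub>R b (real k * h) (e h R k))) \<le> h * \<epsilon>"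
      unfolding eq by (rule d(2)[OF h R(2) m kT])
  qed (use h L_nonneg \<epsilon> nT in auto)
  then show ?thesis using d(1) by blast
qed

lemma solution_drift_continuous:
  assumes X: "continuous_on {0..T} X"
  shows "continuous_on {0..T} (\<lambda>r. b r (X r))"
  unfolding continuous_on_iff
proof (intro ballI allI impI)
  fix r \<epsilon> :: real assume r: "r \<in> {0..T}" and \<epsilon>: "\<epsilon> > 0"
  have L: "L \<ge> 0" by (rule L_nonneg)
  obtain d1 where d1: "d1 > 0" "\<forall>r\<in>{0..T}. \<forall>s\<in>{0..T}. \<bar>r - s\<bar> \<le> d1 \<longrightarrow> (\<forall>x. norm (b r x - b s x) \<le> \<epsilon> / 3)"
    using drift_modulus[of "\<epsilon> / 3"] \<epsilon> by auto
  have p: "\<epsilon> / (3 * (L + 1)) > 0" using \<epsilon> L by auto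
  obtain d2 where d2: "d2 > 0" "\<forall>r\<in>{0..T}. \<forall>s\<in>{0..T}. \<bar>r - s\<bar> \<le> d2 \<longrightarrow> norm (X r - X s) \<le> \<epsilon> / (3 * (L + 1))"
    using path_modulus[OF p X] by blast
  show "\<exists>d>0. \<forall>s\<in>{0..T}. dist s r < d \<longrightarrow> dist (b s (X s)) (b r (X r)) < \<epsilon>"
  proof (intro exI[of _ "min d1 d2"] conjI ballI impI)
    fix s assume s: "s \<in> {0..T}" "dist s r < min d1 d2"
    have 1: "norm (b s (X s) - b r (X s)) \<le> \<epsilon> / 3" using d1(2) s r by (auto simp: dist_real_def)
    have "norm (X s - X r) \<le> \<epsilon> / (3 * (L + 1))" using d2(2) s r by (auto simp: dist_real_def)
    then have "L * norm (X s - X r) \<le> L * (\<epsilon> / (3 * (L + 1)))" using L by (rule mult_left_mono)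
    also have "\<dots> \<le> \<epsilon> / 3" using L \<epsilon> by (simp add: field_simps)
    finally have 2: "norm (b r (X s) - b r (X r)) \<le> \<epsilon> / 3"
      using lipschitz_onD[OF b_lip[OF r], of "X s" "X r"] by (simp add: dist_norm)
    show "dist (b s (X s)) (b r (X r)) < \<epsilon>"
      using norm_triangle_ineq[of "b s (X s) - b r (X s)" "b r (X s) - b r (X r)"] 1 2 \<epsilon> by (simp add: dist_norm)
  qed (use d1 d2 in auto)
qed

text \<open>For a given solution the defect on the grid is the oscillation of
  \<open>b r (X r)\<close> over one step, small by uniform continuity; the noise increments cancel
  exactly.\<close>

lemma solution_defect:
  assumes X: "continuous_on {0..T} X" and sol: "\<And>t. t \<in> {0..T} \<Longrightarrow> X t = x0 + integral {0..t} (\<lambda>r. b r (X r)) + c *\<^sub>R (w t - w 0)"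
    and \<epsilon>: "\<epsilon> > 0"
  shows "\<exists>d>0. \<forall>h R n k. 0 < h \<longrightarrow> h \<le> d \<longrightarrow> R \<ge> pb \<longrightarrow> real n * h \<le> T \<longrightarrow> k \<le> n \<longrightarrow>
    norm (X (real k * h) - e h R k) \<le> exp (L * T) * (T * \<epsilon>)"
proof -
  have L: "L \<ge> 0" by (rule L_nonneg)
  have bc: "continuous_on {0..T} (\<lambda>r. b r (X r))" by (rule solution_drift_continuous[OF X])
  obtain d where d: "d > 0" "\<forall>r\<in>{0..T}. \<forall>s\<in>{0..T}. \<bar>r - s\<bar> \<le> d \<longrightarrow> norm (b r (X r) - b s (X s)) \<le> \<epsilon>"
    using path_modulus[OF \<epsilon> bc] by blast
  have "norm (X (real k * h) - e h R k) \<le> exp (L * T) * (T * \<epsilon>)"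
    if h: "0 < h" "h \<le> d" and R: "R \<ge> pb" and nT: "real n * h \<le> T" and k: "k \<le> n" for h R n k
  proof (rule euler_stability[where a = "\<lambda>k. X (real k * h)" and \<beta> = "\<lambda>k. b (real k * h)" and n = n])
    fix k assume k: "k < n"
    have kT: "real (Suc k) * h \<le> T" by (rule grid_le[OF _ _ nT]) (use k h in auto)
    have le: "real k * h \<le> real (Suc k) * h" using h by (intro mult_right_mono) auto
    then have kk: "real k * h \<in> {0..T}" "real (Suc k) * h \<in> {0..T}"
      using order_trans[OF le kT] kT h by auto
    let ?s = "real k * h" and ?t = "real (Suc k) * h"
    have dd: "?t - ?s = h" by (simp add: algebra_simps)
    show "L-lipschitz_on UNIV (b ?s)" by (rule b_lip[OF kk(1)])
    have i: "(\<lambda>r. b r (X r)) integrable_on {0..?t}"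
      using kk by (intro integrable_continuous_real continuous_on_subset[OF bc]) auto
    have i2: "(\<lambda>r. b r (X r)) integrable_on {?s..?t}"
      using kk by (intro integrable_continuous_real continuous_on_subset[OF bc]) auto
    have "integral {0..?s} (\<lambda>r. b r (X r)) + integral {?s..?t} (\<lambda>r. b r (X r)) = integral {0..?t} (\<lambda>r. b r (X r))"
      by (rule Henstock_Kurzweil_Integration.integral_combine) (use kk le i in auto)
    then have "X ?t - X ?s = integral {?s..?t} (\<lambda>r. b r (X r)) + c *\<^sub>R (w ?t - w ?s)"
      unfolding sol[OF kk(1)] sol[OF kk(2)] by (simp add: scaleR_diff_right algebra_simps)
    moreover have "h *\<^sub>R b ?s (X ?s) = integral {?s..?t} (\<lambda>r. b ?s (X ?s))" using le dd by simp
    moreover have "e h R (Suc k) - e h R k - h *\<^sub>R b ?s (e h R k) = c *\<^sub>R (w ?t - w ?s)"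
      unfolding euler_unclamped[OF h(1) R order_trans[OF le kT]] by simp
    ultimately have e: "(X ?t - X ?s - h *\<^sub>R b ?s (X ?s)) - (e h R (Suc k) - e h R k - h *\<^sub>R b ?s (e h R k)) = integral {?s..?t} (\<lambda>r. b r (X r) - b ?s (X ?s))"
      using i2 by (subst Henstock_Kurzweil_Integration.integral_diff) auto
    have "norm (integral {?s..?t} (\<lambda>r. b r (X r) - b ?s (X ?s))) \<le> \<epsilon> * (?t - ?s)"
    proof (rule integral_bound)
      show "continuous_on {?s..?t} (\<lambda>r. b r (X r) - b ?s (X ?s))"
        using kk by (intro continuous_intros continuous_on_subset[OF bc]) auto
      show "norm (b r (X r) - b ?s (X ?s)) \<le> \<epsilon>" if "r \<in> {?s..?t}" for r
      proof -
        have "\<bar>r - ?s\<bar> \<le> d" using that h dd unfolding atLeastAtMost_iff by linarith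
        moreover have "r \<in> {0..T}" using that kk unfolding atLeastAtMost_iff by linarith
        ultimately show ?thesis using d(2) kk(1) by blast
      qed
    qed (rule le)
    then show "norm ((X ?t - X ?s - h *\<^sub>R b ?s (X ?s)) - (e h R (Suc k) - e h R k - h *\<^sub>R b ?s (e h R k))) \<le> h * \<epsilon>"
      unfolding e dd by (simp add: mult.commute)
  next
    show "X (real 0 * h) = e h R 0" using sol[of 0] T by simp
  qed (use h L \<epsilon> nT k in auto)
  then show ?thesis using d(1) by blast
qed

end

section \<open>Marginals of the McKean--Vlasov process\<close>

lemma path_space_continuous:
  assumes "f \<in> mspace (path_space T)"
  shows "continuous_on {0..T} f"
  using assms unfolding path_space_def by simp

text \<open>Evaluation is 1-Lipschitz for the supremum distance, so preimages of open sets are open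
  and thus among the generators of \<open>path_borel\<close>.\<close>

lemma path_eval_measurable:
  fixes T :: real
  assumes t: "t \<in> {0..T}"
  shows "(\<lambda>f :: real \<Rightarrow> 'a::euclidean_space. f t) \<in> borel_measurable (path_borel T)"
proof (rule borel_measurableI)
  fix U :: "'a set" assume U: "open U"
  let ?m = "path_space T :: (real \<Rightarrow> 'a) metric"
  have "Lipschitz_continuous_map ?m euclidean_metric (\<lambda>f. f t)"
    unfolding Lipschitz_continuous_map_def
  proof (intro conjI exI[of _ 1] ballI)
    fix f g assume "f \<in> mspace ?m" "g \<in> mspace ?m"
    then have "mdist euclidean_metric (f t) (g t) \<le> mdist ?m f g"
      unfolding path_space_def by (rule mdist_cfunspace_imp_mdist_le) (use t in auto)
    then show "mdist euclidean_metric (f t) (g t) \<le> 1 * mdist ?m f g" by simp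
  qed auto
  then have "continuous_map (mtopology_of ?m) euclidean (\<lambda>f. f t)"
    using Lipschitz_continuous_imp_continuous_map by fastforce
  from openin_continuous_map_preimage[OF this, of U] U
  have "openin (mtopology_of ?m) {f \<in> mspace ?m. f t \<in> U}" by simp
  moreover have "(\<lambda>f. f t) -` U \<inter> mspace ?m = {f \<in> mspace ?m. f t \<in> U}" by auto
  moreover have "{U. openin (mtopology_of ?m) U} \<subseteq> Pow (mspace ?m)"
    using openin_subset by fastforce
  ultimately show "(\<lambda>f. f t) -` U \<inter> space (path_borel T) \<in> sets (path_borel T)"
    unfolding path_borel_def by (simp add: space_measure_of sets_measure_of sigma_sets.Basic)
qed

lemma riemann_sum_error:
  fixes f :: "real \<Rightarrow> real"
  assumes h: "h \<ge> 0" and c: "continuous_on {s..s + real n * h} f"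
    and m: "\<And>r q. r \<in> {s..s + real n * h} \<Longrightarrow> q \<in> {s..s + real n * h} \<Longrightarrow> \<bar>r - q\<bar> \<le> h \<Longrightarrow> \<bar>f r - f q\<bar> \<le> e"
  shows "k \<le> n \<Longrightarrow> \<bar>integral {s..s + real k * h} f - (\<Sum>j<k. h * f (s + real j * h))\<bar> \<le> real k * h * e"
proof (induction k)
  case (Suc k)
  let ?a = "s + real k * h" and ?b = "s + real (Suc k) * h"
  have ab: "s \<le> ?a" "?a \<le> ?b" using h by (auto intro: mult_right_mono)
  have bn: "?b \<le> s + real n * h" using Suc.prems h by (simp only: add_le_cancel_left) (rule mult_right_mono, auto)
  have d: "?b - ?a = h" by (simp add: algebra_simps)
  have i: "f integrable_on {s..?b}" using bn by (intro integrable_continuous_real continuous_on_subset[OF c]) auto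
  have c2: "continuous_on {?a..?b} f" using bn ab by (intro continuous_on_subset[OF c]) auto
  have "integral {s..?b} f = integral {s..?a} f + integral {?a..?b} f"
    by (rule Henstock_Kurzweil_Integration.integral_combine[symmetric]) (use ab i in auto)
  moreover have "\<bar>integral {?a..?b} f - h * f ?a\<bar> \<le> h * e"
  proof -
    have "integral {?a..?b} f - h * f ?a = integral {?a..?b} (\<lambda>r. f r - f ?a)"
      using ab(2) d integrable_continuous_real[OF c2] by (subst Henstock_Kurzweil_Integration.integral_diff) auto
    moreover have "norm (integral {?a..?b} (\<lambda>r. f r - f ?a)) \<le> e * (?b - ?a)"
    proof (rule integral_bound[OF ab(2)])
      show "norm (f r - f ?a) \<le> e" if "r \<in> {?a..?b}" for r
      proof -
        have "r \<in> {s..s + real n * h}" "?a \<in> {s..s + real n * h}" "\<bar>r - ?a\<bar> \<le> h"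
          using that ab bn d unfolding atLeastAtMost_iff by linarith+
        then show ?thesis unfolding real_norm_def by (rule m)
      qed
    qed (intro continuous_intros c2)
    ultimately show ?thesis unfolding d by (simp add: mult.commute)
  qed
  ultimately have "\<bar>integral {s..?b} f - (\<Sum>j<Suc k. h * f (s + real j * h))\<bar> \<le> real k * h * e + h * e"
    using Suc.IH Suc.prems by (simp add: abs_le_iff)
  then show ?case by (simp add: algebra_simps)
qed simp

lemma riemann_sum_tendsto:
  fixes f :: "real \<Rightarrow> real"
  assumes c: "continuous_on {s..t} f" and st: "s \<le> t"
  shows "(\<lambda>n. \<Sum>j<n. ((t - s) / real n) * f (s + real j * ((t - s) / real n))) \<longlonglongrightarrow> integral {s..t} f"
proof (rule tendstoI)
  fix e :: real assume e: "e > 0"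
  define d where "d = e / (2 * (t - s + 1))"
  have d: "d > 0" unfolding d_def using e st by auto
  have "(t - s) * d \<le> (t - s + 1) * d" using d by (intro mult_right_mono) auto
  also have "\<dots> = e / 2" unfolding d_def using st by (simp add: field_simps)
  finally have d2: "(t - s) * d < e" using e by linarith
  have "uniformly_continuous_on {s..t} f" by (rule compact_uniformly_continuous[OF c]) simp
  then obtain \<delta> where \<delta>: "\<delta> > 0" "\<forall>q\<in>{s..t}. \<forall>r\<in>{s..t}. dist r q < \<delta> \<longrightarrow> dist (f r) (f q) < d"
    unfolding uniformly_continuous_on_def using d by blast
  have "(\<lambda>n. (t - s) / real n) \<longlonglongrightarrow> 0" by (rule lim_const_over_n)
  then have "eventually (\<lambda>n. (t - s) / real n < \<delta>) sequentially" using \<delta>(1) by (rule order_tendstoD)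
  then show "\<forall>\<^sub>F n in sequentially. dist (\<Sum>j<n. ((t - s) / real n) * f (s + real j * ((t - s) / real n))) (integral {s..t} f) < e"
    using eventually_gt_at_top[of 0]
  proof eventually_elim
    case (elim n)
    let ?h = "(t - s) / real n"
    have h: "?h \<ge> 0" "s + real n * ?h = t" using elim st by auto
    have "\<bar>integral {s..s + real n * ?h} f - (\<Sum>j<n. ?h * f (s + real j * ?h))\<bar> \<le> real n * ?h * d"
      by (rule riemann_sum_error[where n = n]) (use h c \<delta>(2) elim in \<open>auto simp: dist_real_def less_imp_le\<close>)
    also have "real n * ?h * d = (t - s) * d" using elim by simp
    also note d2
    finally show ?case using h(2) by (simp add: dist_real_def abs_minus_commute)
  qed
qed

text \<open>Riemann sums and Fatou's lemma replace Fubini here, so that joint measurability of the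
  process is not needed.\<close>

lemma (in prob_space) expectation_integral_bound:
  fixes g :: "real \<Rightarrow> 'a \<Rightarrow> real"
  assumes st: "s \<le> t" and g: "\<And>r. r \<in> {s..t} \<Longrightarrow> g r \<in> borel_measurable M" "\<And>r \<omega>. g r \<omega> \<ge> 0"
    and c: "AE \<omega> in M. continuous_on {s..t} (\<lambda>r. g r \<omega>)"
    and C: "C \<ge> 0" "\<And>r. r \<in> {s..t} \<Longrightarrow> (\<integral>\<^sup>+\<omega>. ennreal (g r \<omega>) \<partial>M) \<le> ennreal C"
  shows "\<exists>J\<in>borel_measurable M. (AE \<omega> in M. ennreal (integral {s..t} (\<lambda>r. g r \<omega>)) \<le> J \<omega>) \<and> (\<integral>\<^sup>+\<omega>. J \<omega> \<partial>M) \<le> ennreal ((t - s) * C)"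
proof -
  define h where "h n = (t - s) / real (Suc n)" for n
  have h: "h n \<ge> 0" "real (Suc n) * h n = t - s" for n unfolding h_def using st by auto
  have gr: "s + real j * h n \<in> {s..t}" if "j < Suc n" for j n
  proof -
    have "real j * h n \<le> real (Suc n) * h n" using that h by (intro mult_right_mono) auto
    then show ?thesis using h by auto
  qed
  define S where "S n \<omega> = (\<Sum>j<Suc n. h n * g (s + real j * h n) \<omega>)" for n \<omega>
  have Sm[measurable]: "S n \<in> borel_measurable M" for n
    unfolding S_def[abs_def] using g(1)[OF gr] by (intro borel_measurable_sum borel_measurable_times) auto
  have SE: "(\<integral>\<^sup>+\<omega>. ennreal (S n \<omega>) \<partial>M) \<le> ennreal ((t - s) * C)" for n
  proof -
    have "(\<integral>\<^sup>+\<omega>. ennreal (S n \<omega>) \<partial>M) = (\<integral>\<^sup>+\<omega>. (\<Sum>j<Suc n. ennreal (h n) * ennreal (g (s + real j * h n) \<omega>)) \<partial>M)"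
      unfolding S_def using h g(2) by (simp add: sum_ennreal[symmetric] ennreal_mult del: sum.lessThan_Suc)
    also have "\<dots> = (\<Sum>j<Suc n. ennreal (h n) * (\<integral>\<^sup>+\<omega>. ennreal (g (s + real j * h n) \<omega>) \<partial>M))"
      using g(1)[OF gr] by (subst nn_integral_sum) (auto simp: nn_integral_cmult simp del: sum.lessThan_Suc)
    also have "\<dots> \<le> (\<Sum>j<Suc n. ennreal (h n) * ennreal C)"
      by (intro sum_mono mult_left_mono C(2) gr) auto
    also have "\<dots> = ennreal (real (Suc n) * (h n * C))"
      using h C(1) by (simp add: ennreal_mult[symmetric] ennreal_of_nat_eq_real_of_nat del: sum.lessThan_Suc of_nat_Suc)
    also have "real (Suc n) * (h n * C) = (t - s) * C" unfolding mult.assoc[symmetric] h(2) ..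
    finally show ?thesis .
  qed
  show ?thesis
  proof (intro bexI conjI)
    show "(\<lambda>\<omega>. liminf (\<lambda>n. ennreal (S n \<omega>))) \<in> borel_measurable M" by measurable
    show "AE \<omega> in M. ennreal (integral {s..t} (\<lambda>r. g r \<omega>)) \<le> liminf (\<lambda>n. ennreal (S n \<omega>))"
      using c
    proof eventually_elim
      case (elim \<omega>)
      have "(\<lambda>n. S n \<omega>) \<longlonglongrightarrow> integral {s..t} (\<lambda>r. g r \<omega>)"
        unfolding S_def h_def using LIMSEQ_Suc[OF riemann_sum_tendsto[OF elim st]] .
      then have "(\<lambda>n. ennreal (S n \<omega>)) \<longlonglongrightarrow> ennreal (integral {s..t} (\<lambda>r. g r \<omega>))" by (rule tendsto_ennrealI)
      then show ?case by (simp add: lim_imp_Liminf)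
    qed
    have "(\<integral>\<^sup>+\<omega>. liminf (\<lambda>n. ennreal (S n \<omega>)) \<partial>M) \<le> liminf (\<lambda>n. \<integral>\<^sup>+\<omega>. ennreal (S n \<omega>) \<partial>M)"
      by (rule nn_integral_liminf) measurable
    also have "\<dots> \<le> liminf (\<lambda>n. ennreal ((t - s) * C))" by (intro Liminf_mono always_eventually allI SE)
    also have "\<dots> = ennreal ((t - s) * C)" by (intro lim_imp_Liminf) auto
    finally show "(\<integral>\<^sup>+\<omega>. liminf (\<lambda>n. ennreal (S n \<omega>)) \<partial>M) \<le> ennreal ((t - s) * C)" .
  qed
qed

text \<open>The inhomogeneity \<open>a\<close> will contain a Brownian path and is not monotone. The
  integrating factor \<open>exp (- (L * r))\<close> is applied to the integral of \<open>y\<close>,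
  and the result keeps \<open>integral {0..T} a\<close>.\<close>

lemma gronwall_path:
  fixes y a :: "real \<Rightarrow> real"
  assumes y: "continuous_on {0..T} y" and a: "continuous_on {0..T} a" "\<And>t. t \<in> {0..T} \<Longrightarrow> a t \<ge> 0" and L: "L \<ge> 0"
    and le: "\<And>t. t \<in> {0..T} \<Longrightarrow> y t \<le> a t + L * integral {0..t} y" and t: "t \<in> {0..T}"
  shows "y t \<le> a t + L * exp (L * T) * integral {0..T} a"
proof -
  define I where "I t = integral {0..t} y" for t
  have dI: "(I has_real_derivative y r) (at r within {0..T})" if "r \<in> {0..T}" for r
    unfolding I_def[abs_def] has_real_derivative_iff_has_vector_derivative
    by (rule integral_has_vector_derivative[OF y that])
  have "((\<lambda>r. exp (- (L * r)) * (y r - L * I r)) has_integral (exp (- (L * t)) * I t - exp (- (L * 0)) * I 0)) {0..t}"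
  proof (rule fundamental_theorem_of_calculus)
    fix r assume r: "r \<in> {0..t}"
    then have "(I has_real_derivative y r) (at r within {0..t})"
      using t by (intro DERIV_subset[OF dI]) auto
    then have "((\<lambda>r. exp (- (L * r)) * I r) has_real_derivative exp (- (L * r)) * (y r - L * I r)) (at r within {0..t})"
      by (auto intro!: derivative_eq_intros simp: algebra_simps)
    then show "((\<lambda>r. exp (- (L * r)) * I r) has_vector_derivative exp (- (L * r)) * (y r - L * I r)) (at r within {0..t})"
      by (simp add: has_real_derivative_iff_has_vector_derivative)
  qed (use t in auto)
  then have hi: "((\<lambda>r. exp (- (L * r)) * (y r - L * I r)) has_integral (exp (- (L * t)) * I t)) {0..t}"
    by (simp add: I_def)
  have ai: "a integrable_on {0..t}" "a integrable_on {0..T}"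
    using t by (auto intro!: integrable_continuous_real continuous_on_subset[OF a(1)])
  have "exp (- (L * t)) * I t \<le> integral {0..t} a"
  proof (rule has_integral_le[OF hi integrable_integral[OF ai(1)]])
    fix r assume r: "r \<in> {0..t}"
    then have rT: "r \<in> {0..T}" using t by auto
    have "y r - L * I r \<le> a r" using le[OF rT] unfolding I_def by simp
    then have "exp (- (L * r)) * (y r - L * I r) \<le> exp (- (L * r)) * a r" by (intro mult_left_mono) auto
    also have "\<dots> \<le> 1 * a r" using a(2)[OF rT] L rT by (intro mult_right_mono) auto
    finally show "exp (- (L * r)) * (y r - L * I r) \<le> a r" by simp
  qed
  also have "\<dots> \<le> integral {0..T} a"
    by (rule integral_subset_le) (use t ai a(2) in auto)
  finally have "exp (L * t) * (exp (- (L * t)) * I t) \<le> exp (L * t) * integral {0..T} a" by (intro mult_left_mono) auto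
  then have "I t \<le> exp (L * t) * integral {0..T} a" by (simp add: mult.assoc[symmetric] exp_add[symmetric])
  also have "\<dots> \<le> exp (L * T) * integral {0..T} a"
    using t L a(2) ai(2) by (intro mult_right_mono Henstock_Kurzweil_Integration.integral_nonneg) (auto intro: mult_left_mono)
  finally have "L * I t \<le> L * (exp (L * T) * integral {0..T} a)" using L by (rule mult_left_mono)
  then show ?thesis using le[OF t] unfolding I_def by (simp add: mult.assoc)
qed

text \<open>The drift depends on the law of the solution itself, for which only a finite first
  moment at each single time is assumed. The aim is continuity of the law in Wasserstein distance;
  after that the drift is regular and can be treated as given.\<close>

locale mckean_vlasov = brownian M F W T
  for M :: "'w measure" and F and W :: "real \<Rightarrow> 'w \<Rightarrow> 'a::euclidean_space" and T +
  fixes \<sigma> LH LK :: real and H1 K1 :: "'a \<Rightarrow> 'a" and X0 :: "'w \<Rightarrow> 'a" and X :: "'w \<Rightarrow> real \<Rightarrow> 'a"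
    and Y :: "real \<Rightarrow> 'a ^ 'm::finite" and \<mu> :: "real \<Rightarrow> 'a measure"
  defines "\<mu> \<equiv> (\<lambda>t. distr M borel (\<lambda>\<omega>. X \<omega> t))"
  assumes sigma_pos: "\<sigma> > 0" and H1: "LH-lipschitz_on UNIV H1" and K1: "LK-lipschitz_on UNIV K1"
    and X0: "X0 \<in> borel_measurable (F 0)" and X0_int: "integrable M (\<lambda>\<omega>. norm (X0 \<omega>))"
    and X: "X \<in> measurable M (path_borel T)" and mu_w: "\<And>t. t \<in> {0..T} \<Longrightarrow> \<mu> t \<in> wasserstein_space 1"
    and Y: "continuous_on {0..T} Y"
    and sol: "AE \<omega> in M. X \<omega> 0 = X0 \<omega> \<and>
       (\<lambda>s. particle_drift H1 K1 (\<mu> s) (Y s) (X \<omega> s)) absolutely_integrable_on {0..T} \<and>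
       (\<forall>t\<in>{0..T}. X \<omega> t = X0 \<omega> + (LINT s:{0..t}|lebesgue. particle_drift H1 K1 (\<mu> s) (Y s) (X \<omega> s))
          + sqrt (2 * \<sigma>) *\<^sub>R W t \<omega>)"
begin

abbreviation "b \<equiv> \<lambda>t. particle_drift H1 K1 (\<mu> t) (Y t)"
abbreviation "L \<equiv> LH + LK"

lemma X_cont: "\<omega> \<in> space M \<Longrightarrow> continuous_on {0..T} (X \<omega>)"
  using measurable_space[OF X] unfolding path_borel_def
  by (intro path_space_continuous) (auto simp: space_measure_of_conv)

lemma X_M: "t \<in> {0..T} \<Longrightarrow> (\<lambda>\<omega>. X \<omega> t) \<in> borel_measurable M"
  using measurable_compose[OF X path_eval_measurable] .

lemma X0_M: "X0 \<in> borel_measurable M"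
  using F_M[OF _ X0] T_pos by auto

lemma W_cont: "AE \<omega> in M. continuous_on {0..T} (\<lambda>t. W t \<omega>)"
  using bm unfolding brownian_motion_on_def by auto

lemma L_nonneg: "L \<ge> 0" using lipschitz_on_nonneg[OF H1] lipschitz_on_nonneg[OF K1] by auto

lemma b_lip: "t \<in> {0..T} \<Longrightarrow> L-lipschitz_on UNIV (b t)"
  by (rule particle_drift_lipschitz[OF mu_w H1 K1])

definition "c = sqrt (2 * \<sigma>)"
lemma c_pos: "c > 0" unfolding c_def using sigma_pos by simp

definition "gm = (\<integral>z. norm z \<partial>(std_gauss::'a measure))"
lemma gm_nonneg: "gm \<ge> 0" unfolding gm_def by simp

text \<open>At this stage \<open>b r 0\<close> is not known to be bounded, or even integrable, in
  time. One path along which the drift is integrable is fixed as a reference, and the Lipschitz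
  bound compares every other path with it.\<close>

lemma increment_bound:
  "\<exists>p. (\<forall>r. p r \<ge> 0) \<and> p integrable_on {0..T} \<and> (AE \<omega> in M. \<forall>s t. 0 \<le> s \<longrightarrow> s \<le> t \<longrightarrow> t \<le> T \<longrightarrow>
     norm (X \<omega> t - X \<omega> s) \<le> integral {s..t} p + L * integral {s..t} (\<lambda>r. norm (X \<omega> r)) + c * norm (W t \<omega> - W s \<omega>))"
proof -
  \<comment> \<open>An almost sure property holds for at least one \<omega>, since the whole space
    is not a null set.\<close>
  have "\<exists>\<omega>\<in>space M. (\<lambda>s. b s (X \<omega> s)) absolutely_integrable_on {0..T}"
  proof (rule ccontr)
    assume n: "\<not> ?thesis"
    have "AE \<omega> in M. False" using sol AE_space by eventually_elim (use n in auto)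
    then show False by simp
  qed
  then obtain \<omega>0 where \<omega>0: "\<omega>0 \<in> space M" "(\<lambda>s. b s (X \<omega>0 s)) absolutely_integrable_on {0..T}" by blast
  have "compact (X \<omega>0 ` {0..T})" using X_cont[OF \<omega>0(1)] by (intro compact_continuous_image) auto
  then obtain K where K: "\<And>t. t \<in> {0..T} \<Longrightarrow> norm (X \<omega>0 t) \<le> K" using compact_imp_bounded bounded_iff by (metis imageI)
  have K0: "K \<ge> 0" using K[of 0] T_pos norm_ge_zero[of "X \<omega>0 0"] by (meson atLeastAtMost_iff less_imp_le order_refl order_trans)
  define p where "p r = norm (b r (X \<omega>0 r)) + L * K" for r
  have p0: "p r \<ge> 0" for r unfolding p_def using L_nonneg K0 by auto
  have pi: "p integrable_on {0..T}"
  proof -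
    have "(\<lambda>r. norm (b r (X \<omega>0 r))) integrable_on {0..T}" using \<omega>0(2) unfolding absolutely_integrable_on_def by auto
    then show ?thesis unfolding p_def[abs_def] by (intro integrable_add integrable_const_ivl)
  qed
  have pi2: "p integrable_on {s..t}" if "0 \<le> s" "t \<le> T" for s t
    by (rule integrable_subinterval_real[OF pi]) (use that in auto)
  have "AE \<omega> in M. \<forall>s t. 0 \<le> s \<longrightarrow> s \<le> t \<longrightarrow> t \<le> T \<longrightarrow>
     norm (X \<omega> t - X \<omega> s) \<le> integral {s..t} p + L * integral {s..t} (\<lambda>r. norm (X \<omega> r)) + c * norm (W t \<omega> - W s \<omega>)"
    using sol AE_space
  proof eventually_elim
    case (elim \<omega>)
    show ?case
    proof (intro allI impI)
      fix s t assume st: "0 \<le> s" "s \<le> t" "t \<le> T"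
      let ?F = "\<lambda>r. b r (X \<omega> r)"
      have Fa: "?F absolutely_integrable_on {0..T}" using elim by auto
      have Fi: "?F integrable_on {0..T}" using Fa absolutely_integrable_on_def by blast
      have lint: "(LINT r:{0..q}|lebesgue. ?F r) = integral {0..q} ?F" if "q \<in> {0..T}" for q
        by (rule set_lebesgue_integral_eq_integral(2), rule set_integrable_subset[OF Fa]) (use that in auto)
      have Xc: "continuous_on {s..t} (\<lambda>r. norm (X \<omega> r))"
        using X_cont elim(2) st by (intro continuous_on_norm continuous_on_subset[OF X_cont]) auto
      have Xn: "(\<lambda>r. norm (X \<omega> r)) integrable_on {s..t}" by (rule integrable_continuous_real[OF Xc])
      have "integral {0..s} ?F + integral {s..t} ?F = integral {0..t} ?F"
        by (rule Henstock_Kurzweil_Integration.integral_combine) (use st in \<open>auto intro!: integrable_subinterval_real[OF Fi]\<close>)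
      moreover have "X \<omega> t = X0 \<omega> + integral {0..t} ?F + c *\<^sub>R W t \<omega>" "X \<omega> s = X0 \<omega> + integral {0..s} ?F + c *\<^sub>R W s \<omega>"
        using elim(1) lint st unfolding c_def by auto
      ultimately have e: "X \<omega> t - X \<omega> s = integral {s..t} ?F + c *\<^sub>R (W t \<omega> - W s \<omega>)"
        by (simp add: scaleR_diff_right algebra_simps)
      have "norm (integral {s..t} ?F) \<le> integral {s..t} (\<lambda>r. p r + L * norm (X \<omega> r))"
      proof (rule integral_norm_bound_integral)
        show "?F integrable_on {s..t}" by (rule integrable_subinterval_real[OF Fi]) (use st in auto)
        show "(\<lambda>r. p r + L * norm (X \<omega> r)) integrable_on {s..t}"
          using pi2 Xn st by (intro integrable_add integrable_on_mult_right) auto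
        fix r assume "r \<in> {s..t}"
        then have r: "r \<in> {0..T}" using st by auto
        have "norm (b r (X \<omega> r) - b r (X \<omega>0 r)) \<le> L * norm (X \<omega> r - X \<omega>0 r)"
          using lipschitz_onD[OF b_lip[OF r], of "X \<omega> r" "X \<omega>0 r"] by (simp add: dist_norm)
        also have "\<dots> \<le> L * (norm (X \<omega> r) + K)"
          using K[OF r] norm_triangle_ineq4[of "X \<omega> r" "X \<omega>0 r"] L_nonneg by (intro mult_left_mono) auto
        finally show "norm (b r (X \<omega> r)) \<le> p r + L * norm (X \<omega> r)"
          using norm_triangle_sub[of "b r (X \<omega> r)" "b r (X \<omega>0 r)"] unfolding p_def distrib_left by linarith
      qed
      also have "\<dots> = integral {s..t} p + L * integral {s..t} (\<lambda>r. norm (X \<omega> r))"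
        using pi2[of s t] Xn st by (subst Henstock_Kurzweil_Integration.integral_add) (auto intro: integrable_on_mult_right)
      finally have "norm (integral {s..t} ?F) \<le> integral {s..t} p + L * integral {s..t} (\<lambda>r. norm (X \<omega> r))" .
      moreover have "norm (c *\<^sub>R (W t \<omega> - W s \<omega>)) = c * norm (W t \<omega> - W s \<omega>)" using c_pos by simp
      ultimately show "norm (X \<omega> t - X \<omega> s) \<le> integral {s..t} p + L * integral {s..t} (\<lambda>r. norm (X \<omega> r)) + c * norm (W t \<omega> - W s \<omega>)"
        unfolding e by (intro order_trans[OF norm_triangle_ineq]) linarith
    qed
  qed
  then show ?thesis using p0 pi by blast
qed

lemma W_increment_bound:
  assumes "s \<in> {0..T}" "t \<in> {0..T}" "s \<le> t"
  shows "(\<integral>\<^sup>+\<omega>. ennreal (norm (W t \<omega> - W s \<omega>)) \<partial>M) \<le> ennreal (sqrt T * gm)"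
  unfolding increment_norm[OF assms] gm_def[symmetric] using assms gm_nonneg by (intro ennreal_leI mult_right_mono) auto

text \<open>Gronwall's inequality is applied on each path before expectations are taken. Applied to
  the expectations themselves it would presuppose that the moments are integrable in time.\<close>

lemma moment_bound: "\<exists>C\<ge>0. \<forall>t\<in>{0..T}. (\<integral>\<^sup>+\<omega>. ennreal (norm (X \<omega> t)) \<partial>M) \<le> ennreal C"
proof -
  obtain p where p: "\<And>r. p r \<ge> 0" "p integrable_on {0..T}" "AE \<omega> in M. \<forall>s t. 0 \<le> s \<longrightarrow> s \<le> t \<longrightarrow> t \<le> T \<longrightarrow>
     norm (X \<omega> t - X \<omega> s) \<le> integral {s..t} p + L * integral {s..t} (\<lambda>r. norm (X \<omega> r)) + c * norm (W t \<omega> - W s \<omega>)"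
    using increment_bound by blast
  define P where "P = integral {0..T} p"
  have P0: "P \<ge> 0" unfolding P_def using p by (intro Henstock_Kurzweil_Integration.integral_nonneg) auto
  have T0: "0 \<in> {0..T}" "T \<in> {0..T}" using T_pos by auto
  let ?I = "\<lambda>\<omega>. integral {0..T} (\<lambda>r. norm (W r \<omega> - W 0 \<omega>))"
  \<comment> \<open>\<open>J\<close> is a measurable majorant; the time integral itself is not known
    to be measurable in \<omega>.\<close>
  obtain J where J: "J \<in> borel_measurable M" "AE \<omega> in M. ennreal (?I \<omega>) \<le> J \<omega>"
    "(\<integral>\<^sup>+\<omega>. J \<omega> \<partial>M) \<le> ennreal ((T - 0) * (sqrt T * gm))"
  proof -
    have "\<exists>J\<in>borel_measurable M. (AE \<omega> in M. ennreal (?I \<omega>) \<le> J \<omega>) \<and> (\<integral>\<^sup>+\<omega>. J \<omega> \<partial>M) \<le> ennreal ((T - 0) * (sqrt T * gm))"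
    proof (rule expectation_integral_bound)
      show "AE \<omega> in M. continuous_on {0..T} (\<lambda>r. norm (W r \<omega> - W 0 \<omega>))"
        using W_cont by eventually_elim (intro continuous_intros)
      show "(\<integral>\<^sup>+\<omega>. ennreal (norm (W r \<omega> - W 0 \<omega>)) \<partial>M) \<le> ennreal (sqrt T * gm)" if "r \<in> {0..T}" for r
        by (rule W_increment_bound) (use that T0 in auto)
      show "(\<lambda>\<omega>. norm (W r \<omega> - W 0 \<omega>)) \<in> borel_measurable M" if "r \<in> {0..T}" for r
        using W_M[OF that] W_M[OF T0(1)] by measurable
    qed (use T_pos gm_nonneg in auto)
    then show ?thesis using that by blast
  qed
  define k where "k = L * exp (L * T)"
  have k0: "k \<ge> 0" unfolding k_def using L_nonneg by auto
  have [measurable]: "X0 \<in> borel_measurable M" by (rule X0_M)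
  let ?E0 = "\<integral>\<omega>. norm (X0 \<omega>) \<partial>M"
  have E0: "?E0 \<ge> 0" by simp
  \<comment> \<open>The summands come from the initial value together with \<open>P\<close>, from
    the noise at time \<open>t\<close>, and from the noise inside the Gronwall integral.\<close>
  define C where "C = (1 + k * T) * (?E0 + P) + c * (sqrt T * gm) + k * c * (T * (sqrt T * gm))"
  have "(\<integral>\<^sup>+\<omega>. ennreal (norm (X \<omega> t)) \<partial>M) \<le> ennreal C" if t: "t \<in> {0..T}" for t
  proof -
    have [measurable]: "W t \<in> borel_measurable M" "W 0 \<in> borel_measurable M" "J \<in> borel_measurable M"
      using W_M[OF t] W_M[OF T0(1)] J(1) by auto
    have "AE \<omega> in M. ennreal (norm (X \<omega> t)) \<le> ennreal ((1 + k * T) * (norm (X0 \<omega>) + P)) + ennreal c * ennreal (norm (W t \<omega> - W 0 \<omega>)) + ennreal (k * c) * J \<omega>"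
      using p(3) J(2) sol W_cont AE_space
    proof eventually_elim
      case (elim \<omega>)
      define a where "a r = (norm (X0 \<omega>) + P) + c * norm (W r \<omega> - W 0 \<omega>)" for r
      have wc: "continuous_on {0..T} (\<lambda>r. norm (W r \<omega> - W 0 \<omega>))" using elim(4) by (intro continuous_intros)
      have ac: "continuous_on {0..T} a" unfolding a_def[abs_def] by (intro continuous_intros wc)
      have "norm (X \<omega> t) \<le> a t + L * exp (L * T) * integral {0..T} a"
      proof (rule gronwall_path[OF _ ac _ L_nonneg _ t])
        show "continuous_on {0..T} (\<lambda>t. norm (X \<omega> t))" using X_cont[OF elim(5)] by (rule continuous_on_norm)
        show "a r \<ge> 0" for r unfolding a_def using P0 c_pos by auto
        fix r assume r: "r \<in> {0..T}"
        have "norm (X \<omega> r - X \<omega> 0) \<le> integral {0..r} p + L * integral {0..r} (\<lambda>r. norm (X \<omega> r)) + c * norm (W r \<omega> - W 0 \<omega>)"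
          using elim(1) r by auto
        moreover have "integral {0..r} p \<le> P" unfolding P_def
          by (rule integral_subset_le) (use r p in \<open>auto intro: integrable_subinterval_real[OF p(2)]\<close>)
        ultimately show "norm (X \<omega> r) \<le> a r + L * integral {0..r} (\<lambda>t. norm (X \<omega> t))"
          using norm_triangle_sub[of "X \<omega> r" "X \<omega> 0"] conjunct1[OF elim(3)] unfolding a_def by (simp add: add.commute)
      qed
      also have "integral {0..T} a = T * (norm (X0 \<omega>) + P) + c * ?I \<omega>"
        unfolding a_def[abs_def] using T_pos integrable_continuous_real[OF wc]
        by (subst Henstock_Kurzweil_Integration.integral_add) (auto intro: integrable_on_mult_right)
      finally have "norm (X \<omega> t) \<le> (1 + k * T) * (norm (X0 \<omega>) + P) + c * norm (W t \<omega> - W 0 \<omega>) + (k * c) * ?I \<omega>"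
        unfolding a_def k_def by (simp add: algebra_simps)
      then have "ennreal (norm (X \<omega> t)) \<le> ennreal ((1 + k * T) * (norm (X0 \<omega>) + P) + c * norm (W t \<omega> - W 0 \<omega>) + (k * c) * ?I \<omega>)"
        by (rule ennreal_leI)
      also have "\<dots> = ennreal ((1 + k * T) * (norm (X0 \<omega>) + P)) + ennreal c * ennreal (norm (W t \<omega> - W 0 \<omega>)) + ennreal (k * c) * ennreal (?I \<omega>)"
      proof -
        have "?I \<omega> \<ge> 0"
          using integrable_continuous_real[OF wc] by (intro Henstock_Kurzweil_Integration.integral_nonneg) auto
        moreover have "(1 + k * T) * (norm (X0 \<omega>) + P) \<ge> 0" using k0 P0 T_pos by auto
        ultimately show ?thesis using k0 c_pos
          by (simp add: ennreal_mult[symmetric] ennreal_plus[symmetric] del: ennreal_plus)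
      qed
      also have "\<dots> \<le> ennreal ((1 + k * T) * (norm (X0 \<omega>) + P)) + ennreal c * ennreal (norm (W t \<omega> - W 0 \<omega>)) + ennreal (k * c) * J \<omega>"
        by (intro add_left_mono mult_left_mono elim(2)) auto
      finally show ?case .
    qed
    then have "(\<integral>\<^sup>+\<omega>. ennreal (norm (X \<omega> t)) \<partial>M) \<le> (\<integral>\<^sup>+\<omega>. ennreal ((1 + k * T) * (norm (X0 \<omega>) + P)) + ennreal c * ennreal (norm (W t \<omega> - W 0 \<omega>)) + ennreal (k * c) * J \<omega> \<partial>M)"
      by (rule nn_integral_mono_AE)
    also have "\<dots> = (\<integral>\<^sup>+\<omega>. ennreal ((1 + k * T) * (norm (X0 \<omega>) + P)) \<partial>M) + ennreal c * (\<integral>\<^sup>+\<omega>. ennreal (norm (W t \<omega> - W 0 \<omega>)) \<partial>M) + ennreal (k * c) * (\<integral>\<^sup>+\<omega>. J \<omega> \<partial>M)"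
      by (simp add: nn_integral_add nn_integral_cmult)
    also have "(\<integral>\<^sup>+\<omega>. ennreal ((1 + k * T) * (norm (X0 \<omega>) + P)) \<partial>M) = ennreal ((1 + k * T) * (?E0 + P))"
      using X0_int k0 T_pos P0 by (subst nn_integral_eq_integral) (auto simp: prob_space intro!: mult_nonneg_nonneg add_nonneg_nonneg)
    also have "ennreal ((1 + k * T) * (?E0 + P)) + ennreal c * (\<integral>\<^sup>+\<omega>. ennreal (norm (W t \<omega> - W 0 \<omega>)) \<partial>M) + ennreal (k * c) * (\<integral>\<^sup>+\<omega>. J \<omega> \<partial>M)
       \<le> ennreal ((1 + k * T) * (?E0 + P)) + ennreal c * ennreal (sqrt T * gm) + ennreal (k * c) * ennreal ((T - 0) * (sqrt T * gm))"
      using t T0 by (intro add_mono mult_left_mono J(3) W_increment_bound order_refl) auto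
    also have "\<dots> = ennreal C"
      unfolding C_def using k0 c_pos P0 T_pos gm_nonneg E0
      by (simp add: ennreal_mult[symmetric] ennreal_plus[symmetric] del: ennreal_plus)
    finally show ?thesis .
  qed
  moreover have "C \<ge> 0" unfolding C_def using k0 c_pos P0 T_pos gm_nonneg E0 by auto
  ultimately show ?thesis by blast
qed

text \<open>The values of \<open>X\<close> at two times are coupled by the process itself. The
  expected increment has three parts, controlled by the continuous primitive of \<open>p\<close>, by
  the uniform first moment, and by the scaling of Brownian increments.\<close>

lemma wcont: "wasserstein_continuous_on 1 {0..T} \<mu>"
proof -
  obtain p where p: "\<And>r. p r \<ge> 0" "p integrable_on {0..T}" "AE \<omega> in M. \<forall>s t. 0 \<le> s \<longrightarrow> s \<le> t \<longrightarrow> t \<le> T \<longrightarrow>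
     norm (X \<omega> t - X \<omega> s) \<le> integral {s..t} p + L * integral {s..t} (\<lambda>r. norm (X \<omega> r)) + c * norm (W t \<omega> - W s \<omega>)"
    using increment_bound by blast
  obtain C where C: "C \<ge> 0" "\<And>t. t \<in> {0..T} \<Longrightarrow> (\<integral>\<^sup>+\<omega>. ennreal (norm (X \<omega> t)) \<partial>M) \<le> ennreal C"
    using moment_bound by blast
  have E: "(\<integral>\<^sup>+\<omega>. ennreal (norm (X \<omega> t - X \<omega> s)) \<partial>M) \<le> ennreal (integral {s..t} p + L * ((t - s) * C) + c * (sqrt (t - s) * gm))"
    if st: "0 \<le> s" "s \<le> t" "t \<le> T" for s t
  proof -
    have sT: "s \<in> {0..T}" "t \<in> {0..T}" using st by auto
    have [measurable]: "W t \<in> borel_measurable M" "W s \<in> borel_measurable M" using W_M sT by auto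
    have "\<exists>J\<in>borel_measurable M. (AE \<omega> in M. ennreal (integral {s..t} (\<lambda>r. norm (X \<omega> r))) \<le> J \<omega>) \<and> (\<integral>\<^sup>+\<omega>. J \<omega> \<partial>M) \<le> ennreal ((t - s) * C)"
    proof (rule expectation_integral_bound[OF st(2)])
      show "AE \<omega> in M. continuous_on {s..t} (\<lambda>r. norm (X \<omega> r))"
        using AE_space by eventually_elim (intro continuous_on_norm continuous_on_subset[OF X_cont], use st in auto)
      show "(\<lambda>\<omega>. norm (X \<omega> r)) \<in> borel_measurable M" if "r \<in> {s..t}" for r
        using X_M[of r] that st by auto
    qed (use C st in auto)
    then obtain J where J[measurable]: "J \<in> borel_measurable M" and J2: "AE \<omega> in M. ennreal (integral {s..t} (\<lambda>r. norm (X \<omega> r))) \<le> J \<omega>"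
      "(\<integral>\<^sup>+\<omega>. J \<omega> \<partial>M) \<le> ennreal ((t - s) * C)" by blast
    have P0: "integral {s..t} p \<ge> 0" using p st
      by (intro Henstock_Kurzweil_Integration.integral_nonneg integrable_subinterval_real[OF p(2)]) auto
    have "AE \<omega> in M. ennreal (norm (X \<omega> t - X \<omega> s)) \<le> ennreal (integral {s..t} p) + ennreal L * J \<omega> + ennreal c * ennreal (norm (W t \<omega> - W s \<omega>))"
      using p(3) J2(1) AE_space
    proof eventually_elim
      case (elim \<omega>)
      have I0: "integral {s..t} (\<lambda>r. norm (X \<omega> r)) \<ge> 0"
        using st by (intro Henstock_Kurzweil_Integration.integral_nonneg integrable_continuous_real continuous_on_norm continuous_on_subset[OF X_cont[OF elim(3)]]) auto
      have "ennreal (norm (X \<omega> t - X \<omega> s)) \<le> ennreal (integral {s..t} p + L * integral {s..t} (\<lambda>r. norm (X \<omega> r)) + c * norm (W t \<omega> - W s \<omega>))"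
        using elim(1) st by (intro ennreal_leI) auto
      also have "\<dots> = ennreal (integral {s..t} p) + ennreal L * ennreal (integral {s..t} (\<lambda>r. norm (X \<omega> r))) + ennreal c * ennreal (norm (W t \<omega> - W s \<omega>))"
        using P0 I0 L_nonneg c_pos by (simp add: ennreal_mult[symmetric] ennreal_plus[symmetric] del: ennreal_plus)
      also have "\<dots> \<le> ennreal (integral {s..t} p) + ennreal L * J \<omega> + ennreal c * ennreal (norm (W t \<omega> - W s \<omega>))"
        by (intro add_mono mult_left_mono elim(2) order_refl) auto
      finally show ?case .
    qed
    then have "(\<integral>\<^sup>+\<omega>. ennreal (norm (X \<omega> t - X \<omega> s)) \<partial>M) \<le> (\<integral>\<^sup>+\<omega>. ennreal (integral {s..t} p) + ennreal L * J \<omega> + ennreal c * ennreal (norm (W t \<omega> - W s \<omega>)) \<partial>M)"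
      by (rule nn_integral_mono_AE)
    also have "\<dots> = ennreal (integral {s..t} p) + ennreal L * (\<integral>\<^sup>+\<omega>. J \<omega> \<partial>M) + ennreal c * (\<integral>\<^sup>+\<omega>. ennreal (norm (W t \<omega> - W s \<omega>)) \<partial>M)"
      by (simp add: nn_integral_add nn_integral_cmult emeasure_space_1)
    also have "\<dots> \<le> ennreal (integral {s..t} p) + ennreal L * ennreal ((t - s) * C) + ennreal c * ennreal (sqrt (t - s) * gm)"
      unfolding increment_norm[OF sT st(2)] gm_def[symmetric] by (intro add_mono mult_left_mono J2(2) order_refl) auto
    also have "\<dots> = ennreal (integral {s..t} p + L * ((t - s) * C) + c * (sqrt (t - s) * gm))"
      using P0 L_nonneg c_pos C(1) st gm_nonneg by (simp add: ennreal_mult[symmetric] ennreal_plus[symmetric] del: ennreal_plus)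
    finally show ?thesis .
  qed
  define q where "q t = integral {0..t} p" for t
  have qc: "continuous_on {0..T} q" unfolding q_def[abs_def] by (rule indefinite_integral_continuous_1[OF p(2)])
  have W1: "wasserstein 1 (\<mu> s) (\<mu> t) \<le> \<bar>q t - q s\<bar> + L * (\<bar>t - s\<bar> * C) + c * (sqrt \<bar>t - s\<bar> * gm)"
    if st: "s \<in> {0..T}" "t \<in> {0..T}" for s t
  proof -
    have *: "(\<integral>\<^sup>+\<omega>. ennreal (norm (X \<omega> t - X \<omega> s)) \<partial>M) \<le> ennreal (\<bar>q t - q s\<bar> + L * (\<bar>t - s\<bar> * C) + c * (sqrt \<bar>t - s\<bar> * gm))"
      if "s \<le> t" "s \<in> {0..T}" "t \<in> {0..T}" for s t
    proof -
      have "integral {0..s} p + integral {s..t} p = integral {0..t} p"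
        by (rule Henstock_Kurzweil_Integration.integral_combine) (use that in \<open>auto intro!: integrable_subinterval_real[OF p(2)]\<close>)
      then have "integral {s..t} p = q t - q s" unfolding q_def by simp
      moreover have "integral {s..t} p \<ge> 0" using p that
        by (intro Henstock_Kurzweil_Integration.integral_nonneg integrable_subinterval_real[OF p(2)]) auto
      ultimately show ?thesis using E[of s t] that by simp
    qed
    have "(\<integral>\<^sup>+\<omega>. ennreal (dist (X \<omega> s) (X \<omega> t)) \<partial>M) \<le> ennreal (\<bar>q t - q s\<bar> + L * (\<bar>t - s\<bar> * C) + c * (sqrt \<bar>t - s\<bar> * gm))"
      using *[of s t] *[of t s] st by (cases "s \<le> t") (auto simp: dist_norm norm_minus_commute abs_minus_commute)
    then show ?thesis unfolding \<mu>_def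
      by (intro wasserstein_distr_le X_M st) (use L_nonneg c_pos C gm_nonneg in auto)
  qed
  show ?thesis unfolding wasserstein_continuous_on_def
  proof (intro conjI ballI mu_w)
    fix t assume t: "t \<in> {0..T}"
    show "((\<lambda>s. wasserstein 1 (\<mu> s) (\<mu> t)) \<longlongrightarrow> 0) (at t within {0..T})"
    proof (rule tendsto_sandwich[OF _ _ tendsto_const])
      show "\<forall>\<^sub>F s in at t within {0..T}. 0 \<le> wasserstein 1 (\<mu> s) (\<mu> t)" using wasserstein_nonneg by (intro always_eventually) auto
      show "\<forall>\<^sub>F s in at t within {0..T}. wasserstein 1 (\<mu> s) (\<mu> t) \<le> \<bar>q t - q s\<bar> + L * (\<bar>t - s\<bar> * C) + c * (sqrt \<bar>t - s\<bar> * gm)"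
        using W1 t by (auto simp: eventually_at intro!: exI[of _ 1])
      have "(q \<longlongrightarrow> q t) (at t within {0..T})" using qc t unfolding continuous_on_def by auto
      then have "((\<lambda>s. \<bar>q t - q s\<bar> + L * (\<bar>t - s\<bar> * C) + c * (sqrt \<bar>t - s\<bar> * gm)) \<longlongrightarrow> \<bar>q t - q t\<bar> + L * (\<bar>t - t\<bar> * C) + c * (sqrt \<bar>t - t\<bar> * gm)) (at t within {0..T})"
        by (intro tendsto_intros)
      then show "((\<lambda>s. \<bar>q t - q s\<bar> + L * (\<bar>t - s\<bar> * C) + c * (sqrt \<bar>t - s\<bar> * gm)) \<longlongrightarrow> 0) (at t within {0..T})" by simp
    qed
  qed
qed

end

section \<open>The weak equation for the law of the process\<close>

text \<open>The nonlinear problem with its own law frozen into the drift: \<open>b\<close> is now a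
  given function, and the only trace of the nonlinearity is that \<nu> is the law of
  \<open>X\<close>.\<close>

locale sde_solution = euler_scheme T \<sigma> L b \<nu> M F W X0
  for T \<sigma> L :: real and b :: "real \<Rightarrow> 'a::euclidean_space \<Rightarrow> 'a" and \<nu> and M :: "'w measure" and F W X0 +
  fixes X :: "'w \<Rightarrow> real \<Rightarrow> 'a"
  assumes X_M: "\<And>t. t \<in> {0..T} \<Longrightarrow> (\<lambda>\<omega>. X \<omega> t) \<in> borel_measurable M"
    and law: "\<And>t. t \<in> {0..T} \<Longrightarrow> \<nu> t = distr M borel (\<lambda>\<omega>. X \<omega> t)"
    and sde: "AE \<omega> in M. continuous_on {0..T} (\<lambda>t. W t \<omega>) \<and> continuous_on {0..T} (X \<omega>) \<and>
      (\<forall>t\<in>{0..T}. X \<omega> t = X0 \<omega> + integral {0..t} (\<lambda>r. b r (X \<omega> r)) + sqrt (2 * \<sigma>) *\<^sub>R (W t \<omega> - W 0 \<omega>))"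
begin

lemma L_nonneg: "L \<ge> 0"
  using lipschitz_on_nonneg[OF b_lip[of 0]] T_pos by auto

text \<open>The threshold \<open>P\<close> for the radius depends on \<omega>, so no fixed ball
  serves almost all paths at once; this is why the radii must tend to infinity later.\<close>

lemma euler_rv_converges:
  "AE \<omega> in M. \<forall>\<epsilon>>0. \<exists>d>0. \<exists>P. \<forall>h R n k. 0 < h \<longrightarrow> h \<le> d \<longrightarrow> R \<ge> P \<longrightarrow> real n * h \<le> T \<longrightarrow> k \<le> n \<longrightarrow>
     norm (X \<omega> (real k * h) - euler_rv h R k \<omega>) \<le> \<epsilon>"
  using sde
proof eventually_elim
  case (elim \<omega>)
  interpret E: euler_analysis T L growth b c "\<lambda>t. W t \<omega>" "X0 \<omega>"
    by unfold_locales (use T_pos reg growth elim in auto)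
  show ?case
  proof (intro allI impI)
    fix \<epsilon> :: real assume "\<epsilon> > 0"
    then have p: "\<epsilon> / (exp (L * T) * T) > 0" using T_pos by simp
    have x: "continuous_on {0..T} (X \<omega>)" using elim by auto
    have s: "X \<omega> t = X0 \<omega> + integral {0..t} (\<lambda>r. b r (X \<omega> r)) + c *\<^sub>R (W t \<omega> - W 0 \<omega>)" if "t \<in> {0..T}" for t
      using elim that unfolding c_def by auto
    have e: "exp (L * T) * (T * (\<epsilon> / (exp (L * T) * T))) = \<epsilon>" using T_pos by simp
    show "\<exists>d>0. \<exists>P. \<forall>h R n k. 0 < h \<longrightarrow> h \<le> d \<longrightarrow> R \<ge> P \<longrightarrow> real n * h \<le> T \<longrightarrow> k \<le> n \<longrightarrow>
        norm (X \<omega> (real k * h) - euler_rv h R k \<omega>) \<le> \<epsilon>"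
      using E.solution_defect[OF x s p] unfolding e euler_rv_def by blast
  qed
qed

text \<open>This plays the part of Ito's formula. Heat flow and shift are expanded separately: the
  heat step errs by \<open>h * sqrt h\<close>, the shift by the square of its length
  \<open>h * growth * (1 + R)\<close>. From \<open>R0\<close> on the support of the gradient lies in
  the ball, so that the projection does not show in \<open>gen\<close>.\<close>

lemma step_error:
  assumes \<phi>: "test_function \<phi>"
  shows "\<exists>C\<ge>0. \<exists>R0>0. \<forall>s h R A. 0 \<le> s \<longrightarrow> h > 0 \<longrightarrow> s + h \<le> T \<longrightarrow> R \<ge> R0 \<longrightarrow> A \<in> borel_measurable (F s) \<longrightarrow>
    \<bar>(\<integral>\<omega>. \<phi> (A \<omega> + h *\<^sub>R b s (cball_proj R (A \<omega>)) + c *\<^sub>R (W (s + h) \<omega> - W s \<omega>)) \<partial>M) - (\<integral>\<omega>. \<phi> (A \<omega>) \<partial>M) - h * (\<integral>\<omega>. gen \<phi> s (A \<omega>) \<partial>M)\<bar>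
      \<le> C * (h * sqrt h + h\<^sup>2 * (1 + R)\<^sup>2)"
proof -
  have bs: "bsmooth \<phi>" by (rule test_function_bsmooth[OF \<phi>])
  obtain K where K: "K \<ge> 0" "\<forall>a\<ge>0. \<forall>x. \<bar>heat a \<phi> x - \<phi> x - a\<^sup>2 / 2 * laplacian \<phi> x\<bar> \<le> K * a ^ 3"
    using heat_taylor[OF bs] by blast
  obtain K2 where K2: "K2 \<ge> 0" "\<And>x w. \<bar>\<phi> (x + w) - \<phi> x - dirder \<phi> w x\<bar> \<le> K2 * (norm w)\<^sup>2"
    using bsmooth_taylor2[OF bs] by blast
  obtain K3 where K3: "K3-lipschitz_on UNIV (laplacian \<phi>)" using bsmooth_lipschitz[OF bsmooth_laplacian[OF bs]] by blast
  have K30: "K3 \<ge> 0" by (rule lipschitz_on_nonneg[OF K3])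
  obtain A0 where A0: "A0 \<ge> 0" "\<And>x. \<bar>\<phi> x\<bar> \<le> A0" using bsmoothD(1)[OF bs] by blast
  note [measurable] = bsmoothD(2)[OF bs]
  obtain R0 where R0: "R0 > 0" "\<And>x. norm x \<ge> R0 \<Longrightarrow> grad \<phi> x = 0" using test_grad_support[OF \<phi>] by blast
  obtain \<Lambda> A1 where G: "\<And>r. r \<in> {0..T} \<Longrightarrow> \<Lambda>-lipschitz_on UNIV (gen \<phi> r)" "\<And>r x. r \<in> {0..T} \<Longrightarrow> \<bar>gen \<phi> r x\<bar> \<le> A1"
    using gen_test_lipschitz[OF \<phi>] by blast
  define C where "C = K * c ^ 3 + (K2 * growth\<^sup>2 + \<sigma> * K3 * growth)"
  have C0: "C \<ge> 0" unfolding C_def using K K2 K30 c_pos sigma_pos growth by auto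
  have "\<bar>(\<integral>\<omega>. \<phi> (A \<omega> + h *\<^sub>R b s (cball_proj R (A \<omega>)) + c *\<^sub>R (W (s + h) \<omega> - W s \<omega>)) \<partial>M) - (\<integral>\<omega>. \<phi> (A \<omega>) \<partial>M) - h * (\<integral>\<omega>. gen \<phi> s (A \<omega>) \<partial>M)\<bar>
      \<le> C * (h * sqrt h + h\<^sup>2 * (1 + R)\<^sup>2)"
    if s: "0 \<le> s" "s + h \<le> T" and h: "h > 0" and R: "R \<ge> R0" and AF[measurable]: "A \<in> borel_measurable (F s)" for s h R A
  proof -
    have R1: "R \<ge> 0" using R R0 by linarith
    have sT: "s \<in> {0..T}" "s + h \<in> {0..T}" using s h by auto
    have AM[measurable]: "A \<in> borel_measurable M" by (rule F_M[OF sT(1) AF])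
    have [measurable]: "cball_proj R \<in> borel_measurable borel" by (rule lipschitz_measurable[OF cball_proj_lipschitz[OF R1]])
    have [measurable]: "b s \<in> borel_measurable borel" by (rule b_measurable[OF sT(1)])
    have [measurable]: "gen \<phi> s \<in> borel_measurable borel" by (rule lipschitz_measurable[OF G(1)[OF sT(1)]])
    define v where "v x = h *\<^sub>R b s (cball_proj R x)" for x
    have [measurable]: "v \<in> borel_measurable borel" unfolding v_def[abs_def] by measurable
    let ?a = "c * sqrt h"
    have a0: "?a \<ge> 0" using c_pos h by simp
    have [measurable]: "heat ?a \<phi> \<in> borel_measurable borel" by (rule bsmoothD(2)[OF heat_bsmooth(1)[OF bs]])
    have vn: "norm (v x) \<le> h * (growth * (1 + R))" for x
      unfolding v_def using clamped_drift(2)[OF R1 sT(1), of x] h by simp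
    have pw: "\<bar>heat ?a \<phi> (x + v x) - \<phi> x - h * gen \<phi> s x\<bar> \<le> C * (h * sqrt h + h\<^sup>2 * (1 + R)\<^sup>2)" for x
    proof -
      have "?a\<^sup>2 / 2 = \<sigma> * h" using h by (simp add: power_mult_distrib c_sq)
      then have 1: "\<bar>heat ?a \<phi> (x + v x) - \<phi> (x + v x) - \<sigma> * h * laplacian \<phi> (x + v x)\<bar> \<le> K * ?a ^ 3"
        using K(2)[rule_format, OF a0, of "x + v x"] by simp
      have "dirder \<phi> (v x) x = h * (grad \<phi> x \<bullet> b s (cball_proj R x))"
        unfolding grad_inner[OF bsmoothD(3)[OF bs], symmetric] v_def by simp
      then have 2: "\<bar>\<phi> (x + v x) - \<phi> x - h * (grad \<phi> x \<bullet> b s (cball_proj R x))\<bar> \<le> K2 * (norm (v x))\<^sup>2"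
        using K2(2)[of x "v x"] by simp
      \<comment> \<open>The heat step was expanded at the shifted point; its Laplacian is moved back
        to \<open>x\<close>.\<close>
      have "\<bar>laplacian \<phi> (x + v x) - laplacian \<phi> x\<bar> \<le> K3 * norm (v x)"
        using lipschitz_onD[OF K3, of "x + v x" x] by (simp add: dist_norm)
      then have "\<sigma> * h * \<bar>laplacian \<phi> (x + v x) - laplacian \<phi> x\<bar> \<le> \<sigma> * h * (K3 * norm (v x))"
        using sigma_pos h by (intro mult_left_mono) auto
      then have 3: "\<bar>\<sigma> * h * laplacian \<phi> (x + v x) - \<sigma> * h * laplacian \<phi> x\<bar> \<le> \<sigma> * h * (K3 * norm (v x))"
        using sigma_pos h by (simp add: right_diff_distrib[symmetric] abs_mult)
      have g: "h * gen \<phi> s x = h * (grad \<phi> x \<bullet> b s (cball_proj R x)) + \<sigma> * h * laplacian \<phi> x"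
        by (subst gen_clamp[OF _ R0(1) R]) (auto intro: R0(2) simp: algebra_simps)
      have "\<bar>heat ?a \<phi> (x + v x) - \<phi> x - h * gen \<phi> s x\<bar> \<le> K * ?a ^ 3 + K2 * (norm (v x))\<^sup>2 + \<sigma> * h * (K3 * norm (v x))"
        unfolding g using 1 2 3 by linarith
      also have "\<dots> \<le> K * ?a ^ 3 + K2 * (h * (growth * (1 + R)))\<^sup>2 + \<sigma> * h * (K3 * (h * (growth * (1 + R))))"
        using K2(1) K30 sigma_pos h vn[of x] by (intro add_mono mult_left_mono power_mono order_refl) auto
      also have "\<dots> = K * c ^ 3 * (h * sqrt h) + (K2 * growth\<^sup>2) * (h\<^sup>2 * (1 + R)\<^sup>2) + (\<sigma> * K3 * growth) * (h\<^sup>2 * (1 + R))"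
        using h by (simp add: power3_eq_cube power2_eq_square mult_ac)
      also have "\<dots> \<le> C * (h * sqrt h) + (K2 * growth\<^sup>2) * (h\<^sup>2 * (1 + R)\<^sup>2) + (\<sigma> * K3 * growth) * (h\<^sup>2 * (1 + R)\<^sup>2)"
      proof -
        have "K * c ^ 3 \<le> C" unfolding C_def using K2 K30 sigma_pos growth by auto
        moreover have "(1 + R) * 1 \<le> (1 + R)\<^sup>2" unfolding power2_eq_square using R1 by (intro mult_left_mono) auto
        ultimately show ?thesis using h K30 sigma_pos growth by (intro add_mono mult_left_mono mult_right_mono order_refl) auto
      qed
      also have "\<dots> = C * (h * sqrt h) + (K2 * growth\<^sup>2 + \<sigma> * K3 * growth) * (h\<^sup>2 * (1 + R)\<^sup>2)" by (simp add: algebra_simps)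
      also have "\<dots> \<le> C * (h * sqrt h) + C * (h\<^sup>2 * (1 + R)\<^sup>2)"
        unfolding C_def using K c_pos by (intro add_left_mono mult_right_mono) auto
      finally show ?thesis by (simp add: distrib_left)
    qed
    have m: "(\<lambda>\<omega>. A \<omega> + v (A \<omega>)) \<in> borel_measurable (F s)" by measurable
    have st: "(\<integral>\<omega>. \<phi> (A \<omega> + v (A \<omega>) + c *\<^sub>R (W (s + h) \<omega> - W s \<omega>)) \<partial>M) = (\<integral>\<omega>. heat ?a \<phi> (A \<omega> + v (A \<omega>)) \<partial>M)"
      using brownian_step[OF sT _ m bsmoothD(2)[OF bs] A0(2), of c] h by simp
    have i: "integrable M (\<lambda>\<omega>. heat ?a \<phi> (A \<omega> + v (A \<omega>)))" "integrable M (\<lambda>\<omega>. \<phi> (A \<omega>))" "integrable M (\<lambda>\<omega>. gen \<phi> s (A \<omega>))"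
      using heat_bound[OF bsmoothD(2)[OF bs] A0(2), of ?a] A0(2) G(2)[OF sT(1)]
      by (auto intro!: integrable_const_bound[where B = "max A0 A1"] simp: le_max_iff_disj)
    have "\<bar>(\<integral>\<omega>. heat ?a \<phi> (A \<omega> + v (A \<omega>)) \<partial>M) - (\<integral>\<omega>. \<phi> (A \<omega>) \<partial>M) - h * (\<integral>\<omega>. gen \<phi> s (A \<omega>) \<partial>M)\<bar>
       = \<bar>\<integral>\<omega>. heat ?a \<phi> (A \<omega> + v (A \<omega>)) - \<phi> (A \<omega>) - h * gen \<phi> s (A \<omega>) \<partial>M\<bar>"
      using i by simp
    also have "\<dots> \<le> (\<integral>\<omega>. \<bar>heat ?a \<phi> (A \<omega> + v (A \<omega>)) - \<phi> (A \<omega>) - h * gen \<phi> s (A \<omega>)\<bar> \<partial>M)"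
      by (rule integral_abs_bound)
    also have "\<dots> \<le> (\<integral>\<omega>. C * (h * sqrt h + h\<^sup>2 * (1 + R)\<^sup>2) \<partial>M)"
      using i pw by (intro integral_mono integrable_abs Bochner_Integration.integrable_diff integrable_mult_right) auto
    finally show ?thesis using st unfolding v_def by (simp add: prob_space)
  qed
  then show ?thesis using C0 R0(1) by blast
qed

lemma weak_formulation: "weak_fokker_planck T \<sigma> b \<nu>"
proof -
  have T0: "0 \<in> {0..T}" using T_pos by auto
  have main: "(\<integral>x. \<phi> x \<partial>\<nu> t) - (\<integral>x. \<phi> x \<partial>\<nu> 0) = integral {0..t} (\<lambda>r. \<integral>x. gen \<phi> r x \<partial>\<nu> r)"
    if \<phi>: "test_function \<phi>" and t: "0 < t" "t \<le> T" for \<phi> t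
  proof -
    have bs: "bsmooth \<phi>" by (rule test_function_bsmooth[OF \<phi>])
    note [measurable] = bsmoothD(2)[OF bs]
    obtain A0 where A0: "A0 \<ge> 0" "\<And>x. \<bar>\<phi> x\<bar> \<le> A0" using bsmoothD(1)[OF bs] by blast
    obtain \<kappa> where \<kappa>: "\<kappa>-lipschitz_on UNIV \<phi>" using bsmooth_lipschitz[OF bs] by blast
    obtain \<Lambda> A where G: "\<And>r. r \<in> {0..T} \<Longrightarrow> \<Lambda>-lipschitz_on UNIV (gen \<phi> r)" "\<And>r x. r \<in> {0..T} \<Longrightarrow> \<bar>gen \<phi> r x\<bar> \<le> A"
      using gen_test_lipschitz[OF \<phi>] by blast
    have \<Lambda>0: "\<Lambda> \<ge> 0" by (rule lipschitz_on_nonneg[OF G(1)[OF T0]])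
    have gm: "gen \<phi> r \<in> borel_measurable borel" if "r \<in> {0..T}" for r
      by (rule lipschitz_measurable[OF G(1)[OF that]])
    obtain C R0 where CR: "C \<ge> 0" "R0 > 0" and step: "\<forall>s h R A. 0 \<le> s \<longrightarrow> h > 0 \<longrightarrow> s + h \<le> T \<longrightarrow> R \<ge> R0 \<longrightarrow> A \<in> borel_measurable (F s) \<longrightarrow>
      \<bar>(\<integral>\<omega>. \<phi> (A \<omega> + h *\<^sub>R b s (cball_proj R (A \<omega>)) + c *\<^sub>R (W (s + h) \<omega> - W s \<omega>)) \<partial>M) - (\<integral>\<omega>. \<phi> (A \<omega>) \<partial>M) - h * (\<integral>\<omega>. gen \<phi> s (A \<omega>) \<partial>M)\<bar>
      \<le> C * (h * sqrt h + h\<^sup>2 * (1 + R)\<^sup>2)"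
      using step_error[OF \<phi>] by (elim exE conjE) (rule that)
    \<comment> \<open>\<open>Suc n\<close> steps avoid a division by 0. The radius below is of order
      \<open>h\<close> to the power -1/8, slow enough for \<open>h\<close> times the square of
      \<open>1 + R\<close> to vanish.\<close>
    define h where "h n = t / real (Suc n)" for n
    define R where "R n = real (Suc n) powr (1/8)" for n
    define Q where "Q r = (\<integral>x. gen \<phi> r x \<partial>\<nu> r)" for r
    let ?g = "\<lambda>n k. gen \<phi> (real k * h n)" and ?e = "\<lambda>n. euler_rv (h n) (R n)" and ?X = "\<lambda>n k \<omega>. X \<omega> (real k * h n)"
    have h: "h n > 0" "real (Suc n) * h n = t" for n unfolding h_def using t by (simp_all del: of_nat_Suc)
    have R1: "R n \<ge> 0" for n unfolding R_def by simp
    have h0: "h \<longlonglongrightarrow> 0" unfolding h_def[abs_def] by (rule LIMSEQ_Suc[OF lim_const_over_n])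
    have Rinf: "filterlim R at_top sequentially" unfolding R_def[abs_def] by real_asymp
    have gr: "real k * h n \<in> {0..T}" "real k * h n \<le> T" if "k \<le> Suc n" for k n
      using grid_le[OF that, of "h n" T] h[of n] t by auto
    have em: "?e n k \<in> borel_measurable (F (real k * h n))" "?e n k \<in> borel_measurable M" if "k \<le> Suc n" for k n
      using euler_rv_F[OF R1 h(1) gr(2)[OF that]] euler_rv_M[OF R1 h(1) gr(2)[OF that]] by auto
    define I where "I n k = (\<integral>\<omega>. \<phi> (?e n k \<omega>) \<partial>M)" for n k
    define Ge where "Ge n k = (\<integral>\<omega>. ?g n k (?e n k \<omega>) \<partial>M)" for n k
    \<comment> \<open>Closeness is uniform over all grid points of one path, since whole Riemann
      sums are compared.\<close>
    have conv: "AE \<omega> in M. \<forall>\<epsilon>>0. \<forall>\<^sub>F n in sequentially. \<forall>k\<le>Suc n. norm (?X n k \<omega> - ?e n k \<omega>) \<le> \<epsilon>"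
      using euler_rv_converges
    proof eventually_elim
      case (elim \<omega>)
      show ?case
      proof (intro allI impI)
        fix \<epsilon> :: real assume "\<epsilon> > 0"
        then obtain d P where d: "d > 0" "\<forall>h R n k. 0 < h \<longrightarrow> h \<le> d \<longrightarrow> R \<ge> P \<longrightarrow> real n * h \<le> T \<longrightarrow> k \<le> n \<longrightarrow>
          norm (X \<omega> (real k * h) - euler_rv h R k \<omega>) \<le> \<epsilon>" using elim by blast
        show "\<forall>\<^sub>F n in sequentially. \<forall>k\<le>Suc n. norm (?X n k \<omega> - ?e n k \<omega>) \<le> \<epsilon>"
          using order_tendstoD(2)[OF h0 d(1)] filterlim_at_top[THEN iffD1, OF Rinf, rule_format, of P]
        proof eventually_elim
          case (elim n)
          have "real (Suc n) * h n \<le> T" by (rule gr) simp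
          then show ?case using d(2) elim h(1)[of n] by (blast intro: less_imp_le)
        qed
      qed
    qed
    \<comment> \<open>Telescoping the one-step errors: there are \<open>t / h\<close> of them, each
      of order \<open>h * sqrt h + h^2 * (1 + R)^2\<close>.\<close>
    have 1: "(\<lambda>n. I n (Suc n) - I n 0 - (\<Sum>k<Suc n. h n * Ge n k)) \<longlonglongrightarrow> 0"
    proof (rule Lim_null_comparison)
      show "(\<lambda>n. C * (t * (sqrt (h n) + h n * (1 + R n)\<^sup>2))) \<longlonglongrightarrow> 0"
      proof -
        have "(\<lambda>n. sqrt (h n) + h n * (1 + R n)\<^sup>2) \<longlonglongrightarrow> 0" unfolding h_def R_def using t by real_asymp
        from tendsto_mult_left[OF tendsto_mult_left[OF this]] show ?thesis by simp
      qed
      show "\<forall>\<^sub>F n in sequentially. norm (I n (Suc n) - I n 0 - (\<Sum>k<Suc n. h n * Ge n k)) \<le> C * (t * (sqrt (h n) + h n * (1 + R n)\<^sup>2))"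
        using filterlim_at_top[THEN iffD1, OF Rinf, rule_format, of R0]
      proof eventually_elim
        case (elim n)
        have st: "\<bar>I n (Suc k) - I n k - h n * Ge n k\<bar> \<le> C * (h n * sqrt (h n) + (h n)\<^sup>2 * (1 + R n)\<^sup>2)" if k: "k < Suc n" for k
        proof -
          have "real k * h n + h n = real (Suc k) * h n" by (simp add: algebra_simps)
          moreover have "real (Suc k) * h n \<le> T" by (rule gr) (use k in simp)
          moreover have "0 \<le> real k * h n" using h(1)[of n] by simp
          ultimately show ?thesis
            using step[rule_format, of "real k * h n" "h n" R0 , OF _ h(1)] step[rule_format, of "real k * h n" "h n" "R n" "?e n k", OF _ h(1) _ elim em(1)] k
            unfolding I_def Ge_def euler_rv_def euler_path.simps by simp
        qed
        have "I n (Suc n) - I n 0 = (\<Sum>k<Suc n. I n (Suc k) - I n k)" by (rule sum_lessThan_telescope[symmetric])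
        then have "I n (Suc n) - I n 0 - (\<Sum>k<Suc n. h n * Ge n k) = (\<Sum>k<Suc n. I n (Suc k) - I n k - h n * Ge n k)"
          by (simp only: sum_subtractf)
        then have "norm (I n (Suc n) - I n 0 - (\<Sum>k<Suc n. h n * Ge n k)) \<le> (\<Sum>k<Suc n. \<bar>I n (Suc k) - I n k - h n * Ge n k\<bar>)"
          by (simp only: real_norm_def sum_abs)
        also have "\<dots> \<le> (\<Sum>k<Suc n. C * (h n * sqrt (h n) + (h n)\<^sup>2 * (1 + R n)\<^sup>2))"
          by (rule sum_mono) (use st in auto)
        also have "\<dots> = C * ((real (Suc n) * h n) * (sqrt (h n) + h n * (1 + R n)\<^sup>2))"
          by (simp only: sum_constant card_lessThan power2_eq_square distrib_left mult_ac)
        finally show ?case unfolding h(2) .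
      qed
    qed
    \<comment> \<open>In the Riemann sum of the generator the scheme is replaced by the process. The
      difference vanishes for almost every \<omega> and is dominated by
      \<open>t * (2 * A)\<close>.\<close>
    have 2: "(\<lambda>n. (\<Sum>k<Suc n. h n * Ge n k) - (\<Sum>k<Suc n. h n * Q (real k * h n))) \<longlonglongrightarrow> 0"
    proof -
      define Z where "Z n \<omega> = (\<Sum>k<Suc n. h n * (?g n k (?e n k \<omega>) - ?g n k (?X n k \<omega>)))" for n \<omega>
      have mm: "(\<lambda>\<omega>. ?g n k (?e n k \<omega>)) \<in> borel_measurable M"
        "(\<lambda>\<omega>. ?g n k (?X n k \<omega>)) \<in> borel_measurable M" if "k \<le> Suc n" for k n
        using measurable_compose[OF em(2)[OF that] gm[OF gr(1)[OF that]]] measurable_compose[OF X_M[OF gr(1)[OF that]] gm[OF gr(1)[OF that]]] by auto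
      have ii: "integrable M (\<lambda>\<omega>. ?g n k (?e n k \<omega>))"
        "integrable M (\<lambda>\<omega>. ?g n k (?X n k \<omega>))" if "k \<le> Suc n" for k n
        using G(2)[OF gr(1)[OF that]] mm[OF that] by (auto intro!: integrable_const_bound[where B = A])
      have Zb: "norm (Z n \<omega>) \<le> t * B" if "\<And>k. k < Suc n \<Longrightarrow> \<bar>?g n k (?e n k \<omega>) - ?g n k (?X n k \<omega>)\<bar> \<le> B" for n \<omega> B
      proof -
        have "norm (Z n \<omega>) \<le> (\<Sum>k<Suc n. \<bar>h n * (?g n k (?e n k \<omega>) - ?g n k (?X n k \<omega>))\<bar>)"
          unfolding Z_def real_norm_def by (rule sum_abs)
        also have "\<dots> \<le> (\<Sum>k<Suc n. h n * B)"
          by (rule sum_mono) (use that h(1)[of n] in \<open>auto simp: abs_mult intro!: mult_left_mono\<close>)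
        also have "\<dots> = (real (Suc n) * h n) * B" by (simp only: sum_constant card_lessThan mult.assoc)
        finally show ?thesis unfolding h(2) .
      qed
      have "(\<lambda>n. \<integral>\<omega>. Z n \<omega> \<partial>M) \<longlonglongrightarrow> (\<integral>\<omega>. 0 \<partial>M)"
      proof (rule integral_dominated_convergence[where w = "\<lambda>_. t * (2 * A)"])
        show "Z n \<in> borel_measurable M" for n
          unfolding Z_def[abs_def] using mm by (intro borel_measurable_sum borel_measurable_times borel_measurable_diff) auto
        show "AE \<omega> in M. norm (Z n \<omega>) \<le> t * (2 * A)" for n
        proof (intro AE_I2 Zb)
          fix k \<omega> assume k: "k < Suc n"
          have r: "real k * h n \<in> {0..T}" by (rule gr) (use k in simp)
          show "\<bar>?g n k (?e n k \<omega>) - ?g n k (?X n k \<omega>)\<bar> \<le> 2 * A"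
            using G(2)[OF r, of "?e n k \<omega>"] G(2)[OF r, of "?X n k \<omega>"] by linarith
        qed
        show "AE \<omega> in M. (\<lambda>n. Z n \<omega>) \<longlonglongrightarrow> 0"
          using conv
        proof eventually_elim
          case (elim \<omega>)
          show ?case
          proof (rule tendstoI)
            fix e :: real assume e: "e > 0"
            let ?d = "e / (2 * t * (\<Lambda> + 1))"
            have d: "?d > 0" using e t \<Lambda>0 by simp
            show "\<forall>\<^sub>F n in sequentially. dist (Z n \<omega>) 0 < e"
              using elim[rule_format, OF d]
            proof eventually_elim
              case (elim n)
              have "norm (Z n \<omega>) \<le> t * (\<Lambda> * ?d)"
              proof (rule Zb)
                fix k assume k: "k < Suc n"
                have r: "real k * h n \<in> {0..T}" by (rule gr) (use k in simp)
                have "\<bar>?g n k (?e n k \<omega>) - ?g n k (?X n k \<omega>)\<bar> \<le> \<Lambda> * norm (?X n k \<omega> - ?e n k \<omega>)"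
                  using lipschitz_onD[OF G(1)[OF r], of "?e n k \<omega>" "?X n k \<omega>"] by (simp add: dist_norm norm_minus_commute)
                also have "\<dots> \<le> \<Lambda> * ?d" using elim k \<Lambda>0 by (intro mult_left_mono) auto
                finally show "\<bar>?g n k (?e n k \<omega>) - ?g n k (?X n k \<omega>)\<bar> \<le> \<Lambda> * ?d" .
              qed
              also have "t * (\<Lambda> * ?d) \<le> t * ((\<Lambda> + 1) * ?d)" using t d by (intro mult_left_mono mult_right_mono) auto
              also have "(\<Lambda> + 1) * ?d = e / (2 * t)" using \<Lambda>0 by simp
              also have "t * (e / (2 * t)) = e / 2" using t by simp
              finally show ?case using e by simp
            qed
          qed
        qed
      qed auto
      moreover have "(\<integral>\<omega>. Z n \<omega> \<partial>M) = (\<Sum>k<Suc n. h n * Ge n k) - (\<Sum>k<Suc n. h n * Q (real k * h n))" for n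
      proof -
        have q: "Q (real k * h n) = (\<integral>\<omega>. ?g n k (?X n k \<omega>) \<partial>M)" if "k \<le> Suc n" for k
        proof -
          have "Q (real k * h n) = (\<integral>x. ?g n k x \<partial>distr M borel (\<lambda>\<omega>. ?X n k \<omega>))"
            unfolding Q_def by (subst law[OF gr(1)[OF that]]) simp
          also have "\<dots> = (\<integral>\<omega>. ?g n k (?X n k \<omega>) \<partial>M)"
            by (rule integral_distr[OF X_M[OF gr(1)[OF that]] gm[OF gr(1)[OF that]]])
          finally show ?thesis .
        qed
        have "(\<integral>\<omega>. Z n \<omega> \<partial>M) = (\<Sum>k<Suc n. h n * (Ge n k - Q (real k * h n)))"
          unfolding Z_def Ge_def using ii q
          by (subst Bochner_Integration.integral_sum) (auto intro!: sum.cong simp del: sum.lessThan_Suc)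
        then show ?thesis by (simp only: right_diff_distrib sum_subtractf)
      qed
      ultimately show ?thesis by simp
    qed
    have 3: "(\<lambda>n. \<Sum>k<Suc n. h n * Q (real k * h n)) \<longlonglongrightarrow> integral {0..t} Q"
    proof -
      have "continuous_on {0..t} Q" using gen_test_continuous[OF \<phi>] t unfolding Q_def by (rule_tac continuous_on_subset) auto
      from LIMSEQ_Suc[OF riemann_sum_tendsto[OF this less_imp_le[OF t(1)]]] show ?thesis unfolding h_def by simp
    qed
    have 4: "(\<lambda>n. I n (Suc n)) \<longlonglongrightarrow> (\<integral>x. \<phi> x \<partial>\<nu> t)"
    proof -
      have tT: "t \<in> {0..T}" using t by auto
      have "(\<lambda>n. I n (Suc n)) \<longlonglongrightarrow> (\<integral>\<omega>. \<phi> (X \<omega> t) \<partial>M)"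
        unfolding I_def
      proof (rule integral_dominated_convergence[where w = "\<lambda>_. A0"])
        show "(\<lambda>\<omega>. \<phi> (X \<omega> t)) \<in> borel_measurable M" using X_M[OF tT] by measurable
        show "(\<lambda>\<omega>. \<phi> (?e n (Suc n) \<omega>)) \<in> borel_measurable M" for n using em(2)[OF order_refl] by measurable
        show "AE \<omega> in M. (\<lambda>n. \<phi> (?e n (Suc n) \<omega>)) \<longlonglongrightarrow> \<phi> (X \<omega> t)"
          using conv
        proof eventually_elim
          case (elim \<omega>)
          have "(\<lambda>n. ?e n (Suc n) \<omega>) \<longlonglongrightarrow> X \<omega> t"
          proof (rule tendstoI)
            fix e :: real assume e: "e > 0"
            show "\<forall>\<^sub>F n in sequentially. dist (?e n (Suc n) \<omega>) (X \<omega> t) < e"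
              using elim[rule_format, OF half_gt_zero[OF e]]
            proof eventually_elim
              case (elim n)
              have "norm (X \<omega> (real (Suc n) * h n) - ?e n (Suc n) \<omega>) \<le> e / 2" using elim by blast
              then show ?case unfolding h(2) using e by (simp add: dist_norm norm_minus_commute)
            qed
          qed
          moreover have "isCont \<phi> (X \<omega> t)"
            using lipschitz_on_continuous_on[OF \<kappa>] by (simp add: continuous_on_eq_continuous_at)
          ultimately show ?case by (rule isCont_tendsto_compose[rotated])
        qed
      qed (use A0 in auto)
      moreover have "(\<integral>x. \<phi> x \<partial>\<nu> t) = (\<integral>\<omega>. \<phi> (X \<omega> t) \<partial>M)"
        unfolding law[OF tT] by (rule integral_distr) (use X_M[OF tT] in auto)
      ultimately show ?thesis by simp
    qed
    have 5: "I n 0 = (\<integral>x. \<phi> x \<partial>\<nu> 0)" for n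
    proof -
      have "(\<integral>x. \<phi> x \<partial>\<nu> 0) = (\<integral>\<omega>. \<phi> (X \<omega> 0) \<partial>M)"
        unfolding law[OF T0] by (rule integral_distr) (use X_M[OF T0] in auto)
      also have "\<dots> = I n 0"
        unfolding I_def euler_rv_def
      proof (rule integral_cong_AE)
        show "AE \<omega> in M. \<phi> (X \<omega> 0) = \<phi> (euler_path b c (h n) (R n) (X0 \<omega>) (\<lambda>t. W t \<omega>) 0)"
          using sde by eventually_elim (use T0 in auto)
      qed (use X_M[OF T0] F_M[OF T0 X0] in auto)
      finally show ?thesis by simp
    qed
    have "(\<lambda>n. I n (Suc n) - I n 0 - (\<Sum>k<Suc n. h n * Ge n k) + ((\<Sum>k<Suc n. h n * Ge n k) - (\<Sum>k<Suc n. h n * Q (real k * h n)))) \<longlonglongrightarrow> 0 + 0"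
      by (rule tendsto_add[OF 1 2])
    moreover have "I n (Suc n) - I n 0 - (\<Sum>k<Suc n. h n * Ge n k) + ((\<Sum>k<Suc n. h n * Ge n k) - (\<Sum>k<Suc n. h n * Q (real k * h n)))
       = I n (Suc n) - (\<integral>x. \<phi> x \<partial>\<nu> 0) - (\<Sum>k<Suc n. h n * Q (real k * h n))" for n
      unfolding 5 by simp
    ultimately have "(\<lambda>n. I n (Suc n) - (\<integral>x. \<phi> x \<partial>\<nu> 0) - (\<Sum>k<Suc n. h n * Q (real k * h n))) \<longlonglongrightarrow> 0"
      by (simp only: add_0)
    moreover have "(\<lambda>n. I n (Suc n) - (\<integral>x. \<phi> x \<partial>\<nu> 0) - (\<Sum>k<Suc n. h n * Q (real k * h n))) \<longlonglongrightarrow> (\<integral>x. \<phi> x \<partial>\<nu> t) - (\<integral>x. \<phi> x \<partial>\<nu> 0) - integral {0..t} Q"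
      by (intro tendsto_diff 4 3 tendsto_const)
    ultimately have "(\<integral>x. \<phi> x \<partial>\<nu> t) - (\<integral>x. \<phi> x \<partial>\<nu> 0) - integral {0..t} Q = 0"
      by (rule LIMSEQ_unique[rotated])
    then show ?thesis unfolding Q_def by simp
  qed
  show ?thesis unfolding weak_fokker_planck_def gen_def[symmetric]
  proof (intro allI impI ballI)
    fix \<phi> t assume \<phi>: "test_function (\<phi> :: 'a \<Rightarrow> real)" and t: "t \<in> {0..T}"
    have "(\<lambda>r. \<integral>x. gen \<phi> r x \<partial>\<nu> r) absolutely_integrable_on {0..t}"
      using t by (intro absolutely_integrable_continuous_real continuous_on_subset[OF gen_test_continuous[OF \<phi>]]) auto
    from set_lebesgue_integral_eq_integral(2)[OF this]
    show "(\<integral>x. \<phi> x \<partial>\<nu> t) = (\<integral>x. \<phi> x \<partial>\<nu> 0) + (LINT s:{0..t}|lebesgue. \<integral>x. gen \<phi> s x \<partial>\<nu> s)"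
      using main[OF \<phi>, of t] t by (cases "t = 0") auto
  qed
qed

end

section \<open>Uniqueness\<close>

lemma eventually_dyadic:
  fixes t d P :: real
  assumes "d > 0"
  shows "\<forall>\<^sub>F i in sequentially. t / 2 ^ i < d \<and> (2 ^ i) powr (1/8) \<ge> P"
proof -
  have "(\<lambda>i. t / 2 ^ i) \<longlonglongrightarrow> 0" by real_asymp
  moreover have "filterlim (\<lambda>i. (2 ^ i :: real) powr (1/8)) at_top sequentially" by real_asymp
  ultimately show ?thesis using assms by (intro eventually_conj order_tendstoD) (auto simp: filterlim_at_top)
qed

text \<open>Dyadic step sizes, because only nested grids are compared by \<open>euler_refinement\<close>.\<close>

lemma (in fp_brownian) limit_rv:
  assumes t: "0 < t" "t \<le> T"
  shows "\<exists>\<xi>\<in>borel_measurable M. \<nu> t = distr M borel \<xi> \<and>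
    (AE \<omega> in M. (\<lambda>i. euler_rv (t / 2 ^ i) ((2 ^ i) powr (1/8)) (2 ^ i) \<omega>) \<longlonglongrightarrow> \<xi> \<omega>)"
proof -
  have tT: "t \<in> {0..T}" using t by auto
  define u where "u i \<omega> = euler_rv (t / 2 ^ i) ((2 ^ i) powr (1/8)) (2 ^ i) \<omega>" for i \<omega>
  have um[measurable]: "u i \<in> borel_measurable M" for i
    unfolding u_def[abs_def] by (rule F_M[OF _ euler_rv_F]) (use t in auto)
  \<comment> \<open>\<open>lim\<close> is total, so \<xi> is measurable without restriction to the
    set of convergence; its values on the remaining null set do not matter.\<close>
  define \<xi> where "\<xi> \<omega> = lim (\<lambda>i. u i \<omega>)" for \<omega>
  have \<xi>m[measurable]: "\<xi> \<in> borel_measurable M" unfolding \<xi>_def[abs_def] by measurable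
  have Wc: "AE \<omega> in M. continuous_on {0..T} (\<lambda>t. W t \<omega>)" using bm unfolding brownian_motion_on_def by auto
  have conv: "AE \<omega> in M. (\<lambda>i. u i \<omega>) \<longlonglongrightarrow> \<xi> \<omega>"
    using Wc
  proof eventually_elim
    case (elim \<omega>)
    interpret E: euler_analysis T L growth b c "\<lambda>t. W t \<omega>" "X0 \<omega>"
      by unfold_locales (use T_pos reg growth elim in auto)
    have "Cauchy (\<lambda>i. u i \<omega>)"
    proof (rule CauchyI')
      fix e :: real assume e: "e > 0"
      have p: "e / (2 * exp (L * T) * T) > 0" using e T_pos by simp
      obtain d where d: "d > 0" "\<forall>h R R' n m. 0 < h \<longrightarrow> h \<le> d \<longrightarrow> R \<ge> E.pb \<longrightarrow> R' \<ge> E.pb \<longrightarrow> m > 0 \<longrightarrow> real n * h \<le> T \<longrightarrow>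
        norm (E.e (h / real m) R' (m * n) - E.e h R n) \<le> exp (L * T) * (T * (e / (2 * exp (L * T) * T)))"
        using E.euler_refinement[OF p] by (elim exE conjE) (rule that)
      obtain N where N: "\<And>i. i \<ge> N \<Longrightarrow> t / 2 ^ i < d \<and> (2 ^ i) powr (1/8) \<ge> E.pb"
        using eventually_dyadic[OF d(1), of t E.pb] unfolding eventually_sequentially by blast
      show "\<exists>N. \<forall>m\<ge>N. \<forall>n>m. dist (u m \<omega>) (u n \<omega>) < e"
      proof (intro exI[of _ N] allI impI)
        fix m n :: nat assume mn: "m \<ge> N" "n > m"
        obtain j where j: "n = m + j" using mn less_imp_add_positive by blast
        have "norm (E.e ((t / 2 ^ m) / real (2 ^ j)) ((2 ^ n) powr (1/8)) (2 ^ j * 2 ^ m) - E.e (t / 2 ^ m) ((2 ^ m) powr (1/8)) (2 ^ m))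
            \<le> exp (L * T) * (T * (e / (2 * exp (L * T) * T)))"
          by (rule d(2)[rule_format]) (use N[of m] N[of n] mn t in auto)
        also have "\<dots> = e / 2" using T_pos by simp
        finally have "norm (u n \<omega> - u m \<omega>) \<le> e / 2"
          unfolding u_def euler_rv_def j by (simp add: power_add mult.commute)
        then show "dist (u m \<omega>) (u n \<omega>) < e" using e by (simp add: dist_norm norm_minus_commute)
      qed
    qed
    then show ?case unfolding \<xi>_def by (simp add: Cauchy_convergent_iff convergent_LIMSEQ_iff)
  qed
  \<comment> \<open>Both integrals are limits of the expectation of \<open>f\<close> along the
    dyadic schemes: one by pathwise convergence, the other by \<open>euler_rv_limit\<close>.\<close>
  have "\<nu> t = distr M borel \<xi>"
  proof (rule measure_eqI_bounded_lipschitz)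
    fix f :: "'a \<Rightarrow> real" and K assume f: "K-lipschitz_on UNIV f" "\<And>x. 0 \<le> f x \<and> f x \<le> 1"
    have [measurable]: "f \<in> borel_measurable borel" by (rule lipschitz_measurable[OF f(1)])
    have "(\<lambda>i. \<integral>\<omega>. f (u i \<omega>) \<partial>M) \<longlonglongrightarrow> (\<integral>\<omega>. f (\<xi> \<omega>) \<partial>M)"
    proof (rule integral_dominated_convergence[where w = "\<lambda>_. 1"])
      show "AE \<omega> in M. (\<lambda>i. f (u i \<omega>)) \<longlonglongrightarrow> f (\<xi> \<omega>)"
        using conv
      proof eventually_elim
        case (elim \<omega>)
        have "isCont f (\<xi> \<omega>)" using lipschitz_on_continuous_on[OF f(1)] by (simp add: continuous_on_eq_continuous_at)
        then show ?case using elim by (rule isCont_tendsto_compose)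
      qed
    qed (use f in auto)
    moreover have "(\<lambda>i. \<integral>\<omega>. f (u i \<omega>) \<partial>M) \<longlonglongrightarrow> (\<integral>x. f x \<partial>\<nu> t)"
    proof -
      have "\<bar>f x\<bar> \<le> 1" for x using f(2)[of x] by auto
      moreover have "filterlim (\<lambda>i. 2 ^ i :: nat) at_top sequentially"
        by (rule filterlim_subseq) (simp add: strict_mono_def)
      ultimately have "(\<lambda>i. \<integral>\<omega>. f (euler_rv (t / real (2 ^ i)) (real (2 ^ i) powr (1/8)) (2 ^ i) \<omega>) \<partial>M) \<longlonglongrightarrow> (\<integral>x. f x \<partial>\<nu> t)"
        by (intro filterlim_compose[OF euler_rv_limit[OF f(1) _ t]])
      then show ?thesis unfolding u_def by simp
    qed
    ultimately have "(\<integral>\<omega>. f (\<xi> \<omega>) \<partial>M) = (\<integral>x. f x \<partial>\<nu> t)" by (rule LIMSEQ_unique)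
    then show "(\<integral>x. f x \<partial>\<nu> t) = (\<integral>x. f x \<partial>distr M borel \<xi>)" by (simp add: integral_distr)
  qed (use nu_prob[OF tT] nu_sets[OF tT] in \<open>auto intro: prob_space_distr\<close>)
  then show ?thesis using conv \<xi>m unfolding u_def by blast
qed

text \<open>The solution is approximated by its own scheme with drift \<open>b\<close>, which is
  compared with the scheme for \<open>b'\<close> on the same grid and with the same noise. As the
  drifts agree up to \<open>s\<close>, only the time after \<open>s\<close> costs anything.\<close>

lemma (in euler_analysis) solution_comparison:
  assumes E': "euler_analysis T L C' b' w"
    and X: "continuous_on {0..T} X" and sol: "\<And>t. t \<in> {0..T} \<Longrightarrow> X t = x0 + integral {0..t} (\<lambda>r. b r (X r)) + c *\<^sub>R (w t - w 0)"
    and st: "0 \<le> s" "s \<le> t" "0 < t" "t \<le> T" and \<delta>: "\<delta> \<ge> 0"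
    and eq: "\<And>r x. r \<in> {0..s} \<Longrightarrow> b r x = b' r x" and le: "\<And>r x. r \<in> {s..t} \<Longrightarrow> norm (b r x - b' r x) \<le> \<delta>"
    and lim: "(\<lambda>i. euler_path b' c (t / 2 ^ i) ((2 ^ i) powr (1/8)) x0 w (2 ^ i)) \<longlonglongrightarrow> \<xi>"
  shows "norm (X t - \<xi>) \<le> exp (L * T) * (\<delta> * (t - s))"
proof -
  interpret E': euler_analysis T L C' b' c w x0 by (rule E')
  let ?h = "\<lambda>i::nat. t / 2 ^ i" and ?R = "\<lambda>i::nat. (2 ^ i :: real) powr (1/8)"
  define n :: "nat \<Rightarrow> nat" where "n i = 2 ^ i" for i
  have nh: "real (n i) * ?h i = t" for i unfolding n_def by simp
  have h: "?h i > 0" for i using st by simp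
  have 1: "(\<lambda>i. X t - e (?h i) (?R i) (n i)) \<longlonglongrightarrow> 0"
  proof (rule tendstoI)
    fix \<epsilon> :: real assume \<epsilon>: "\<epsilon> > 0"
    then have p: "\<epsilon> / (2 * exp (L * T) * T) > 0" using T by simp
    have "\<exists>d>0. \<forall>h R n k. 0 < h \<longrightarrow> h \<le> d \<longrightarrow> R \<ge> pb \<longrightarrow> real n * h \<le> T \<longrightarrow> k \<le> n \<longrightarrow>
      norm (X (real k * h) - e h R k) \<le> exp (L * T) * (T * (\<epsilon> / (2 * exp (L * T) * T)))"
      by (rule solution_defect[OF X _ p]) (rule sol)
    then obtain d where d: "d > 0" "\<forall>h R n k. 0 < h \<longrightarrow> h \<le> d \<longrightarrow> R \<ge> pb \<longrightarrow> real n * h \<le> T \<longrightarrow> k \<le> n \<longrightarrow>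
      norm (X (real k * h) - e h R k) \<le> exp (L * T) * (T * (\<epsilon> / (2 * exp (L * T) * T)))"
      by (elim exE conjE) (rule that)
    show "\<forall>\<^sub>F i in sequentially. dist (X t - e (?h i) (?R i) (n i)) 0 < \<epsilon>"
      using eventually_dyadic[OF d(1), of t pb]
    proof eventually_elim
      case (elim i)
      have "norm (X (real (n i) * ?h i) - e (?h i) (?R i) (n i)) \<le> exp (L * T) * (T * (\<epsilon> / (2 * exp (L * T) * T)))"
        by (rule d(2)[rule_format, of _ _ "n i"]) (use h elim nh st in auto)
      also have "\<dots> = \<epsilon> / 2" using T by simp
      finally show ?case unfolding nh using \<epsilon> by simp
    qed
  qed
  have 2: "\<forall>\<^sub>F i in sequentially. norm (e (?h i) (?R i) (n i) - E'.e (?h i) (?R i) (n i)) \<le> exp (L * T) * (\<delta> * (t - s))"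
    using eventually_dyadic[OF zero_less_one, of t "max pb E'.pb"]
  proof eventually_elim
    case (elim i)
    then have R: "?R i \<ge> pb" "?R i \<ge> E'.pb" by auto
    let ?\<epsilon> = "\<lambda>k. if real k * ?h i \<le> s then 0 else \<delta>"
    have kt: "real k * ?h i \<le> t" if "k \<le> n i" for k
      using grid_le[OF that, of "?h i" t] h[of i] nh[of i] by auto
    have "norm (e (?h i) (?R i) (n i) - E'.e (?h i) (?R i) (n i)) \<le> exp (L * T) * (\<Sum>k<n i. ?h i * ?\<epsilon> k)"
    \<comment> \<open>Both schemes are measured against the recursion with \<open>b'\<close>; the
      scheme for \<open>b\<close> misses it by \<open>h\<close> times the difference of the
      drifts.\<close>
    proof (rule euler_stability_sum[where \<beta> = "\<lambda>k. b' (real k * ?h i)" and n = "n i"])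
      fix k assume k: "k < n i"
      have k2: "real k * ?h i \<le> t" "0 \<le> real k * ?h i" using kt[of k] k st by auto
      then have kT: "real k * ?h i \<le> T" "real k * ?h i \<in> {0..T}" using st by auto
      show "L-lipschitz_on UNIV (b' (real k * ?h i))" by (rule E'.b_lip[OF kT(2)])
      let ?x = "e (?h i) (?R i) k"
      have "(e (?h i) (?R i) (Suc k) - ?x - ?h i *\<^sub>R b' (real k * ?h i) ?x)
         - (E'.e (?h i) (?R i) (Suc k) - E'.e (?h i) (?R i) k - ?h i *\<^sub>R b' (real k * ?h i) (E'.e (?h i) (?R i) k))
         = ?h i *\<^sub>R (b (real k * ?h i) ?x - b' (real k * ?h i) ?x)"
        unfolding euler_unclamped[OF h R(1) kT(1)] E'.euler_unclamped[OF h R(2) kT(1)] by (simp add: scaleR_diff_right)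
      moreover have "norm (b (real k * ?h i) ?x - b' (real k * ?h i) ?x) \<le> ?\<epsilon> k"
        using eq[of "real k * ?h i"] le[of "real k * ?h i"] k2 by auto
      ultimately show "norm ((e (?h i) (?R i) (Suc k) - ?x - ?h i *\<^sub>R b' (real k * ?h i) ?x)
         - (E'.e (?h i) (?R i) (Suc k) - E'.e (?h i) (?R i) k - ?h i *\<^sub>R b' (real k * ?h i) (E'.e (?h i) (?R i) k))) \<le> ?h i * ?\<epsilon> k"
        using h[of i] by (simp only: norm_scaleR abs_of_pos) (rule mult_left_mono, auto)
    qed (use h L_nonneg \<delta> nh st in \<open>auto simp: less_imp_le\<close>)
    \<comment> \<open>Only grid points after \<open>s\<close> count, and their steps up to
      \<open>m\<close> cover no more time than lies between \<open>s\<close> and \<open>m\<close>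
      times the step size.\<close>
    also have "(\<Sum>k<m. ?h i * ?\<epsilon> k) \<le> \<delta> * max 0 (real m * ?h i - s)" for m
    proof (induction m)
      case (Suc m)
      have e: "real (Suc m) * ?h i = real m * ?h i + ?h i" by (simp only: of_nat_Suc distrib_right mult_1 add.commute)
      have "?h i * ?\<epsilon> m + \<delta> * max 0 (real m * ?h i - s) \<le> \<delta> * max 0 (real m * ?h i + ?h i - s)"
      proof (cases "real m * ?h i \<le> s")
        case True
        then show ?thesis using \<delta> h[of i] by (auto intro!: mult_left_mono)
      next
        case False
        then have m: "max 0 (real m * ?h i - s) = real m * ?h i - s" "max 0 (real m * ?h i + ?h i - s) = real m * ?h i + ?h i - s"
          using h[of i] by (auto simp del: times_divide_eq_right)
        show ?thesis unfolding m using False by (simp add: algebra_simps)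
      qed
      then show ?case unfolding e using Suc.IH by simp
    qed (use st \<delta> in auto)
    from mult_left_mono[OF this[of "n i"], of "exp (L * T)"]
    have "exp (L * T) * (\<Sum>k<n i. ?h i * ?\<epsilon> k) \<le> exp (L * T) * (\<delta> * (t - s))" unfolding nh using st by simp
    finally show ?case .
  qed
  have "(\<lambda>i. e (?h i) (?R i) (n i) - E'.e (?h i) (?R i) (n i)) \<longlonglongrightarrow> X t - \<xi>"
  proof -
    have "(\<lambda>i. e (?h i) (?R i) (n i)) \<longlonglongrightarrow> X t" using tendsto_diff[OF tendsto_const[of "X t"] 1] by simp
    then show ?thesis using lim unfolding n_def by (rule tendsto_diff)
  qed
  from tendsto_upperbound[OF tendsto_norm[OF this] 2] show ?thesis by simp
qed

text \<open>The variable \<xi> with law \<open>\<nu> t\<close> is built from the same noise and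
  initial value as \<open>X\<close>; an almost sure bound on their distance is then a bound on a
  coupling.\<close>

lemma solution_law_comparison:
  assumes S: "sde_solution T \<sigma> L b \<mu> M F W X0 X" and N: "fp_brownian T \<sigma> L b' \<nu> M F W X0"
    and st: "0 \<le> s" "s \<le> t" "0 < t" "t \<le> T" and \<delta>: "\<delta> \<ge> 0"
    and eq: "\<And>r x. r \<in> {0..s} \<Longrightarrow> b r x = b' r x" and le: "\<And>r x. r \<in> {s..t} \<Longrightarrow> norm (b r x - b' r x) \<le> \<delta>"
  shows "\<exists>\<xi>\<in>borel_measurable M. \<nu> t = distr M borel \<xi> \<and> (AE \<omega> in M. norm (X \<omega> t - \<xi> \<omega>) \<le> exp (L * T) * (\<delta> * (t - s)))"
proof -
  interpret S: sde_solution T \<sigma> L b \<mu> M F W X0 X by (rule S)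
  interpret N: fp_brownian T \<sigma> L b' \<nu> M F W X0 by (rule N)
  obtain \<xi> where \<xi>: "\<xi> \<in> borel_measurable M" "\<nu> t = distr M borel \<xi>"
    "AE \<omega> in M. (\<lambda>i. N.euler_rv (t / 2 ^ i) ((2 ^ i) powr (1/8)) (2 ^ i) \<omega>) \<longlonglongrightarrow> \<xi> \<omega>"
    using N.limit_rv[OF st(3,4)] by blast
  have "AE \<omega> in M. norm (X \<omega> t - \<xi> \<omega>) \<le> exp (L * T) * (\<delta> * (t - s))"
    using S.sde \<xi>(3)
  proof eventually_elim
    case (elim \<omega>)
    interpret E: euler_analysis T L S.growth b S.c "\<lambda>t. W t \<omega>" "X0 \<omega>"
      by unfold_locales (use S.T_pos S.reg S.growth elim in auto)
    have E': "euler_analysis T L N.growth b' (\<lambda>t. W t \<omega>)"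
      by unfold_locales (use S.T_pos N.reg N.growth elim in auto)
    show ?case
      by (rule E.solution_comparison[OF E' _ _ st \<delta> eq le])
        (use elim in \<open>auto simp: S.c_def N.c_def N.euler_rv_def\<close>)
  qed
  then show ?thesis using \<xi> by blast
qed

text \<open>On an interval of length \<open>d\<close> after a time up to which \<open>D\<close>
  vanishes, every bound can be halved, so \<open>D\<close> vanishes there too; finitely many
  intervals reach \<open>t\<close>. Of \<open>D\<close> only boundedness is used, neither continuity
  nor measurability.\<close>

lemma zero_propagation:
  fixes D :: "real \<Rightarrow> real"
  assumes D: "\<And>t. t \<in> {0..T} \<Longrightarrow> 0 \<le> D t" "\<And>t. t \<in> {0..T} \<Longrightarrow> D t \<le> B" "D 0 = 0" and d: "d > 0"
    and step: "\<And>s t B. 0 \<le> s \<Longrightarrow> s \<le> t \<Longrightarrow> 0 < t \<Longrightarrow> t \<le> T \<Longrightarrow> t \<le> s + d \<Longrightarrow> (\<And>r. r \<in> {0..s} \<Longrightarrow> D r = 0) \<Longrightarrow>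
      (\<And>r. r \<in> {s..t} \<Longrightarrow> D r \<le> B) \<Longrightarrow> D t \<le> B / 2"
    and t: "t \<in> {0..T}"
  shows "D t = 0"
proof -
  have "\<forall>t\<in>{0..T}. t \<le> real k * d \<longrightarrow> D t = 0" for k
  proof (induction k)
    case 0
    then show ?case using D(3) by (metis atLeastAtMost_iff mult_zero_left of_nat_0 order_antisym)
  next
    case (Suc k)
    let ?s = "real k * d"
    have s0: "0 \<le> ?s" using d by simp
    have e: "real (Suc k) * d = ?s + d" by (simp add: distrib_right)
    have bd: "\<forall>t\<in>{0..T}. ?s \<le> t \<longrightarrow> t \<le> ?s + d \<longrightarrow> D t \<le> B / 2 ^ j" for j
    proof (induction j)
      case 0
      then show ?case using D(2) by simp
    next
      case (Suc j)
      show ?case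
      proof (intro ballI impI)
        fix t assume t: "t \<in> {0..T}" "?s \<le> t" "t \<le> ?s + d"
        show "D t \<le> B / 2 ^ Suc j"
        proof (cases "t = 0")
          case True
          have "0 \<le> B" using D(1,2)[OF t(1)] by linarith
          then show ?thesis using D(3) True by simp
        next
          case False
          have "D t \<le> (B / 2 ^ j) / 2"
          proof (rule step[OF s0 t(2) _ _ t(3)])
            show "D r = 0" if "r \<in> {0..?s}" for r using \<open>\<forall>t\<in>{0..T}. t \<le> ?s \<longrightarrow> D t = 0\<close> that t by auto
            show "D r \<le> B / 2 ^ j" if "r \<in> {?s..t}" for r
            proof -
              have "r \<in> {0..T}" "?s \<le> r" "r \<le> ?s + d" using that t s0 unfolding atLeastAtMost_iff by linarith+
              then show ?thesis using Suc.IH by blast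
            qed
          qed (use False t in auto)
          then show ?thesis by (simp add: field_simps)
        qed
      qed
    qed
    show ?case
    proof (intro ballI impI)
      fix t assume t: "t \<in> {0..T}" "t \<le> real (Suc k) * d"
      show "D t = 0"
      proof (cases "t \<le> ?s")
        case False
        have "(\<lambda>j. B / 2 ^ j) \<longlonglongrightarrow> 0" by real_asymp
        then have "D t \<le> 0"
          by (rule tendsto_lowerbound[OF _ always_eventually]) (use bd t False e in auto)
        then show ?thesis using D(1)[OF t(1)] by simp
      qed (use Suc.IH t in auto)
    qed
  qed
  moreover obtain k where "t < real k * d" using ex_less_of_nat_mult[OF d, of t] by blast
  ultimately show ?thesis using t by (meson less_imp_le)
qed

text \<open>Two conventions are bridged: \<open>W t\<close> against \<open>W t - W 0\<close>, as
  \<open>W 0\<close> vanishes almost surely, and the Lebesgue against the gauge integral.\<close>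

lemma (in mckean_vlasov) sde_solution:
  "sde_solution T \<sigma> (LH + LK) (\<lambda>t. particle_drift H1 K1 (\<mu> t) (Y t)) \<mu> M F W X0 X"
proof unfold_locales
  show "regular_drift T (LH + LK) (\<lambda>t. particle_drift H1 K1 (\<mu> t) (Y t))"
    by (rule regular_drift_particle[OF wcont Y H1 K1])
  have W0: "AE \<omega> in M. W 0 \<omega> = 0" using bm unfolding brownian_motion_on_def by auto
  show "AE \<omega> in M. continuous_on {0..T} (\<lambda>t. W t \<omega>) \<and> continuous_on {0..T} (X \<omega>) \<and>
      (\<forall>t\<in>{0..T}. X \<omega> t = X0 \<omega> + integral {0..t} (\<lambda>r. particle_drift H1 K1 (\<mu> r) (Y r) (X \<omega> r)) + sqrt (2 * \<sigma>) *\<^sub>R (W t \<omega> - W 0 \<omega>))"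
    using sol W_cont AE_space W0
  proof eventually_elim
    case (elim \<omega>)
    have "(LINT r:{0..t}|lebesgue. particle_drift H1 K1 (\<mu> r) (Y r) (X \<omega> r)) = integral {0..t} (\<lambda>r. particle_drift H1 K1 (\<mu> r) (Y r) (X \<omega> r))"
      if "t \<in> {0..T}" for t
      by (rule set_lebesgue_integral_eq_integral(2), rule set_integrable_subset[where A = "{0..T}"]) (use elim that in auto)
    then show ?case using elim X_cont[OF elim(3)] by auto
  qed
qed (use sigma_pos wcont X0 X_M \<mu>_def in auto)

lemma integrals_cong:
  fixes f g :: "real \<Rightarrow> 'b::euclidean_space"
  assumes e: "\<And>s. s \<in> {0..T} \<Longrightarrow> f s = g s"
  shows "f absolutely_integrable_on {0..T} \<longleftrightarrow> g absolutely_integrable_on {0..T}"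
    and "\<forall>t\<in>{0..T}. (LINT s:{0..t}|lebesgue. f s) = (LINT s:{0..t}|lebesgue. g s)"
proof -
  show "f absolutely_integrable_on {0..T} \<longleftrightarrow> g absolutely_integrable_on {0..T}"
    by (rule set_integrable_cong) (use e in auto)
  show "\<forall>t\<in>{0..T}. (LINT s:{0..t}|lebesgue. f s) = (LINT s:{0..t}|lebesgue. g s)"
    by (intro ballI set_lebesgue_integral_cong) (use e in auto)
qed

lemma caratheodory_increment:
  assumes y: "caratheodory_solution T f y0 y" and st: "0 \<le> s" "s \<le> t" "t \<le> T"
  shows "(\<lambda>r. f r (y r)) integrable_on {s..t}" "y t = y s + integral {s..t} (\<lambda>r. f r (y r))" "y 0 = y0"
proof -
  have a: "(\<lambda>r. f r (y r)) absolutely_integrable_on {0..T}" using y unfolding caratheodory_solution_def by auto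
  have i: "(\<lambda>r. f r (y r)) integrable_on {u..v}" if "0 \<le> u" "v \<le> T" for u v
    by (rule integrable_subinterval_real[OF set_lebesgue_integral_eq_integral(1)[OF a]]) (use that in auto)
  show "(\<lambda>r. f r (y r)) integrable_on {s..t}" using i st by auto
  have e: "y q = y0 + integral {0..q} (\<lambda>r. f r (y r))" if q: "q \<in> {0..T}" for q
  proof -
    have "(LINT r:{0..q}|lebesgue. f r (y r)) = integral {0..q} (\<lambda>r. f r (y r))"
      by (rule set_lebesgue_integral_eq_integral(2), rule set_integrable_subset[OF a]) (use q in auto)
    then show ?thesis using y q unfolding caratheodory_solution_def by auto
  qed
  have "integral {0..s} (\<lambda>r. f r (y r)) + integral {s..t} (\<lambda>r. f r (y r)) = integral {0..t} (\<lambda>r. f r (y r))"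
    by (rule Henstock_Kurzweil_Integration.integral_combine) (use st i in auto)
  then show "y t = y s + integral {s..t} (\<lambda>r. f r (y r))" using e[of s] e[of t] st by (simp add: algebra_simps)
  show "y 0 = y0" using e[of 0] st by simp
qed

lemma pde_ode_uniqueness:
  fixes Y Z :: "real \<Rightarrow> 'a::euclidean_space ^ 'm::finite"
  assumes S: "sde_solution T \<sigma> (LH + LK) (\<lambda>t. particle_drift H1 K1 (\<mu> t) (Y t)) \<mu> M F W X0 X"
    and H1: "LH-lipschitz_on UNIV H1" and K1: "LK-lipschitz_on UNIV K1"
    and H2: "LH'-lipschitz_on UNIV H2" and K2: "LK'-lipschitz_on UNIV K2"
    and u: "\<And>i. integrably_lipschitz_control T (u i)"
    and Y: "caratheodory_solution T (\<lambda>t. leader_field K2 H2 u t (\<mu> t)) Y0 Y"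
    and Z: "pde_ode_solution T \<sigma> H1 H2 K1 K2 u (distr M borel X0) Y0 \<nu> Z"
    and t: "t \<in> {0..T}"
  shows "\<nu> t = \<mu> t \<and> Z t = Y t"
proof -
  interpret S: sde_solution T \<sigma> "LH + LK" "\<lambda>t. particle_drift H1 K1 (\<mu> t) (Y t)" \<mu> M F W X0 X by (rule S)
  have \<nu>w: "wasserstein_continuous_on 1 {0..T} \<nu>" and Zc: "continuous_on {0..T} Z"
    and Zs: "caratheodory_solution T (\<lambda>t. leader_field K2 H2 u t (\<nu> t)) Y0 Z"
    and fp: "weak_fokker_planck T \<sigma> (\<lambda>t. particle_drift H1 K1 (\<nu> t) (Z t)) \<nu>" and \<nu>0: "\<nu> 0 = distr M borel X0"
    using Z unfolding pde_ode_solution_def by auto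
  have N: "fp_brownian T \<sigma> (LH + LK) (\<lambda>t. particle_drift H1 K1 (\<nu> t) (Z t)) \<nu> M F W X0"
    by unfold_locales (use S.sigma_pos regular_drift_particle[OF \<nu>w Zc H1 K1] \<nu>w fp S.X0 \<nu>0 in auto)
  interpret N: fp_brownian T \<sigma> "LH + LK" "\<lambda>t. particle_drift H1 K1 (\<nu> t) (Z t)" \<nu> M F W X0 by (rule N)
  let ?L = "LH + LK"
  let ?b = "\<lambda>r. particle_drift H1 K1 (\<mu> r) (Y r)" and ?b' = "\<lambda>r. particle_drift H1 K1 (\<nu> r) (Z r)"
  define D where "D r = wasserstein 1 (\<mu> r) (\<nu> r) + norm (Y r - Z r)" for r
  have D0: "0 \<le> D r" for r unfolding D_def by (intro add_nonneg_nonneg wasserstein_nonneg norm_ge_zero)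
  have Yc: "continuous_on {0..T} Y" using Y unfolding caratheodory_solution_def by auto
  have T0: "0 \<in> {0..T}" using t by auto
  have \<mu>0: "\<mu> 0 = \<nu> 0" unfolding \<nu>0 S.law[OF T0]
    by (rule distr_cong_AE) (use S.sde T0 S.X_M[OF T0] S.F_M[OF T0 S.X0] in auto)
  have YZ0: "Y 0 = Y0" "Z 0 = Y0"
    using caratheodory_increment(3)[OF Y order_refl order_refl] caratheodory_increment(3)[OF Zs order_refl order_refl] T0 by auto
  have drift: "norm (?b r x - ?b' r x) \<le> ?L * D r" if r: "r \<in> {0..T}" for r x
  proof -
    have "norm (?b r x - ?b' r x) \<le> LH * wasserstein 1 (\<mu> r) (\<nu> r) + LK * norm (Y r - Z r)"
      by (rule particle_drift_diff_wasserstein[OF S.nu_w[OF r] N.nu_w[OF r] H1 K1])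
    also have "\<dots> \<le> ?L * D r"
      unfolding D_def using lipschitz_on_nonneg[OF H1] lipschitz_on_nonneg[OF K1] wasserstein_nonneg[of "\<mu> r" "\<nu> r"]
      by (simp add: algebra_simps)
    finally show ?thesis .
  qed
  have "\<exists>l. l absolutely_integrable_on {0..T} \<and> (\<forall>r\<in>{0..T}. 0 \<le> l r \<and> dist (u i r (\<mu> r)) (u i r (\<nu> r)) \<le> l r * wasserstein 1 (\<mu> r) (\<nu> r))" for i
    using u[of i] S.nu_w N.nu_w unfolding integrably_lipschitz_control_def by blast
  then obtain l where l: "\<And>i. l i absolutely_integrable_on {0..T}"
    "\<And>i r. r \<in> {0..T} \<Longrightarrow> 0 \<le> l i r \<and> dist (u i r (\<mu> r)) (u i r (\<nu> r)) \<le> l i r * wasserstein 1 (\<mu> r) (\<nu> r)"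
    by metis
  let ?f = "\<lambda>r. leader_field K2 H2 u r (\<mu> r) (Y r) - leader_field K2 H2 u r (\<nu> r) (Z r)"
  \<comment> \<open>The constant of \<open>leader_field_diff\<close>; because of the controls it is
    only integrable in time, so that \<open>g\<close> enters through the increments of its primitive
    \<open>q\<close>.\<close>
  define g where "g r = real CARD('m) * (LK' + 2 * LH') + (\<Sum>i\<in>UNIV. l i r)" for r
  have g0: "g r \<ge> 0" if "r \<in> {0..T}" for r
    unfolding g_def using l(2)[OF that] lipschitz_on_nonneg[OF H2] lipschitz_on_nonneg[OF K2] by (auto intro!: add_nonneg_nonneg sum_nonneg)
  have gi: "g integrable_on {0..T}"
    unfolding g_def[abs_def] using set_lebesgue_integral_eq_integral(1)[OF l(1)]
    by (intro integrable_add integrable_const_ivl integrable_sum) auto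
  have field: "norm (?f r) \<le> g r * D r" if r: "r \<in> {0..T}" for r
    unfolding g_def D_def by (rule leader_field_diff[OF S.nu_w[OF r] N.nu_w[OF r] K2 H2]) (use l(2)[OF r] in auto)
  define q where "q t = integral {0..t} g" for t
  have qg: "integral {s..t} g = q t - q s" if "0 \<le> s" "s \<le> t" "t \<le> T" for s t
  proof -
    have "integral {0..s} g + integral {s..t} g = integral {0..t} g"
      by (rule Henstock_Kurzweil_Integration.integral_combine) (use that in \<open>auto intro!: integrable_subinterval_real[OF gi]\<close>)
    then show ?thesis unfolding q_def by simp
  qed
  have "continuous_on {0..T} q" unfolding q_def[abs_def] by (rule indefinite_integral_continuous_1[OF gi])
  then have "uniformly_continuous_on {0..T} q" by (rule compact_uniformly_continuous) simp
  \<comment> \<open>A quarter for the leaders here and a quarter for the law through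
    \<open>C * d \<le> 1/4\<close> below make up the factor 1/2 of
    \<open>zero_propagation\<close>.\<close>
  from this[unfolded uniformly_continuous_on_def, rule_format, of "1/4"]
  obtain d1 where d1: "d1 > 0" "\<And>s t. s \<in> {0..T} \<Longrightarrow> t \<in> {0..T} \<Longrightarrow> dist t s < d1 \<Longrightarrow> dist (q t) (q s) < 1/4"
    by auto
  define C where "C = exp (?L * T) * ?L"
  have C0: "C \<ge> 0" unfolding C_def using S.L_nonneg by auto
  define d where "d = min (d1 / 2) (1 / (4 * (C + 1)))"
  have d: "d > 0" "d < d1" "C * d \<le> 1/4"
  proof -
    show "d > 0" "d < d1" unfolding d_def using d1(1) C0 by auto
    have "C * d \<le> C * (1 / (4 * (C + 1)))" unfolding d_def using C0 by (intro mult_left_mono) auto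
    also have "\<dots> \<le> 1/4" using C0 by (simp add: field_simps)
    finally show "C * d \<le> 1/4" .
  qed
  have D_zero: "D r = 0" if "r \<in> {0..T}" for r
  proof -
    have "compact ((\<lambda>r. Y r - Z r) ` {0..T})" by (intro compact_continuous_image continuous_intros Yc Zc) auto
    then obtain B1 where B1: "\<And>r. r \<in> {0..T} \<Longrightarrow> norm (Y r - Z r) \<le> B1"
      using compact_imp_bounded bounded_iff by (metis (no_types, lifting) imageI)
    show ?thesis
    proof (rule zero_propagation[where D = D and B = "S.mom + N.mom + B1", OF D0 _ _ d(1) _ that])
      show "D r \<le> S.mom + N.mom + B1" if r: "r \<in> {0..T}" for r
        unfolding D_def using wasserstein_le_moments[OF S.nu_w[OF r] N.nu_w[OF r]] S.mom(2)[OF r] N.mom(2)[OF r] B1[OF r] by linarith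
      show "D 0 = 0"
      proof -
        have "wasserstein 1 (\<nu> 0) (\<nu> 0) \<le> 0"
          unfolding \<nu>0 by (rule S.wasserstein_distr_le) (use S.F_M[OF T0 S.X0] in auto)
        then show ?thesis unfolding D_def \<mu>0 YZ0 using wasserstein_nonneg[of "\<nu> 0" "\<nu> 0"] by simp
      qed
      fix s t B assume st: "0 \<le> s" "s \<le> t" "0 < t" "t \<le> T" "t \<le> s + d"
        and Ds: "\<And>r. r \<in> {0..s} \<Longrightarrow> D r = 0" and DB: "\<And>r. r \<in> {s..t} \<Longrightarrow> D r \<le> B"
      have B0: "B \<ge> 0" using DB[of t] D0[of t] st by auto
      have tT: "t \<in> {0..T}" "s \<in> {0..T}" using st by auto
      obtain \<xi> where \<xi>: "\<xi> \<in> borel_measurable M" "\<nu> t = distr M borel \<xi>"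
        "AE \<omega> in M. norm (X \<omega> t - \<xi> \<omega>) \<le> exp (?L * T) * ((?L * B) * (t - s))"
      proof -
        have "\<exists>\<xi>\<in>borel_measurable M. \<nu> t = distr M borel \<xi> \<and> (AE \<omega> in M. norm (X \<omega> t - \<xi> \<omega>) \<le> exp (?L * T) * ((?L * B) * (t - s)))"
        proof (rule solution_law_comparison[OF S N st(1-4)])
          show "?b r x = ?b' r x" if "r \<in> {0..s}" for r x
            using drift[of r x] Ds[OF that] that st by auto
          show "norm (?b r x - ?b' r x) \<le> ?L * B" if "r \<in> {s..t}" for r x
          proof -
            have "r \<in> {0..T}" using that st by auto
            from drift[OF this, of x] mult_left_mono[OF DB[OF that] S.L_nonneg] show ?thesis by linarith
          qed
        qed (use B0 S.L_nonneg in auto)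
        then show ?thesis using that by blast
      qed
      have W: "wasserstein 1 (\<mu> t) (\<nu> t) \<le> C * d * B"
      proof -
        have "exp (?L * T) * ((?L * B) * (t - s)) \<le> exp (?L * T) * ((?L * B) * d)"
          using st S.L_nonneg B0 by (intro mult_left_mono) auto
        also have "\<dots> = C * d * B" unfolding C_def by simp
        finally have le: "exp (?L * T) * ((?L * B) * (t - s)) \<le> C * d * B" .
        have "(\<integral>\<^sup>+\<omega>. ennreal (dist (X \<omega> t) (\<xi> \<omega>)) \<partial>M) \<le> (\<integral>\<^sup>+\<omega>. ennreal (C * d * B) \<partial>M)"
        proof (rule nn_integral_mono_AE)
          show "AE \<omega> in M. ennreal (dist (X \<omega> t) (\<xi> \<omega>)) \<le> ennreal (C * d * B)"
            using \<xi>(3) by eventually_elim (use le in \<open>auto simp: dist_norm intro!: ennreal_leI\<close>)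
        qed
        then show ?thesis unfolding \<xi>(2) S.law[OF tT(1)]
          by (intro S.wasserstein_distr_le S.X_M[OF tT(1)] \<xi>(1)) (use C0 d B0 S.emeasure_space_1 in auto)
      qed
      have YZ: "norm (Y t - Z t) \<le> (q t - q s) * B"
      proof -
        have "D s = 0" using Ds[of s] st by auto
        then have "Y s = Z s" unfolding D_def using wasserstein_nonneg[of "\<mu> s" "\<nu> s"] by (simp add: add_nonneg_eq_0_iff)
        then have "Y t - Z t = integral {s..t} (\<lambda>r. ?f r)"
          using caratheodory_increment[OF Y st(1,2,4)] caratheodory_increment[OF Zs st(1,2,4)]
          by (subst Henstock_Kurzweil_Integration.integral_diff) auto
        also have "norm \<dots> \<le> integral {s..t} (\<lambda>r. g r * B)"
        proof (rule integral_norm_bound_integral)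
          show "(\<lambda>r. g r * B) integrable_on {s..t}"
            using st by (intro integrable_on_mult_left integrable_subinterval_real[OF gi]) auto
          fix r assume r: "r \<in> {s..t}"
          then have rT: "r \<in> {0..T}" using st by auto
          show "norm (?f r) \<le> g r * B"
            using field[OF rT] mult_left_mono[OF DB[OF r] g0[OF rT]] by linarith
        qed (intro integrable_diff caratheodory_increment(1)[OF Y st(1,2,4)] caratheodory_increment(1)[OF Zs st(1,2,4)])
        finally show ?thesis using qg[OF st(1,2,4)] by simp
      qed
      have "q t - q s \<le> 1/4"
        using d1(2)[OF tT(2) tT(1)] abs_ge_self[of "q t - q s"] st d unfolding dist_real_def by linarith
      then have "(q t - q s) * B \<le> 1/4 * B" using B0 by (rule mult_right_mono)
      moreover have "C * d * B \<le> 1/4 * B" using d(3) B0 by (rule mult_right_mono)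
      ultimately show "D t \<le> B / 2" unfolding D_def using W YZ by linarith
    qed
  qed
  \<comment> \<open>Equality of the measures is not read off from a vanishing distance. With equal
    drifts the comparison holds with \<open>\<delta> = 0\<close>, so that \<xi> is almost surely the
    value of \<open>X\<close> at \<open>t\<close>.\<close>
  have "\<nu> t = \<mu> t"
  proof (cases "t = 0")
    case False
    then have t0: "0 < t" "t \<le> T" using t by auto
    have "?b r x = ?b' r x" if "r \<in> {0..T}" for r x
      using drift[OF that, of x] D_zero[OF that] by simp
    then obtain \<xi> where \<xi>: "\<xi> \<in> borel_measurable M" "\<nu> t = distr M borel \<xi>"
      "AE \<omega> in M. norm (X \<omega> t - \<xi> \<omega>) \<le> exp (?L * T) * (0 * (t - 0))"
      using solution_law_comparison[OF S N order_refl less_imp_le[OF t0(1)] t0 order_refl] t0 by auto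
    show ?thesis unfolding \<xi>(2) S.law[OF t]
      by (rule distr_cong_AE) (use \<xi> S.X_M[OF t] in auto)
  qed (use \<mu>0 in simp)
  moreover have "Z t = Y t"
    using D_zero[OF t] wasserstein_nonneg[of "\<mu> t" "\<nu> t"] unfolding D_def by (simp add: add_nonneg_eq_0_iff)
  ultimately show ?thesis by blast
qed

theorem theorem3p7:
  fixes M :: "'w measure" and F :: "real \<Rightarrow> 'w measure"
    and W :: "real \<Rightarrow> 'w \<Rightarrow> real ^ 'd::finite"
    and T \<sigma> :: real
    and H1 H2 K1 K2 :: "real ^ 'd \<Rightarrow> real ^ 'd"
    and u :: "'m::finite \<Rightarrow> real \<Rightarrow> (real ^ 'd) measure \<Rightarrow> real ^ 'd"
    and X0 :: "'w \<Rightarrow> real ^ 'd" and Y0 :: "(real ^ 'd) ^ 'm"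
    and X :: "'w \<Rightarrow> real \<Rightarrow> real ^ 'd" and Y :: "real \<Rightarrow> (real ^ 'd) ^ 'm"
    and \<rho>0 :: "real ^ 'd \<Rightarrow> real"
  assumes "T > 0" and "\<sigma> > 0"
    and "prob_space M" and "filtration_on {0..T} M F" and "brownian_motion_on {0..T} M F W"
    and "globally_lipschitz H1" and "globally_lipschitz H2"
    and "globally_lipschitz K1" and "globally_lipschitz K2"
    and "\<And>i. caratheodory_control T (u i)" and "\<And>i. integrably_lipschitz_control T (u i)"
    and "X0 \<in> borel_measurable (F 0)"
    and "pathwise_solution M W T \<sigma> H1 H2 K1 K2 u X0 Y0 X Y"
    and "distr M borel X0 \<in> wasserstein_space 2"
    and "\<rho>0 \<in> borel_measurable borel" and "\<And>x. 0 \<le> \<rho>0 x"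
    and "distr M borel X0 = density lborel (\<lambda>x. ennreal (\<rho>0 x))"
    and "entropy_integral \<rho>0 < \<infinity>"
  shows "pde_ode_solution T \<sigma> H1 H2 K1 K2 u (distr M borel X0) Y0
           (\<lambda>t. distr M borel (\<lambda>\<omega>. X \<omega> t)) Y \<and>
         (\<forall>\<nu> Z. pde_ode_solution T \<sigma> H1 H2 K1 K2 u (distr M borel X0) Y0 \<nu> Z \<longrightarrow>
            (\<forall>t\<in>{0..T}. \<nu> t = distr M borel (\<lambda>\<omega>. X \<omega> t) \<and> Z t = Y t))"
proof -
  obtain LH LK LH' LK' where H1: "LH-lipschitz_on UNIV H1" and K1: "LK-lipschitz_on UNIV K1"
    and H2: "LH'-lipschitz_on UNIV H2" and K2: "LK'-lipschitz_on UNIV K2"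
    using assms(6-9) unfolding globally_lipschitz_def by blast
  interpret brownian M F W T
    using assms(1,3-5) by (intro brownian.intro brownian_axioms.intro)
  define \<mu> where "\<mu> = (\<lambda>t. distr M borel (\<lambda>\<omega>. X \<omega> t))"
  have X: "X \<in> measurable M (path_borel T)" using assms(13) unfolding pathwise_solution_def by auto
  \<comment> \<open>Measurability of the evaluation was shown for times in the interval only, so
    marginals and laws are identified there; \<open>integrals_cong\<close> then transfers the
    equations.\<close>
  have marg: "marginal (distr M (path_borel T) X) t = \<mu> t" if "t \<in> {0..T}" for t
    unfolding marginal_def \<mu>_def by (subst distr_distr[OF path_eval_measurable[OF that] X]) (simp add: o_def)
  have sol0: "\<forall>t\<in>{0..T}. \<mu> t \<in> wasserstein_space 1"
    and sol1: "AE \<omega> in M. X \<omega> 0 = X0 \<omega> \<and>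
       (\<lambda>s. particle_drift H1 K1 (marginal (distr M (path_borel T) X) s) (Y s) (X \<omega> s)) absolutely_integrable_on {0..T} \<and>
       (\<forall>t\<in>{0..T}. X \<omega> t = X0 \<omega> + (LINT s:{0..t}|lebesgue. particle_drift H1 K1 (marginal (distr M (path_borel T) X) s) (Y s) (X \<omega> s))
          + sqrt (2 * \<sigma>) *\<^sub>R W t \<omega>)"
    and sol2: "caratheodory_solution T (\<lambda>t. leader_field K2 H2 u t (marginal (distr M (path_borel T) X) t)) Y0 Y"
    using assms(13) marg unfolding pathwise_solution_def Let_def by auto
  have sol: "AE \<omega> in M. X \<omega> 0 = X0 \<omega> \<and>
       (\<lambda>s. particle_drift H1 K1 (\<mu> s) (Y s) (X \<omega> s)) absolutely_integrable_on {0..T} \<and>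
       (\<forall>t\<in>{0..T}. X \<omega> t = X0 \<omega> + (LINT s:{0..t}|lebesgue. particle_drift H1 K1 (\<mu> s) (Y s) (X \<omega> s)) + sqrt (2 * \<sigma>) *\<^sub>R W t \<omega>)"
    using sol1
  proof eventually_elim
    case (elim \<omega>)
    have e: "particle_drift H1 K1 (\<mu> s) (Y s) (X \<omega> s) = particle_drift H1 K1 (marginal (distr M (path_borel T) X) s) (Y s) (X \<omega> s)"
      if "s \<in> {0..T}" for s using marg[OF that] by simp
    note c = integrals_cong[where T = T, of "\<lambda>s. particle_drift H1 K1 (\<mu> s) (Y s) (X \<omega> s)", OF e]
    show ?case using elim c by simp
  qed
  have e: "leader_field K2 H2 u s (\<mu> s) (Y s) = leader_field K2 H2 u s (marginal (distr M (path_borel T) X) s) (Y s)"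
    if "s \<in> {0..T}" for s using marg[OF that] by simp
  have Y: "caratheodory_solution T (\<lambda>t. leader_field K2 H2 u t (\<mu> t)) Y0 Y"
    using sol2 integrals_cong[where T = T, of "\<lambda>s. leader_field K2 H2 u s (\<mu> s) (Y s)", OF e]
    unfolding caratheodory_solution_def by simp
  have X0M: "X0 \<in> borel_measurable M" by (rule F_M[OF _ assms(12)]) (use assms(1) in auto)
  have X0i: "integrable M (\<lambda>\<omega>. norm (X0 \<omega>))"
  proof -
    have "integrable (distr M borel X0) (\<lambda>x. norm x powr 2)" using assms(14) unfolding wasserstein_space_def by auto
    then have "integrable M (\<lambda>\<omega>. norm (X0 \<omega>) powr 2)" using X0M by (simp add: integrable_distr_eq)
    then have "integrable M (\<lambda>\<omega>. 1 + norm (X0 \<omega>) powr 2)" by simp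
    then show ?thesis
    proof (rule Bochner_Integration.integrable_bound)
      show "AE \<omega> in M. norm (norm (X0 \<omega>)) \<le> norm (1 + norm (X0 \<omega>) powr 2)"
      proof (rule AE_I2)
        fix \<omega>
        have "2 * norm (X0 \<omega>) \<le> 1 + (norm (X0 \<omega>))\<^sup>2"
          using zero_le_power2[of "norm (X0 \<omega>) - 1"] by (simp add: power2_diff)
        then have "norm (X0 \<omega>) \<le> 1 + (norm (X0 \<omega>))\<^sup>2" using norm_ge_zero[of "X0 \<omega>"] by linarith
        then show "norm (norm (X0 \<omega>)) \<le> norm (1 + norm (X0 \<omega>) powr 2)" by simp
      qed
    qed (use X0M in measurable)
  qed
  interpret mv: mckean_vlasov M F W T \<sigma> LH LK H1 K1 X0 X Y \<mu>
  proof unfold_locales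
    show "\<mu> \<equiv> (\<lambda>t. distr M borel (\<lambda>\<omega>. X \<omega> t))" by (rule eq_reflection) (rule \<mu>_def)
    show "continuous_on {0..T} Y" using Y unfolding caratheodory_solution_def by auto
    show "distr M borel (\<lambda>\<omega>. X \<omega> t) \<in> wasserstein_space 1" if "t \<in> {0..T}" for t
      using sol0 that unfolding \<mu>_def by blast
  qed (fact assms(2) H1 K1 assms(12) X0i X sol[unfolded \<mu>_def])+
  have S: "sde_solution T \<sigma> (LH + LK) (\<lambda>t. particle_drift H1 K1 (\<mu> t) (Y t)) \<mu> M F W X0 X" by (rule mv.sde_solution)
  interpret S: sde_solution T \<sigma> "LH + LK" "\<lambda>t. particle_drift H1 K1 (\<mu> t) (Y t)" \<mu> M F W X0 X by (rule S)
  have T0: "0 \<in> {0..T}" using assms(1) by auto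
  have "\<mu> 0 = distr M borel X0"
    unfolding \<mu>_def by (rule distr_cong_AE) (use sol S.X_M[OF T0] X0M in auto)
  then have "pde_ode_solution T \<sigma> H1 H2 K1 K2 u (distr M borel X0) Y0 \<mu> Y"
    unfolding pde_ode_solution_def using S.wcont S.weak_formulation Y unfolding caratheodory_solution_def by auto
  moreover have "\<nu> t = \<mu> t \<and> Z t = Y t"
    if "pde_ode_solution T \<sigma> H1 H2 K1 K2 u (distr M borel X0) Y0 \<nu> Z" "t \<in> {0..T}" for \<nu> Z t
    by (rule pde_ode_uniqueness[OF S H1 K1 H2 K2 assms(11) Y that])
  ultimately show ?thesis unfolding \<mu>_def by blast
qed

end
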